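(* Let $G$ be a finitely generated, torsion-free, one-ended CSA group such that abelian subgroups of $G$ are finitely generated of bounded rank. Suppose that $G$ admits a splitting over abelian subgroups, with Bass–Serre tree $T$, such that the associated tree of cylinders $T_{c}$ has a non-abelian flexible vertex stabilizer $G_{v}$. Then there exists a positive integer $n$ such that $V_{n}^{CSA}(G)>0$.
   Context: A group is CSA if its maximal abelian subgroups are malnormal. Tree of cylinders (Guirardel–Levitt): let $G$ be a torsion-free one-ended CSA group and $T$ a $G$-tree with (necessarily nontrivial) abelian edge stabilizers. Call two edges of $T$ equivalent if their stabilizers generate an abelian subgroup; the union of all edges in an equivalence class is a subtree, called a cylinder. $T_c$ is the bipartite tree whose vertices are the vertices of $T$ lying in at least two cylinders, together with the cylinders, with an edge joining a vertex $x$ to a cylinder $Z$ when $x\in Z$. A vertex stabilizer $G_v$ is rigid if, whenever $G_v$ acts on a tree with abelian edge stabilizers, it stabilizes a vertex, and flexible otherwise. It is a standing fact (recalled from Guirardel and Levitt) that the edge stabilizers of $T_c$ are nontrivial abelian, that $T_c$ is $2$-acylindrical, that $T$ and $T_c$ have the same non-abelian vertex stabilizers, and that non-abelian flexible vertex stabilizers are fundamental groups of compact surfaces with (non-empty) boundary; in particular this is to be taken as given for $G_v$. Actions on trees are without inversions. A splitting $(\mathcal{G},Y)$ of a group $G$ is a decomposition of $G$ as the fundamental group of a graph of groups, equivalently an action of $G$ on the Bass–Serre tree $X$ with $Y=X/G$. It is $k$-acylindrical if the stabilizer of any path in $X$ of length greater than $k+1$ is trivial. An element is elliptic if it fixes a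 vertex of $X$ and hyperbolic otherwise. $r(Y)$ is the rank of the free group $\pi_1(Y)$. A vertex $v$ of $Y$ is degenerate if there is an edge $e$ incident to $v$ with $G_e=G_v$; $V_{ndeg}(Y)$ is the set of non-degenerate vertices. The splitting is reduced if for every edge $e$ that is not a loop, $G_e$ is properly contained in the vertex groups of both endpoints. Given a function $\varphi\ge 0$ on vertex groups, the weighted complexity of a splitting of a finitely generated group $G$ is $r(Y)+\sum_{v\in V_{ndeg}(Y)}(1+\varphi(G_v))$ if $G$ contains hyperbolic elements, and $1$ if every element of $G$ is elliptic; it is computed on the minimal invariant subtree. With $\varphi=0$ it is called the complexity. $N_G$ is the set of normal subgroups of finite index of $G$ ordered by reverse inclusion. For a function $C$ on finite index subgroups, $\varlimsup_{H\in N_G}\frac{C(H)}{[G:H]}$ is the supremum of all $\ell$ such that $(C(K)/[G:K])_{K\in\mathcal K}\to\ell$ for some cofinal subset $\mathcal K\subseteq N_G$. $V_{fin}(\Gamma)=\varlimsup_{H\in N_\Gamma}\frac{C_{max}(H)}{[\Gamma:H]}$, where $C_{max}(H)$ is the maximal complexity of $H$ over all reduced splittings of $H$ with finite edge groups. Fix an acylindricity constant $k\ge 2$. For $G$ finitely generated, torsion-free, one-ended, CSA with abelian subgroups finitely generated of bounded rank, $V_n^{CSA}(G)=\varlimsup_{H\in N_G}\frac{C^{\varphi}_{max}(H)}{[G:H]}$, where $C^{\varphi}_{max}(H)$ is the maximal weighted complexity of $H$ over all reduced $k$-acylindrical splittings of $H$ with (free) abelian edge groups of rank at most $n$, with $\varphi(H_v)=V_{fin}(H_v)$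 for each (finitely generated, torsion-free) vertex group $H_v$. *)

theory Defs
  imports
    "HOL-Analysis.Infinite_Sum"
    "HOL-Library.Extended_Nonnegative_Real"
    "HOL-Algebra.FiniteProduct"
    "HOL-Algebra.Generated_Groups"
    "HOL-Algebra.Group_Action"
    "Graph_Theory.Graph_Theory"
begin

section \<open>Groups\<close>

abbreviation subgrp :: "'g monoid \<Rightarrow> 'g set \<Rightarrow> 'g monoid" where
  "subgrp G H \<equiv> G\<lparr>carrier := H\<rparr>"

definition finitely_generated :: "'g monoid \<Rightarrow> bool" where
  "finitely_generated G \<longleftrightarrow>
     (\<exists>S. finite S \<and> S \<subseteq> carrier G \<and> generate G S = carrier G)"

definition torsion_free :: "'g monoid \<Rightarrow> bool" where
  "torsion_free G \<longleftrightarrow>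
     (\<forall>x\<in>carrier G. \<forall>m::nat. m > 0 \<longrightarrow> x [^]\<^bsub>G\<^esub> m = \<one>\<^bsub>G\<^esub> \<longrightarrow> x = \<one>\<^bsub>G\<^esub>)"

definition maximal_abelian :: "'g monoid \<Rightarrow> 'g set \<Rightarrow> bool" where
  "maximal_abelian G M \<longleftrightarrow> subgroup M G \<and> comm_group (subgrp G M) \<and>
     (\<forall>A. subgroup A G \<and> comm_group (subgrp G A) \<and> M \<subseteq> A \<longrightarrow> A = M)"

definition malnormal :: "'g monoid \<Rightarrow> 'g set \<Rightarrow> bool" where
  "malnormal G M \<longleftrightarrow>
     (\<forall>g\<in>carrier G - M. M \<inter> (g <#\<^bsub>G\<^esub> M #>\<^bsub>G\<^esub> (inv\<^bsub>G\<^esub> g)) = {\<one>\<^bsub>G\<^esub>})"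

definition CSA :: "'g monoid \<Rightarrow> bool" where
  "CSA G \<longleftrightarrow> (\<forall>M. maximal_abelian G M \<longrightarrow> malnormal G M)"

definition cayley_rel :: "'g monoid \<Rightarrow> 'g set \<Rightarrow> 'g rel" where
  "cayley_rel G S = (\<Union>x\<in>carrier G. \<Union>s\<in>S. {(x, x \<otimes>\<^bsub>G\<^esub> s), (x \<otimes>\<^bsub>G\<^esub> s, x)})"

text \<open>
  One end: after deletion of any finite set of vertices, the Cayley graph with respect to a
  finite generating set has exactly one infinite connected component.  This does not depend on
  the finite generating set.
\<close>
definition one_ended :: "'g monoid \<Rightarrow> bool" where
  "one_ended G \<longleftrightarrow> finitely_generated G \<and>
     (\<forall>S K. finite S \<and> S \<subseteq> carrier G \<and> generate G S = carrier G \<and> finite K \<longrightarrow>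
        (\<exists>!C. C \<in> (carrier G - K) // (Restr (cayley_rel G S) (carrier G - K))\<^sup>* \<and> infinite C))"

definition independent_in :: "'g monoid \<Rightarrow> 'g set \<Rightarrow> bool" where
  "independent_in A S \<longleftrightarrow> S \<subseteq> carrier A \<and> finite S \<and>
     (\<forall>f :: 'g \<Rightarrow> int. finprod A (\<lambda>s. s [^]\<^bsub>A\<^esub> f s) S = \<one>\<^bsub>A\<^esub> \<longrightarrow> (\<forall>s\<in>S. f s = 0))"

text \<open>
  Finitely generated abelian group of rank at most \<open>n\<close>.  In a torsion-free group such a subgroup
  is automatically free abelian, of rank at most \<open>n\<close>.
\<close>
definition fg_abelian_rank_le :: "'g monoid \<Rightarrow> nat \<Rightarrow> bool" where
  "fg_abelian_rank_le A n \<longleftrightarrow> comm_group A \<and> finitely_generated A \<and>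
     (\<forall>S. independent_in A S \<longrightarrow> card S \<le> n)"

text \<open>The least cardinality of a generating set; for a free group, the cardinality of a basis.\<close>
definition group_rank :: "'g monoid \<Rightarrow> ennreal" where
  "group_rank G =
     (INF S\<in>{S. finite S \<and> S \<subseteq> carrier G \<and> generate G S = carrier G}. of_nat (card S))"


section \<open>Combinatorial fundamental groups\<close>

text \<open>
  Fundamental group, based at \<open>x\<close>, of the 2-complex whose 1-skeleton is the graph in the sense
  of Serre given by \<open>D\<close> and the edge reversal \<open>arev\<close>, with a 2-cell attached along each closed
  walk in \<open>R\<close>: classes of closed walks modulo insertion and deletion of
  backtrackings and of the boundaries of 2-cells.
\<close>
definition loops_at :: "('a, 'e) pre_digraph \<Rightarrow> 'a \<Rightarrow> 'e list set" where
  "loops_at D x = {p. pre_digraph.awalk D x p x}"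

definition loop_step ::
  "('a, 'e) pre_digraph \<Rightarrow> ('e \<Rightarrow> 'e) \<Rightarrow> 'e list set \<Rightarrow> 'a \<Rightarrow> 'e list rel" where
  "loop_step D arev R x = {(p, q). p \<in> loops_at D x \<and> q \<in> loops_at D x \<and>
     (\<exists>u r v. p = u @ v \<and> q = u @ r @ v \<and> r \<in> R \<union> (\<lambda>a. [a, arev a]) ` arcs D)}"

definition loop_homotopy ::
  "('a, 'e) pre_digraph \<Rightarrow> ('e \<Rightarrow> 'e) \<Rightarrow> 'e list set \<Rightarrow> 'a \<Rightarrow> 'e list rel" where
  "loop_homotopy D arev R x = (loop_step D arev R x \<union> (loop_step D arev R x)\<inverse>)\<^sup>*"

definition pi1 ::
  "('a, 'e) pre_digraph \<Rightarrow> ('e \<Rightarrow> 'e) \<Rightarrow> 'e list set \<Rightarrow> 'a \<Rightarrow> 'e list set monoid" where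
  "pi1 D arev R x =
     \<lparr>carrier = loops_at D x // loop_homotopy D arev R x,
      mult = (\<lambda>A B. \<Union>a\<in>A. \<Union>b\<in>B. loop_homotopy D arev R x `` {a @ b}),
      one = loop_homotopy D arev R x `` {[]}\<rparr>"

text \<open>
  A compact connected surface with non-empty boundary, given by the set \<open>F\<close> of
  triangles of a triangulation (every compact surface is triangulable).  Since every edge is in at
  most two triangles, a connected vertex link is an arc or a circle, so the vertex has a
  half-disc or disc neighbourhood.  The boundary consists of the edges in exactly one triangle.
\<close>
definition tri_edge_rel :: "nat set set \<Rightarrow> nat rel" where
  "tri_edge_rel F = {(a, b). a \<noteq> b \<and> (\<exists>t\<in>F. {a, b} \<subseteq> t)}"

definition tri_link_rel :: "nat set set \<Rightarrow> nat \<Rightarrow> nat rel" where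
  "tri_link_rel F v = {(a, b). {v, a, b} \<in> F}"

definition triangulated_surface_with_boundary :: "nat set set \<Rightarrow> bool" where
  "triangulated_surface_with_boundary F \<longleftrightarrow>
     finite F \<and> F \<noteq> {} \<and> (\<forall>t\<in>F. card t = 3) \<and>
     (\<forall>(a, b)\<in>tri_edge_rel F. card {t\<in>F. {a, b} \<subseteq> t} \<le> 2) \<and>
     (\<forall>v\<in>\<Union>F. \<forall>a b. (v, a) \<in> tri_edge_rel F \<and> (v, b) \<in> tri_edge_rel F \<longrightarrow>
        (a, b) \<in> (tri_link_rel F v)\<^sup>*) \<and>
     (\<forall>a\<in>\<Union>F. \<forall>b\<in>\<Union>F. (a, b) \<in> (tri_edge_rel F)\<^sup>*) \<and>
     (\<exists>(a, b)\<in>tri_edge_rel F. card {t\<in>F. {a, b} \<subseteq> t} = 1)"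

definition triangulation_pi1 :: "nat set set \<Rightarrow> nat \<Rightarrow> (nat \<times> nat) list set monoid" where
  "triangulation_pi1 F x =
     pi1 (with_proj \<lparr>pverts = \<Union>F, parcs = tri_edge_rel F\<rparr>) prod.swap
       {[(a, b), (b, c), (c, a)] | a b c. {a, b, c} \<in> F} x"

definition bounded_surface_group :: "'g monoid \<Rightarrow> bool" where
  "bounded_surface_group G \<longleftrightarrow>
     (\<exists>F x. triangulated_surface_with_boundary F \<and> x \<in> \<Union>F \<and> G \<cong> triangulation_pi1 F x)"


section \<open>Group actions on trees\<close>

text \<open>
  Trees are symmetric loop-free digraphs; a cycle of length 2 only traverses an edge and its
  reverse.  (The predicate \<open>tree\<close> of the graph library excludes directed cycles only.)
\<close>
definition simplicial_tree :: "'v pair_pre_digraph \<Rightarrow> bool" where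
  "simplicial_tree X \<longleftrightarrow> pair_bidirected_digraph X \<and> strongly_connected (with_proj X) \<and>
     \<not> (\<exists>p. pre_digraph.cycle (with_proj X) p \<and> length p \<ge> 3)"

text \<open>
  A splitting of \<open>G\<close> is an action without inversions on a tree (its Bass--Serre tree).
\<close>
definition splitting :: "'g monoid \<Rightarrow> 'v pair_pre_digraph \<Rightarrow> ('g \<Rightarrow> 'v \<Rightarrow> 'v) \<Rightarrow> bool" where
  "splitting G X \<alpha> \<longleftrightarrow> group G \<and> simplicial_tree X \<and> group_action G (pverts X) \<alpha> \<and>
     (\<forall>g\<in>carrier G. \<forall>(x, y)\<in>parcs X. (\<alpha> g x, \<alpha> g y) \<in> parcs X \<and> \<not> (\<alpha> g x = y \<and> \<alpha> g y = x))"

definition pointwise_stab :: "'g monoid \<Rightarrow> ('g \<Rightarrow> 'v \<Rightarrow> 'v) \<Rightarrow> 'v set \<Rightarrow> 'g set" where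
  "pointwise_stab G \<alpha> S = {g\<in>carrier G. \<forall>x\<in>S. \<alpha> g x = x}"

abbreviation vertex_group :: "'g monoid \<Rightarrow> ('g \<Rightarrow> 'v \<Rightarrow> 'v) \<Rightarrow> 'v \<Rightarrow> 'g monoid" where
  "vertex_group G \<alpha> x \<equiv> subgrp G (stabilizer G \<alpha> x)"

abbreviation edge_group :: "'g monoid \<Rightarrow> ('g \<Rightarrow> 'v \<Rightarrow> 'v) \<Rightarrow> 'v \<Rightarrow> 'v \<Rightarrow> 'g monoid" where
  "edge_group G \<alpha> x y \<equiv> subgrp G (pointwise_stab G \<alpha> {x, y})"

definition abelian_edge_groups ::
  "'g monoid \<Rightarrow> 'v pair_pre_digraph \<Rightarrow> ('g \<Rightarrow> 'v \<Rightarrow> 'v) \<Rightarrow> bool" where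
  "abelian_edge_groups G X \<alpha> \<longleftrightarrow> (\<forall>(x, y)\<in>parcs X. comm_group (edge_group G \<alpha> x y))"

definition acylindrical ::
  "nat \<Rightarrow> 'g monoid \<Rightarrow> 'v pair_pre_digraph \<Rightarrow> ('g \<Rightarrow> 'v \<Rightarrow> 'v) \<Rightarrow> bool" where
  "acylindrical k G X \<alpha> \<longleftrightarrow>
     (\<forall>p. vpath p (with_proj X) \<and> vwalk_length p > k + 1 \<longrightarrow>
        pointwise_stab G \<alpha> (set p) = {\<one>\<^bsub>G\<^esub>})"

text \<open>An edge maps to a loop of the quotient graph iff its endpoints are in one orbit.\<close>
definition reduced ::
  "'g monoid \<Rightarrow> 'v pair_pre_digraph \<Rightarrow> ('g \<Rightarrow> 'v \<Rightarrow> 'v) \<Rightarrow> bool" where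
  "reduced G X \<alpha> \<longleftrightarrow>
     (\<forall>(x, y)\<in>parcs X. Group_Action.orbit G \<alpha> x \<noteq> Group_Action.orbit G \<alpha> y \<longrightarrow>
        pointwise_stab G \<alpha> {x, y} \<subset> stabilizer G \<alpha> x \<and>
        pointwise_stab G \<alpha> {x, y} \<subset> stabilizer G \<alpha> y)"

text \<open>
  For countable groups, such as the subgroups of a finitely generated group, trees with vertices
  in \<open>nat\<close> suffice here: the hull of the orbit of a single vertex is a countable invariant
  subtree.
\<close>
definition rigid :: "'g monoid \<Rightarrow> bool" where
  "rigid G \<longleftrightarrow>
     (\<forall>(X :: nat pair_pre_digraph) \<alpha>. splitting G X \<alpha> \<and> abelian_edge_groups G X \<alpha> \<longrightarrow>
        (\<exists>x\<in>pverts X. stabilizer G \<alpha> x = carrier G))"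

abbreviation flexible :: "'g monoid \<Rightarrow> bool" where
  "flexible G \<equiv> \<not> rigid G"


section \<open>The tree of cylinders\<close>

definition edge_set :: "'v pair_pre_digraph \<Rightarrow> 'v set set" where
  "edge_set X = (\<lambda>(x, y). {x, y}) ` parcs X"

definition cylinder_rel ::
  "'g monoid \<Rightarrow> 'v pair_pre_digraph \<Rightarrow> ('g \<Rightarrow> 'v \<Rightarrow> 'v) \<Rightarrow> 'v set rel" where
  "cylinder_rel G X \<alpha> = {(e, f). e \<in> edge_set X \<and> f \<in> edge_set X \<and>
     comm_group (subgrp G (generate G (pointwise_stab G \<alpha> e \<union> pointwise_stab G \<alpha> f)))}"

text \<open>
  A cylinder is represented by its set of edges, so its vertices are the elements of \<open>\<Union>Z\<close>.
\<close>
definition cylinders ::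
  "'g monoid \<Rightarrow> 'v pair_pre_digraph \<Rightarrow> ('g \<Rightarrow> 'v \<Rightarrow> 'v) \<Rightarrow> 'v set set set" where
  "cylinders G X \<alpha> = edge_set X // cylinder_rel G X \<alpha>"

definition tc_old_verts ::
  "'g monoid \<Rightarrow> 'v pair_pre_digraph \<Rightarrow> ('g \<Rightarrow> 'v \<Rightarrow> 'v) \<Rightarrow> 'v set" where
  "tc_old_verts G X \<alpha> = {x\<in>pverts X.
     \<exists>Z\<in>cylinders G X \<alpha>. \<exists>Z'\<in>cylinders G X \<alpha>. Z \<noteq> Z' \<and> x \<in> \<Union>Z \<and> x \<in> \<Union>Z'}"

definition tree_of_cylinders ::
  "'g monoid \<Rightarrow> 'v pair_pre_digraph \<Rightarrow> ('g \<Rightarrow> 'v \<Rightarrow> 'v) \<Rightarrow> ('v + 'v set set) pair_pre_digraph" where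
  "tree_of_cylinders G X \<alpha> =
     \<lparr>pverts = Inl ` tc_old_verts G X \<alpha> \<union> Inr ` cylinders G X \<alpha>,
      parcs = (\<Union>x\<in>tc_old_verts G X \<alpha>. \<Union>Z\<in>{Z\<in>cylinders G X \<alpha>. x \<in> \<Union>Z}.
                 {(Inl x, Inr Z), (Inr Z, Inl x)})\<rparr>"

definition tc_action ::
  "'g monoid \<Rightarrow> 'v pair_pre_digraph \<Rightarrow> ('g \<Rightarrow> 'v \<Rightarrow> 'v) \<Rightarrow> 'g \<Rightarrow> 'v + 'v set set \<Rightarrow> 'v + 'v set set" where
  "tc_action G X \<alpha> g =
     restrict (map_sum (\<alpha> g) (image (image (\<alpha> g)))) (pverts (tree_of_cylinders G X \<alpha>))"


section \<open>Complexity of splittings\<close>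

text \<open>
  Quotient graph.  The origin and terminus of the orbit of an oriented edge are its domain
  and range, and its inverse edge is its converse relation.
\<close>
definition quotient_graph ::
  "'g monoid \<Rightarrow> 'v pair_pre_digraph \<Rightarrow> ('g \<Rightarrow> 'v \<Rightarrow> 'v) \<Rightarrow> ('v set, 'v rel) pre_digraph" where
  "quotient_graph G X \<alpha> =
     \<lparr>verts = orbits G (pverts X) \<alpha>,
      arcs = (\<lambda>(x, y). {(\<alpha> g x, \<alpha> g y) | g. g \<in> carrier G}) ` parcs X,
      tail = Domain, head = Range\<rparr>"

definition quotient_rank ::
  "'g monoid \<Rightarrow> 'v pair_pre_digraph \<Rightarrow> ('g \<Rightarrow> 'v \<Rightarrow> 'v) \<Rightarrow> ennreal" where
  "quotient_rank G X \<alpha> =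
     group_rank (pi1 (quotient_graph G X \<alpha>) converse {} (SOME Q. Q \<in> orbits G (pverts X) \<alpha>))"

definition nondegenerate_orbits ::
  "'g monoid \<Rightarrow> 'v pair_pre_digraph \<Rightarrow> ('g \<Rightarrow> 'v \<Rightarrow> 'v) \<Rightarrow> 'v set set" where
  "nondegenerate_orbits G X \<alpha> = {Q\<in>orbits G (pverts X) \<alpha>.
     \<not> (\<exists>(x, y)\<in>parcs X. x \<in> Q \<and> pointwise_stab G \<alpha> {x, y} = stabilizer G \<alpha> x)}"

definition sub_graph :: "'v pair_pre_digraph \<Rightarrow> 'v set \<Rightarrow> 'v pair_pre_digraph" where
  "sub_graph X W = \<lparr>pverts = W, parcs = Restr (parcs X) W\<rparr>"

definition minimal_verts ::
  "'g monoid \<Rightarrow> 'v pair_pre_digraph \<Rightarrow> ('g \<Rightarrow> 'v \<Rightarrow> 'v) \<Rightarrow> 'v set" where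
  "minimal_verts G X \<alpha> = \<Inter>{W. W \<subseteq> pverts X \<and> strongly_connected (with_proj (sub_graph X W)) \<and>
     (\<forall>g\<in>carrier G. \<alpha> g ` W \<subseteq> W)}"

definition elliptic :: "'v pair_pre_digraph \<Rightarrow> ('g \<Rightarrow> 'v \<Rightarrow> 'v) \<Rightarrow> 'g \<Rightarrow> bool" where
  "elliptic X \<alpha> g \<longleftrightarrow> (\<exists>x\<in>pverts X. \<alpha> g x = x)"

text \<open>
  Vertex groups of the quotient are stabilizers of orbit representatives, well defined up to
  conjugation.  For a finitely generated group the sum is finite.
\<close>
definition graph_complexity :: "'g monoid \<Rightarrow> ('g monoid \<Rightarrow> ennreal) \<Rightarrow>
    'v pair_pre_digraph \<Rightarrow> ('g \<Rightarrow> 'v \<Rightarrow> 'v) \<Rightarrow> ennreal" where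
  "graph_complexity G \<phi> X \<alpha> = quotient_rank G X \<alpha> +
     (\<Sum>\<^sub>\<infinity>Q\<in>nondegenerate_orbits G X \<alpha>. 1 + \<phi> (vertex_group G \<alpha> (SOME x. x \<in> Q)))"

definition weighted_complexity :: "'g monoid \<Rightarrow> ('g monoid \<Rightarrow> ennreal) \<Rightarrow>
    'v pair_pre_digraph \<Rightarrow> ('g \<Rightarrow> 'v \<Rightarrow> 'v) \<Rightarrow> ennreal" where
  "weighted_complexity G \<phi> X \<alpha> =
     (if \<forall>g\<in>carrier G. elliptic X \<alpha> g then 1
      else graph_complexity G \<phi> (sub_graph X (minimal_verts G X \<alpha>))
             (\<lambda>g. restrict (\<alpha> g) (minimal_verts G X \<alpha>)))"


section \<open>Volumes\<close>

definition finite_index_normal :: "'g monoid \<Rightarrow> 'g set set" where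
  "finite_index_normal G = {H. H \<lhd> G \<and> finite (rcosets\<^bsub>G\<^esub> H)}"

text \<open>
  The filter is that of tails of the directed set \<open>\<K>\<close>, ordered by reverse inclusion.
\<close>
definition index_limsup :: "'g monoid \<Rightarrow> ('g monoid \<Rightarrow> ennreal) \<Rightarrow> ennreal" where
  "index_limsup G C = Sup {l. \<exists>\<K> \<subseteq> finite_index_normal G.
     (\<forall>H\<in>finite_index_normal G. \<exists>K\<in>\<K>. K \<subseteq> H) \<and>
     ((\<lambda>K. C (subgrp G K) / of_nat (card (rcosets\<^bsub>G\<^esub> K))) \<longlongrightarrow> l)
       (INF L\<in>\<K>. principal {K\<in>\<K>. K \<subseteq> L})}"

text \<open>
  A reduced splitting of a finitely generated group is minimal, so its tree is countable;
  hence the suprema below range over all reduced splittings in question up to isomorphism.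
\<close>
definition C_max_fin :: "'g monoid \<Rightarrow> ennreal" where
  "C_max_fin H = Sup {weighted_complexity H (\<lambda>_. 0) X \<alpha> | (X :: nat pair_pre_digraph) \<alpha>.
     splitting H X \<alpha> \<and> reduced H X \<alpha> \<and>
     (\<forall>(x, y)\<in>parcs X. finite (pointwise_stab H \<alpha> {x, y}))}"

definition V_fin :: "'g monoid \<Rightarrow> ennreal" where
  "V_fin G = index_limsup G C_max_fin"

definition C_max_CSA :: "nat \<Rightarrow> nat \<Rightarrow> 'g monoid \<Rightarrow> ennreal" where
  "C_max_CSA k n H = Sup {weighted_complexity H V_fin X \<alpha> | (X :: nat pair_pre_digraph) \<alpha>.
     splitting H X \<alpha> \<and> reduced H X \<alpha> \<and> acylindrical k H X \<alpha> \<and>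
     (\<forall>(x, y)\<in>parcs X. fg_abelian_rank_le (edge_group H \<alpha> x y) n)}"

definition V_CSA :: "nat \<Rightarrow> nat \<Rightarrow> 'g monoid \<Rightarrow> ennreal" where
  "V_CSA k n G = index_limsup G (C_max_CSA k n)"

end

(*
  Every finite index normal subgroup H of G satisfies C_max(H) >= [G:H], so the volume is at least 1.

  Let x be the vertex of T whose stabilizer is the flexible vertex group S, and let W be its orbit.
  The tree of cylinders (with all vertices of T kept, so that no minimality is needed) is acylindrical,
  because the centralizers of the edge stabilizers are maximal abelian and a nontrivial element lies
  in at most one of them.  Collapse it along a maximal H-invariant equivalence relation with connected
  classes that contain at most one point of W each: the quotient is a reduced acylindrical splitting of H
  in which every H-orbit in W survives as a nondegenerate vertex.  If w runs through representatives of
  these orbits, the indices [G_w : H_w] sum up to at least [G:H], so it remains to see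
  V_fin(H_w) >= [G_w : H_w].

  The group of a compact surface with boundary is the fundamental group of a graph, by collapsing free
  faces, and a non-separating edge of the graph splits it as S = A * <t>.  When S is not abelian, A is
  nontrivial.  A subgroup M of finite index acts on the tree of this splitting with trivial edge
  stabilizers and infinite vertex stabilizers, so each vertex of the quotient counts at least 1; the
  quotient has [S:M] edges, and rank plus number of vertices is at least the number of edges.  Hence
  C_max(M) >= [S:M], and the bound for V_fin follows.

  Finally W has more than one point: if G were S, then the half-space of the splitting A * <t> would
  be an almost invariant subset of G, so that G would have more than one end.
*)
theory Submission
  imports Defs "HOL-Analysis.Extended_Real_Limits"
begin

section \<open>Trees\<close>

text \<open>Collapsing is delicate because it might absorb the surface vertices. What protects them
  is commutativity: a non-abelian vertex group meets a normal subgroup of finite index in a group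
  that is still non-abelian, whereas all edge groups are abelian, so no edge group contains that
  intersection. No finiteness of the quotient graph is at hand, so the collapse comes from Zorn's
  lemma and not from an induction on edges.

  A lower bound for all the quotients bounds the limit superior only if some cofinal family of
  subgroups has convergent quotients. Finite generation leaves only countably many subgroups of
  finite index, hence a decreasing cofinal sequence, and compactness of \<open>ennreal\<close>
  provides a convergent subsequence.

  The free splitting is carried by a half-space \<open>P\<close>, not by normal forms: translates of
  \<open>P\<close> separate the ends of each edge, \<open>P\<close> shows that edge stabilizers are
  trivial, and the same set serves in the argument on ends.

  All complexities are suprema over trees with vertices in \<open>nat\<close>, so every tree that is
  used has to be countable first.\<close>

definition rwalk :: "'v rel \<Rightarrow> 'v list \<Rightarrow> bool" where
  "rwalk E xs \<longleftrightarrow> xs \<noteq> [] \<and> (\<forall>i. Suc i < length xs \<longrightarrow> (xs ! i, xs ! Suc i) \<in> E) \<and>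
     (\<forall>i. Suc (Suc i) < length xs \<longrightarrow> xs ! i \<noteq> xs ! Suc (Suc i))"

lemma rwalk_single [simp]: "rwalk E [x]"
  by (simp add: rwalk_def)

lemma rwalk_Nil [simp]: "\<not> rwalk E []"
  by (simp add: rwalk_def)

lemma rwalk_Cons2 [simp]:
  "rwalk E (x # y # zs) \<longleftrightarrow> (x, y) \<in> E \<and> rwalk E (y # zs) \<and> (zs \<noteq> [] \<longrightarrow> x \<noteq> hd zs)"
proof
  assume l: "rwalk E (x # y # zs)"
  then have E: "Suc i < length (x # y # zs) \<Longrightarrow> ((x # y # zs) ! i, (x # y # zs) ! Suc i) \<in> E"
    and R: "Suc (Suc i) < length (x # y # zs) \<Longrightarrow> (x # y # zs) ! i \<noteq> (x # y # zs) ! Suc (Suc i)" for i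
    by (simp_all add: rwalk_def)
  have "rwalk E (y # zs)"
    unfolding rwalk_def
  proof (intro conjI allI impI)
    show "(y # zs) ! i \<noteq> (y # zs) ! Suc (Suc i)" if "Suc (Suc i) < length (y # zs)" for i
      using R[of "Suc i"] that by simp
    show "((y # zs) ! i, (y # zs) ! Suc i) \<in> E" if "Suc i < length (y # zs)" for i
      using E[of "Suc i"] that by simp
  qed simp
  then show "(x, y) \<in> E \<and> rwalk E (y # zs) \<and> (zs \<noteq> [] \<longrightarrow> x \<noteq> hd zs)"
    using E[of 0] R[of 0] by (simp add: hd_conv_nth)
next
  assume r: "(x, y) \<in> E \<and> rwalk E (y # zs) \<and> (zs \<noteq> [] \<longrightarrow> x \<noteq> hd zs)"
  show "rwalk E (x # y # zs)"
    unfolding rwalk_def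
  proof (intro conjI allI impI)
    show "((x # y # zs) ! i, (x # y # zs) ! Suc i) \<in> E" if "Suc i < length (x # y # zs)" for i
      using r that by (cases i) (auto simp: rwalk_def)
    show "(x # y # zs) ! i \<noteq> (x # y # zs) ! Suc (Suc i)"
      if "Suc (Suc i) < length (x # y # zs)" for i
      using r that by (cases i) (auto simp: rwalk_def hd_conv_nth)
  qed simp
qed

text \<open>Only the two neighbours of the junction \<open>m\<close> can create a backtrack. Gluing
  a walk to a translate of itself in this way and then appealing to \<open>rwalk_unique\<close> is
  the main device of the geometric arguments.\<close>

lemma rwalk_append:
  assumes "rwalk E (xs @ [m])" "rwalk E (m # ys)" "xs \<noteq> [] \<Longrightarrow> ys \<noteq> [] \<Longrightarrow> last xs \<noteq> hd ys"
  shows "rwalk E (xs @ m # ys)"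
  using assms
proof (induction xs)
  case (Cons x xs)
  show ?case
  proof (cases xs)
    case Nil
    then show ?thesis using Cons.prems by simp
  next
    case (Cons z zs)
    then show ?thesis using Cons.prems Cons.IH
      by (cases zs) auto
  qed
qed simp

lemma rwalk_prefix: "rwalk E (xs @ ys) \<Longrightarrow> xs \<noteq> [] \<Longrightarrow> rwalk E xs"
proof -
  assume a: "rwalk E (xs @ ys)" "xs \<noteq> []"
  show "rwalk E xs" unfolding rwalk_def
  proof (intro conjI allI impI)
    show "(xs ! i, xs ! Suc i) \<in> E" if "Suc i < length xs" for i
      using a(1) that unfolding rwalk_def
      by (metis Suc_lessD length_append nth_append trans_less_add1)
    show "xs ! i \<noteq> xs ! Suc (Suc i)" if "Suc (Suc i) < length xs" for i
      using a(1) that unfolding rwalk_def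
      by (metis Suc_lessD length_append nth_append trans_less_add1)
  qed (use a in simp)
qed

lemma rwalk_suffix: "rwalk E (xs @ ys) \<Longrightarrow> ys \<noteq> [] \<Longrightarrow> rwalk E ys"
proof (induction xs)
  case (Cons x xs)
  then obtain z zs where "xs @ ys = z # zs" by (metis append_is_Nil_conv neq_Nil_conv)
  then show ?case using Cons by simp
qed simp

lemma rwalk_rev:
  assumes "sym E" "rwalk E xs"
  shows "rwalk E (rev xs)"
  unfolding rwalk_def
proof (intro conjI allI impI)
  show "(rev xs ! i, rev xs ! Suc i) \<in> E" if i: "Suc i < length (rev xs)" for i
  proof -
    have "(xs ! (length xs - Suc (Suc i)), xs ! Suc (length xs - Suc (Suc i))) \<in> E"
      using assms(2) i unfolding rwalk_def by auto
    then show ?thesis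
      using i assms(1) by (auto simp: rev_nth Suc_diff_Suc dest: symD)
  qed
  show "rev xs ! i \<noteq> rev xs ! Suc (Suc i)" if i: "Suc (Suc i) < length (rev xs)" for i
  proof -
    have "xs ! (length xs - Suc (Suc (Suc i))) \<noteq> xs ! Suc (Suc (length xs - Suc (Suc (Suc i))))"
      using assms(2) i unfolding rwalk_def by auto
    then show ?thesis
      using i by (auto simp: rev_nth Suc_diff_Suc)
  qed
qed (use assms in auto)

lemma rwalk_map:
  assumes "rwalk E xs" "\<And>a b. (a, b) \<in> E \<Longrightarrow> (f a, f b) \<in> E'" "inj_on f (set xs)"
  shows "rwalk E' (map f xs)"
  using assms unfolding rwalk_def
  by (auto simp: inj_on_eq_iff)

lemma rwalk_mono: "rwalk E xs \<Longrightarrow> E \<subseteq> E' \<Longrightarrow> rwalk E' xs"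
  by (auto simp: rwalk_def)

lemma rwalk_restr: "rwalk E xs \<Longrightarrow> set xs \<subseteq> S \<Longrightarrow> rwalk (E \<inter> S \<times> S) xs"
  by (auto simp: rwalk_def)

lemma rwalk_set:
  assumes "rwalk E xs" "E \<subseteq> V \<times> V" "hd xs \<in> V"
  shows "set xs \<subseteq> V"
  using assms
proof (induction xs)
  case (Cons x xs)
  then show ?case by (cases xs) auto
qed simp

lemma rtrancl_imp_rwalk:
  assumes "(x, y) \<in> E\<^sup>*"
  obtains p where "rwalk E p" "hd p = x" "last p = y"
proof -
  have "\<exists>p. rwalk E p \<and> hd p = x \<and> last p = y"
    using assms
  proof (induction rule: converse_rtrancl_induct)
    case base
    then show ?case by (intro exI[of _ "[y]"]) simp
  next
    case (step a b)
    then obtain p where p: "rwalk E p" "hd p = b" "last p = y" by blast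
    then obtain ps where ps: "p = b # ps" by (cases p) auto
    \<comment> \<open>A walk from \<open>b\<close> that begins by going to \<open>a\<close> already
      contains a walk from \<open>a\<close>; otherwise \<open>a\<close> can be put in front.\<close>
    show ?case
    proof (cases "ps \<noteq> [] \<and> hd ps = a")
      case True
      then show ?thesis using p ps by (intro exI[of _ ps]) (cases ps; auto)
    next
      case False
      then show ?thesis using p ps step by (intro exI[of _ "a # p"]) auto
    qed
  qed
  with that show thesis by blast
qed

text \<open>Removing backtracks never lengthens a walk. The bound on the length is what the
  ping-pong argument exploits.\<close>

lemma rwalk_shorten:
  assumes "xs \<noteq> []" "\<And>i. Suc i < length xs \<Longrightarrow> (xs ! i, xs ! Suc i) \<in> E"
  shows "\<exists>p. rwalk E p \<and> hd p = hd xs \<and> last p = last xs \<and> length p \<le> length xs"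
  using assms
proof (induction xs)
  case (Cons a xs)
  show ?case
  proof (cases xs)
    case Nil
    then show ?thesis by (intro exI[of _ "[a]"]) simp
  next
    case (Cons b bs)
    have "(a, b) \<in> E" using Cons.prems(2)[of 0] Cons by simp
    have "\<exists>p. rwalk E p \<and> hd p = hd xs \<and> last p = last xs \<and> length p \<le> length xs"
      using Cons Cons.prems(2) by (intro Cons.IH) force+
    then obtain p where p: "rwalk E p" "hd p = b" "last p = last xs" "length p \<le> length xs"
      using Cons by auto
    then obtain ps where ps: "p = b # ps" by (cases p) auto
    show ?thesis
    proof (cases "ps \<noteq> [] \<and> hd ps = a")
      case True
      then show ?thesis using p ps Cons by (intro exI[of _ ps]) (cases ps; auto)
    next
      case False
      then show ?thesis using p ps \<open>(a, b) \<in> E\<close> Cons by (intro exI[of _ "a # p"]) auto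
    qed
  qed
qed simp

lemma rwalk_imp_rtrancl: "rwalk E p \<Longrightarrow> (hd p, last p) \<in> E\<^sup>*"
proof (induction p)
  case (Cons x p)
  then show ?case by (cases p) (auto intro: converse_rtrancl_into_rtrancl)
qed simp

text \<open>Demanding that every edge is a bridge, instead of forbidding cycles, suits subtrees,
  collapses and coset graphs: the condition can be checked by lifting a path or by exhibiting a set
  that separates the two ends.\<close>

locale simp_tree =
  fixes V :: "'v set" and E :: "'v rel"
  assumes V_nonempty: "V \<noteq> {}"
    and E_subset: "E \<subseteq> V \<times> V"
    and E_sym: "sym E"
    and E_irrefl: "(x, x) \<notin> E"
    and connected: "x \<in> V \<Longrightarrow> y \<in> V \<Longrightarrow> (x, y) \<in> E\<^sup>*"
    and bridge: "(x, y) \<in> E \<Longrightarrow> (x, y) \<notin> (E - {(x, y), (y, x)})\<^sup>*"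
begin

definition side :: "'v \<Rightarrow> 'v \<Rightarrow> 'v set" where
  "side x y = {z. (y, z) \<in> (E - {(x, y), (y, x)})\<^sup>*}"

lemma E_symD: "(x, y) \<in> E \<Longrightarrow> (y, x) \<in> E"
  using E_sym by (rule symD)

lemma sym_minus: "sym (E - {(x, y), (y, x)})"
  using E_sym by (auto simp: sym_def)

lemma side_self: "y \<in> side x y"
  by (simp add: side_def)

lemma side_neighbour: "(x, y) \<in> E \<Longrightarrow> x \<notin> side x y"
  using bridge sym_minus[of x y] by (metis mem_Collect_eq side_def symD sym_rtrancl)

lemma side_step:
  assumes "(a, b) \<in> E" "(a, b) \<noteq> (x, y)" "(a, b) \<noteq> (y, x)"
  shows "a \<in> side x y \<longleftrightarrow> b \<in> side x y"
proof -
  have "(b, a) \<in> E"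
    using assms(1) by (rule E_symD)
  then have "(a, b) \<in> E - {(x, y), (y, x)}" "(b, a) \<in> E - {(x, y), (y, x)}"
    using assms by auto
  then show ?thesis unfolding side_def by (auto intro: rtrancl.rtrancl_into_rtrancl)
qed

lemma side_disjoint: "(x, y) \<in> E \<Longrightarrow> z \<in> side x y \<Longrightarrow> z \<notin> side y x"
proof
  assume a: "(x, y) \<in> E" "z \<in> side x y" "z \<in> side y x"
  have "{(y, x), (x, y)} = {(x, y), (y, x)}" by auto
  then have "(y, z) \<in> (E - {(x, y), (y, x)})\<^sup>*" "(x, z) \<in> (E - {(x, y), (y, x)})\<^sup>*"
    using a by (auto simp: side_def insert_commute)
  then have "(x, y) \<in> (E - {(x, y), (y, x)})\<^sup>*"
    using sym_minus by (meson rtrancl_trans symD sym_rtrancl)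
  then show False using a bridge by blast
qed

text \<open>A path from \<open>z\<close> that avoids the edge to \<open>y\<close> stays away from
  \<open>y\<close>, hence cannot use the edge between \<open>x\<close> and \<open>y\<close>.
  Half-trees are therefore nested along a reduced walk.\<close>

lemma side_mono:
  assumes "(x, y) \<in> E" "(y, z) \<in> E" "z \<noteq> x"
  shows "side y z \<subseteq> side x y"
proof
  fix u assume "u \<in> side y z"
  then have "(z, u) \<in> (E - {(y, z), (z, y)})\<^sup>*" by (simp add: side_def)
  then show "u \<in> side x y"
  proof (induction rule: rtrancl_induct)
    case base
    have "(y, z) \<noteq> (x, y)" "(y, z) \<noteq> (y, x)" using assms E_irrefl by auto
    then show ?case using side_step[of y z x y] assms side_self by blast
  next
    case (step a b)
    have "a \<in> side y z" using step(1) by (simp add: side_def)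
    have "b \<in> side y z" using step(1,2) by (auto simp: side_def intro: rtrancl.rtrancl_into_rtrancl)
    have "y \<notin> side y z" using side_neighbour assms by blast
    then have "(a, b) \<noteq> (x, y)" "(a, b) \<noteq> (y, x)"
      using \<open>a \<in> side y z\<close> \<open>b \<in> side y z\<close> by auto
    then show ?case using step side_step[of a b x y] by blast
  qed
qed

lemma rwalk_side: "rwalk E (x # y # ys) \<Longrightarrow> set (y # ys) \<subseteq> side x y"
proof (induction ys arbitrary: x y)
  case (Cons z zs)
  then have "set (z # zs) \<subseteq> side y z" by simp
  moreover have "side y z \<subseteq> side x y" using Cons.prems by (intro side_mono) auto
  ultimately show ?case using side_self by auto
qed (simp add: side_self)

text \<open>Walks that part at \<open>x\<close> end in disjoint half-trees, since
  \<open>side x z\<close> lies in \<open>side y x\<close>. For the same kind of reason a nontrivial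
  reduced walk never ends at its origin.\<close>

lemma rwalk_unique:
  assumes "rwalk E p" "rwalk E q" "hd p = hd q" "last p = last q"
  shows "p = q"
  using assms
proof (induction p arbitrary: q)
  case (Cons x p)
  obtain q' where q: "q = x # q'" using Cons.prems by (cases q) auto
  have nontriv: "last (x # y # r) \<noteq> x" if "rwalk E (x # y # r)" for y r
  proof -
    have "last (y # r) \<in> side x y" using rwalk_side[OF that] last_in_set[of "y # r"] by blast
    then show ?thesis using side_neighbour[of x y] that by auto
  qed
  show ?case
  proof (cases p)
    case Nil
    then show ?thesis using Cons.prems q nontriv[of "hd q'" "tl q'"] by (cases q') (auto simp del: rwalk_Cons2)
  next
    case p: (Cons y p')
    then obtain z q'' where q': "q' = z # q''"
      using Cons.prems q nontriv[of y p'] by (cases q') (auto simp del: rwalk_Cons2)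
    have "y = z"
    proof (rule ccontr)
      assume "y \<noteq> z"
      have e: "(x, y) \<in> E" "(x, z) \<in> E" using Cons.prems p q q' by auto
      have "last (y # p') \<in> side x y"
        using rwalk_side[of x y p'] Cons.prems p last_in_set[of "y # p'"] by blast
      moreover have "last (z # q'') \<in> side x z"
        using rwalk_side[of x z q''] Cons.prems q q' last_in_set[of "z # q''"] by blast
      moreover have "side x z \<subseteq> side y x" using side_mono[of y x z] e E_symD \<open>y \<noteq> z\<close> by blast
      ultimately show False using side_disjoint[OF e(1)] Cons.prems(4) q q' p
        by (metis last_ConsR list.distinct(1) subsetD)
    qed
    then show ?thesis using Cons.IH[of q'] Cons.prems p q q' by auto
  qed
qed simp

lemma rwalk_exists:
  assumes "x \<in> V" "y \<in> V"
  obtains p where "rwalk E p" "hd p = x" "last p = y" "set p \<subseteq> V"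
  using connected[OF assms] rtrancl_imp_rwalk rwalk_set E_subset assms by metis

text \<open>The reduced walk that exists inside \<open>S\<close> is \<open>p\<close> by uniqueness;
  connected vertex sets are convex.\<close>

lemma rwalk_closed:
  assumes "S \<subseteq> V" "\<And>x y. x \<in> S \<Longrightarrow> y \<in> S \<Longrightarrow> (x, y) \<in> (E \<inter> S \<times> S)\<^sup>*"
    and "rwalk E p" "hd p \<in> S" "last p \<in> S"
  shows "set p \<subseteq> S"
proof -
  obtain q where q: "rwalk (E \<inter> S \<times> S) q" "hd q = hd p" "last q = last p"
    using rtrancl_imp_rwalk[OF assms(2)[OF assms(4,5)]] by blast
  then have "q = p" by (intro rwalk_unique rwalk_mono[of "E \<inter> S \<times> S" q E] assms) auto
  then show ?thesis using q rwalk_set[of "E \<inter> S \<times> S" q S] assms by auto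
qed

end

section \<open>Group actions on trees\<close>

text \<open>Nothing is required of \<open>act\<close> off \<open>V\<close> or off the carrier. One
  and the same function can thus be kept when passing to subgroups and to invariant subtrees, which
  an action by extensional bijections would not allow.\<close>

locale tree_act = simp_tree V E + group G
  for V :: "'v set" and E :: "'v rel" and G :: "'g monoid" (structure) +
  fixes act :: "'g \<Rightarrow> 'v \<Rightarrow> 'v"
  assumes act_one: "x \<in> V \<Longrightarrow> act \<one> x = x"
    and act_mult: "g \<in> carrier G \<Longrightarrow> h \<in> carrier G \<Longrightarrow> x \<in> V \<Longrightarrow> act (g \<otimes> h) x = act g (act h x)"
    and act_closed: "g \<in> carrier G \<Longrightarrow> x \<in> V \<Longrightarrow> act g x \<in> V"
    and act_E: "g \<in> carrier G \<Longrightarrow> (x, y) \<in> E \<Longrightarrow> (act g x, act g y) \<in> E"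
    and no_inversion: "g \<in> carrier G \<Longrightarrow> (x, y) \<in> E \<Longrightarrow> \<not> (act g x = y \<and> act g y = x)"
begin

abbreviation stab :: "'v \<Rightarrow> 'g set" where
  "stab x \<equiv> stabilizer G act x"

lemma stab_iff: "g \<in> stab x \<longleftrightarrow> g \<in> carrier G \<and> act g x = x"
  by (simp add: stabilizer_def)

lemma pointwise_stab_pair: "pointwise_stab G act {x, y} = stab x \<inter> stab y"
  by (auto simp: pointwise_stab_def stabilizer_def)

lemma act_inv: "g \<in> carrier G \<Longrightarrow> x \<in> V \<Longrightarrow> act (inv g) (act g x) = x"
  using act_mult[of "inv g" g x] act_one by simp

lemma act_inv': "g \<in> carrier G \<Longrightarrow> x \<in> V \<Longrightarrow> act g (act (inv g) x) = x"
  using act_mult[of g "inv g" x] act_one by simp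

lemma act_inj: "g \<in> carrier G \<Longrightarrow> x \<in> V \<Longrightarrow> y \<in> V \<Longrightarrow> act g x = act g y \<longleftrightarrow> x = y"
  by (metis act_inv)

lemma act_inv_fix: "g \<in> carrier G \<Longrightarrow> x \<in> V \<Longrightarrow> act g x = x \<Longrightarrow> act (inv g) x = x"
  by (metis act_inv)

lemma stab_subgroup:
  assumes "x \<in> V" shows "subgroup (stab x) G"
proof (rule subgroupI)
  show "stab x \<noteq> {}" using assms act_one[of x] stab_iff by blast
qed (use assms in \<open>auto simp: stab_iff act_mult act_inv_fix\<close>)

lemma E_in_V: "(x, y) \<in> E \<Longrightarrow> x \<in> V" "(x, y) \<in> E \<Longrightarrow> y \<in> V"
  using E_subset by auto

lemma rwalk_act: "g \<in> carrier G \<Longrightarrow> rwalk E p \<Longrightarrow> set p \<subseteq> V \<Longrightarrow> rwalk E (map (act g) p)"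
  by (rule rwalk_map) (auto simp: inj_on_def act_inj act_E subset_iff)

text \<open>The translate of the walk has the same ends, so it is the same walk. Fixed point sets
  are convex.\<close>

lemma fix_rwalk:
  assumes "g \<in> carrier G" "rwalk E p" "set p \<subseteq> V" "act g (hd p) = hd p" "act g (last p) = last p" "x \<in> set p"
  shows "act g x = x"
proof -
  have "p \<noteq> []" using assms by auto
  then have "map (act g) p = p"
    using assms rwalk_act by (intro rwalk_unique) (auto simp: hd_map last_map)
  then show ?thesis using assms(6) by (metis map_eq_conv map_ident)
qed

lemma fix_rwalk_between:
  assumes "g \<in> carrier G" "rwalk E p" "set p \<subseteq> V" "act g (p ! i) = p ! i" "act g (p ! j) = p ! j"
    "i \<le> l" "l \<le> j" "j < length p"
  shows "act g (p ! l) = p ! l"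
proof -
  define q where "q = drop i (take (Suc j) p)"
  have q: "q \<noteq> []" "hd q = p ! i" "last q = p ! j" "set q \<subseteq> set p"
    using assms by (auto simp: q_def hd_drop_conv_nth last_conv_nth dest: in_set_dropD in_set_takeD)
  have "rwalk E (take (Suc j) p)"
    using rwalk_prefix[of E "take (Suc j) p" "drop (Suc j) p"] assms(2,8) by (cases p) auto
  moreover have "take (Suc j) p = take i (take (Suc j) p) @ q"
    unfolding q_def by (rule append_take_drop_id[symmetric])
  ultimately have rq: "rwalk E q"
    using rwalk_suffix[of E "take i (take (Suc j) p)" q] q(1) by metis
  have mem: "p ! l \<in> set q"
  proof -
    have "q ! (l - i) = p ! l" "l - i < length q" using assms(6-8) by (auto simp: q_def)
    then show ?thesis using nth_mem[of "l - i" q] by simp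
  qed
  show ?thesis
  proof (rule fix_rwalk[OF assms(1) rq _ _ _ mem])
    show "set q \<subseteq> V" using q(4) assms(3) by blast
  qed (simp_all only: q(2,3) assms(4,5))
qed

lemma last_fixed_index:
  assumes "P (0::nat)" 
  shows "\<exists>i\<le>n. P i \<and> (\<forall>l. i < l \<longrightarrow> l \<le> n \<longrightarrow> \<not> P l)"
proof -
  define i where "i = Max {i. i \<le> n \<and> P i}"
  have "finite {i. i \<le> n \<and> P i}" "{i. i \<le> n \<and> P i} \<noteq> {}" using assms by auto
  then have "i \<in> {i. i \<le> n \<and> P i}" "\<And>l. l \<in> {i. i \<le> n \<and> P i} \<Longrightarrow> l \<le> i"
    unfolding i_def by (rule Max_in) (rule Max_ge[OF \<open>finite _\<close>])
  then show ?thesis by fastforce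
qed

text \<open>Commuting elliptic elements have intersecting fixed subtrees, because each preserves the
  fixed subtree of the other. Any path from one fixed subtree to the other is then covered by the
  two.\<close>

lemma commuting_fix_rwalk:
  assumes gh: "g \<in> carrier G" "h \<in> carrier G" "g \<otimes> h = h \<otimes> g"
    and p: "rwalk E p" "set p \<subseteq> V" "act g (hd p) = hd p" "act h (last p) = last p"
    and l: "Suc l < length p"
  shows "(act g (p ! l) = p ! l \<and> act g (p ! Suc l) = p ! Suc l) \<or>
    (act h (p ! l) = p ! l \<and> act h (p ! Suc l) = p ! Suc l)"
proof -
  define n where "n = length p - 1"
  have ne: "p \<noteq> []" using p by auto
  have n: "n < length p" "last p = p ! n" "hd p = p ! 0"
    using ne by (auto simp: n_def last_conv_nth hd_conv_nth)
  have V: "p ! k \<in> V" if "k < length p" for k using p(2) that by (meson nth_mem subsetD)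
  have g0: "act g (p ! 0) = p ! 0"
    using p(3) unfolding n(3) .
  obtain i where i: "i \<le> n" "act g (p ! i) = p ! i" "\<And>l. i < l \<Longrightarrow> l \<le> n \<Longrightarrow> act g (p ! l) \<noteq> p ! l"
    using last_fixed_index[of "\<lambda>l. act g (p ! l) = p ! l" n, OF g0] by blast
  define j where "j = (LEAST j. act h (p ! j) = p ! j)"
  have hn: "act h (p ! n) = p ! n" using p(4) unfolding n(2) .
  have j: "act h (p ! j) = p ! j" unfolding j_def by (rule LeastI[of "\<lambda>j. act h (p ! j) = p ! j", OF hn])
  have jn: "j \<le> n" unfolding j_def by (rule Least_le[of "\<lambda>j. act h (p ! j) = p ! j", OF hn])
  have jm: "act h (p ! k) \<noteq> p ! k" if "k < j" for k using that not_less_Least unfolding j_def by blast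
  \<comment> \<open>Suppose there is a gap from \<open>p ! i\<close> to \<open>p ! j\<close>.
    Followed by its reversed image under \<open>h\<close>, it is a reduced walk from
    \<open>p ! i\<close> to \<open>act h (p ! i)\<close>. Both ends are fixed by \<open>g\<close>,
    since \<open>g\<close> and \<open>h\<close> commute, so \<open>g\<close> fixes
    \<open>p ! j\<close>, beyond its last fixed index.\<close>
  have "j \<le> i"
  proof (rule ccontr)
    assume "\<not> j \<le> i"
    then have ij: "i < j" by simp
    define xs where "xs = drop i (take j p)"
    have lx: "length xs = j - i" using jn n by (auto simp: xs_def)
    then have xs: "xs \<noteq> []" "hd xs = p ! i" "last xs = p ! (j - 1)"
      using ij jn n by (auto simp: xs_def hd_drop_conv_nth last_conv_nth)
    have eq: "p = take i p @ (xs @ [p ! j]) @ drop (Suc j) p"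
    proof -
      have "take (Suc j) p = take j p @ [p ! j]" using jn n by (simp add: take_Suc_conv_app_nth)
      moreover have "take j p = take i p @ xs" unfolding xs_def
        using ij by (metis append_take_drop_id less_imp_le min.absorb1 take_take)
      ultimately show ?thesis by (metis append.assoc append_take_drop_id)
    qed
    have "rwalk E ((xs @ [p ! j]) @ drop (Suc j) p)"
      by (rule rwalk_suffix[of _ "take i p"]) (use eq p in auto)
    then have r1: "rwalk E (xs @ [p ! j])" by (rule rwalk_prefix) simp
    have sub: "set xs \<subseteq> V" "p ! j \<in> V" using p V jn n by (auto simp: xs_def dest!: in_set_dropD in_set_takeD)
    have "rwalk E (map (act h) (xs @ [p ! j]))"
      using rwalk_act[of h "xs @ [p ! j]"] gh r1 sub by auto
    then have "rwalk E (rev (map (act h) (xs @ [p ! j])))" by (rule rwalk_rev[OF E_sym])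
    then have r2: "rwalk E (p ! j # rev (map (act h) xs))" using j by simp
    have "rwalk E (xs @ p ! j # rev (map (act h) xs))"
      using r1 r2
    proof (rule rwalk_append)
      have "hd (rev (map (act h) xs)) = act h (last xs)" using xs by (simp add: hd_rev last_map)
      then show "last xs \<noteq> hd (rev (map (act h) xs))"
        using xs jm[of "j - 1"] ij by (metis diff_less less_nat_zero_code linorder_neqE_nat zero_less_one)
    qed
    moreover have "set (xs @ p ! j # rev (map (act h) xs)) \<subseteq> V"
      using sub act_closed gh by auto
    moreover have "act g (act h (p ! i)) = act h (p ! i)"
      using gh i V[of i] n by (metis act_mult order.strict_trans1)
    moreover have "last (xs @ p ! j # rev (map (act h) xs)) = act h (p ! i)"
      using xs by (simp add: last_rev hd_map)
    moreover have "hd (xs @ p ! j # rev (map (act h) xs)) = p ! i" using xs by simp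
    ultimately have all: "\<And>x. x \<in> set (xs @ p ! j # rev (map (act h) xs)) \<Longrightarrow> act g x = x"
      using fix_rwalk[of g "xs @ p ! j # rev (map (act h) xs)"] gh(1) i(2) by metis
    have "act g (p ! j) = p ! j" by (rule all) simp
    then show False using i(3)[of j] ij jn by simp
  qed
  \<comment> \<open>As \<open>j \<le> i\<close>, the stretch up to \<open>i\<close>, fixed by
    \<open>g\<close>, and the stretch from \<open>j\<close> on, fixed by \<open>h\<close>, together
    contain every edge of the walk.\<close>
  show ?thesis
  proof (cases "Suc l \<le> i")
    case True
    then show ?thesis
      using fix_rwalk_between[of g p 0 i l] fix_rwalk_between[of g p 0 i "Suc l"] gh p i n by auto
  next
    case False
    then show ?thesis
      using fix_rwalk_between[of h p j n l] fix_rwalk_between[of h p j n "Suc l"] gh p j jn n \<open>j \<le> i\<close> l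
      by (auto simp: n_def)
  qed
qed

definition invariant_subtree :: "'v set \<Rightarrow> bool" where
  "invariant_subtree S \<longleftrightarrow> S \<noteq> {} \<and> S \<subseteq> V \<and> (\<forall>x\<in>S. \<forall>y\<in>S. (x, y) \<in> (E \<inter> S \<times> S)\<^sup>*) \<and>
     (\<forall>g\<in>carrier G. \<forall>x\<in>S. act g x \<in> S)"

text \<open>If \<open>w\<close> lay outside \<open>S\<close>, some element of its stabilizer would
  move the first step towards \<open>S\<close>. The walk from \<open>S\<close> back to the last
  fixed vertex and out again along the translate is reduced, joins two points of \<open>S\<close>
  and passes outside \<open>S\<close>, against convexity.\<close>

lemma in_invariant_subtree:
  assumes w: "w \<in> V" "\<And>y. (w, y) \<in> E \<Longrightarrow> \<not> stab w \<subseteq> stab y"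
    and S: "invariant_subtree S"
  shows "w \<in> S"
proof (rule ccontr)
  assume "w \<notin> S"
  obtain s where s: "s \<in> S" "s \<in> V" using S by (auto simp: invariant_subtree_def)
  obtain p where p: "rwalk E p" "hd p = w" "last p = s" "set p \<subseteq> V"
    using rwalk_exists w s by metis
  have ne: "p \<noteq> []" using p by auto
  define j where "j = (LEAST j. p ! j \<in> S)"
  have S_last: "p ! (length p - 1) \<in> S" using p s ne by (simp add: last_conv_nth)
  have j: "p ! j \<in> S" unfolding j_def using S_last by (rule LeastI)
  have jl: "j < length p" unfolding j_def using Least_le[of "\<lambda>j. p ! j \<in> S", OF S_last] ne
    by (simp add: order.strict_trans1)
  have jm: "k < j \<Longrightarrow> p ! k \<notin> S" for k unfolding j_def by (rule not_less_Least)
  have j0: "0 < j" using p j ne \<open>w \<notin> S\<close> by (metis gr0I hd_conv_nth)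
  have "act h (p ! 1) = p ! 1" if h: "h \<in> stab w" for h
  proof -
    have hc: "h \<in> carrier G" "act h (p ! 0) = p ! 0" using h p ne by (auto simp: stab_iff hd_conv_nth)
    obtain i where i: "i \<le> j" "act h (p ! i) = p ! i" "\<And>l. i < l \<Longrightarrow> l \<le> j \<Longrightarrow> act h (p ! l) \<noteq> p ! l"
      using last_fixed_index[of "\<lambda>l. act h (p ! l) = p ! l" j, OF hc(2)] by blast
    have "i = j"
    proof (rule ccontr)
      assume "i \<noteq> j"
      then have ij: "i < j" using i by simp
      define zs where "zs = drop (Suc i) (take (Suc j) p)"
      have "length zs = j - i" using jl by (auto simp: zs_def)
      then have zs: "zs \<noteq> []" "hd zs = p ! Suc i" "last zs = p ! j" "set zs \<subseteq> V"
        using ij jl p by (auto simp: zs_def hd_drop_conv_nth last_conv_nth dest!: in_set_dropD in_set_takeD)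
      have eq: "p = take i p @ (p ! i # zs) @ drop (Suc j) p"
      proof -
        have "drop i (take (Suc j) p) = p ! i # zs"
          unfolding zs_def using ij jl by (subst Cons_nth_drop_Suc[symmetric]) auto
        moreover have "take (Suc j) p = take i p @ drop i (take (Suc j) p)"
          using ij by (metis append_take_drop_id less_Suc_eq less_imp_le min.absorb1 take_take)
        ultimately show ?thesis by (metis append.assoc append_take_drop_id)
      qed
      have "rwalk E ((p ! i # zs) @ drop (Suc j) p)"
        by (rule rwalk_suffix[of _ "take i p"]) (use eq p in auto)
      then have r1: "rwalk E (p ! i # zs)" by (rule rwalk_prefix) simp
      have iV: "p ! i \<in> V" using p ij jl by auto
      have r2: "rwalk E (p ! i # map (act h) zs)"
        using rwalk_act[OF hc(1) r1] i zs iV by auto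
      have "rwalk E (rev (p ! i # zs))" using r1 by (rule rwalk_rev[OF E_sym])
      then have "rwalk E (rev zs @ [p ! i])" by simp
      then have r: "rwalk E (rev zs @ p ! i # map (act h) zs)"
        using r2
      proof (rule rwalk_append)
        show "last (rev zs) \<noteq> hd (map (act h) zs)"
          using zs i(3)[of "Suc i"] ij by (simp add: last_rev hd_map)
      qed
      have "set (rev zs @ p ! i # map (act h) zs) \<subseteq> S"
      proof (rule rwalk_closed[OF _ _ r])
        show "S \<subseteq> V" "\<And>x y. x \<in> S \<Longrightarrow> y \<in> S \<Longrightarrow> (x, y) \<in> (E \<inter> S \<times> S)\<^sup>*"
          using S by (auto simp: invariant_subtree_def)
        show "hd (rev zs @ p ! i # map (act h) zs) \<in> S" using zs j by (simp add: hd_rev)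
        show "last (rev zs @ p ! i # map (act h) zs) \<in> S"
          using zs j hc S by (simp add: last_map invariant_subtree_def)
      qed
      then show False using jm[OF ij] by auto
    qed
    then show ?thesis using fix_rwalk_between[of h p 0 j 1] hc p i j0 jl by auto
  qed
  moreover have "(w, p ! 1) \<in> E"
    using p j0 jl ne unfolding rwalk_def by (metis One_nat_def Suc_lessI Suc_lessD hd_conv_nth less_trans_Suc)
  ultimately show False using w(2)[of "p ! 1"] by (fastforce simp: stab_iff)
qed

text \<open>
  Ping-pong: if \<open>a \<otimes> b\<close> fixed \<open>v\<close>, then \<open>act (inv a) v = act b v\<close>; the distances of this point
  from \<open>w\<close> and from \<open>w'\<close> are incompatible.
\<close>
lemma product_not_elliptic:
  assumes p: "rwalk E p" "set p \<subseteq> V" "p = w # u # ps" "p = qs @ [u', w']"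
    and a: "a \<in> stab w" "act a u \<noteq> u"
    and b: "b \<in> stab w'" "act b u' \<noteq> u'"
    and v: "v \<in> V"
  shows "act (a \<otimes> b) v \<noteq> v"
proof
  assume fixed: "act (a \<otimes> b) v = v"
  have ac: "a \<in> carrier G" "act a w = w" "inv a \<in> carrier G" and bc: "b \<in> carrier G" "act b w' = w'"
    using a b by (auto simp: stab_iff)
  have "set (qs @ [u', w']) \<subseteq> V" "set (w # u # ps) \<subseteq> V" using p(2) p(3,4) by metis+
  then have V: "w \<in> V" "u \<in> V" "w' \<in> V" "u' \<in> V" using p(2) by auto
  have aw: "act (inv a) w = w" using ac V by (simp add: act_inv_fix)
  have au: "act (inv a) u \<noteq> u" using a ac V by (metis act_inv')
  have vv: "act (inv a) v = act b v"
    using fixed ac bc v by (metis act_closed act_inv act_mult)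
  obtain q where q: "rwalk E q" "hd q = w" "last q = v" "set q \<subseteq> V"
    using rwalk_exists V v by metis
  obtain q' where q': "q = w # q'" using q by (cases q) auto
  have rp: "rwalk E (rev (u # ps) @ [w])" using rwalk_rev[OF E_sym p(1)] p(3) by simp
  have hdp: "hd (rev (u # ps)) = w'" "last p = w'" using p(3,4) by (metis hd_rev last.simps last_snoc list.discI append.assoc append_Cons append_Nil)+
  have rp2: "rev (u # ps) @ [w] = w' # u' # rev qs" using p(3,4)
    by (metis append_Cons append_Nil append_assoc rev.simps(2) rev_append rev_rev_ident)
  have lenp: "length p = Suc (length (u # ps))" using p(3) by simp
  show False
  proof (cases "q' \<noteq> [] \<and> hd q' = u")
    \<comment> \<open>Here \<open>q\<close> leaves \<open>w\<close> away from \<open>u\<close>, so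
      \<open>v\<close> is seen from \<open>w'\<close> through \<open>w\<close>, and
      \<open>act b v\<close> is seen from \<open>w\<close> through \<open>w'\<close>. Its distance
      from \<open>w\<close> then exceeds that of \<open>v\<close>, while
      \<open>act (inv a) v\<close>, the same point, is as far from \<open>w\<close> as
      \<open>v\<close>.\<close>
    case False
    define r where "r = rev (u # ps) @ w # q'"
    have r: "rwalk E r" unfolding r_def
      by (rule rwalk_append) (use rp q q' False in auto)
    have r_eq: "r = w' # u' # rev qs @ q'" using rp2 by (simp add: r_def)
    have rV: "set r \<subseteq> V" using p(2) q(4) unfolding r_def p(3) q' by auto
    have last_r: "last r = v" using q q' by (simp add: r_def)
    have mr: "rwalk E (map (act b) r)" using rwalk_act bc r rV by blast
    have "rwalk E ((qs @ [u']) @ w' # tl (map (act b) r))"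
    proof (rule rwalk_append)
      show "rwalk E ((qs @ [u']) @ [w'])" using p by simp
      show "rwalk E (w' # tl (map (act b) r))" using mr bc r_eq by simp
      show "last (qs @ [u']) \<noteq> hd (tl (map (act b) r))" using b r_eq by simp
    qed
    moreover have "rwalk E (map (act (inv a)) q)" using rwalk_act ac q by blast
    moreover have "hd ((qs @ [u']) @ w' # tl (map (act b) r)) = hd (map (act (inv a)) q)"
      using p(3,4) q q' aw by (cases qs) auto
    moreover have "last ((qs @ [u']) @ w' # tl (map (act b) r)) = last (map (act (inv a)) q)"
    proof -
      have "last ((qs @ [u']) @ w' # tl (map (act b) r)) = last (map (act b) r)"
        using r_eq by simp
      also have "\<dots> = act b v" using last_r r by (subst last_map) auto
      also have "\<dots> = last (map (act (inv a)) q)" using vv q by (subst last_map) auto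
      finally show ?thesis .
    qed
    ultimately have "(qs @ [u']) @ w' # tl (map (act b) r) = map (act (inv a)) q"
      by (rule rwalk_unique)
    then have "length ((qs @ [u']) @ w' # tl (map (act b) r)) = length q" by simp
    moreover have "length r = length p - 1 + length q" using lenp q' by (simp add: r_def)
    moreover have "length r > 0" "length p \<ge> 2" using r_eq p(3) by auto
    ultimately show False using p(4) by simp
  next
    case True
    then obtain q2 where q2: "q = w # u # q2" using q' by (cases q') auto
    have mq: "rwalk E (map (act (inv a)) q)" using rwalk_act ac q by blast
    then have mq': "rwalk E (w # map (act (inv a)) (u # q2))" using q2 aw by simp
    have r1: "rwalk E (rev (u # ps) @ w # map (act (inv a)) (u # q2))"
      by (rule rwalk_append[OF rp mq']) (use au in simp)
    define z where "z = rev (u # ps) @ q2"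
    have z: "z \<noteq> []" "hd z = w'" "last z = v"
      using hdp q q2 by (auto simp: z_def hd_append last_append)
    have "(z ! i, z ! Suc i) \<in> E" if "Suc i < length z" for i
    proof -
      have su: "successively (\<lambda>a b. (a, b) \<in> E) (rev (u # ps))"
      proof -
        have "rwalk E (rev (u # ps))" using rp rwalk_prefix by (metis Nil_is_rev_conv list.discI)
        then show ?thesis unfolding successively_conv_nth rwalk_def by auto
      qed
      have "rwalk E (u # q2)" using q q2 by simp
      then have "successively (\<lambda>a b. (a, b) \<in> E) (u # q2)"
        unfolding successively_conv_nth rwalk_def by auto
      then have "successively (\<lambda>a b. (a, b) \<in> E) z"
        unfolding z_def using su by (auto simp: successively_append_iff successively_Cons)
      then show ?thesis using that by (simp add: successively_conv_nth)
    qed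
    then obtain r' where r': "rwalk E r'" "hd r' = w'" "last r' = v" "length r' \<le> length z"
      using rwalk_shorten[OF z(1)] z by metis
    have "set r' \<subseteq> V" using rwalk_set[OF r'(1) E_subset] r' V by simp
    then have r2: "rwalk E (map (act b) r')" using rwalk_act bc r' by blast
    have "rev (u # ps) @ w # map (act (inv a)) (u # q2) = map (act b) r'"
    proof (rule rwalk_unique[OF r1 r2])
      show "hd (rev (u # ps) @ w # map (act (inv a)) (u # q2)) = hd (map (act b) r')"
        using hdp r' bc by (cases r') (auto simp: hd_append)
      have "last (rev (u # ps) @ w # map (act (inv a)) (u # q2)) = act (inv a) v"
        using q(3) q2 by (auto simp: last_map)
      also have "\<dots> = last (map (act b) r')"
        using vv r' by (subst last_map) auto
      finally show "last (rev (u # ps) @ w # map (act (inv a)) (u # q2)) = last (map (act b) r')" .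
    qed
    then have "length (rev (u # ps) @ w # map (act (inv a)) (u # q2)) = length r'"
      by (metis length_map)
    then show False using r' by (simp add: z_def)
  qed
qed

text \<open>Stabilizer elements at \<open>w\<close> and \<open>w'\<close> that move the first and
  the last edge of the path between them play ping-pong, and their product is hyperbolic. This keeps
  the complexity from taking its default value 1.\<close>

lemma exists_not_elliptic:
  assumes w: "w \<in> V" "w' \<in> V" "w \<noteq> w'" "\<And>y. (w, y) \<in> E \<Longrightarrow> \<not> stab w \<subseteq> stab y"
    "\<And>y. (w', y) \<in> E \<Longrightarrow> \<not> stab w' \<subseteq> stab y"
  obtains g where "g \<in> carrier G" "\<And>v. v \<in> V \<Longrightarrow> act g v \<noteq> v"
proof -
  obtain p where p: "rwalk E p" "hd p = w" "last p = w'" "set p \<subseteq> V"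
    using rwalk_exists w by metis
  obtain u ps where p1: "p = w # u # ps"
    using p w(3) by (metis hd_Cons_tl last_ConsL rwalk_Nil)
  obtain q' u' where "rev p = w' # u' # q'"
    using p w(3) by (metis hd_Cons_tl hd_rev last_ConsL last_rev rev_is_Nil_conv rwalk_Nil)
  then have p2: "p = rev q' @ [u', w']" by (metis append.assoc append_Cons append_Nil rev.simps(2) rev_rev_ident)
  have "(w, u) \<in> E" using p p1 by simp
  moreover have "rwalk E [u', w']" using p p2 rwalk_suffix by (metis list.discI)
  then have "(w', u') \<in> E" using E_symD by simp
  ultimately obtain a b where "a \<in> stab w" "act a u \<noteq> u" "b \<in> stab w'" "act b u' \<noteq> u'"
    using w(4,5) by (auto simp: stab_iff subset_iff) blast
  then show thesis
    using product_not_elliptic[OF p(1,4) p1 p2] by (intro that[of "a \<otimes> b"]) (auto simp: stab_iff)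
qed

end

section \<open>Passage between trees given by bridges and trees given by cycles\<close>

lemma pair_awalk_iff:
  "pre_digraph.awalk (with_proj X) u p v \<longleftrightarrow> u \<in> pverts X \<and> set p \<subseteq> parcs X \<and> pcas u p v"
  by (simp add: pre_digraph.awalk_def cas_with_proj_eq)

lemma pcas_vwalk_arcs: "xs \<noteq> [] \<Longrightarrow> pcas (hd xs) (vwalk_arcs xs) (last xs)"
  by (induction xs rule: vwalk_arcs.induct) auto

lemma pawalk_verts_vwalk_arcs: "xs \<noteq> [] \<Longrightarrow> pawalk_verts (hd xs) (vwalk_arcs xs) = xs"
  by (induction xs rule: vwalk_arcs.induct) auto

lemma pawalk_verts_props:
  assumes "pcas u p v"
  shows "hd (pawalk_verts u p) = u" "last (pawalk_verts u p) = v"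
    "length (pawalk_verts u p) = Suc (length p)"
    "Suc i < length (pawalk_verts u p) \<Longrightarrow> (pawalk_verts u p ! i, pawalk_verts u p ! Suc i) \<in> set p"
  using assms
proof (induction p arbitrary: u i)
  case (Cons a p)
  { case 1 then show ?case by simp }
  { case 2 then show ?case using Cons(2) by (cases p) auto }
  { case 3 then show ?case using Cons(3) by simp }
  { case 4
    have "pawalk_verts (snd a) p \<noteq> []" by (cases p) auto
    then have "pawalk_verts (snd a) p ! 0 = snd a" using Cons(1) 4 by (simp add: hd_conv_nth[symmetric])
    then show ?case using 4 Cons(4)[of "i - 1" "snd a"] by (cases i) auto }
qed auto

lemma rtrancl_imp_distinct_walk:
  assumes "(x, y) \<in> R\<^sup>*"
  obtains xs where "xs \<noteq> []" "hd xs = x" "last xs = y" "distinct xs" "set (vwalk_arcs xs) \<subseteq> R"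
proof -
  have "\<exists>xs. xs \<noteq> [] \<and> hd xs = x \<and> last xs = y \<and> distinct xs \<and> set (vwalk_arcs xs) \<subseteq> R"
    using assms
  proof (induction rule: converse_rtrancl_induct)
    case base
    then show ?case by (intro exI[of _ "[y]"]) simp
  next
    case (step a b)
    then obtain xs where xs: "xs \<noteq> []" "hd xs = b" "last xs = y" "distinct xs" "set (vwalk_arcs xs) \<subseteq> R"
      by blast
    show ?case
    proof (cases "a \<in> set xs")
      case True
      then obtain us vs where uv: "xs = us @ a # vs" by (meson split_list)
      then have "set (vwalk_arcs (a # vs)) \<subseteq> set (vwalk_arcs xs)"
        using set_vwalk_arcs_append2[of "a # vs" us] by simp
      then show ?thesis using xs uv by (intro exI[of _ "a # vs"]) auto
    next
      case False
      obtain zs where "xs = b # zs" using xs by (cases xs) auto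
      then show ?thesis using xs step False by (intro exI[of _ "a # xs"]) auto
    qed
  qed
  with that show thesis by blast
qed

lemma simplicial_tree_imp_simp_tree:
  assumes "simplicial_tree X"
  shows "simp_tree (pverts X) (parcs X)"
proof -
  interpret pair_bidirected_digraph X using assms by (simp add: simplicial_tree_def)
  have sc: "strongly_connected (with_proj X)"
    and nc: "\<And>p. pre_digraph.cycle (with_proj X) p \<Longrightarrow> length p < 3"
    using assms by (auto simp: simplicial_tree_def not_le)
  show ?thesis
  proof
    show "pverts X \<noteq> {}" using sc by (simp add: strongly_connected_def)
    show "parcs X \<subseteq> pverts X \<times> pverts X" by (auto dest: in_arcsD1 in_arcsD2)
    show "sym (parcs X)" using pair_sym_arcs by (simp add: symmetric_def)
    show "(x, x) \<notin> parcs X" for x using pair_no_loops by force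
    show "(x, y) \<in> (parcs X)\<^sup>*" if "x \<in> pverts X" "y \<in> pverts X" for x y
    proof -
      have "x \<rightarrow>\<^sup>*\<^bsub>with_proj X\<^esub> y" using sc that by (simp add: strongly_connected_def)
      then show ?thesis by (metis reachable_rtranclI with_proj_simps(3))
    qed
    show "(x, y) \<notin> (parcs X - {(x, y), (y, x)})\<^sup>*" if xy: "(x, y) \<in> parcs X" for x y
    proof
      assume "(x, y) \<in> (parcs X - {(x, y), (y, x)})\<^sup>*"
      then obtain xs where xs: "xs \<noteq> []" "hd xs = x" "last xs = y" "distinct xs"
        "set (vwalk_arcs xs) \<subseteq> parcs X - {(x, y), (y, x)}"
        by (rule rtrancl_imp_distinct_walk)
      have "x \<noteq> y" using xy pair_no_loops by force
      then have "length xs \<ge> 2" using xs by (cases xs rule: vwalk_arcs.cases) auto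
      moreover have "length xs \<noteq> 2"
        using xs by (auto simp: length_Suc_conv numeral_2_eq_2)
      ultimately have len: "length xs \<ge> 3" by simp
      \<comment> \<open>A detour from \<open>x\<close> to \<open>y\<close> has at least three
        vertices, so closing it up with the edge from \<open>y\<close> to \<open>x\<close> produces
        a cycle of length at least 3.\<close>
      define zs where "zs = y # xs"
      have yx: "(y, x) \<in> parcs X" using xy pair_sym_arcs by (simp add: symmetric_def symD)
      then have "set (vwalk_arcs zs) \<subseteq> parcs X"
        using xs unfolding zs_def by (cases xs) auto
      moreover have "pcas y (vwalk_arcs zs) y"
        using pcas_vwalk_arcs[of zs] xs by (simp add: zs_def)
      moreover have "pawalk_verts y (vwalk_arcs zs) = zs"
        using pawalk_verts_vwalk_arcs[of zs] by (simp add: zs_def)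
      moreover have "length (vwalk_arcs zs) = length xs"
        using vwalk_length_simp[of zs] unfolding vwalk_length_def by (simp add: zs_def)
      ultimately have "pre_digraph.cycle (with_proj X) (vwalk_arcs zs)" "length (vwalk_arcs zs) \<ge> 3"
        using xs len in_arcsD2[OF xy] unfolding pre_digraph.cycle_def pair_awalk_iff awalk_verts_with_proj_eq
        by (auto simp: zs_def intro!: exI[of _ y])
      then show False using nc by fastforce
    qed
  qed
qed

lemma (in simp_tree) simplicial_tree: "simplicial_tree \<lparr>pverts = V, parcs = E\<rparr>"
proof -
  define X where "X = \<lparr>pverts = V, parcs = E\<rparr>"
  have X [simp]: "pverts X = V" "parcs X = E" by (simp_all add: X_def)
  have "pair_bidirected_digraph X"
  proof
    show "\<And>e. e \<in> parcs X \<Longrightarrow> fst e \<in> pverts X" "\<And>e. e \<in> parcs X \<Longrightarrow> snd e \<in> pverts X"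
      using E_subset by auto
    show "symmetric (with_proj X)" using E_sym by (simp add: symmetric_def)
    show "fst e \<noteq> snd e" if "e \<in> parcs X" for e
      using that E_irrefl[of "fst e"] by (cases e) auto
  qed
  moreover have "strongly_connected (with_proj X)"
  proof -
    have "(x, y) \<in> rtrancl_on V E" if "x \<in> V" "y \<in> V" for x y
      using connected[OF that] that(1)
    proof (induction rule: rtrancl_induct)
      case (step a b)
      have "a \<in> V" "b \<in> V" using step(2) E_subset by auto
      then show ?case using rtrancl_on_into_rtrancl_on[of x a V E b] step by blast
    qed simp
    then show ?thesis using V_nonempty by (auto simp: strongly_connected_def reachable_def)
  qed
  moreover have "\<not> (\<exists>p. pre_digraph.cycle (with_proj X) p \<and> length p \<ge> 3)"
  proof
    assume "\<exists>p. pre_digraph.cycle (with_proj X) p \<and> length p \<ge> 3"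
    then obtain p u where p: "pcas u p u" "set p \<subseteq> E" "distinct (tl (pawalk_verts u p))" "length p \<ge> 3"
      by (auto simp: pre_digraph.cycle_def pair_awalk_iff awalk_verts_with_proj_eq)
    define L where "L = pawalk_verts u p"
    note L = pawalk_verts_props[OF p(1), folded L_def]
    have ne: "L \<noteq> []" using L(3) by auto
    \<comment> \<open>Only the tail of the vertex list is known to be distinct. For
      \<open>i = 0\<close> the first vertex is therefore read as the last one, and length at least 3
      keeps it apart from the vertex at position 2.\<close>
    have "L ! i \<noteq> L ! Suc (Suc i)" if i: "Suc (Suc i) < length L" for i
    proof (cases i)
      case 0
      have "L ! 0 = L ! (length L - 1)" using L(1,2) ne by (simp add: hd_conv_nth last_conv_nth)
      then have "L ! 0 = tl L ! (length p - 1)" using L(3) p(4) by (cases "length p") (simp_all add: nth_tl)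
      moreover have "tl L ! 1 \<noteq> tl L ! (length p - 1)"
        using p(3,4) L(3) unfolding L_def[symmetric] by (subst nth_eq_iff_index_eq) auto
      moreover have "tl L ! 1 = L ! 2" using L(3) p(4) by (simp add: nth_tl numeral_2_eq_2)
      ultimately show ?thesis using 0 by (simp add: numeral_2_eq_2)
    next
      case (Suc j)
      then have "tl L ! j \<noteq> tl L ! Suc (Suc j)"
        using p(3) i unfolding L_def[symmetric] by (subst nth_eq_iff_index_eq) auto
      then show ?thesis using Suc i by (simp add: nth_tl)
    qed
    then have "rwalk E L" unfolding rwalk_def using L(4) p(2) ne by blast
    then have "L = [u]" using rwalk_unique[of L "[u]"] L by simp
    then show False using L(3) p(4) by simp
  qed
  ultimately show ?thesis unfolding simplicial_tree_def X_def by blast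
qed

lemma splitting_imp_tree_act:
  assumes "splitting G X \<alpha>"
  shows "tree_act (pverts X) (parcs X) G \<alpha>"
proof -
  interpret simp_tree "pverts X" "parcs X"
    using assms simplicial_tree_imp_simp_tree by (auto simp: splitting_def)
  interpret group_action G "pverts X" \<alpha> using assms by (simp add: splitting_def)
  interpret group G using assms by (simp add: splitting_def)
  have sp: "g \<in> carrier G \<Longrightarrow> (x, y) \<in> parcs X \<Longrightarrow> (\<alpha> g x, \<alpha> g y) \<in> parcs X \<and> \<not> (\<alpha> g x = y \<and> \<alpha> g y = x)"
    for g x y
    using assms by (fastforce simp: splitting_def)
  show ?thesis
  proof
    show "\<alpha> \<one>\<^bsub>G\<^esub> x = x" if "x \<in> pverts X" for x using id_eq_one that by (metis restrict_apply')
    show "\<alpha> (g \<otimes>\<^bsub>G\<^esub> h) x = \<alpha> g (\<alpha> h x)"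
      if "g \<in> carrier G" "h \<in> carrier G" "x \<in> pverts X" for g h x
      using composition_rule that by blast
    show "\<alpha> g x \<in> pverts X" if "g \<in> carrier G" "x \<in> pverts X" for g x
      using element_image that by blast
    show "(\<alpha> g x, \<alpha> g y) \<in> parcs X" "\<not> (\<alpha> g x = y \<and> \<alpha> g y = x)"
      if "g \<in> carrier G" "(x, y) \<in> parcs X" for g x y
      using sp that by blast+
  qed
qed

text \<open>The elements of \<open>BijGroup V\<close> are functions that are undefined off
  \<open>V\<close>, whence the restriction.\<close>

lemma (in tree_act) splitting_restrict:
  "splitting G \<lparr>pverts = V, parcs = E\<rparr> (\<lambda>g. restrict (act g) V)"
proof -
  have bij: "restrict (act g) V \<in> Bij V" if g: "g \<in> carrier G" for g
  proof -
    have "bij_betw (act g) V V"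
      by (rule bij_betw_byWitness[where f' = "act (inv g)"]) (use g in \<open>auto simp: act_inv act_inv' act_closed\<close>)
    then have "bij_betw (restrict (act g) V) V V" by (subst bij_betw_cong[of _ _ "act g"]) auto
    then show ?thesis by (simp add: Bij_def)
  qed
  have "group_action G V (\<lambda>g. restrict (act g) V)"
    unfolding group_action_def group_hom_def group_hom_axioms_def
  proof (intro conjI)
    show "(\<lambda>g. restrict (act g) V) \<in> hom G (BijGroup V)"
    proof (rule homI)
      fix g h assume gh: "g \<in> carrier G" "h \<in> carrier G"
      show "restrict (act g) V \<in> carrier (BijGroup V)" using bij[OF gh(1)] by (simp add: BijGroup_def)
      have "restrict (act (g \<otimes> h)) V = compose V (restrict (act g) V) (restrict (act h) V)"
        by (rule ext) (simp add: compose_def restrict_def act_mult[OF gh] act_closed[OF gh(2)])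
      then show "restrict (act (g \<otimes> h)) V = restrict (act g) V \<otimes>\<^bsub>BijGroup V\<^esub> restrict (act h) V"
        using bij gh by (simp add: BijGroup_def)
    qed
  qed (rule is_group, rule group_BijGroup)
  moreover have "(restrict (act g) V x, restrict (act g) V y) \<in> E"
    "\<not> (restrict (act g) V x = y \<and> restrict (act g) V y = x)"
    if "g \<in> carrier G" "(x, y) \<in> E" for g x y
    using act_E[OF that] no_inversion[OF that] E_in_V[OF that(2)] by simp_all
  ultimately show ?thesis
    unfolding splitting_def using simplicial_tree is_group by (auto simp del: restrict_apply)
qed

lemma (in simp_tree) simp_tree_image:
  assumes "inj_on f V"
  shows "simp_tree (f ` V) ((\<lambda>(x, y). (f x, f y)) ` E)"
proof -
  let ?F = "\<lambda>(x, y). (f x, f y)"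
  have lift: "(f x, f y) \<in> (?F ` R)\<^sup>*" if "(x, y) \<in> R\<^sup>*" for x y R
    using that
  proof (induction rule: rtrancl_induct)
    case (step a b)
    then show ?case by (auto intro!: rtrancl.rtrancl_into_rtrancl[of "f x" "f a"])
  qed simp
  have unlift: "(x, inv_into V f z) \<in> R\<^sup>*" if "(f x, z) \<in> (?F ` R)\<^sup>*" "x \<in> V" "R \<subseteq> V \<times> V" for x z R
    using that
  proof (induction rule: rtrancl_induct)
    case base
    then show ?case using assms by simp
  next
    case (step a b)
    then obtain a' b' where "(a', b') \<in> R" "a = f a'" "b = f b'" by auto
    then have "(inv_into V f a, inv_into V f b) \<in> R" using assms step by auto
    then show ?case using step by (meson rtrancl.rtrancl_into_rtrancl)
  qed
  show ?thesis
  proof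
    show "f ` V \<noteq> {}" using V_nonempty by simp
    show "?F ` E \<subseteq> f ` V \<times> f ` V" using E_subset by auto
    show "sym (?F ` E)" using E_sym by (auto simp: sym_def)
    show "(x, x) \<notin> ?F ` E" for x
    proof
      assume "(x, x) \<in> ?F ` E"
      then obtain a b where ab: "(a, b) \<in> E" "f a = f b" by auto
      then have "a = b" using assms E_subset by (auto dest: inj_onD)
      then show False using ab E_irrefl by simp
    qed
    show "(x, y) \<in> (?F ` E)\<^sup>*" if "x \<in> f ` V" "y \<in> f ` V" for x y
      using that lift connected by auto
    show "(x, y) \<notin> (?F ` E - {(x, y), (y, x)})\<^sup>*" if "(x, y) \<in> ?F ` E" for x y
    proof
      assume a: "(x, y) \<in> (?F ` E - {(x, y), (y, x)})\<^sup>*"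
      from \<open>(x, y) \<in> ?F ` E\<close> obtain x' y' where e: "(x', y') \<in> E" "x = f x'" "y = f y'" by auto
      have "?F ` E - {(x, y), (y, x)} \<subseteq> ?F ` (E - {(x', y'), (y', x')})" using e by auto
      then have "(f x', y) \<in> (?F ` (E - {(x', y'), (y', x')}))\<^sup>*" using a e rtrancl_mono by blast
      then have "(x', inv_into V f y) \<in> (E - {(x', y'), (y', x')})\<^sup>*"
        by (rule unlift) (use e E_subset in auto)
      moreover have "inv_into V f y = y'" using e E_subset assms by auto
      ultimately show False using bridge e by simp
    qed
  qed
qed

lemma (in tree_act) tree_act_image:
  assumes f: "inj_on f V"
  shows "tree_act (f ` V) ((\<lambda>(x, y). (f x, f y)) ` E) G (\<lambda>g n. f (act g (inv_into V f n)))"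
proof -
  interpret T: simp_tree "f ` V" "(\<lambda>(x, y). (f x, f y)) ` E" by (rule simp_tree_image[OF f])
  have feq: "f x = f y \<longleftrightarrow> x = y" if "x \<in> V" "y \<in> V" for x y using f that by (auto dest: inj_onD)
  show ?thesis
  proof
    fix g x y assume g: "g \<in> carrier G" and "(x, y) \<in> (\<lambda>(x, y). (f x, f y)) ` E"
    then obtain a b where ab: "(a, b) \<in> E" "x = f a" "y = f b" by auto
    have V: "a \<in> V" "b \<in> V" using ab E_subset by auto
    show "(f (act g (inv_into V f x)), f (act g (inv_into V f y))) \<in> (\<lambda>(x, y). (f x, f y)) ` E"
      using ab act_E[OF g ab(1)] V f by auto
    show "\<not> (f (act g (inv_into V f x)) = y \<and> f (act g (inv_into V f y)) = x)"
      using no_inversion[OF g ab(1)] ab V f act_closed[OF g] by (simp add: feq)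
  qed (use f in \<open>auto simp: act_one act_mult act_closed\<close>)
qed

text \<open>The maximal complexities only see trees with vertices in \<open>nat\<close>; this
  renaming is the entrance for all trees constructed on other types.\<close>

lemma (in tree_act) countable_splitting:
  assumes "countable V"
  obtains X :: "nat pair_pre_digraph" and \<alpha> f where "splitting G X \<alpha>" "bij_betw f V (pverts X)"
    "parcs X = (\<lambda>(x, y). (f x, f y)) ` E"
    "\<And>g x. x \<in> V \<Longrightarrow> g \<in> carrier G \<Longrightarrow> \<alpha> g (f x) = f (act g x)"
proof -
  define f where "f = to_nat_on V"
  have f: "inj_on f V" unfolding f_def using assms by (rule inj_on_to_nat_on)
  interpret T: tree_act "f ` V" "(\<lambda>(x, y). (f x, f y)) ` E" G "\<lambda>g n. f (act g (inv_into V f n))"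
    by (rule tree_act_image[OF f])
  show thesis
    by (rule that[OF T.splitting_restrict, of f]) (use f in \<open>auto simp: bij_betw_def\<close>)
qed

section \<open>Lower bounds for the complexity\<close>

text \<open>\<open>W_branching\<close> forces \<open>W\<close> into the minimal subtree and makes
  its orbits nondegenerate there; with \<open>W_two\<close> it also yields a hyperbolic element. So
  each orbit in \<open>W\<close> contributes to the complexity.\<close>

locale branching_splitting =
  fixes H :: "'g monoid" and X :: "'v pair_pre_digraph" and \<alpha> and W
  assumes splitting: "splitting H X \<alpha>"
    and W_subset: "W \<subseteq> pverts X"
    and W_invariant: "g \<in> carrier H \<Longrightarrow> w \<in> W \<Longrightarrow> \<alpha> g w \<in> W"
    and W_branching: "w \<in> W \<Longrightarrow> (w, y) \<in> parcs X \<Longrightarrow> \<not> stabilizer H \<alpha> w \<subseteq> stabilizer H \<alpha> y"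
    and W_two: "\<exists>w\<in>W. \<exists>w'\<in>W. w \<noteq> w'"
begin

sublocale tree_act "pverts X" "parcs X" H \<alpha>
  using splitting by (rule splitting_imp_tree_act)

abbreviation M where "M \<equiv> minimal_verts H X \<alpha>"

lemma invariant_subtreeI:
  assumes "S \<subseteq> pverts X" "strongly_connected (with_proj (sub_graph X S))" "\<forall>g\<in>carrier H. \<alpha> g ` S \<subseteq> S"
  shows "invariant_subtree S"
proof -
  have "(x, y) \<in> (parcs X \<inter> S \<times> S)\<^sup>*" if "x \<in> S" "y \<in> S" for x y
  proof -
    have "x \<rightarrow>\<^sup>*\<^bsub>with_proj (sub_graph X S)\<^esub> y"
      using assms(2) that by (simp add: strongly_connected_def sub_graph_def)
    then show ?thesis
      using reachable_rtranclI[of "with_proj (sub_graph X S)" x y] by (simp add: sub_graph_def)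
  qed
  moreover have "S \<noteq> {}" using assms(2) by (auto simp: strongly_connected_def sub_graph_def)
  ultimately show ?thesis using assms(1,3) unfolding invariant_subtree_def by blast
qed

lemma W_minimal: "W \<subseteq> M"
  unfolding minimal_verts_def
  using in_invariant_subtree[OF _ W_branching] invariant_subtreeI W_subset by blast

lemma M_subset: "M \<subseteq> pverts X"
proof -
  have "strongly_connected (with_proj (sub_graph X (pverts X)))"
  proof -
    have "sub_graph X (pverts X) = X"
      using E_subset by (cases X) (auto simp: sub_graph_def)
    then show ?thesis using branching_splitting.splitting[OF branching_splitting_axioms]
      by (simp add: splitting_def simplicial_tree_def)
  qed
  then show ?thesis unfolding minimal_verts_def using act_closed by blast
qed

lemma weighted_complexity_eq:
  "weighted_complexity H \<phi> X \<alpha> = graph_complexity H \<phi> (sub_graph X M) (\<lambda>g. restrict (\<alpha> g) M)"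
proof -
  obtain w w' where w: "w \<in> W" "w' \<in> W" "w \<noteq> w'" using W_two by blast
  obtain g where g: "g \<in> carrier H" "\<And>v. v \<in> pverts X \<Longrightarrow> \<alpha> g v \<noteq> v"
    by (rule exists_not_elliptic[of w w'])
      (use w W_subset W_branching[OF w(1)] W_branching[OF w(2)] in blast)+
  then have "\<not> (\<forall>g\<in>carrier H. elliptic X \<alpha> g)" unfolding elliptic_def by blast
  then show ?thesis unfolding weighted_complexity_def by (rule if_not_P)
qed

lemma nondegenerate:
  assumes "w \<in> W"
  shows "Group_Action.orbit H \<alpha> w \<in> nondegenerate_orbits H (sub_graph X M) (\<lambda>g. restrict (\<alpha> g) M)"
proof -
  have wM: "w \<in> M" using assms W_minimal by blast
  then have eq: "Group_Action.orbit H (\<lambda>g. restrict (\<alpha> g) M) w = Group_Action.orbit H \<alpha> w"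
    by (auto simp: Group_Action.orbit_def)
  have "Group_Action.orbit H \<alpha> w \<in> orbits H M (\<lambda>g. restrict (\<alpha> g) M)"
    using wM eq unfolding orbits_def by blast
  moreover have False if xy: "(x, y) \<in> parcs X" "x \<in> M" "y \<in> M" "x \<in> Group_Action.orbit H \<alpha> w"
    "pointwise_stab H (\<lambda>g. restrict (\<alpha> g) M) {x, y} = stabilizer H (\<lambda>g. restrict (\<alpha> g) M) x" for x y
  proof -
    have "x \<in> W" using xy(4) W_invariant assms by (auto simp: Group_Action.orbit_def)
    then have "\<not> stab x \<subseteq> stab y" using W_branching xy by blast
    moreover have "stab x \<subseteq> stab y"
      using xy(2,3,5) unfolding pointwise_stab_def stabilizer_def set_eq_iff by force
    ultimately show False by blast
  qed
  ultimately show ?thesis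
    by (auto simp: nondegenerate_orbits_def sub_graph_def)
qed

lemma stabilizer_restrict: "x \<in> M \<Longrightarrow> stabilizer H (\<lambda>g. restrict (\<alpha> g) M) x = stabilizer H \<alpha> x"
  by (auto simp: stabilizer_def)

lemma orbit_some:
  assumes "w \<in> W"
  shows "(SOME x. x \<in> Group_Action.orbit H \<alpha> w) \<in> Group_Action.orbit H \<alpha> w"
    "(SOME x. x \<in> Group_Action.orbit H \<alpha> w) \<in> W"
proof -
  have "w \<in> Group_Action.orbit H \<alpha> w"
    using assms W_subset act_one[of w] by (force simp: Group_Action.orbit_def)
  then show *: "(SOME x. x \<in> Group_Action.orbit H \<alpha> w) \<in> Group_Action.orbit H \<alpha> w" by (rule someI)
  have "Group_Action.orbit H \<alpha> w \<subseteq> W" using assms W_invariant by (auto simp: Group_Action.orbit_def)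
  then show "(SOME x. x \<in> Group_Action.orbit H \<alpha> w) \<in> W" using * by blast
qed

text \<open>An infinite sum of nonnegative terms is the supremum of its finite partial sums, so any
  finite set of orbits in \<open>W\<close> may be singled out without knowing that the whole sum is
  finite.\<close>

lemma sum_le_weighted_complexity:
  assumes "finite F" "F \<subseteq> Group_Action.orbit H \<alpha> ` W"
  shows "quotient_rank H (sub_graph X M) (\<lambda>g. restrict (\<alpha> g) M)
      + (\<Sum>Q\<in>F. 1 + \<phi> (vertex_group H \<alpha> (SOME x. x \<in> Q))) \<le> weighted_complexity H \<phi> X \<alpha>"
proof -
  let ?\<beta> = "\<lambda>g. restrict (\<alpha> g) M"
  have "(\<Sum>Q\<in>F. 1 + \<phi> (vertex_group H \<alpha> (SOME x. x \<in> Q)))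
      = (\<Sum>Q\<in>F. 1 + \<phi> (vertex_group H ?\<beta> (SOME x. x \<in> Q)))"
  proof (rule sum.cong)
    fix Q assume "Q \<in> F"
    then obtain w where "w \<in> W" "Q = Group_Action.orbit H \<alpha> w" using assms by blast
    then have "(SOME x. x \<in> Q) \<in> M" using orbit_some W_minimal by blast
    then show "1 + \<phi> (vertex_group H \<alpha> (SOME x. x \<in> Q)) = 1 + \<phi> (vertex_group H ?\<beta> (SOME x. x \<in> Q))"
      by (simp add: stabilizer_restrict)
  qed simp
  also have "\<dots> \<le> (\<Sum>\<^sub>\<infinity>Q\<in>nondegenerate_orbits H (sub_graph X M) ?\<beta>. 1 + \<phi> (vertex_group H ?\<beta> (SOME x. x \<in> Q)))"
    by (subst nonneg_infsum_complete) (use assms nondegenerate in \<open>auto intro!: SUP_upper\<close>)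
  finally show ?thesis
    unfolding weighted_complexity_eq graph_complexity_def by (rule add_left_mono)
qed

end

section \<open>Subgroups of finite index\<close>

text \<open>Being a cardinality, it is 0 at infinite index; hence the finiteness assumption in
  \<open>index_mult_le\<close>.\<close>

definition index :: "'g monoid \<Rightarrow> 'g set \<Rightarrow> nat" where
  "index G H = card (rcosets\<^bsub>G\<^esub> H)"

locale grp = group G for G :: "'g monoid" (structure)

lemma (in grp) rcos_eq_iff:
  assumes "subgroup H G" "x \<in> carrier G" "y \<in> carrier G"
  shows "H #> x = H #> y \<longleftrightarrow> x \<otimes> inv y \<in> H"
proof
  assume "H #> x = H #> y"
  then have "x \<in> H #> y" using assms rcos_self by blast
  then obtain h where "h \<in> H" "x = h \<otimes> y" by (auto simp: r_coset_def)
  then show "x \<otimes> inv y \<in> H"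
    using assms subgroup.mem_carrier by (metis inv_solve_right)
next
  assume a: "x \<otimes> inv y \<in> H"
  have "x = (x \<otimes> inv y) \<otimes> y" using assms by (simp add: m_assoc)
  then have "x \<in> H #> y" using a by (auto simp: r_coset_def)
  then show "H #> x = H #> y" using repr_independence assms by metis
qed

lemma (in grp) rcosets_image: "rcosets H = (\<lambda>x. H #> x) ` carrier G"
  by (auto simp: RCOSETS_def)

lemma rcoset_subgrp [simp]: "M #>\<^bsub>subgrp G N\<^esub> x = M #>\<^bsub>G\<^esub> x"
  by (simp add: r_coset_def)

lemma rcosets_subgrp: "rcosets\<^bsub>subgrp G N\<^esub> M = (\<lambda>x. M #>\<^bsub>G\<^esub> x) ` N"
  by (auto simp: RCOSETS_def)

lemma (in grp) finite_rcosets_trans: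
  assumes N: "subgroup N G" and M: "subgroup M G" "M \<subseteq> N"
    and fin: "finite (rcosets N)" "finite (rcosets\<^bsub>subgrp G N\<^esub> M)"
  shows "finite (rcosets M)"
proof -
  have Nc: "N \<subseteq> carrier G" using N by (rule subgroup.subset)
  have Mc: "M \<subseteq> carrier G" using M(1) by (rule subgroup.subset)
  define r where "r C = (SOME x. x \<in> C)" for C :: "'g set"
  \<comment> \<open>Representatives of \<open>N\<close> in \<open>G\<close> and of \<open>M\<close>
    in \<open>N\<close> multiply to representatives of \<open>M\<close> in \<open>G\<close>. The
    representative of \<open>N #> x\<close> is \<open>n \<otimes> x\<close> for some
    \<open>n\<close>, and the coset of \<open>inv n\<close> undoes this choice.\<close>
  have "rcosets M \<subseteq> (\<lambda>(C, D). M #> (r D \<otimes> r C)) ` ((rcosets N) \<times> (rcosets\<^bsub>subgrp G N\<^esub> M))"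
  proof
    fix B assume "B \<in> rcosets M"
    then obtain x where x: "x \<in> carrier G" "B = M #> x" by (auto simp: rcosets_image)
    have "r (N #> x) \<in> N #> x" unfolding r_def using rcos_self[OF x(1) N] by (rule someI)
    then obtain n where n: "n \<in> N" "r (N #> x) = n \<otimes> x" by (auto simp: r_coset_def)
    have ni: "inv n \<in> N" using N n(1) by (rule subgroup.m_inv_closed)
    have "r (M #> inv n) \<in> M #> inv n" unfolding r_def
      using rcos_self[OF _ M(1)] ni Nc by (intro someI) blast
    then obtain m where m: "m \<in> M" "r (M #> inv n) = m \<otimes> inv n" by (auto simp: r_coset_def)
    have c: "n \<in> carrier G" "m \<in> carrier G" using n m Nc Mc by auto
    have "r (M #> inv n) \<otimes> r (N #> x) = m \<otimes> x" using n m c x by (simp add: m_assoc inv_solve_left')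
    moreover have "M #> (m \<otimes> x) = M #> x"
      using rcos_eq_iff[OF M(1)] c x m by (simp add: m_assoc)
    ultimately show "B \<in> (\<lambda>(C, D). M #> (r D \<otimes> r C)) ` ((rcosets N) \<times> (rcosets\<^bsub>subgrp G N\<^esub> M))"
      using x ni Nc
      by (intro image_eqI[of _ _ "(N #> x, M #> inv n)"]) (auto simp: rcosets_image rcosets_subgrp)
  qed
  then show ?thesis using fin by (meson finite_SigmaI finite_imageI finite_subset)
qed

text \<open>Products of coset representatives are pairwise inequivalent modulo \<open>M\<close>:
  comparing them modulo \<open>N\<close> recovers \<open>C\<close>, and after cancellation the coset
  \<open>D\<close> is recovered as well.\<close>

lemma (in grp) index_mult_le:
  assumes N: "subgroup N G" and M: "subgroup M G" "M \<subseteq> N"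
    and fin: "finite (rcosets M)"
  shows "index G N * index (subgrp G N) M \<le> index G M"
proof -
  have Nc: "N \<subseteq> carrier G" using N by (rule subgroup.subset)
  define r where "r C = (SOME x. x \<in> C)" for C :: "'g set"
  have rN: "r (N #> x) \<in> N #> x" if "x \<in> carrier G" for x
    unfolding r_def using rcos_self[OF that N] by (rule someI)
  have rM: "r (M #> x) \<in> M #> x" if "x \<in> carrier G" for x
    unfolding r_def using rcos_self[OF that M(1)] by (rule someI)
  have RN: "r C \<in> carrier G" "N #> r C = C" if C: "C \<in> rcosets N" for C
  proof -
    obtain x where x: "x \<in> carrier G" "C = N #> x" using C by (auto simp: rcosets_image)
    then show "r C \<in> carrier G" using rN[OF x(1)] Nc r_coset_subset_G by blast
    show "N #> r C = C" using repr_independence[OF _ x(1) N, of "r C"] rN[OF x(1)] x(2) by simp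
  qed
  have RM: "r C \<in> N" "M #> r C = C" if C: "C \<in> rcosets\<^bsub>subgrp G N\<^esub> M" for C
  proof -
    obtain x where x: "x \<in> N" "C = M #> x" using C by (auto simp: rcosets_subgrp)
    have xc: "x \<in> carrier G" using x Nc by blast
    have "M #> x \<subseteq> N" using x M(2) subgroup.m_closed[OF N] by (auto simp: r_coset_def)
    then show "r C \<in> N" using rM[OF xc] x by blast
    show "M #> r C = C" using repr_independence[OF _ xc M(1), of "r C"] rM[OF xc] x(2) by simp
  qed
  have "inj_on (\<lambda>(C, D). M #> (r D \<otimes> r C)) ((rcosets N) \<times> (rcosets\<^bsub>subgrp G N\<^esub> M))"
  proof (rule inj_onI, clarify)
    fix C D C' D'
    assume C: "C \<in> rcosets N" "C' \<in> rcosets N" and D: "D \<in> rcosets\<^bsub>subgrp G N\<^esub> M" "D' \<in> rcosets\<^bsub>subgrp G N\<^esub> M"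
      and eq: "M #> (r D \<otimes> r C) = M #> (r D' \<otimes> r C')"
    note RC = RN[OF C(1)] RN[OF C(2)] RM[OF D(1)] RM[OF D(2)]
    have c: "r D \<in> carrier G" "r D' \<in> carrier G" using RC Nc by auto
    have m: "r D \<otimes> r C \<otimes> inv (r D' \<otimes> r C') \<in> M"
      using eq rcos_eq_iff[OF M(1)] RC c by simp
    then have n: "r D \<otimes> r C \<otimes> inv (r D' \<otimes> r C') \<in> N" using M by blast
    have "r C \<otimes> inv (r C') = inv (r D) \<otimes> (r D \<otimes> r C \<otimes> inv (r D' \<otimes> r C')) \<otimes> r D'"
      using RC c by (simp add: inv_mult_group m_assoc) (simp add: m_assoc[symmetric])
    also have "\<dots> \<in> N"
      by (rule subgroup.m_closed[OF N subgroup.m_closed[OF N subgroup.m_inv_closed[OF N RC(5)] n] RC(7)])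
    finally have "N #> r C = N #> r C'" using rcos_eq_iff[OF N RC(1,3)] by simp
    then have CC: "C = C'" using RC by simp
    have "r C' \<otimes> (inv (r C') \<otimes> inv (r D')) = inv (r D')"
      using RC c by (simp add: m_assoc[symmetric])
    then have "r D \<otimes> r C' \<otimes> inv (r D' \<otimes> r C') = r D \<otimes> inv (r D')"
      using RC c by (simp add: inv_mult_group m_assoc)
    then have "r D \<otimes> inv (r D') \<in> M" using m unfolding CC by simp
    then have "M #> r D = M #> r D'" using rcos_eq_iff[OF M(1) c] by simp
    then show "C = C' \<and> D = D'" using RC CC by simp
  qed
  moreover have "(\<lambda>(C, D). M #> (r D \<otimes> r C)) ` ((rcosets N) \<times> (rcosets\<^bsub>subgrp G N\<^esub> M)) \<subseteq> rcosets M"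
  proof (clarify)
    fix C D assume "C \<in> rcosets N" "D \<in> rcosets\<^bsub>subgrp G N\<^esub> M"
    then have "r D \<otimes> r C \<in> carrier G" using RN(1) RM(1) Nc by blast
    then show "M #> (r D \<otimes> r C) \<in> rcosets M" by (simp add: rcosets_image)
  qed
  ultimately have "card ((rcosets N) \<times> (rcosets\<^bsub>subgrp G N\<^esub> M)) \<le> card (rcosets M)"
    using fin by (intro card_inj_on_le)
  then show ?thesis by (simp add: index_def card_cartesian_product)
qed

text \<open>A coset of \<open>H \<inter> K\<close> in \<open>K\<close> is determined by the coset of
  \<open>H\<close> that contains it; \<open>f\<close> makes this assignment explicit.\<close>

lemma (in grp) finite_rcosets_subgrp:
  assumes H: "subgroup H G" "finite (rcosets H)" and K: "subgroup K G"
  shows "finite (rcosets\<^bsub>subgrp G K\<^esub> (H \<inter> K))"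
proof -
  have Kc: "K \<subseteq> carrier G" using K by (rule subgroup.subset)
  have HK: "subgroup (H \<inter> K) G" using H(1) K by (rule subgroups_Inter_pair)
  define f where "f C = (SOME D. \<exists>x\<in>K. C = H #> x \<and> D = (H \<inter> K) #> x)" for C
  have "(H \<inter> K) #> x = f (H #> x)" if x: "x \<in> K" for x
  proof -
    have "\<exists>y\<in>K. H #> x = H #> y \<and> f (H #> x) = (H \<inter> K) #> y"
      unfolding f_def using x by (intro someI[of "\<lambda>D. \<exists>y\<in>K. H #> x = H #> y \<and> D = (H \<inter> K) #> y" "(H \<inter> K) #> x"]) blast
    then obtain y where y: "y \<in> K" "H #> x = H #> y" "f (H #> x) = (H \<inter> K) #> y" by blast
    have "x \<otimes> inv y \<in> H" using rcos_eq_iff[OF H(1)] x y Kc by blast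
    moreover have "x \<otimes> inv y \<in> K" using K x y by (simp add: subgroup.m_closed subgroup.m_inv_closed)
    ultimately show ?thesis using rcos_eq_iff[OF HK, of x y] x y Kc by auto
  qed
  then have "rcosets\<^bsub>subgrp G K\<^esub> (H \<inter> K) \<subseteq> f ` (rcosets H)"
    using Kc by (auto simp: rcosets_subgrp rcosets_image)
  then show ?thesis using H(2) by (meson finite_imageI finite_subset)
qed

lemma (in grp) finite_rcosets_Int:
  assumes "subgroup H G" "finite (rcosets H)" "subgroup K G" "finite (rcosets K)"
  shows "finite (rcosets (H \<inter> K))"
  using finite_rcosets_trans[of K "H \<inter> K"] finite_rcosets_subgrp[of H K] assms subgroups_Inter_pair
  by blast

text \<open>Otherwise \<open>K\<close> would be a union of finitely many cosets of a finite
  subgroup.\<close>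

lemma (in grp) infinite_Int:
  assumes "subgroup H G" "finite (rcosets H)" "subgroup K G" "infinite K"
  shows "infinite (H \<inter> K)"
proof
  assume fin: "finite (H \<inter> K)"
  have Kc: "K \<subseteq> carrier G" using assms(3) by (rule subgroup.subset)
  have "K = \<Union>(rcosets\<^bsub>subgrp G K\<^esub> (H \<inter> K))"
  proof -
    interpret K: group "subgrp G K" using assms(3) by (rule subgroup_imp_group)
    have "subgroup (H \<inter> K) (subgrp G K)"
      using subgroup_incl[OF subgroups_Inter_pair[OF assms(1,3)] assms(3)] by simp
    then show ?thesis using K.rcosets_part_G by simp
  qed
  moreover have "finite C" if "C \<in> rcosets\<^bsub>subgrp G K\<^esub> (H \<inter> K)" for C
    using that fin by (auto simp: rcosets_subgrp r_coset_def)
  ultimately show False using finite_rcosets_subgrp[OF assms(1-3)] assms(4) by (metis finite_Union)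
qed

lemma (in grp) torsion_free_infinite:
  assumes tf: "torsion_free G" and K: "subgroup K G" "K \<noteq> {\<one>}"
  shows "infinite K"
proof -
  obtain x where x: "x \<in> K" "x \<noteq> \<one>" using K subgroup.one_closed[OF K(1)] by blast
  have xc: "x \<in> carrier G" using subgroup.mem_carrier[OF K(1) x(1)] .
  have "inj (\<lambda>n::nat. x [^] n)"
  proof (rule linorder_injI)
    fix m n :: nat assume mn: "m < n"
    show "x [^] m \<noteq> x [^] n"
    proof
      assume "x [^] m = x [^] n"
      moreover have "x [^] m \<otimes> x [^] (n - m) = x [^] n"
        using nat_pow_mult[OF xc, of m "n - m"] mn by simp
      ultimately have "x [^] m \<otimes> x [^] (n - m) = x [^] m \<otimes> \<one>"
        using xc by simp
      then have "x [^] (n - m) = \<one>"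
        using xc by (simp del: r_one)
      then show False using tf x xc mn by (auto simp: torsion_free_def)
    qed
  qed
  moreover have "x [^] n \<in> K" for n :: nat
    using x by (induction n) (simp_all add: subgroup.one_closed[OF K(1)] subgroup.m_closed[OF K(1)])
  ultimately show ?thesis by (meson finite_subset image_subsetI range_inj_infinite)
qed

section \<open>Finitely generated groups\<close>

text \<open>
  A subgroup of finite index is recognized by the action of finitely many generators on its
  finitely many cosets, that is, by a finite automaton; there are only countably many of these.
\<close>

fun run :: "(nat \<Rightarrow> nat list) \<Rightarrow> nat \<Rightarrow> nat list \<Rightarrow> nat" where
  "run t q [] = q"
| "run t q (i # is) = run t (t i ! q) is"

context grp
begin

fun word :: "'g list \<Rightarrow> nat list \<Rightarrow> 'g" where
  "word ss [] = \<one>"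
| "word ss (i # is) = ss ! i \<otimes> word ss is"

lemma word_closed: "set ss \<subseteq> carrier G \<Longrightarrow> set is \<subseteq> {..<length ss} \<Longrightarrow> word ss is \<in> carrier G"
  by (induction "is") (auto simp: subset_iff)

lemma word_append:
  "set ss \<subseteq> carrier G \<Longrightarrow> set is \<subseteq> {..<length ss} \<Longrightarrow> set js \<subseteq> {..<length ss} \<Longrightarrow>
    word ss (is @ js) = word ss is \<otimes> word ss js"
  by (induction "is") (auto simp: m_assoc word_closed subset_iff)

lemma fg_words:
  assumes "finitely_generated G"
  obtains ss where "set ss \<subseteq> carrier G" "carrier G = word ss ` {is. set is \<subseteq> {..<length ss}}"
proof -
  obtain S where S: "finite S" "S \<subseteq> carrier G" "generate G S = carrier G"
    using assms by (auto simp: finitely_generated_def)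
  \<comment> \<open>With the inverses adjoined to the generators, positive words suffice, and a word
    is just a list of indices.\<close>
  have "finite (S \<union> m_inv G ` S)" using S by simp
  from finite_list[OF this] obtain ss where ss: "set ss = S \<union> m_inv G ` S" ..
  have c: "set ss \<subseteq> carrier G" using ss S by auto
  have idx: "\<exists>is. set is \<subseteq> {..<length ss} \<and> s = word ss is" if "s \<in> set ss" for s
  proof -
    obtain i where i: "i < length ss" "s = ss ! i" using \<open>s \<in> set ss\<close> unfolding in_set_conv_nth by blast
    have "s \<in> carrier G" using c \<open>s \<in> set ss\<close> by blast
    then have "set [i] \<subseteq> {..<length ss} \<and> s = word ss [i]" using i by simp
    then show ?thesis by blast
  qed
  have "\<exists>is. set is \<subseteq> {..<length ss} \<and> g = word ss is" if "g \<in> generate G S" for g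
    using that
  proof (induction rule: generate.induct)
    case one
    then show ?case by (intro exI[of _ "[]"]) simp
  next
    case (incl h)
    then show ?case using ss idx by blast
  next
    case (inv h)
    then show ?case using ss idx by blast
  next
    case (eng h1 h2)
    then obtain is1 is2 where "set is1 \<subseteq> {..<length ss}" "h1 = word ss is1"
      "set is2 \<subseteq> {..<length ss}" "h2 = word ss is2" by blast
    then show ?case using c by (intro exI[of _ "is1 @ is2"]) (auto simp: word_append)
  qed
  then have "carrier G \<subseteq> word ss ` {is. set is \<subseteq> {..<length ss}}"
    unfolding S(3)[symmetric] by blast
  moreover have "word ss ` {is. set is \<subseteq> {..<length ss}} \<subseteq> carrier G"
    using word_closed[OF c] by blast
  ultimately have "carrier G = word ss ` {is. set is \<subseteq> {..<length ss}}"
    by (rule equalityI)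
  then show thesis using that c by blast
qed

lemma fg_countable:
  assumes "finitely_generated G" shows "countable (carrier G)"
proof -
  obtain ss where "carrier G = word ss ` {is. set is \<subseteq> {..<length ss}}" by (rule fg_words[OF assms])
  then show ?thesis by (metis countableI_type countable_image)
qed

lemma countable_finite_index:
  assumes "finitely_generated G"
  shows "countable {H. subgroup H G \<and> finite (rcosets H)}"
proof -
  obtain ss where ss: "set ss \<subseteq> carrier G" "carrier G = word ss ` {is. set is \<subseteq> {..<length ss}}"
    by (rule fg_words[OF assms])
  define K where "K T = {word ss is | is. set is \<subseteq> {..<length ss} \<and> run (\<lambda>i. T ! i) (0::nat) is = 0}"
    for T :: "nat list list"
  have "\<exists>T. H = K T" if H: "subgroup H G" "finite (rcosets H)" for H
  proof -
    have Hc: "H \<subseteq> carrier G" using H(1) by (rule subgroup.subset)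
    have Hin: "H \<in> rcosets H" using coset_mult_one[OF Hc]
      unfolding rcosets_image image_iff by (intro bexI[of _ \<one>]) simp_all
    obtain cs0 where cs0: "set cs0 = rcosets H - {H}" using H(2) finite_list[of "rcosets H - {H}"] by auto
    \<comment> \<open>The trivial coset comes first, so that state 0 is at once the initial and the
      only accepting state of the automaton.\<close>
    define cs where "cs = H # cs0"
    have cs: "set cs = rcosets H" "cs ! 0 = H" using cs0 Hin by (auto simp: cs_def)
    have H0: "cs ! q = H \<longleftrightarrow> q = 0" if "q < length cs" for q
    proof (cases q)
      case (Suc m)
      then have "cs ! q \<in> set cs0" using that by (simp add: cs_def)
      then show ?thesis using cs0 Suc by auto
    qed (simp add: cs_def)
    define pos where "pos C = (SOME q. q < length cs \<and> cs ! q = C)" for C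
    have pos: "pos C < length cs" "cs ! pos C = C" if "C \<in> rcosets H" for C
    proof -
      have "\<exists>q. q < length cs \<and> cs ! q = C" using that cs by (metis in_set_conv_nth)
      then have "pos C < length cs \<and> cs ! pos C = C" unfolding pos_def by (rule someI_ex)
      then show "pos C < length cs" "cs ! pos C = C" by auto
    qed
    define T where "T = map (\<lambda>s. map (\<lambda>C. pos (C #> s)) cs) ss"
    have step: "T ! i ! q < length cs \<and> cs ! (T ! i ! q) = cs ! q #> ss ! i"
      if iq: "i < length ss" "q < length cs" for i q
    proof -
      have "cs ! q \<in> rcosets H" using cs iq by (metis nth_mem)
      then obtain x where x: "x \<in> carrier G" "cs ! q = H #> x" by (auto simp: rcosets_image)
      have s: "ss ! i \<in> carrier G" using ss iq by auto
      have "cs ! q #> ss ! i \<in> rcosets H" using x s Hc by (auto simp: rcosets_image coset_mult_assoc)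
      then show ?thesis using pos iq by (simp add: T_def)
    qed
    have run: "run (\<lambda>i. T ! i) q is < length cs \<and> cs ! run (\<lambda>i. T ! i) q is = cs ! q #> word ss is"
      if "set is \<subseteq> {..<length ss}" "q < length cs" for "is" q
      using that
    proof (induction "is" arbitrary: q)
      case Nil
      then have "cs ! q \<in> rcosets H" using cs by (metis nth_mem)
      then have "cs ! q \<subseteq> carrier G" using subgroup.rcosets_carrier[OF H(1) is_group] by blast
      then show ?case using Nil by (simp add: coset_mult_one)
    next
      case (Cons i "is")
      then have st: "T ! i ! q < length cs \<and> cs ! (T ! i ! q) = cs ! q #> ss ! i" using step by simp
      have "cs ! q \<in> rcosets H" using cs Cons.prems by (metis nth_mem)
      then have "cs ! q \<subseteq> carrier G" using subgroup.rcosets_carrier[OF H(1) is_group] by blast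
      moreover have "ss ! i \<in> carrier G" "word ss is \<in> carrier G"
        using ss(1) Cons.prems word_closed[OF ss(1), of "is"] by auto
      ultimately show ?case using Cons.IH[of "T ! i ! q"] Cons.prems st by (simp add: coset_mult_assoc)
    qed
    have len: "0 < length cs" by (simp add: cs_def)
    have key: "word ss is \<in> H \<longleftrightarrow> run (\<lambda>i. T ! i) 0 is = 0" if i: "set is \<subseteq> {..<length ss}" for "is"
    proof -
      have "word ss is \<in> H \<longleftrightarrow> H #> word ss is = H"
        using rcos_eq_iff[OF H(1), of "word ss is" \<one>] word_closed[OF ss(1) i] coset_mult_one[OF Hc] by simp
      also have "\<dots> \<longleftrightarrow> run (\<lambda>i. T ! i) 0 is = 0" using run[OF i len] H0 cs(2) by metis
      finally show ?thesis .
    qed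
    have "H = K T"
    proof (rule equalityI; rule subsetI)
      fix h assume h: "h \<in> H"
      then have "h \<in> word ss ` {is. set is \<subseteq> {..<length ss}}" using Hc ss(2) by blast
      then obtain "is" where i: "set is \<subseteq> {..<length ss}" "h = word ss is" by blast
      then show "h \<in> K T" using key[OF i(1)] h unfolding K_def by blast
    next
      fix h assume "h \<in> K T"
      then obtain "is" where i: "set is \<subseteq> {..<length ss}" "h = word ss is" "run (\<lambda>i. T ! i) 0 is = 0"
        unfolding K_def by blast
      then show "h \<in> H" using key[OF i(1)] by simp
    qed
    then show ?thesis ..
  qed
  then have "{H. subgroup H G \<and> finite (rcosets H)} \<subseteq> range K" by blast
  then show ?thesis by (meson countableI_type countable_image countable_subset)
qed

lemma finite_index_normal_Int:
  assumes "H \<in> finite_index_normal G" "K \<in> finite_index_normal G"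
  shows "H \<inter> K \<in> finite_index_normal G"
proof -
  have n: "H \<lhd> G" "K \<lhd> G" "finite (rcosets H)" "finite (rcosets K)"
    using assms by (auto simp: finite_index_normal_def)
  then have s: "subgroup H G" "subgroup K G" by (auto intro: normal_imp_subgroup)
  have "subgroup (H \<inter> K) G" using s by (rule subgroups_Inter_pair)
  then have "(H \<inter> K) \<lhd> G" using n by (auto simp: normal_inv_iff)
  then show ?thesis using finite_rcosets_Int[OF s(1) n(3) s(2) n(4)] by (simp add: finite_index_normal_def)
qed

lemma carrier_finite_index_normal: "carrier G \<in> finite_index_normal G"
proof -
  have "carrier G \<lhd> G" by (rule normal_invI) (auto intro: subgroup_self)
  moreover have "rcosets (carrier G) \<subseteq> {carrier G}"
    by (auto simp: rcosets_image) (metis coset_join2 subgroup_self)+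
  then have "finite (rcosets (carrier G))" using finite_subset by blast
  ultimately show ?thesis by (simp add: finite_index_normal_def)
qed

text \<open>
  Along a decreasing cofinal sequence of subgroups, some subsequence of the quotients converges,
  because \<open>ennreal\<close> is compact.
\<close>
lemma index_limsup_ge:
  assumes count: "countable (finite_index_normal G)"
    and le: "\<And>K. K \<in> finite_index_normal G \<Longrightarrow> c \<le> C (subgrp G K) / of_nat (card (rcosets K))"
  shows "c \<le> index_limsup G C"
proof -
  let ?N = "finite_index_normal G"
  have ne: "?N \<noteq> {}" using carrier_finite_index_normal by blast
  define e where "e = from_nat_into ?N"
  have e: "range e = ?N" unfolding e_def by (rule range_from_nat_into[OF ne count])
  \<comment> \<open>Intersecting the members of an enumeration successively gives a decreasing
    sequence that is cofinal in the directed set.\<close>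
  define D where "D = rec_nat (e 0) (\<lambda>n d. d \<inter> e (Suc n))"
  have D0: "D 0 = e 0" and DS: "D (Suc n) = D n \<inter> e (Suc n)" for n by (simp_all add: D_def)
  have DN: "D n \<in> ?N" for n
    by (induction n) (use e finite_index_normal_Int in \<open>auto simp: D0 DS\<close>)
  have De: "D n \<subseteq> e n" for n by (cases n) (auto simp: D0 DS)
  have "decseq D" by (rule decseq_SucI) (simp add: DS)
  then have Dmono: "D n \<subseteq> D m" if "m \<le> n" for m n using that by (auto simp: decseq_def)
  define F where "F K = C (subgrp G K) / of_nat (card (rcosets K))" for K
  obtain r where r: "strict_mono r" "(\<lambda>n. F (D (r n))) \<longlonglongrightarrow> limsup (\<lambda>n. F (D n))"
    using limsup_subseq_lim[of "\<lambda>n. F (D n)"] by (auto simp: comp_def)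
  define l where "l = limsup (\<lambda>n. F (D n))"
  define KK where "KK = range (\<lambda>n. D (r n))"
  have "KK \<subseteq> ?N" using DN by (auto simp: KK_def)
  moreover have "\<forall>H\<in>?N. \<exists>K\<in>KK. K \<subseteq> H"
  proof
    fix H assume "H \<in> ?N"
    then obtain n where "H = e n" using e by auto
    moreover have "D (r n) \<subseteq> e n" using De Dmono[of n "r n"] r(1) seq_suble by blast
    ultimately show "\<exists>K\<in>KK. K \<subseteq> H" by (auto simp: KK_def)
  qed
  moreover have "(F \<longlongrightarrow> l) (INF L\<in>KK. principal {K\<in>KK. K \<subseteq> L})"
  proof (rule topological_tendstoI)
    fix S assume S: "open S" "l \<in> S"
    then have "\<forall>\<^sub>F n in sequentially. F (D (r n)) \<in> S"
      using r(2) unfolding l_def by (auto dest: topological_tendstoD)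
    then obtain n where n: "\<And>m. n \<le> m \<Longrightarrow> F (D (r m)) \<in> S" by (auto simp: eventually_sequentially)
    have "F K \<in> S" if K: "K \<in> KK" "K \<subseteq> D (r n)" for K
    proof -
      obtain m where m: "K = D (r m)" using K by (auto simp: KK_def)
      \<comment> \<open>A member of the tail with a smaller index both contains
        \<open>D (r n)\<close> and is contained in it, so it is equal to it.\<close>
      show ?thesis
      proof (cases "n \<le> m")
        case False
        then have "D (r n) \<subseteq> D (r m)" using r(1) by (intro Dmono) (simp add: strict_mono_less_eq)
        then have "K = D (r n)" using K m by auto
        then show ?thesis using n by simp
      qed (use n m in simp)
    qed
    then have "eventually (\<lambda>K. F K \<in> S) (principal {K\<in>KK. K \<subseteq> D (r n)})"
      by (auto simp: eventually_principal)
    moreover have "(INF L\<in>KK. principal {K\<in>KK. K \<subseteq> L}) \<le> principal {K\<in>KK. K \<subseteq> D (r n)}"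
      by (rule INF_lower) (auto simp: KK_def)
    ultimately show "eventually (\<lambda>K. F K \<in> S) (INF L\<in>KK. principal {K\<in>KK. K \<subseteq> L})"
      by (meson le_filter_def)
  qed
  ultimately have "l \<le> index_limsup G C"
    unfolding index_limsup_def F_def by (intro Sup_upper) blast
  moreover have "c \<le> l"
    using r(2) unfolding l_def[symmetric]
    by (rule LIMSEQ_le_const) (use le DN in \<open>auto simp: F_def\<close>)
  ultimately show ?thesis by simp
qed

end

section \<open>Combinatorial fundamental groups\<close>

text \<open>The 2-cells are kept as a parameter because two kinds of complexes are instances:
  quotient graphs, which have none, and triangulated surfaces.\<close>

locale serre_graph = wf_digraph D for D :: "('a, 'e) pre_digraph" +
  fixes arev :: "'e \<Rightarrow> 'e" and R :: "'e list set" and x :: 'a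
  assumes arev_arc: "a \<in> arcs D \<Longrightarrow> arev a \<in> arcs D"
    and tail_arev: "a \<in> arcs D \<Longrightarrow> tail D (arev a) = head D a"
    and arev_arev: "a \<in> arcs D \<Longrightarrow> arev (arev a) = a"
    and base: "x \<in> verts D"
begin

lemma head_arev: "a \<in> arcs D \<Longrightarrow> head D (arev a) = tail D a"
  using tail_arev[of "arev a"] arev_arc arev_arev by simp

abbreviation loops where "loops \<equiv> loops_at D x"
abbreviation htp where "htp \<equiv> loop_homotopy D arev R x"
abbreviation \<pi> where "\<pi> \<equiv> pi1 D arev R x"

definition cls :: "'e list \<Rightarrow> 'e list set" where
  "cls p = htp `` {p}"

definition rpath :: "'e list \<Rightarrow> 'e list" where
  "rpath p = rev (map arev p)"

lemma rpath_simps [simp]: "rpath [] = []" "rpath (p @ q) = rpath q @ rpath p"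
  "rpath (a # p) = rpath p @ [arev a]"
  by (simp_all add: rpath_def)

lemma awalk_Cons: "awalk u (a # p) v \<longleftrightarrow> a \<in> arcs D \<and> u = tail D a \<and> awalk (head D a) p v"
  by (auto simp: awalk_Cons_iff)

lemma awalk_app: "awalk u (p @ q) v \<longleftrightarrow> (\<exists>w. awalk u p w \<and> awalk w q v)"
proof (induction p arbitrary: u)
  case Nil
  then show ?case by (auto simp: awalk_Nil_iff awalk_def)
next
  case (Cons a p)
  then show ?case by (auto simp: awalk_Cons)
qed

lemma awalk_Nil: "awalk u [] v \<longleftrightarrow> u = v \<and> u \<in> verts D"
  by (auto simp: awalk_def)

lemma awalk_rpath: "awalk u p v \<Longrightarrow> awalk v (rpath p) u"
proof (induction p arbitrary: u)
  case Nil
  then show ?case by (auto simp: awalk_Nil)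
next
  case (Cons a p)
  then have a: "a \<in> arcs D" "u = tail D a" "awalk v (rpath p) (head D a)" by (auto simp: awalk_Cons)
  then have "awalk (head D a) [arev a] u"
    by (simp add: awalk_Cons awalk_Nil arev_arc tail_arev head_arev)
  then show ?case using a by (auto simp: awalk_app)
qed

lemma awalk_arcs: "awalk u p v \<Longrightarrow> set p \<subseteq> arcs D"
  by (simp add: awalk_def)

lemma awalk_verts_ends: "awalk u p v \<Longrightarrow> u \<in> verts D" "awalk u p v \<Longrightarrow> v \<in> verts D"
  using awalk_rpath[of u p v] by (auto simp: awalk_def)

lemma rpath_rpath: "awalk u p v \<Longrightarrow> rpath (rpath p) = p"
  by (induction p arbitrary: u) (auto simp: awalk_Cons arev_arev)

lemma loops_iff: "p \<in> loops \<longleftrightarrow> awalk x p x"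
  by (simp add: loops_at_def)

lemma loops_append: "p \<in> loops \<Longrightarrow> q \<in> loops \<Longrightarrow> p @ q \<in> loops"
  by (auto simp: loops_iff awalk_app)

lemma loops_rpath: "p \<in> loops \<Longrightarrow> rpath p \<in> loops"
  by (simp add: loops_iff awalk_rpath)

lemma loops_Nil: "[] \<in> loops"
  by (simp add: loops_iff awalk_Nil base)

lemma hom_refl: "(p, p) \<in> htp"
  by (simp add: loop_homotopy_def)

lemma hom_sym: "(p, q) \<in> htp \<Longrightarrow> (q, p) \<in> htp"
proof -
  have "sym htp" unfolding loop_homotopy_def by (intro sym_rtrancl sym_Un_converse)
  then show "(p, q) \<in> htp \<Longrightarrow> (q, p) \<in> htp" by (rule symD)
qed

lemma hom_trans: "(p, q) \<in> htp \<Longrightarrow> (q, r) \<in> htp \<Longrightarrow> (p, r) \<in> htp"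
  unfolding loop_homotopy_def by (rule rtrancl_trans)

lemma loop_stepE:
  assumes "(p, q) \<in> loop_step D arev R x"
  obtains u r v where "p = u @ v" "q = u @ r @ v" "r \<in> R \<union> (\<lambda>a. [a, arev a]) ` arcs D"
    "p \<in> loops" "q \<in> loops"
proof -
  have "p \<in> loops \<and> q \<in> loops \<and>
     (\<exists>u r v. p = u @ v \<and> q = u @ r @ v \<and> r \<in> R \<union> (\<lambda>a. [a, arev a]) ` arcs D)"
    using assms unfolding loop_step_def mem_Collect_eq case_prod_conv .
  then show thesis by (elim conjE exE) (rule that)
qed

lemma loop_stepI:
  assumes "u @ v \<in> loops" "u @ r @ v \<in> loops" "r \<in> R \<union> (\<lambda>a. [a, arev a]) ` arcs D"
  shows "(u @ v, u @ r @ v) \<in> loop_step D arev R x"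
  unfolding loop_step_def mem_Collect_eq case_prod_conv
  by (intro conjI exI[of _ u] exI[of _ r] exI[of _ v] refl assms)

lemma hom_step: "(p, q) \<in> loop_step D arev R x \<Longrightarrow> (p, q) \<in> htp"
  unfolding loop_homotopy_def by (intro r_into_rtrancl) simp

lemma hom_induct:
  assumes "(p, q) \<in> htp" "p \<in> loops"
    and refl: "P p p"
    and step: "\<And>a b. (a, b) \<in> loop_step D arev R x \<Longrightarrow> P p a \<Longrightarrow> P p b"
      "\<And>a b. (a, b) \<in> loop_step D arev R x \<Longrightarrow> P p b \<Longrightarrow> P p a"
  shows "P p q"
  using assms(1) unfolding loop_homotopy_def
proof (induction rule: rtrancl_induct)
  case base
  then show ?case by (rule refl)
next
  case (step a b)
  then show ?case using assms(4,5) by blast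
qed

lemma hom_loops:
  assumes "(p, q) \<in> htp" "p \<in> loops" shows "q \<in> loops"
  using assms(1,2)
proof (rule hom_induct)
  show "p \<in> loops" by fact
qed (auto simp: loop_step_def)

lemma cls_eq_iff: "cls p = cls q \<longleftrightarrow> (p, q) \<in> htp"
proof
  assume "cls p = cls q"
  then have "q \<in> cls p" by (simp add: cls_def hom_refl)
  then show "(p, q) \<in> htp" by (simp add: cls_def)
next
  assume h: "(p, q) \<in> htp"
  show "cls p = cls q"
    unfolding cls_def by (auto intro: hom_trans[OF h] hom_trans[OF hom_sym[OF h]])
qed

lemma cls_self: "p \<in> cls p"
  by (simp add: cls_def hom_refl)

lemma hom_insert:
  assumes "awalk x u y" "awalk y v x" "awalk y r y" "r \<in> R \<union> (\<lambda>a. [a, arev a]) ` arcs D"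
  shows "(u @ v, u @ r @ v) \<in> htp"
proof (rule hom_step)
  have "u @ v \<in> loops" "u @ r @ v \<in> loops" using assms(1-3) by (auto simp: loops_iff awalk_app)
  then show "(u @ v, u @ r @ v) \<in> loop_step D arev R x"
    using assms(4) by (rule loop_stepI)
qed

lemma hom_cancel:
  assumes "awalk x u y" "awalk y p z" "awalk y v x"
  shows "(u @ p @ rpath p @ v, u @ v) \<in> htp"
  using assms
proof (induction p arbitrary: u v y)
  case Nil
  then show ?case by (simp add: hom_refl)
next
  case (Cons a p)
  then have a: "a \<in> arcs D" "y = tail D a" "awalk (head D a) p z" by (auto simp: awalk_Cons)
  have ra: "awalk (head D a) [arev a] (tail D a)" "awalk (tail D a) [a] (head D a)"
    using a by (simp_all add: awalk_Cons awalk_Nil arev_arc tail_arev head_arev)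
  have "awalk x (u @ [a]) (head D a)" "awalk (head D a) ([arev a] @ v) x"
    using Cons.prems a ra unfolding awalk_app by blast+
  then have f: "((u @ [a]) @ p @ rpath p @ [arev a] @ v, (u @ [a]) @ [arev a] @ v) \<in> htp"
    by (rule Cons.IH[OF _ a(3)])
  have f': "(u @ v, u @ [a, arev a] @ v) \<in> htp"
    by (rule hom_insert[of u y]) (use Cons.prems a ra in \<open>auto simp: awalk_Cons\<close>)
  show ?case using hom_trans[OF f, of "u @ v"] hom_sym[OF f'] by simp
qed

lemma hom_append:
  assumes "(p, p') \<in> htp" "(q, q') \<in> htp" "p \<in> loops" "q \<in> loops"
  shows "(p @ q, p' @ q') \<in> htp"
proof -
  have s1: "(a @ q, b @ q) \<in> htp" if st: "(a, b) \<in> loop_step D arev R x" for a b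
  proof (rule hom_step)
    obtain u r v where "a = u @ v" "b = u @ r @ v" "r \<in> R \<union> (\<lambda>a. [a, arev a]) ` arcs D" "a \<in> loops" "b \<in> loops"
      using st by (rule loop_stepE)
    then show "(a @ q, b @ q) \<in> loop_step D arev R x"
      using loops_append[of a q] loops_append[of b q] assms(4) loop_stepI[of u "v @ q" r] by simp
  qed
  have p': "p' \<in> loops" using hom_loops assms by blast
  have s2: "(p' @ a, p' @ b) \<in> htp" if st: "(a, b) \<in> loop_step D arev R x" for a b
  proof (rule hom_step)
    obtain u r v where "a = u @ v" "b = u @ r @ v" "r \<in> R \<union> (\<lambda>a. [a, arev a]) ` arcs D" "a \<in> loops" "b \<in> loops"
      using st by (rule loop_stepE)
    then show "(p' @ a, p' @ b) \<in> loop_step D arev R x"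
      using loops_append[of p' a] loops_append[of p' b] p' loop_stepI[of "p' @ u" v r] by simp
  qed
  have "(p @ q, p' @ q) \<in> htp"
    using assms(1,3)
    by (rule hom_induct[where P = "\<lambda>p p'. (p @ q, p' @ q) \<in> htp"])
      (blast intro: hom_refl hom_trans hom_sym s1)+
  moreover have "(p' @ q, p' @ q') \<in> htp"
    using assms(2,4)
    by (rule hom_induct[where P = "\<lambda>q q'. (p' @ q, p' @ q') \<in> htp"])
      (blast intro: hom_refl hom_trans hom_sym s2)+
  ultimately show ?thesis by (rule hom_trans)
qed

lemma carrier_pi1: "carrier \<pi> = cls ` loops"
  by (auto simp: pi1_def quotient_def cls_def)

lemma one_pi1: "\<one>\<^bsub>\<pi>\<^esub> = cls []"
  by (simp add: pi1_def cls_def)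

lemma mult_pi1:
  assumes "p \<in> loops" "q \<in> loops"
  shows "cls p \<otimes>\<^bsub>\<pi>\<^esub> cls q = cls (p @ q)"
proof -
  have eq: "cls (a @ b) = cls (p @ q)" if "a \<in> cls p" "b \<in> cls q" for a b
  proof -
    have "(p, a) \<in> htp" "(q, b) \<in> htp" using that by (simp_all add: cls_def)
    then have "(p @ q, a @ b) \<in> htp" by (rule hom_append) (rule assms)+
    then show ?thesis by (simp add: cls_eq_iff hom_sym)
  qed
  have "(\<Union>a\<in>cls p. \<Union>b\<in>cls q. cls (a @ b)) = (\<Union>a\<in>cls p. \<Union>b\<in>cls q. cls (p @ q))"
    by (rule SUP_cong[OF refl], rule SUP_cong[OF refl], rule eq)
  also have "\<dots> = cls (p @ q)" using cls_self[of p] cls_self[of q] by blast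
  finally have "(\<Union>a\<in>cls p. \<Union>b\<in>cls q. cls (a @ b)) = cls (p @ q)" .
  then show ?thesis by (simp add: pi1_def cls_def)
qed

lemma group_pi1: "group \<pi>"
proof (rule groupI)
  show "\<one>\<^bsub>\<pi>\<^esub> \<in> carrier \<pi>" using loops_Nil by (simp add: one_pi1 carrier_pi1)
  show "\<one>\<^bsub>\<pi>\<^esub> \<otimes>\<^bsub>\<pi>\<^esub> a = a" if "a \<in> carrier \<pi>" for a
    using that loops_Nil mult_pi1[OF loops_Nil] by (auto simp: one_pi1 carrier_pi1)
  show "a \<otimes>\<^bsub>\<pi>\<^esub> b \<in> carrier \<pi>" if "a \<in> carrier \<pi>" "b \<in> carrier \<pi>" for a b
    using that loops_append by (auto simp: carrier_pi1 mult_pi1)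
  show "a \<otimes>\<^bsub>\<pi>\<^esub> b \<otimes>\<^bsub>\<pi>\<^esub> c = a \<otimes>\<^bsub>\<pi>\<^esub> (b \<otimes>\<^bsub>\<pi>\<^esub> c)"
    if "a \<in> carrier \<pi>" "b \<in> carrier \<pi>" "c \<in> carrier \<pi>" for a b c
    using that loops_append by (auto simp: carrier_pi1 mult_pi1)
  show "\<exists>b\<in>carrier \<pi>. b \<otimes>\<^bsub>\<pi>\<^esub> a = \<one>\<^bsub>\<pi>\<^esub>" if a: "a \<in> carrier \<pi>" for a
  proof -
    obtain p where p: "p \<in> loops" "a = cls p" using a by (auto simp: carrier_pi1)
    have "([] @ rpath p @ rpath (rpath p) @ [], [] @ []) \<in> htp"
      by (rule hom_cancel[of _ x _ x]) (use p loops_rpath loops_Nil in \<open>auto simp: loops_iff\<close>)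
    then have "cls (rpath p @ p) = cls []"
      using rpath_rpath[of x p x] p by (simp add: cls_eq_iff loops_iff)
    then show ?thesis using p loops_rpath by (auto simp: carrier_pi1 mult_pi1 one_pi1)
  qed
qed

lemma inv_pi1:
  assumes "p \<in> loops"
  shows "inv\<^bsub>\<pi>\<^esub> (cls p) = cls (rpath p)"
proof -
  have "([] @ p @ rpath p @ [], [] @ []) \<in> htp"
    by (rule hom_cancel[of _ x _ x]) (use assms loops_Nil in \<open>auto simp: loops_iff\<close>)
  then have "cls p \<otimes>\<^bsub>\<pi>\<^esub> cls (rpath p) = \<one>\<^bsub>\<pi>\<^esub>"
    using assms loops_rpath by (simp add: mult_pi1 one_pi1 cls_eq_iff)
  then show ?thesis
    using assms loops_rpath group.inv_equality[OF group_pi1] group.inv_inv[OF group_pi1]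
      group.inv_comm[OF group_pi1] by (auto simp: carrier_pi1)
qed

text \<open>Telescoping: between consecutive edges of the walk the return to the base point along
  \<open>c\<close> cancels. As \<open>c x\<close> need not be empty, \<open>start\<close> takes care
  of the beginning.\<close>

lemma walk_in_generate:
  assumes c: "\<And>z. z \<in> verts D \<Longrightarrow> awalk x (c z) z"
    and gen: "\<And>a. a \<in> arcs D \<Longrightarrow> cls (c (tail D a) @ [a] @ rpath (c (head D a))) \<in> generate \<pi> S"
    and start: "cls (rpath (c x)) \<in> generate \<pi> S"
    and p: "awalk x p z"
  shows "cls (p @ rpath (c z)) \<in> generate \<pi> S"
  using p
proof (induction p arbitrary: z rule: rev_induct)
  case Nil
  then show ?case using start by (auto simp: awalk_Nil)
next
  case (snoc a p)
  then have a: "awalk x p (tail D a)" "a \<in> arcs D" "z = head D a"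
    by (auto simp: awalk_app awalk_Cons awalk_Nil)
  have V: "tail D a \<in> verts D" "head D a \<in> verts D" using a(2) by auto
  let ?c = "c (tail D a)" and ?d = "c (head D a)"
  have cw: "awalk x ?c (tail D a)" "awalk (tail D a) (rpath ?c) x" "awalk (head D a) (rpath ?d) x"
    using c V awalk_rpath by auto
  have aw: "awalk (tail D a) [a] (head D a)" using a V by (simp add: awalk_Cons awalk_Nil)
  have l1: "p @ rpath ?c \<in> loops" using a cw by (auto simp: loops_iff awalk_app)
  have l2: "?c @ [a] @ rpath ?d \<in> loops" using cw aw unfolding loops_iff awalk_app by blast
  have "awalk (tail D a) ([a] @ rpath ?d) x" using aw cw unfolding awalk_app by blast
  then have "(p @ rpath ?c @ rpath (rpath ?c) @ [a] @ rpath ?d, p @ [a] @ rpath ?d) \<in> htp"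
    by (rule hom_cancel[OF a(1) cw(2)])
  then have "cls ((p @ rpath ?c) @ (?c @ [a] @ rpath ?d)) = cls ((p @ [a]) @ rpath (c z))"
    using rpath_rpath[OF cw(1)] a by (simp add: cls_eq_iff)
  then have "cls ((p @ [a]) @ rpath (c z)) = cls (p @ rpath ?c) \<otimes>\<^bsub>\<pi>\<^esub> cls (?c @ [a] @ rpath ?d)"
    using mult_pi1[OF l1 l2] by simp
  then show ?case using snoc.IH[OF a(1)] gen[OF a(2)] generate.eng[of _ \<pi> S] by simp
qed

lemma generate_pi1:
  assumes c: "\<And>z. z \<in> verts D \<Longrightarrow> awalk x (c z) z"
    and gen: "\<And>a. a \<in> arcs D \<Longrightarrow> cls (c (tail D a) @ [a] @ rpath (c (head D a))) \<in> generate \<pi> S"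
    and start: "cls (rpath (c x)) \<in> generate \<pi> S"
    and S: "S \<subseteq> carrier \<pi>"
  shows "generate \<pi> S = carrier \<pi>"
proof
  show "generate \<pi> S \<subseteq> carrier \<pi>" using S by (rule group.generate_incl[OF group_pi1])
  show "carrier \<pi> \<subseteq> generate \<pi> S"
  proof
    fix C assume "C \<in> carrier \<pi>"
    then obtain p where p: "p \<in> loops" "C = cls p" by (auto simp: carrier_pi1)
    have cx: "c x \<in> loops" using c base by (simp add: loops_iff)
    have g: "cls (p @ rpath (c x)) \<in> generate \<pi> S"
      by (rule walk_in_generate[OF c gen start]) (use p in \<open>auto simp: loops_iff\<close>)
    have "inv\<^bsub>\<pi>\<^esub> (cls (rpath (c x))) \<in> generate \<pi> S"
      using group.generate_m_inv_closed[OF group_pi1 S start] .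
    then have "cls (c x) \<in> generate \<pi> S"
      using inv_pi1[OF loops_rpath[OF cx]] rpath_rpath[of x "c x" x] cx by (simp add: loops_iff)
    then have "cls (p @ rpath (c x)) \<otimes>\<^bsub>\<pi>\<^esub> cls (c x) \<in> generate \<pi> S" using g by (rule generate.eng[rotated])
    moreover have "(p @ rpath (c x) @ rpath (rpath (c x)) @ [], p @ []) \<in> htp"
      by (rule hom_cancel[of _ x _ x]) (use p loops_rpath[OF cx] loops_Nil in \<open>auto simp: loops_iff\<close>)
    ultimately show "C \<in> generate \<pi> S"
      using p cx loops_append loops_rpath rpath_rpath[of x "c x" x]
      by (simp add: mult_pi1 cls_eq_iff[symmetric] loops_iff[symmetric])
  qed
qed

end

section \<open>The rank of the fundamental group of a graph\<close>

locale plain_graph = serre_graph D arev "{}" x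
  for D :: "('a, 'e) pre_digraph" and arev x
begin

text \<open>A symmetric set of edges is a cochain with values mod 2, and \<open>par c\<close> is its
  value on a walk. Without 2-cells every such cochain is a cocycle, so its value on loops is a
  homotopy invariant.\<close>

definition par :: "'e set \<Rightarrow> 'e list \<Rightarrow> bool" where
  "par c p \<longleftrightarrow> odd (length (filter (\<lambda>a. a \<in> c) p))"

definition symm :: "'e set \<Rightarrow> bool" where
  "symm c \<longleftrightarrow> (\<forall>a\<in>arcs D. arev a \<in> c \<longleftrightarrow> a \<in> c)"

lemma par_append: "par c (p @ q) \<longleftrightarrow> (par c p \<noteq> par c q)"
  by (auto simp: par_def)

lemma par_rpath: "symm c \<Longrightarrow> set p \<subseteq> arcs D \<Longrightarrow> par c (rpath p) = par c p"
  by (induction p) (auto simp: par_append symm_def, auto simp: par_def)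

lemma par_hom:
  assumes "symm c" "(p, q) \<in> htp" "p \<in> loops"
  shows "par c q = par c p"
proof -
  have s: "par c a = par c b" if "(a, b) \<in> loop_step D arev {} x" for a b
    using that assms(1) unfolding loop_step_def by (auto simp: par_append) (auto simp: par_def symm_def)
  show ?thesis
    using assms(2,3) by (rule hom_induct[where P = "\<lambda>p q. par c q = par c p"]) (use s in auto)
qed

text \<open>On loops, evaluation is a homomorphism to the integers mod 2, so that agreement of two
  cochains can be tested on generators.\<close>

lemma par_agree:
  assumes c: "symm c" "symm c'" and S: "S \<subseteq> carrier \<pi>"
    and agree: "\<And>C p. C \<in> S \<Longrightarrow> p \<in> C \<Longrightarrow> par c p = par c' p"
    and g: "C \<in> generate \<pi> S" and p: "p \<in> C"
  shows "par c p = par c' p"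
  using g p
proof (induction arbitrary: p rule: generate.induct)
  case one
  then have "([], p) \<in> htp" by (simp add: one_pi1 cls_def)
  then have "par c p = par c []" "par c' p = par c' []" using par_hom c loops_Nil by blast+
  then show ?case by (simp add: par_def)
next
  case (incl h)
  then show ?case using agree by blast
next
  case (inv h)
  then obtain q where q: "q \<in> loops" "h = cls q" using S by (auto simp: carrier_pi1)
  then have "(rpath q, p) \<in> htp" using inv inv_pi1 by (simp add: cls_def)
  then have "par c p = par c (rpath q)" "par c' p = par c' (rpath q)"
    using par_hom c loops_rpath q by blast+
  moreover have "par c q = par c' q" using agree[OF inv(1), of q] q cls_self by blast
  ultimately show ?case using par_rpath c q awalk_arcs by (metis loops_iff)
next
  case (eng h1 h2)
  have sub: "generate \<pi> S \<subseteq> carrier \<pi>" using S by (rule group.generate_incl[OF group_pi1])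
  then have "h1 \<in> cls ` loops" "h2 \<in> cls ` loops" using eng(1,2) unfolding carrier_pi1 by auto
  then obtain p1 p2 where q: "p1 \<in> loops" "h1 = cls p1" "p2 \<in> loops" "h2 = cls p2"
    by (elim imageE) (rule that)
  then have "(p1 @ p2, p) \<in> htp" using eng(5) mult_pi1 by (simp add: cls_def)
  then have "par c p = par c (p1 @ p2)" "par c' p = par c' (p1 @ p2)"
    using par_hom c loops_append q by blast+
  moreover have "par c p1 = par c' p1" "par c p2 = par c' p2" using eng q cls_self by auto
  ultimately show ?case by (simp add: par_append)
qed

text \<open>Each subset of \<open>A\<close> gives a cochain, and it is determined by its values on
  the generators and on one chosen walk to each vertex. Hence \<open>2 ^ card A\<close> is at most
  \<open>2 ^ (card S + card (verts D))\<close>. The Euler characteristic would improve the bound by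
  1.\<close>

lemma generator_count:
  assumes conn: "\<And>z. z \<in> verts D \<Longrightarrow> \<exists>p. awalk x p z" and fin: "finite (verts D)"
    and A: "finite A" "A \<subseteq> arcs D" "\<And>a. a \<in> A \<Longrightarrow> arev a \<notin> A"
    and S: "finite S" "S \<subseteq> carrier \<pi>" "generate \<pi> S = carrier \<pi>"
  shows "card A \<le> card S + card (verts D)"
proof -
  define w where "w z = (SOME p. awalk x p z)" for z
  have w: "awalk x (w z) z" if "z \<in> verts D" for z
    unfolding w_def using conn[OF that] by (rule someI_ex)
  define cc where "cc J = J \<union> arev ` J" for J
  have sym: "symm (cc J)" if "J \<subseteq> A" for J
    unfolding symm_def
  proof
    fix a assume a: "a \<in> arcs D"
    have *: "arev b \<in> cc J" if "b \<in> cc J" for b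
      using that \<open>J \<subseteq> A\<close> A(2) arev_arev unfolding cc_def by auto
    show "arev a \<in> cc J \<longleftrightarrow> a \<in> cc J"
      using *[of a] *[of "arev a"] arev_arev[OF a] by metis
  qed
  have cc: "a \<in> cc J \<longleftrightarrow> a \<in> J" if "J \<subseteq> A" "a \<in> A" for J a
    using that A arev_arev unfolding cc_def by blast
  define F where "F J = ({C \<in> S. \<exists>p\<in>C. par (cc J) p}, {z \<in> verts D. par (cc J) (w z)})" for J
  have "inj_on F (Pow A)"
  proof (rule inj_onI)
    fix J J' assume J: "J \<in> Pow A" "J' \<in> Pow A" and eq: "F J = F J'"
    have JA: "J \<subseteq> A" "J' \<subseteq> A" using J by auto
    note s = sym[OF JA(1)] sym[OF JA(2)]
    have inv: "par c p \<longleftrightarrow> (\<exists>q\<in>C. par c q)" if C: "C \<in> S" "p \<in> C" and c: "symm c" for C p c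
    proof -
      obtain r where r: "r \<in> loops" "C = cls r" using C(1) S(2) by (auto simp: carrier_pi1)
      have "par c q = par c r" if "q \<in> C" for q
        using par_hom[OF c, of r q] that r by (simp add: cls_def)
      then show ?thesis using C by blast
    qed
    have "par (cc J) p = par (cc J') p" if C: "C \<in> S" "p \<in> C" for C p
    proof -
      have "(\<exists>q\<in>C. par (cc J) q) \<longleftrightarrow> (\<exists>q\<in>C. par (cc J') q)"
        using eq C(1) unfolding F_def by blast
      then show ?thesis using inv[OF C s(1)] inv[OF C s(2)] by blast
    qed
    then have agree: "par (cc J) p = par (cc J') p" if "p \<in> loops" for p
      using par_agree[OF s S(2), of "cls p" p] S(3) that cls_self by (auto simp: carrier_pi1)
    have agw: "par (cc J) (w z) = par (cc J') (w z)" if "z \<in> verts D" for z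
      using eq that unfolding F_def by blast
    have "a \<in> J \<longleftrightarrow> a \<in> J'" if a: "a \<in> A" for a
    proof -
      have aD: "a \<in> arcs D" using a A by blast
      then have V: "tail D a \<in> verts D" "head D a \<in> verts D" by auto
      \<comment> \<open>The two cochains agree on this loop and on the chosen walks at both ends of
        \<open>a\<close>, so they agree on the edge \<open>a\<close> alone.\<close>
      let ?l = "w (tail D a) @ [a] @ rpath (w (head D a))"
      have "awalk (tail D a) [a] (head D a)" using aD V by (simp add: awalk_Cons awalk_Nil)
      then have "?l \<in> loops" using w V awalk_rpath unfolding loops_iff awalk_app by blast
      then have "par (cc J) ?l = par (cc J') ?l" by (rule agree)
      moreover have "par (cc J) (rpath (w (head D a))) = par (cc J) (w (head D a))"
        "par (cc J') (rpath (w (head D a))) = par (cc J') (w (head D a))"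
        using par_rpath s w[OF V(2)] awalk_arcs by blast+
      ultimately have "par (cc J) [a] = par (cc J') [a]"
        using agw[OF V(1)] agw[OF V(2)] unfolding par_append by blast
      then show ?thesis using cc JA a by (auto simp: par_def split: if_splits)
    qed
    then show "J = J'" using JA by blast
  qed
  moreover have "F ` Pow A \<subseteq> Pow S \<times> Pow (verts D)" by (auto simp: F_def)
  ultimately have "card (Pow A) \<le> card (Pow S \<times> Pow (verts D))"
    using S fin by (intro card_inj_on_le) auto
  then have "(2::nat) ^ card A \<le> 2 ^ (card S + card (verts D))"
    using A S fin by (simp add: card_Pow card_cartesian_product power_add)
  then show ?thesis by (simp add: power_increasing_iff)
qed

lemma rank_ge:
  assumes conn: "\<And>z. z \<in> verts D \<Longrightarrow> \<exists>p. awalk x p z" and fin: "finite (verts D)"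
    and A: "finite A" "A \<subseteq> arcs D" "\<And>a. a \<in> A \<Longrightarrow> arev a \<notin> A"
  shows "of_nat (card A) \<le> group_rank \<pi> + of_nat (card (verts D))"
proof -
  \<comment> \<open>The truncated difference is a bound that can be proved for each finite
    generating set separately, below the infimum; if there is none, the infimum is infinite.\<close>
  have "of_nat (card A - card (verts D)) \<le> group_rank \<pi>"
    unfolding group_rank_def
  proof (rule INF_greatest)
    fix S assume "S \<in> {S. finite S \<and> S \<subseteq> carrier \<pi> \<and> generate \<pi> S = carrier \<pi>}"
    then have "card A \<le> card S + card (verts D)" using generator_count[OF conn fin A] by blast
    then show "(of_nat (card A - card (verts D)) :: ennreal) \<le> of_nat (card S)"
      by (intro of_nat_mono) simp
  qed
  then have "of_nat (card A - card (verts D)) + of_nat (card (verts D)) \<le> group_rank \<pi> + of_nat (card (verts D))"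
    by (rule add_right_mono)
  moreover have "(of_nat (card A) :: ennreal) \<le> of_nat (card A - card (verts D)) + of_nat (card (verts D))"
    unfolding of_nat_add[symmetric] by (intro of_nat_mono) simp
  ultimately show ?thesis by (rule order_trans[rotated])
qed

end

section \<open>Fundamental groups of graphs and of collapsible complexes\<close>

locale edge_complex =
  fixes V :: "'v set" and E :: "'v rel" and F :: "'v set set" and x :: 'v
  assumes E_V: "E \<subseteq> V \<times> V" and E_sym: "sym E" and E_irrefl: "\<And>a. (a, a) \<notin> E"
    and x_V: "x \<in> V" and conn: "\<And>a b. a \<in> V \<Longrightarrow> b \<in> V \<Longrightarrow> (a, b) \<in> E\<^sup>*"
begin

definition tri :: "('v \<times> 'v) list set" where
  "tri = {[(a, b), (b, c), (c, a)] | a b c. {a, b, c} \<in> F}"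

sublocale serre_graph "with_proj \<lparr>pverts = V, parcs = E\<rparr>" prod.swap tri x
proof
  show "a \<in> arcs (with_proj \<lparr>pverts = V, parcs = E\<rparr>) \<Longrightarrow> prod.swap a \<in> arcs (with_proj \<lparr>pverts = V, parcs = E\<rparr>)" for a
    using E_sym by (cases a) (auto dest: symD)
qed (use E_V x_V in auto)

lemma E_symD: "(a, b) \<in> E \<Longrightarrow> (b, a) \<in> E"
  using E_sym by (rule symD)

lemma aw_Cons: "awalk u (a # p) v \<longleftrightarrow> a \<in> E \<and> u = fst a \<and> awalk (snd a) p v"
  by (simp add: awalk_Cons)

lemma aw_Nil: "awalk u [] v \<longleftrightarrow> u = v \<and> u \<in> V"
  by (simp add: awalk_Nil)

lemma E_in_V: "(a, b) \<in> E \<Longrightarrow> a \<in> V" "(a, b) \<in> E \<Longrightarrow> b \<in> V"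
  using E_V by auto

lemma aw_single: "(a, b) \<in> E \<Longrightarrow> awalk a [(a, b)] b"
  by (simp add: aw_Cons aw_Nil E_in_V)

lemma rtrancl_walk:
  assumes "(a, b) \<in> E'\<^sup>*" "E' \<subseteq> E" "a \<in> V"
  shows "\<exists>p. awalk a p b \<and> set p \<subseteq> E'"
  using assms(1)
proof (induction rule: rtrancl_induct)
  case base
  then show ?case using assms(3) by (intro exI[of _ "[]"]) (simp add: aw_Nil)
next
  case (step b c)
  then obtain p where p: "awalk a p b" "set p \<subseteq> E'" by blast
  have "awalk a (p @ [(b, c)]) c" using p aw_single[of b c] step assms(2) awalk_app by blast
  then show ?case using p step by (intro exI[of _ "p @ [(b, c)]"]) auto
qed

lemma walk_rtrancl:
  assumes "awalk a p b" "set p \<subseteq> E'"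
  shows "(a, b) \<in> E'\<^sup>*"
  using assms
proof (induction p arbitrary: a)
  case (Cons e p)
  then show ?case by (cases e) (auto simp: aw_Cons intro: converse_rtrancl_into_rtrancl)
qed (simp add: aw_Nil)

lemma pi1_finitely_generated:
  assumes "finite E"
  shows "finitely_generated \<pi>"
proof -
  \<comment> \<open>The empty walk at \<open>x\<close> makes the start condition of
    \<open>generate_pi1\<close> hold trivially.\<close>
  define c where "c z = (if z = x then [] else SOME p. awalk x p z)" for z
  have c: "awalk x (c z) z" if z: "z \<in> V" for z
  proof (cases "z = x")
    case True
    then show ?thesis using x_V by (simp add: c_def aw_Nil)
  next
    case False
    have "\<exists>p. awalk x p z" using rtrancl_walk[OF conn[OF x_V z]] x_V by blast
    then have "awalk x (SOME p. awalk x p z) z" by (rule someI_ex)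
    then show ?thesis using False unfolding c_def by simp
  qed
  define S where "S = (\<lambda>a. cls (c (fst a) @ [a] @ rpath (c (snd a)))) ` E"
  have "S \<subseteq> carrier \<pi>"
  proof
    fix C assume "C \<in> S"
    then obtain a b where ab: "(a, b) \<in> E" "C = cls (c a @ [(a, b)] @ rpath (c b))" by (auto simp: S_def)
    have "awalk x (c a) a" "awalk a [(a, b)] b" "awalk b (rpath (c b)) x"
      using c ab E_in_V[OF ab(1)] aw_single awalk_rpath by auto
    then show "C \<in> carrier \<pi>" unfolding carrier_pi1 ab(2) loops_iff[symmetric]
      by (intro imageI) (auto simp: loops_iff awalk_app simp del: append.simps)
  qed
  moreover have "generate \<pi> S = carrier \<pi>"
  proof (rule generate_pi1[where c = c])
    show "cls (rpath (c x)) \<in> generate \<pi> S"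
      using generate.one[of \<pi> S] by (simp add: c_def one_pi1)
    show "cls (c (tail (with_proj \<lparr>pverts = V, parcs = E\<rparr>) a) @ [a] @ rpath (c (head (with_proj \<lparr>pverts = V, parcs = E\<rparr>) a))) \<in> generate \<pi> S"
      if "a \<in> arcs (with_proj \<lparr>pverts = V, parcs = E\<rparr>)" for a
      using that by (intro generate.incl) (auto simp: S_def)
  qed (use c \<open>S \<subseteq> carrier \<pi>\<close> in auto)
  moreover have "finite S" using assms by (simp add: S_def)
  ultimately show ?thesis unfolding finitely_generated_def by blast
qed

end

text \<open>
  The data of a splitting \<open>\<Gamma> = A * \<langle>t\<rangle>\<close> with \<open>A\<close> possibly trivial.  The set \<open>P\<close> plays the role
  of the set of reduced words that begin with \<open>t\<close>: it is a half-space of the Bass--Serre tree.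
\<close>
definition free_hnn :: "'g monoid \<Rightarrow> 'g set \<Rightarrow> 'g \<Rightarrow> 'g set \<Rightarrow> bool" where
  "free_hnn G A t P \<longleftrightarrow> subgroup A G \<and> t \<in> carrier G \<and> generate G (insert t A) = carrier G \<and>
     P \<subseteq> carrier G \<and> (\<forall>g\<in>P. \<forall>a\<in>A. g \<otimes>\<^bsub>G\<^esub> a \<in> P) \<and> \<one>\<^bsub>G\<^esub> \<notin> P \<and> t \<in> P \<and>
     (\<forall>g\<in>carrier G - {\<one>\<^bsub>G\<^esub>}. g \<in> P \<longleftrightarrow> g \<otimes>\<^bsub>G\<^esub> t \<in> P)"

locale edge_graph = edge_complex V E "{}" x for V :: "'v set" and E x
begin

lemma tri_empty: "tri = {}"
  by (simp add: tri_def)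

text \<open>A closed walk that sets out over a bridge has to come back over it. Its first return
  cuts it into two shorter closed walks, both null-homotopic by induction, and a backtrack remains.
  The disjunction in the conclusion lets the induction range over arbitrary continuations
  \<open>v\<close>.\<close>

lemma bridges_imp_null:
  assumes br: "\<And>a b. (a, b) \<in> E \<Longrightarrow> (a, b) \<notin> (E - {(a, b), (b, a)})\<^sup>*"
    and "awalk x u y" "awalk y p y"
  shows "(u @ p @ v, u @ v) \<in> htp \<or> \<not> awalk y v x"
  using assms(2,3)
proof (induction p arbitrary: u v y rule: length_induct)
  case (1 p)
  show ?case
  proof (cases "p = [] \<or> \<not> awalk y v x")
    case True
    then show ?thesis using hom_refl by auto
  next
    case False
    then have v: "awalk y v x" by simp
    obtain e m where p: "p = e # m" using False by (cases p) auto
    obtain z where e: "e = (y, z)" "(y, z) \<in> E" "awalk z m y" using 1(3) p by (cases e) (auto simp: aw_Cons)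
    let ?B = "{(y, z), (z, y)}"
    have "\<not> set m \<subseteq> E - ?B"
    proof
      assume "set m \<subseteq> E - ?B"
      then have "(z, y) \<in> (E - ?B)\<^sup>*" using walk_rtrancl e by blast
      then show False using br[OF E_symD[OF e(2)]] by (simp add: insert_commute)
    qed
    then have "\<exists>f\<in>set m. f \<in> ?B" using awalk_arcs[OF e(3)] by auto
    then obtain m1 f m2 where m: "m = m1 @ f # m2" "f \<in> ?B" "\<forall>g\<in>set m1. g \<notin> ?B"
      using split_list_first_prop[of m "\<lambda>f. f \<in> ?B"] by blast
    have aw: "awalk z m1 (fst f)" "f \<in> E" "awalk (snd f) m2 y"
      using e(3) m(1) by (auto simp: awalk_app aw_Cons)
    have zf: "(z, fst f) \<in> (E - ?B)\<^sup>*"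
      using walk_rtrancl[OF aw(1), of "E - ?B"] awalk_arcs[OF aw(1)] m(3) by auto
    have f: "f = (z, y)"
    proof (rule ccontr)
      assume "f \<noteq> (z, y)"
      then have "(z, y) \<in> (E - ?B)\<^sup>*" using zf m(2) by auto
      then show False using br[OF E_symD[OF e(2)]] by (simp add: insert_commute)
    qed
    have aw': "awalk z m1 z" "awalk y m2 y" using aw f by auto
    have "awalk x (u @ [(y, z)]) z" using 1(2) aw_single[OF e(2)] awalk_app by blast
    moreover have w2: "awalk z ([(z, y)] @ m2 @ v) x"
      using aw_single[OF E_symD[OF e(2)]] aw'(2) v unfolding awalk_app by blast
    moreover have "length m1 < length p" using p m by simp
    ultimately have h1: "((u @ [(y, z)]) @ m1 @ ([(z, y)] @ m2 @ v), (u @ [(y, z)]) @ ([(z, y)] @ m2 @ v)) \<in> htp"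
      using 1(1) aw'(1) by blast
    have "awalk y (m2 @ v) x" using aw'(2) v awalk_app by blast
    then have h2: "(u @ [(y, z)] @ rpath [(y, z)] @ m2 @ v, u @ m2 @ v) \<in> htp"
      by (rule hom_cancel[OF 1(2) aw_single[OF e(2)]])
    have "length m2 < length p" using p m by simp
    then have h3: "(u @ m2 @ v, u @ v) \<in> htp" using 1(1,2) aw'(2) v by blast
    have "(u @ p @ v, u @ [(y, z)] @ rpath [(y, z)] @ m2 @ v) \<in> htp"
      using h1 p e(1) m(1) f by simp
    then show ?thesis using hom_trans h2 h3 by blast
  qed
qed

text \<open>If all edges were bridges, the graph would be a tree and its fundamental group trivial,
  in particular abelian.\<close>

lemma exists_nonbridge:
  assumes "\<not> comm_group \<pi>"
  obtains a b where "(a, b) \<in> E" "(a, b) \<in> (E - {(a, b), (b, a)})\<^sup>*"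
proof (rule ccontr)
  assume n: "\<not> thesis"
  then have br: "\<And>a b. (a, b) \<in> E \<Longrightarrow> (a, b) \<notin> (E - {(a, b), (b, a)})\<^sup>*" using that by blast
  have x0: "awalk x [] x" using x_V by (simp add: aw_Nil)
  have c0: "cls p = cls []" if "p \<in> loops" for p
    using bridges_imp_null[OF br x0, of p "[]"] that x0 by (simp add: cls_eq_iff loops_iff)
  have "cls ` loops = (\<lambda>_. cls []) ` loops" by (rule image_cong[OF refl c0])
  then have "carrier \<pi> = {cls []}" unfolding carrier_pi1 image_constant[OF loops_Nil] .
  then have "comm_group \<pi>"
    by (intro group.group_comm_groupI[OF group_pi1]) simp
  then show False using assms by blast
qed

text \<open>
  \<open>P\<close> consists of the loops crossing the lift of the edge \<open>(a, b)\<close> next to the base point an odd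
  number of times; \<open>cnt u l\<close> counts the crossings along \<open>l\<close> after an initial walk \<open>u\<close>.
\<close>
lemma nonbridge_free_hnn:
  assumes ab: "(a, b) \<in> E" "(a, b) \<in> (E - {(a, b), (b, a)})\<^sup>*"
  obtains A t P where "free_hnn \<pi> A t P"
proof -
  define E' where "E' = E - {(a, b), (b, a)}"
  have "a \<noteq> b" using ab E_irrefl by auto
  have symE': "(q, p) \<in> E'\<^sup>*" if "(p, q) \<in> E'\<^sup>*" for p q
  proof -
    have "sym E'" using E_sym by (auto simp: E'_def sym_def)
    then show ?thesis using that sym_rtrancl by (metis symD)
  qed
  have E'E: "E' \<subseteq> E" by (auto simp: E'_def)
  have "E\<^sup>* \<subseteq> E'\<^sup>*"
  proof (rule rtrancl_subset_rtrancl, clarify)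
    fix p q assume "(p, q) \<in> E"
    then consider "(p, q) \<in> E'" | "(p, q) = (a, b)" | "(p, q) = (b, a)" by (auto simp: E'_def)
    then show "(p, q) \<in> E'\<^sup>*" using ab(2) symE' by cases (auto simp: E'_def[symmetric])
  qed
  then have ex: "\<exists>p. awalk x p z \<and> set p \<subseteq> E'" if "z \<in> V" for z
    using rtrancl_walk[OF _ E'E x_V] conn[OF x_V that] by blast
  \<comment> \<open>The graph stays connected without the edge, so the walks to all vertices can be
    chosen to avoid it. They then contribute no crossings.\<close>
  define c where "c z = (SOME p. awalk x p z \<and> set p \<subseteq> E')" for z
  have c: "awalk x (c z) z" "set (c z) \<subseteq> E'" if "z \<in> V" for z
    using someI_ex[OF ex[OF that]] unfolding c_def by auto
  have V: "a \<in> V" "b \<in> V" using E_in_V ab by auto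
  have swap: "prod.swap ` S \<subseteq> E'" if "S \<subseteq> E'" for S
    using that E_sym by (auto simp: E'_def sym_def)
  have rp: "set (rpath p) \<subseteq> E'" if "set p \<subseteq> E'" for p
    using swap[OF that] by (simp add: rpath_def)
  define e where "e = (a, b)"
  define e' where "e' = (b, a)"
  have ee': "e \<noteq> e'" "e \<notin> E'" "e' \<notin> E'" "prod.swap e = e'" "e \<in> E" "e' \<in> E"
    using \<open>a \<noteq> b\<close> ab E_symD by (auto simp: e_def e'_def E'_def)
  have we: "awalk a [e] b" "awalk b [e'] a" using ab E_symD aw_single by (auto simp: e_def e'_def)
  define nul where "nul u \<longleftrightarrow> (u, []) \<in> htp" for u
  have nul_htp: "nul u \<longleftrightarrow> nul u'" if "(u, u') \<in> htp" for u u'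
    unfolding nul_def using hom_trans[OF that] hom_trans[OF hom_sym[OF that]] by blast
  \<comment> \<open>A walk from the base point stands for a vertex of the universal cover. The next
    edge \<open>e\<close> crosses the distinguished lift exactly if the walk has arrived at the end
    of \<open>c a\<close> lifted from the base point; for the reversed edge \<open>e'\<close> the
    position after the crossing is tested.\<close>
  define here where "here u s \<longleftrightarrow> (s = e \<and> nul (u @ rpath (c a))) \<or> (s = e' \<and> nul (u @ [e'] @ rpath (c a)))" for u s
  define cnt where "cnt = rec_list (\<lambda>u. 0 :: nat) (\<lambda>s _ r u. (if here u s then 1 else 0) + r (u @ [s]))"
  have cnt0: "cnt [] u = 0" for u by (simp add: cnt_def)
  have cntS: "cnt (s # l) u = (if here u s then 1 else 0) + cnt l (u @ [s])" for s l u by (simp add: cnt_def)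
  have cnt_app: "cnt (l @ m) u = cnt l u + cnt m (u @ l)" for l m u
    by (induction l arbitrary: u) (simp_all add: cnt0 cntS)
  have cnt_E': "cnt l u = 0" if "set l \<subseteq> E'" for l u
    using that ee' by (induction l arbitrary: u) (auto simp: cnt0 cntS here_def)
  \<comment> \<open>The assumption says that \<open>u\<close> and \<open>u'\<close> end at the same
    vertex of the universal cover; inserting \<open>rpath (c y) @ c y\<close> turns it into a
    statement about loops, where homotopies can be concatenated.\<close>
  have nul_cong: "nul (u @ w) \<longleftrightarrow> nul (u' @ w)"
    if "awalk x u y" "awalk x u' y" "awalk y w x" "(u @ rpath (c y), u' @ rpath (c y)) \<in> htp" "y \<in> V" for u u' w y
  proof -
    have r: "awalk y (rpath (c y)) x" using c that(5) awalk_rpath by blast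
    have l: "c y @ w \<in> loops" using c that awalk_app unfolding loops_iff by blast
    have l1: "u @ rpath (c y) \<in> loops" using that r awalk_app unfolding loops_iff by blast
    have h: "((u @ rpath (c y)) @ (c y @ w), (u' @ rpath (c y)) @ (c y @ w)) \<in> htp"
      by (rule hom_append[OF that(4) hom_refl l1 l])
    have cc: "(v @ rpath (c y) @ rpath (rpath (c y)) @ w, v @ w) \<in> htp" if "awalk x v y" for v
      by (rule hom_cancel[OF that r]) fact
    have "(u @ w, u' @ w) \<in> htp"
      using cc[OF that(1)] cc[OF that(2)] h rpath_rpath[OF c(1)[OF that(5)]]
      by (simp) (meson hom_sym hom_trans)
    then show ?thesis unfolding nul_def using hom_sym hom_trans by blast
  qed
  have here_cong: "here u s \<longleftrightarrow> here u' s"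
    if "awalk x u y" "awalk x u' y" "awalk y [s] z" "(u @ rpath (c y), u' @ rpath (c y)) \<in> htp" "y \<in> V" for u u' s y z
  proof -
    have ra: "awalk a (rpath (c a)) x" using c V awalk_rpath by blast
    have "nul (u @ rpath (c a)) \<longleftrightarrow> nul (u' @ rpath (c a))" if "s = e"
    proof -
      have "y = a" using that \<open>awalk y [s] z\<close> by (simp add: aw_Cons e_def)
      then show ?thesis using nul_cong[of u y u' "rpath (c a)"] ra \<open>awalk x u y\<close> \<open>awalk x u' y\<close>
        \<open>(u @ rpath (c y), u' @ rpath (c y)) \<in> htp\<close> \<open>y \<in> V\<close> by simp
    qed
    moreover have "nul (u @ [e'] @ rpath (c a)) \<longleftrightarrow> nul (u' @ [e'] @ rpath (c a))" if "s = e'"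
    proof -
      have "y = b" using that \<open>awalk y [s] z\<close> by (simp add: aw_Cons e'_def)
      moreover have "awalk b ([e'] @ rpath (c a)) x" using we ra awalk_app by blast
      ultimately show ?thesis using nul_cong[of u y u' "[e'] @ rpath (c a)"] \<open>awalk x u y\<close> \<open>awalk x u' y\<close>
        \<open>(u @ rpath (c y), u' @ rpath (c y)) \<in> htp\<close> \<open>y \<in> V\<close> by simp
    qed
    ultimately show ?thesis unfolding here_def by blast
  qed
  have cls_ext: "((u @ w) @ rpath (c z), (u' @ w) @ rpath (c z)) \<in> htp"
    if "awalk x u y" "awalk x u' y" "awalk y w z" "(u @ rpath (c y), u' @ rpath (c y)) \<in> htp" "y \<in> V" "z \<in> V" for u u' w y z
  proof -
    have r: "awalk y (rpath (c y)) x" "awalk z (rpath (c z)) x" using c that awalk_rpath by blast+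
    have wz: "awalk y (w @ rpath (c z)) x" using that r awalk_app by blast
    have l: "c y @ w @ rpath (c z) \<in> loops" using c(1)[OF that(5)] wz awalk_app unfolding loops_iff by blast
    have l1: "u @ rpath (c y) \<in> loops" using that r awalk_app unfolding loops_iff by blast
    have h: "((u @ rpath (c y)) @ (c y @ w @ rpath (c z)), (u' @ rpath (c y)) @ (c y @ w @ rpath (c z))) \<in> htp"
      by (rule hom_append[OF that(4) hom_refl l1 l])
    have cc: "(v @ rpath (c y) @ rpath (rpath (c y)) @ (w @ rpath (c z)), v @ (w @ rpath (c z))) \<in> htp"
      if "awalk x v y" for v
      by (rule hom_cancel[OF that r(1) wz])
    show ?thesis
      using cc[OF that(1)] cc[OF that(2)] h rpath_rpath[OF c(1)[OF that(5)]]
      by (simp) (meson hom_sym hom_trans)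
  qed
  have cnt_cong: "cnt l u = cnt l u'"
    if "awalk x u y" "awalk x u' y" "awalk y l z" "(u @ rpath (c y), u' @ rpath (c y)) \<in> htp" for u u' l y z
    using that
  proof (induction l arbitrary: u u' y)
    case (Cons s l)
    have yV: "y \<in> V" using Cons.prems awalk_verts_ends by auto
    have s: "awalk y [s] (snd s)" "awalk (snd s) l z" "snd s \<in> V"
      using Cons.prems(3) E_V by (auto simp: aw_Cons aw_Nil)
    have "here u s \<longleftrightarrow> here u' s" using here_cong[OF Cons.prems(1,2) s(1) Cons.prems(4) yV] .
    moreover have "cnt l (u @ [s]) = cnt l (u' @ [s])"
    proof (rule Cons.IH[OF _ _ s(2)])
      show "awalk x (u @ [s]) (snd s)" "awalk x (u' @ [s]) (snd s)" using Cons.prems s awalk_app by blast+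
      show "((u @ [s]) @ rpath (c (snd s)), (u' @ [s]) @ rpath (c (snd s))) \<in> htp"
        by (rule cls_ext[OF Cons.prems(1,2) s(1) Cons.prems(4) yV s(3)])
    qed
    ultimately show ?case by (simp add: cntS)
  qed (simp add: cnt0)
  define N where "N l = cnt l []" for l
  \<comment> \<open>A backtrack crosses the distinguished lift either not at all or twice. Hence
    only the parity of the number of crossings is invariant.\<close>
  have backtrack: "even (cnt [s, prod.swap s] u)" if u: "awalk x u (fst s)" and s: "s \<in> E" for s u
  proof -
    have "nul (u @ [e] @ [e'] @ rpath (c a)) \<longleftrightarrow> nul (u @ rpath (c a))" if "fst s = a"
    proof -
      have ra: "awalk a (rpath (c a)) x" using c V awalk_rpath by blast
      have "(u @ [e] @ rpath [e] @ rpath (c a), u @ rpath (c a)) \<in> htp"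
        by (rule hom_cancel[of _ a _ b]) (use u that we ra in auto)
      from nul_htp[OF this] show ?thesis using ee'(4) by simp
    qed
    then show ?thesis using ee'(1,4) unfolding cntS cnt0 here_def by (cases s) (auto simp: e_def e'_def)
  qed
  have step_even: "even (N q) = even (N p)" if st: "(p, q) \<in> loop_step (with_proj \<lparr>pverts = V, parcs = E\<rparr>) prod.swap tri x" for p q
  proof -
    obtain u r v where uv: "p = u @ v" "q = u @ r @ v" "r \<in> tri \<union> (\<lambda>a. [a, prod.swap a]) ` arcs (with_proj \<lparr>pverts = V, parcs = E\<rparr>)"
      "p \<in> loops" "q \<in> loops" using st by (rule loop_stepE)
    then obtain s where s: "s \<in> E" "r = [s, prod.swap s]" using tri_empty by auto
    have "awalk x (u @ r @ v) x" using uv(2,5) by (simp add: loops_iff)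
    then obtain y where y: "awalk x u y" "awalk y (r @ v) x" unfolding awalk_app[of x u "r @ v"] by blast
    have ys: "y = fst s" using y(2) s by (simp add: aw_Cons)
    have rr: "awalk y r y" using s E_in_V[of "fst s" "snd s"] E_symD[of "fst s" "snd s"]
      by (simp add: ys aw_Cons aw_Nil prod.swap_def)
    obtain y' where "awalk y r y'" "awalk y' v x" using y(2) unfolding awalk_app by blast
    then have v: "awalk y v x" using s ys by (auto simp: aw_Cons aw_Nil)
    have yV: "y \<in> V" using y(1) awalk_verts_ends by auto
    have ry: "awalk y (rpath (c y)) x" using c yV awalk_rpath by blast
    have "(u @ rpath (c y), (u @ r) @ rpath (c y)) \<in> htp"
      using hom_insert[OF y(1) ry rr uv(3)] by simp
    moreover have "awalk x (u @ r) y" using y(1) rr awalk_app by blast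
    ultimately have "cnt v (u @ r) = cnt v u" using cnt_cong[OF y(1) _ v] by metis
    moreover have "N q = cnt u [] + (cnt r u + cnt v (u @ r))"
      unfolding N_def uv(2) by (simp only: cnt_app append_Nil)
    moreover have "N p = cnt u [] + cnt v u"
      unfolding N_def uv(1) by (simp only: cnt_app append_Nil)
    ultimately show ?thesis using backtrack[of u s] y(1) ys s by simp
  qed
  have N_hom: "even (N q) = even (N p)" if "(p, q) \<in> htp" "p \<in> loops" for p q
    using that by (rule hom_induct[where P = "\<lambda>p q. even (N q) = even (N p)"]) (use step_even in auto)
  define t where "t = c a @ [e] @ rpath (c b)"
  have cw: "awalk x (c a) a" "awalk a (rpath (c a)) x" "awalk b (rpath (c b)) x"
    using c V awalk_rpath by auto
  have tl: "t \<in> loops" unfolding t_def loops_iff awalk_app using cw we by blast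
  \<comment> \<open>The subgroup \<open>A\<close> is the image of the fundamental group of the graph
    without the edge.\<close>
  define L where "L = {l \<in> loops. set l \<subseteq> E'}"
  define A where "A = cls ` L"
  define P where "P = {cls l | l. l \<in> loops \<and> odd (N l)}"
  have P_iff: "cls l \<in> P \<longleftrightarrow> odd (N l)" if "l \<in> loops" for l
  proof
    assume "cls l \<in> P"
    then obtain m where "m \<in> loops" "odd (N m)" "cls l = cls m" by (auto simp: P_def)
    then show "odd (N l)" using N_hom[of l m] that by (simp add: cls_eq_iff)
  qed (use that in \<open>auto simp: P_def\<close>)
  have LL: "L \<subseteq> loops" by (auto simp: L_def)
  have A_carrier: "A \<subseteq> carrier \<pi>" unfolding A_def carrier_pi1 using LL by blast
  have subA: "subgroup A \<pi>"
  proof (rule group.subgroupI[OF group_pi1 A_carrier])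
    show "A \<noteq> {}" using loops_Nil by (auto simp: A_def L_def)
    show "inv\<^bsub>\<pi>\<^esub> C \<in> A" if C: "C \<in> A" for C
    proof -
      obtain l where l: "l \<in> L" "C = cls l" using C by (auto simp: A_def)
      then show ?thesis using inv_pi1[of l] loops_rpath[of l] rp[of l] by (auto simp: A_def L_def)
    qed
    show "C \<otimes>\<^bsub>\<pi>\<^esub> D \<in> A" if C: "C \<in> A" and D: "D \<in> A" for C D
    proof -
      obtain l m where l: "l \<in> L" "C = cls l" "m \<in> L" "D = cls m" using C D by (auto simp: A_def)
      then show ?thesis using mult_pi1[of l m] loops_append[of l m] by (auto simp: A_def L_def)
    qed
  qed
  have inA: "cls l \<in> generate \<pi> (insert (cls t) A)" if "l \<in> loops" "set l \<subseteq> E'" for l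
    using that by (intro generate.incl) (auto simp: A_def L_def)
  have S: "insert (cls t) A \<subseteq> carrier \<pi>" using A_carrier tl by (auto simp: carrier_pi1)
  have gen: "generate \<pi> (insert (cls t) A) = carrier \<pi>"
  proof (rule generate_pi1[where c = c, OF _ _ _ S])
    show "awalk x (c z) z" if "z \<in> verts (with_proj \<lparr>pverts = V, parcs = E\<rparr>)" for z using c that by simp
    show "cls (rpath (c x)) \<in> generate \<pi> (insert (cls t) A)"
      by (rule inA) (use c[OF x_V] awalk_rpath rp in \<open>auto simp: loops_iff\<close>)
    fix s assume "s \<in> arcs (with_proj \<lparr>pverts = V, parcs = E\<rparr>)"
    then have s: "s \<in> E" by simp
    have sV: "fst s \<in> V" "snd s \<in> V" using s E_V by auto
    have "awalk (fst s) [s] (snd s)" using s sV by (simp add: aw_Cons aw_Nil)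
    moreover have "awalk (snd s) (rpath (c (snd s))) x" using c sV awalk_rpath by blast
    ultimately have l: "c (fst s) @ [s] @ rpath (c (snd s)) \<in> loops"
      using c(1)[OF sV(1)] unfolding loops_iff awalk_app by blast
    consider "s \<in> E'" | "s = e" | "s = e'" using s by (auto simp: E'_def e_def e'_def)
    then have "cls (c (fst s) @ [s] @ rpath (c (snd s))) \<in> generate \<pi> (insert (cls t) A)"
    proof cases
      case 1
      then show ?thesis using l c(2) sV rp by (intro inA) auto
    next
      case 2
      then show ?thesis by (intro generate.incl) (simp add: t_def e_def)
    next
      case 3
      have "c b @ [e'] @ rpath (c a) = rpath t"
        using rpath_rpath[OF c(1)[OF V(2)]] ee' by (simp add: t_def)
      then have "cls (c (fst s) @ [s] @ rpath (c (snd s))) = inv\<^bsub>\<pi>\<^esub> (cls t)"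
        using 3 inv_pi1[OF tl] by (simp add: e'_def)
      then show ?thesis using generate.inv[of "cls t" "insert (cls t) A" \<pi>] by simp
    qed
    then show "cls (c (tail (with_proj \<lparr>pverts = V, parcs = E\<rparr>) s) @ [s] @ rpath (c (head (with_proj \<lparr>pverts = V, parcs = E\<rparr>) s)))
      \<in> generate \<pi> (insert (cls t) A)" by simp
  qed
  \<comment> \<open>After the loop \<open>l\<close>, the edge inside \<open>t\<close> is the
    distinguished lift only if \<open>l\<close> is null-homotopic. This is the clause of
    \<open>free_hnn\<close> on multiplication by \<open>t\<close>.\<close>
  have Nt: "N (l @ t) = N l + (if nul l then 1 else 0)" if l: "l \<in> loops" for l
  proof -
    have "nul (l @ c a @ rpath (c a)) \<longleftrightarrow> nul l"
    proof -
      have "(l @ c a @ rpath (c a) @ [], l @ []) \<in> htp"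
        by (rule hom_cancel[of _ x _ a]) (use l cw x_V in \<open>auto simp: loops_iff aw_Nil\<close>)
      from nul_htp[OF this] show ?thesis by simp
    qed
    then have "here (l @ c a) e \<longleftrightarrow> nul l" using ee' by (simp add: here_def)
    then show ?thesis
      using cnt_E'[OF c(2)[OF V(1)]] cnt_E'[OF rp[OF c(2)[OF V(2)]]]
      unfolding t_def N_def by (simp add: cnt_app cntS cnt0)
  qed
  have "free_hnn \<pi> A (cls t) P"
    unfolding free_hnn_def
  proof (intro conjI subA gen)
    show "cls t \<in> carrier \<pi>" using S by simp
    show "P \<subseteq> carrier \<pi>" by (auto simp: P_def carrier_pi1)
    show "\<forall>g\<in>P. \<forall>h\<in>A. g \<otimes>\<^bsub>\<pi>\<^esub> h \<in> P"
    proof (intro ballI)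
      fix g h assume "g \<in> P" "h \<in> A"
      then obtain l m where l: "l \<in> loops" "odd (N l)" "g = cls l" "m \<in> loops" "set m \<subseteq> E'" "h = cls m"
        by (auto simp: P_def A_def L_def)
      then have "N (l @ m) = N l" using cnt_E' by (simp add: N_def cnt_app)
      then show "g \<otimes>\<^bsub>\<pi>\<^esub> h \<in> P" using l loops_append by (simp add: mult_pi1 P_iff)
    qed
    show "\<one>\<^bsub>\<pi>\<^esub> \<notin> P" using P_iff[OF loops_Nil] by (simp add: one_pi1 N_def cnt0)
    show "cls t \<in> P" using P_iff[OF tl] Nt[OF loops_Nil] hom_refl by (simp add: N_def cnt0 nul_def)
    show "\<forall>g\<in>carrier \<pi> - {\<one>\<^bsub>\<pi>\<^esub>}. g \<in> P \<longleftrightarrow> g \<otimes>\<^bsub>\<pi>\<^esub> cls t \<in> P"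
    proof
      fix g assume "g \<in> carrier \<pi> - {\<one>\<^bsub>\<pi>\<^esub>}"
      then obtain l where l: "l \<in> loops" "g = cls l" "cls l \<noteq> cls []"
        unfolding carrier_pi1 one_pi1 by blast
      then have nl: "\<not> nul l" by (simp add: cls_eq_iff nul_def)
      then show "g \<in> P \<longleftrightarrow> g \<otimes>\<^bsub>\<pi>\<^esub> cls t \<in> P"
        using Nt[OF l(1)] nl l tl loops_append by (simp add: mult_pi1 P_iff)
    qed
  qed
  then show thesis by (rule that)
qed

end

section \<open>Elementary collapses of triangles\<close>

lemma (in serre_graph) hom_cancel2:
  assumes "awalk x u y" "awalk y p z" "awalk y q w" "awalk y v x"
  shows "(u @ p @ rpath p @ q @ rpath q @ v, u @ v) \<in> htp"
proof -
  have "awalk w (rpath q) y" using assms(3) by (rule awalk_rpath)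
  then have "awalk y (q @ rpath q @ v) x" unfolding awalk_app using assms(3,4) by blast
  then have "(u @ p @ rpath p @ (q @ rpath q @ v), u @ (q @ rpath q @ v)) \<in> htp"
    by (rule hom_cancel[OF assms(1,2)])
  then show ?thesis using hom_cancel[OF assms(1,3,4)] by (rule hom_trans)
qed

lemma (in serre_graph) hom_map:
  assumes "(p, q) \<in> htp"
    and refl: "\<And>a. Q a a" and sym: "\<And>a b. Q a b \<Longrightarrow> Q b a" and trans: "\<And>a b c. Q a b \<Longrightarrow> Q b c \<Longrightarrow> Q a c"
    and step: "\<And>a b. (a, b) \<in> loop_step D arev R x \<Longrightarrow> Q a b"
  shows "Q p q"
  using assms(1) unfolding loop_homotopy_def
proof (induction rule: rtrancl_induct)
  case base
  show ?case by (rule refl)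
next
  case (step a b)
  then have "Q a b" using assms(5)[of a b] sym[OF assms(5)[of b a]] by blast
  with step(3) show ?case by (rule trans)
qed

text \<open>The setting of an elementary collapse: the edge between \<open>a\<close> and
  \<open>b\<close> is free, and it will be removed together with the only triangle on it.\<close>

locale free_face = edge_complex V E F x for V :: "'v set" and E F x +
  fixes a b c :: 'v
  assumes card3: "t \<in> F \<Longrightarrow> card t = 3"
    and tri_E: "t \<in> F \<Longrightarrow> p \<in> t \<Longrightarrow> q \<in> t \<Longrightarrow> p \<noteq> q \<Longrightarrow> (p, q) \<in> E"
    and abc: "{a, b, c} \<in> F"
    and face: "t \<in> F \<Longrightarrow> a \<in> t \<Longrightarrow> b \<in> t \<Longrightarrow> t = {a, b, c}"
begin

abbreviation E' where "E' \<equiv> E - {(a, b), (b, a)}"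
abbreviation F' where "F' \<equiv> F - {{a, b, c}}"

lemma distinct_abc: "a \<noteq> b" "a \<noteq> c" "b \<noteq> c"
  using card3[OF abc] by (auto simp: card_insert_if split: if_splits)

lemma abcE: "(a, b) \<in> E" "(b, a) \<in> E" "(a, c) \<in> E'" "(c, a) \<in> E'" "(b, c) \<in> E'" "(c, b) \<in> E'"
  using tri_E[OF abc] distinct_abc by auto

lemma distinct_tri: "{p, q, r} \<in> F \<Longrightarrow> p \<noteq> q \<and> p \<noteq> r \<and> q \<noteq> r"
  using card3[of "{p, q, r}"] by (auto simp: card_insert_if split: if_splits)

lemma edge_complex': "edge_complex V E' x"
proof
  show "sym E'" using E_sym by (auto simp: sym_def)
  have "E \<subseteq> E'\<^sup>*"
  proof (rule subrelI)
    fix p q assume "(p, q) \<in> E"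
    then consider "(p, q) \<in> E'" | "p = a" "q = b" | "p = b" "q = a" by auto
    then show "(p, q) \<in> E'\<^sup>*"
    proof cases
      case 2
      show ?thesis unfolding 2
        by (rule rtrancl_trans[OF r_into_rtrancl[OF abcE(3)] r_into_rtrancl[OF abcE(6)]])
    next
      case 3
      show ?thesis unfolding 3
        by (rule rtrancl_trans[OF r_into_rtrancl[OF abcE(5)] r_into_rtrancl[OF abcE(4)]])
    qed (rule r_into_rtrancl)
  qed
  then have "E\<^sup>* \<subseteq> E'\<^sup>*" by (rule rtrancl_subset_rtrancl)
  then show "(p, q) \<in> E'\<^sup>*" if "p \<in> V" "q \<in> V" for p q using conn that by blast
qed (use E_V E_irrefl x_V in auto)

sublocale C': edge_complex V E' F' x
  by (rule edge_complex')

text \<open>This is the retraction on edges: the free edge is pushed across the triangle to the path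
  through \<open>c\<close>.\<close>

definition sub :: "'v \<times> 'v \<Rightarrow> ('v \<times> 'v) list" where
  "sub s = (if s = (a, b) then [(a, c), (c, b)] else if s = (b, a) then [(b, c), (c, a)] else [s])"

definition subs :: "('v \<times> 'v) list \<Rightarrow> ('v \<times> 'v) list" where
  "subs p = concat (map sub p)"

lemma subs_simps [simp]: "subs [] = []" "subs (s # p) = sub s @ subs p" "subs (p @ q) = subs p @ subs q"
  by (simp_all add: subs_def)

lemma sub_walk:
  assumes "s \<in> E" shows "C'.awalk (fst s) (sub s) (snd s)"
  using assms abcE E_V distinct_abc by (auto simp: sub_def C'.aw_Cons C'.aw_Nil)

lemma subs_walk: "awalk u p v \<Longrightarrow> C'.awalk u (subs p) v"
proof (induction p arbitrary: u)
  case Nil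
  then show ?case by (auto simp: C'.aw_Nil aw_Nil)
next
  case (Cons s p)
  then have "C'.awalk u (sub s) (snd s)" "C'.awalk (snd s) (subs p) v"
    using sub_walk by (auto simp: aw_Cons)
  then show ?case using C'.awalk_app by auto
qed

lemma walk_C': "C'.awalk u p v \<Longrightarrow> awalk u p v"
  by (induction p arbitrary: u) (auto simp: C'.aw_Cons aw_Cons C'.aw_Nil aw_Nil)

lemma subs_id: "set p \<subseteq> E' \<Longrightarrow> subs p = p"
  by (induction p) (auto simp: sub_def)

lemma sub_swap: "sub (prod.swap s) = C'.rpath (sub s)"
  using distinct_abc by (cases s) (auto simp: sub_def C'.rpath_def)

lemma loops_C': "p \<in> C'.loops \<Longrightarrow> p \<in> loops"
  using walk_C' by (simp add: loops_iff C'.loops_iff)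

lemma htp_C':
  assumes "(p, q) \<in> C'.htp" "p \<in> C'.loops"
  shows "(p, q) \<in> htp"
proof -
  have s: "(p, q) \<in> htp" if st: "(p, q) \<in> loop_step (with_proj \<lparr>pverts = V, parcs = E'\<rparr>) prod.swap C'.tri x" for p q
  proof -
    obtain u r v where uv: "p = u @ v" "q = u @ r @ v"
      "r \<in> C'.tri \<union> (\<lambda>a. [a, prod.swap a]) ` arcs (with_proj \<lparr>pverts = V, parcs = E'\<rparr>)"
      "p \<in> C'.loops" "q \<in> C'.loops" using st by (rule C'.loop_stepE)
    have "C'.tri \<subseteq> tri" unfolding C'.tri_def tri_def by blast
    then have "r \<in> tri \<union> (\<lambda>a. [a, prod.swap a]) ` arcs (with_proj \<lparr>pverts = V, parcs = E\<rparr>)"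
      using uv(3) by auto
    moreover have "u @ v \<in> loops" "u @ r @ v \<in> loops" using uv loops_C' by auto
    ultimately show ?thesis unfolding uv(1,2) by (intro hom_step loop_stepI)
  qed
  show ?thesis
    by (rule C'.hom_map[where Q = "\<lambda>p q. (p, q) \<in> htp", OF assms(1) hom_refl hom_sym hom_trans s])
qed

lemma subs_tri:
  assumes r: "r \<in> tri" and y: "awalk y r y" and u: "C'.awalk x u y" and v: "C'.awalk y v x"
  shows "(u @ subs r @ v, u @ v) \<in> C'.htp"
proof -
  obtain p q s where r': "r = [(p, q), (q, s), (s, p)]" "{p, q, s} \<in> F" using r by (auto simp: tri_def)
  have yp: "y = p" using y r' by (simp add: aw_Cons)
  show ?thesis
  proof (cases "{p, q, s} = {a, b, c}")
    case False
    then have "\<not> (a \<in> {p, q, s} \<and> b \<in> {p, q, s})" using face[OF r'(2)] by blast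
    then have "sub (p, q) = [(p, q)]" "sub (q, s) = [(q, s)]" "sub (s, p) = [(s, p)]"
      by (auto simp: sub_def)
    then have "subs r = r" by (simp add: r'(1))
    moreover have "r \<in> C'.tri" using False r' unfolding C'.tri_def by blast
    moreover have "C'.awalk y r y" using subs_walk[OF y] \<open>subs r = r\<close> by simp
    ultimately show ?thesis using C'.hom_sym[OF C'.hom_insert[OF u v, of r]] by simp
  next
    case True
    have d: "p \<noteq> q" "p \<noteq> s" "q \<noteq> s" using distinct_tri[OF r'(2)] by auto
    have w: "C'.awalk a [(a, c)] c" "C'.awalk c [(c, a)] a" "C'.awalk b [(b, c)] c" "C'.awalk c [(c, b)] b"
      using abcE by (auto intro!: C'.aw_single)
    have w2: "C'.awalk a [(a, c), (c, b)] b" "C'.awalk b [(b, c), (c, a)] a"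
      using w by (auto simp: C'.aw_Cons)
    have "p \<in> {a, b, c}" "q \<in> {a, b, c}" "s \<in> {a, b, c}" using True by auto
    \<comment> \<open>These are the three starting points in two orientations. The image of the
      boundary of the removed triangle is one backtrack along the two remaining sides, or two
      successive backtracks when it starts at \<open>c\<close>.\<close>
    then consider "p = a" "q = b" "s = c" | "p = b" "q = c" "s = a" | "p = c" "q = a" "s = b"
      | "p = b" "q = a" "s = c" | "p = a" "q = c" "s = b" | "p = c" "q = b" "s = a"
      using d by auto
    then show ?thesis
    proof cases
      case 1
      then show ?thesis using C'.hom_cancel[of u a "[(a, c), (c, b)]" b v] u v w2 yp r' distinct_abc
        by (simp add: sub_def)
    next
      case 2
      then show ?thesis using C'.hom_cancel[of u b "[(b, c), (c, a)]" a v] u v w2 yp r' distinct_abc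
        by (simp add: sub_def)
    next
      case 3
      then show ?thesis using C'.hom_cancel2[of u c "[(c, a)]" a "[(c, b)]" b v] u v w yp r' distinct_abc
        by (simp add: sub_def)
    next
      case 4
      then show ?thesis using C'.hom_cancel[of u b "[(b, c), (c, a)]" a v] u v w2 yp r' distinct_abc
        by (simp add: sub_def)
    next
      case 5
      then show ?thesis using C'.hom_cancel[of u a "[(a, c), (c, b)]" b v] u v w2 yp r' distinct_abc
        by (simp add: sub_def)
    next
      case 6
      then show ?thesis using C'.hom_cancel2[of u c "[(c, b)]" b "[(c, a)]" a v] u v w yp r' distinct_abc
        by (simp add: sub_def)
    qed
  qed
qed

lemma htp_subs:
  assumes "(p, q) \<in> htp" "p \<in> loops"
  shows "(subs p, subs q) \<in> C'.htp"
proof -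
  have s: "(subs p, subs q) \<in> C'.htp" if st: "(p, q) \<in> loop_step (with_proj \<lparr>pverts = V, parcs = E\<rparr>) prod.swap tri x" for p q
  proof -
    obtain u r v where uv: "p = u @ v" "q = u @ r @ v"
      "r \<in> tri \<union> (\<lambda>a. [a, prod.swap a]) ` arcs (with_proj \<lparr>pverts = V, parcs = E\<rparr>)"
      "p \<in> loops" "q \<in> loops" using st by (rule loop_stepE)
    have "awalk x (u @ r @ v) x" using uv(2,5) by (simp add: loops_iff)
    then obtain y z where y: "awalk x u y" "awalk y r z" "awalk z v x" unfolding awalk_app by blast
    have "y = z"
      using uv(3) y(2) by (auto simp: tri_def aw_Cons aw_Nil)
    have u: "C'.awalk x (subs u) y" and v: "C'.awalk y (subs v) x" using subs_walk y \<open>y = z\<close> by auto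
    show ?thesis
    proof (cases "r \<in> tri")
      case True
      then show ?thesis using subs_tri[OF True _ u v] y \<open>y = z\<close> uv C'.hom_sym by simp
    next
      case False
      then obtain s where s: "s \<in> E" "r = [s, prod.swap s]" using uv by auto
      then have "y = fst s" using y by (simp add: aw_Cons)
      then have "C'.awalk y (sub s) (snd s)" using sub_walk s by simp
      from C'.hom_cancel[OF u this v] show ?thesis
        using uv s by (simp add: sub_swap C'.hom_sym)
    qed
  qed
  show ?thesis
    by (rule hom_map[where Q = "\<lambda>p q. (subs p, subs q) \<in> C'.htp",
          OF assms(1) C'.hom_refl C'.hom_sym C'.hom_trans s])
qed

lemma subs_htp_walk:
  assumes "awalk x u y" "awalk y p z" "awalk z v x"
  shows "(u @ subs p @ v, u @ p @ v) \<in> htp"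
  using assms
proof (induction p arbitrary: u y)
  case Nil
  then show ?case by (simp add: hom_refl)
next
  case (Cons s p)
  have s: "s \<in> E" "y = fst s" "awalk (snd s) p z" using Cons.prems by (auto simp: aw_Cons)
  have us: "awalk x (u @ [s]) (snd s)"
    using Cons.prems(1) s E_V awalk_app[of x u "[s]" "snd s"] by (auto simp: aw_Cons aw_Nil)
  have 1: "((u @ [s]) @ subs p @ v, (u @ [s]) @ p @ v) \<in> htp" by (rule Cons.IH[OF us s(3) Cons.prems(3)])
  have sp: "awalk (snd s) (subs p) z" using walk_C'[OF subs_walk[OF s(3)]] .
  have w: "awalk (snd s) (subs p @ v) x" using sp Cons.prems(3) awalk_app by blast
  \<comment> \<open>Two sides of a filled triangle may be exchanged for the third one, which is why
    \<open>subs\<close> does not change the class of a loop in the large complex.\<close>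
  have key: "(u @ [(p1, r), (r, q1)] @ w', u @ [(p1, q1)] @ w') \<in> htp"
    if pq: "{p1, q1, r} \<in> F" "awalk x u p1" "awalk q1 w' x" for p1 q1 r w'
  proof -
    have d: "p1 \<noteq> q1" "p1 \<noteq> r" "q1 \<noteq> r" using distinct_tri[OF pq(1)] by auto
    have e: "(p1, q1) \<in> E" "(q1, p1) \<in> E" "(p1, r) \<in> E" "(r, q1) \<in> E" using tri_E[OF pq(1)] d by auto
    have aw: "awalk p1 [(p1, q1)] q1" "awalk p1 [(p1, r), (r, q1)] q1"
      using e E_in_V by (auto simp: aw_Cons aw_Nil)
    have "awalk p1 ([(p1, r), (r, q1)] @ w') x" using aw pq awalk_app by blast
    then have h1: "(u @ [(p1, q1)] @ rpath [(p1, q1)] @ [(p1, r), (r, q1)] @ w', u @ [(p1, r), (r, q1)] @ w') \<in> htp"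
      by (rule hom_cancel[OF pq(2) aw(1)])
    have "{q1, p1, r} \<in> F" using pq(1) by (simp add: insert_commute)
    then have t: "[(q1, p1), (p1, r), (r, q1)] \<in> tri" unfolding tri_def by blast
    have "awalk x (u @ [(p1, q1)]) q1" using pq aw awalk_app by blast
    then have "((u @ [(p1, q1)]) @ w', (u @ [(p1, q1)]) @ [(q1, p1), (p1, r), (r, q1)] @ w') \<in> htp"
      by (rule hom_insert[OF _ pq(3)]) (use t e E_in_V in \<open>auto simp: aw_Cons aw_Nil\<close>)
    then show ?thesis using hom_trans[OF hom_sym[OF h1]] hom_sym by simp
  qed
  have "(u @ sub s @ subs p @ v, u @ [s] @ subs p @ v) \<in> htp"
  proof -
    consider "s = (a, b)" | "s = (b, a)" | "sub s = [s]" unfolding sub_def by metis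
    then show ?thesis
    proof cases
      case 1
      then show ?thesis using key[OF abc, of "subs p @ v"] w Cons.prems(1) s by (simp add: sub_def)
    next
      case 2
      have "{b, a, c} \<in> F" using abc by (simp add: insert_commute)
      then show ?thesis using key[of b a c "subs p @ v"] w Cons.prems(1) s 2 distinct_abc by (simp add: sub_def)
    qed (simp add: hom_refl)
  qed
  then show ?case using 1 hom_trans by simp
qed

lemma subs_htp: "p \<in> loops \<Longrightarrow> (subs p, p) \<in> htp"
  using subs_htp_walk[of "[]" x p x "[]"] by (simp add: loops_iff aw_Nil x_V)

lemma collapse_iso: "C'.\<pi> \<cong> \<pi>"
proof -
  \<comment> \<open>Saturating a class with respect to the coarser homotopy is the map induced by
    the inclusion. The substitution \<open>subs\<close> provides its inverse: it is the identity on
    loops of the small complex and homotopic to the identity on loops of the large one.\<close>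
  define \<theta> where "\<theta> C = htp `` C" for C
  have \<theta>: "\<theta> (C'.cls p) = cls p" if "p \<in> C'.loops" for p
  proof (rule equalityI; rule subsetI)
    fix q assume "q \<in> \<theta> (C'.cls p)"
    then obtain r where "(p, r) \<in> C'.htp" "(r, q) \<in> htp" by (auto simp: \<theta>_def C'.cls_def)
    then show "q \<in> cls p" using htp_C'[OF _ that] hom_trans by (auto simp: cls_def)
  next
    fix q assume "q \<in> cls p"
    then show "q \<in> \<theta> (C'.cls p)" using C'.cls_self[of p] by (auto simp: \<theta>_def cls_def)
  qed
  have subs_loops: "subs p \<in> C'.loops" if "p \<in> loops" for p
    using subs_walk that by (simp add: loops_iff C'.loops_iff)
  have id: "subs p = p" if "p \<in> C'.loops" for p
    using that C'.awalk_arcs[of x p x] by (intro subs_id) (simp add: C'.loops_iff)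
  have "\<theta> \<in> hom C'.\<pi> \<pi>"
  proof (rule homI)
    show "\<theta> C \<in> carrier \<pi>" if "C \<in> carrier C'.\<pi>" for C
      using that \<theta> loops_C' by (auto simp: C'.carrier_pi1 carrier_pi1)
    show "\<theta> (C \<otimes>\<^bsub>C'.\<pi>\<^esub> D) = \<theta> C \<otimes>\<^bsub>\<pi>\<^esub> \<theta> D" if "C \<in> carrier C'.\<pi>" "D \<in> carrier C'.\<pi>" for C D
    proof -
      obtain p q where "p \<in> C'.loops" "C = C'.cls p" "q \<in> C'.loops" "D = C'.cls q"
        using \<open>C \<in> carrier C'.\<pi>\<close> \<open>D \<in> carrier C'.\<pi>\<close> unfolding C'.carrier_pi1 by blast
      then show ?thesis using \<theta> loops_C' C'.loops_append by (simp add: C'.mult_pi1 mult_pi1)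
    qed
  qed
  moreover have "bij_betw \<theta> (carrier C'.\<pi>) (carrier \<pi>)"
    unfolding bij_betw_def
  proof
    show "inj_on \<theta> (carrier C'.\<pi>)"
    proof (rule inj_onI)
      fix C D assume "C \<in> carrier C'.\<pi>" "D \<in> carrier C'.\<pi>" and eq: "\<theta> C = \<theta> D"
      then obtain p q where pq: "p \<in> C'.loops" "C = C'.cls p" "q \<in> C'.loops" "D = C'.cls q"
        unfolding C'.carrier_pi1 by blast
      then have "(p, q) \<in> htp" using eq \<theta> by (simp add: cls_eq_iff)
      then have "(subs p, subs q) \<in> C'.htp" using htp_subs loops_C' pq by blast
      then show "C = D" using pq id by (simp add: C'.cls_eq_iff)
    qed
    have "cls p \<in> \<theta> ` carrier C'.\<pi>" if "p \<in> loops" for p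
    proof -
      have "cls p = \<theta> (C'.cls (subs p))"
        using \<theta> subs_loops[OF that] subs_htp[OF that] by (simp add: cls_eq_iff hom_sym)
      then show ?thesis using subs_loops[OF that] by (simp add: C'.carrier_pi1)
    qed
    then show "\<theta> ` carrier C'.\<pi> = carrier \<pi>"
      using \<theta> loops_C' by (auto simp: C'.carrier_pi1 carrier_pi1)
  qed
  ultimately show ?thesis unfolding is_iso_def iso_def by blast
qed

end

text \<open>The hypothesis on free edges is made for every nonempty subfamily, so that it is
  inherited after each collapse and the induction on the number of triangles goes through.\<close>

lemma collapse_to_graph:
  assumes "edge_complex V E x" "finite F" "\<And>t. t \<in> F \<Longrightarrow> card t = 3"
    and "\<And>t p q. t \<in> F \<Longrightarrow> p \<in> t \<Longrightarrow> q \<in> t \<Longrightarrow> p \<noteq> q \<Longrightarrow> (p, q) \<in> E"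
    and "\<And>F'. F' \<subseteq> F \<Longrightarrow> F' \<noteq> {} \<Longrightarrow> \<exists>t\<in>F'. \<exists>a\<in>t. \<exists>b\<in>t. a \<noteq> b \<and> (\<forall>s\<in>F'. {a, b} \<subseteq> s \<longrightarrow> s = t)"
  shows "\<exists>E'. edge_complex V E' x \<and>
    pi1 (with_proj \<lparr>pverts = V, parcs = E'\<rparr>) prod.swap (edge_complex.tri {}) x
      \<cong> pi1 (with_proj \<lparr>pverts = V, parcs = E\<rparr>) prod.swap (edge_complex.tri F) x"
  using assms
proof (induction "card F" arbitrary: E F)
  case 0
  interpret edge_complex V E F x by (rule 0)
  have "F = {}" using 0 by simp
  then show ?case using 0(2) iso_refl[of \<pi>] by (intro exI[of _ E]) simp
next
  case (Suc n)
  interpret edge_complex V E F x by (rule Suc)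
  have "F \<noteq> {}" using Suc(2) by auto
  obtain t a b where t: "t \<in> F" "a \<in> t" "b \<in> t" "a \<noteq> b" "\<forall>s\<in>F. {a, b} \<subseteq> s \<longrightarrow> s = t"
    using Suc.prems(5)[OF order_refl \<open>F \<noteq> {}\<close>] by (elim bexE conjE) (rule that)
  have "card (t - {a, b}) = 1" using Suc.prems(3)[OF t(1)] t(2-4) by (simp add: card_Diff_subset)
  then obtain c where "t - {a, b} = {c}" by (rule card_1_singletonE)
  then have tc: "t = {a, b, c}" using t(2,3) by auto
  interpret free_face V E F x a b c
  proof
    show "card s = 3" if "s \<in> F" for s using that by (rule Suc.prems(3))
    show "(p, q) \<in> E" if "s \<in> F" "p \<in> s" "q \<in> s" "p \<noteq> q" for s p q using that by (rule Suc.prems(4))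
    show "{a, b, c} \<in> F" using t(1) unfolding tc .
    show "s = {a, b, c}" if "s \<in> F" "a \<in> s" "b \<in> s" for s
      using bspec[OF t(5) that(1)] that unfolding tc by blast
  qed
  have "\<exists>E''. edge_complex V E'' x \<and>
    pi1 (with_proj \<lparr>pverts = V, parcs = E''\<rparr>) prod.swap (edge_complex.tri {}) x
      \<cong> pi1 (with_proj \<lparr>pverts = V, parcs = E'\<rparr>) prod.swap (edge_complex.tri F') x"
  proof (rule Suc(1))
    show "n = card F'" using Suc(2) Suc.prems(2) abc by simp
    show "edge_complex V E' x" by (rule edge_complex')
    show "(p, q) \<in> E'" if s: "s \<in> F'" "p \<in> s" "q \<in> s" "p \<noteq> q" for s p q
      using Suc.prems(4)[of s p q] s face[of s] by auto
    show "\<exists>t\<in>F''. \<exists>a\<in>t. \<exists>b\<in>t. a \<noteq> b \<and> (\<forall>s\<in>F''. {a, b} \<subseteq> s \<longrightarrow> s = t)"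
      if F'': "F'' \<subseteq> F'" "F'' \<noteq> {}" for F''
    proof (rule Suc.prems(5))
      show "F'' \<subseteq> F" using F''(1) by blast
    qed (rule F''(2))
  qed (use Suc.prems in auto)
  then show ?case using collapse_iso iso_trans by blast
qed

section \<open>Triangulated surfaces with boundary\<close>

lemma surface_edge_complex:
  assumes "triangulated_surface_with_boundary F" "x \<in> \<Union>F"
  shows "edge_complex (\<Union>F) (tri_edge_rel F) x"
proof
  show "(a, b) \<in> (tri_edge_rel F)\<^sup>*" if "a \<in> \<Union>F" "b \<in> \<Union>F" for a b
    using assms(1) that unfolding triangulated_surface_with_boundary_def by blast
qed (use assms(2) in \<open>auto simp: tri_edge_rel_def sym_def\<close>)

text \<open>A subfamily without a free edge contains, with each of its edges, all triangles on that
  edge; by connected links all triangles at its vertices; by connectedness the whole surface. But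
  the surface has a boundary edge, and that edge is free.\<close>

lemma surface_free_face:
  assumes F: "triangulated_surface_with_boundary F" and F': "F' \<subseteq> F" "F' \<noteq> {}"
  shows "\<exists>t\<in>F'. \<exists>a\<in>t. \<exists>b\<in>t. a \<noteq> b \<and> (\<forall>s\<in>F'. {a, b} \<subseteq> s \<longrightarrow> s = t)"
proof (rule ccontr)
  assume n: "\<not> ?thesis"
  have other: "\<exists>s\<in>F'. {a, b} \<subseteq> s \<and> s \<noteq> t" if tab: "t \<in> F'" "a \<in> t" "b \<in> t" "a \<noteq> b" for t a b
  proof (rule ccontr)
    assume "\<not> ?thesis"
    then have "\<forall>s\<in>F'. {a, b} \<subseteq> s \<longrightarrow> s = t" by (metis (no_types))
    with tab(4) have "a \<noteq> b \<and> (\<forall>s\<in>F'. {a, b} \<subseteq> s \<longrightarrow> s = t)" by (rule conjI)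
    then show False using n tab(1-3) by (metis (no_types, lifting))
  qed
  have fin: "finite F" and c3: "\<And>t. t \<in> F \<Longrightarrow> card t = 3"
    using F by (simp_all add: triangulated_surface_with_boundary_def)
  have two': "\<forall>(a, b)\<in>tri_edge_rel F. card {t\<in>F. {a, b} \<subseteq> t} \<le> 2"
    and link': "\<forall>v\<in>\<Union>F. \<forall>a b. (v, a) \<in> tri_edge_rel F \<and> (v, b) \<in> tri_edge_rel F \<longrightarrow> (a, b) \<in> (tri_link_rel F v)\<^sup>*"
    and con': "\<forall>a\<in>\<Union>F. \<forall>b\<in>\<Union>F. (a, b) \<in> (tri_edge_rel F)\<^sup>*"
    and bd: "\<exists>(a, b)\<in>tri_edge_rel F. card {t\<in>F. {a, b} \<subseteq> t} = 1"
    using F[unfolded triangulated_surface_with_boundary_def] by - (elim conjE, assumption)+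
  have two: "card {t\<in>F. {a, b} \<subseteq> t} \<le> 2" if "(a, b) \<in> tri_edge_rel F" for a b
    using bspec[OF two' that] by simp
  have link: "(a, b) \<in> (tri_link_rel F v)\<^sup>*"
    if "v \<in> \<Union>F" "(v, a) \<in> tri_edge_rel F" "(v, b) \<in> tri_edge_rel F" for v a b
    using link' that by blast
  have con: "(a, b) \<in> (tri_edge_rel F)\<^sup>*" if "a \<in> \<Union>F" "b \<in> \<Union>F" for a b
    using con' that by blast
  \<comment> \<open>A triangle outside \<open>F'\<close> would be the third one on the edge, as two
    triangles on it lie in \<open>F'\<close>.\<close>
  have c1: "s \<in> F'" if t: "t \<in> F'" "s \<in> F" "{a, b} \<subseteq> t" "{a, b} \<subseteq> s" "a \<noteq> b" for t s a b
  proof (rule ccontr)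
    assume "s \<notin> F'"
    obtain t' where t': "t' \<in> F'" "{a, b} \<subseteq> t'" "t' \<noteq> t" using other[of t a b] t by auto
    have "{s, t, t'} \<subseteq> {t\<in>F. {a, b} \<subseteq> t}" using t t' F' by auto
    then have "card {s, t, t'} \<le> card {t\<in>F. {a, b} \<subseteq> t}" using fin by (intro card_mono) auto
    moreover have "s \<noteq> t" "s \<noteq> t'" using t(1) t'(1) \<open>s \<notin> F'\<close> by blast+
    then have "card {s, t, t'} = 3" using t'(3) by simp
    moreover have "(a, b) \<in> tri_edge_rel F" using t by (auto simp: tri_edge_rel_def)
    ultimately show False using two by fastforce
  qed
  \<comment> \<open>Walking through the link of \<open>v\<close> reaches every triangle at
    \<open>v\<close>, and each step crosses an edge at \<open>v\<close>, where \<open>c1\<close>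
    applies.\<close>
  have c2: "s \<in> F'" if t: "t \<in> F'" "v \<in> t" "s \<in> F" "v \<in> s" for t v s
  proof -
    have "card (t - {v}) = 2" "card (s - {v}) = 2" using t c3 F' by (auto simp: subset_iff)
    then have "t - {v} \<noteq> {}" "s - {v} \<noteq> {}" by (metis card.empty zero_neq_numeral)+
    then obtain a d where a: "a \<in> t" "a \<noteq> v" and d: "d \<in> s" "d \<noteq> v" by blast
    have "(a, d) \<in> (tri_link_rel F v)\<^sup>*"
      by (rule link) (use t a d F' in \<open>auto simp: tri_edge_rel_def\<close>)
    then have "d \<noteq> v \<and> (\<forall>s\<in>F. {v, d} \<subseteq> s \<longrightarrow> s \<in> F')"
    proof (induction rule: rtrancl_induct)
      case base
      then show ?case using c1[of t _ v a] t a by auto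
    next
      case (step y z)
      have yz: "{v, y, z} \<in> F" using step(2) by (simp add: tri_link_rel_def)
      then have "{v, y, z} \<in> F'" using step(3) by auto
      moreover have "z \<noteq> v" using c3[OF yz] by (auto simp: card_insert_if split: if_splits)
      ultimately show ?case using c1[of "{v, y, z}" _ v z] by auto
    qed
    then show ?thesis using t d by auto
  qed
  have c3': "b \<in> \<Union>F'" if "(a, b) \<in> (tri_edge_rel F)\<^sup>*" "a \<in> \<Union>F'" for a b
    using that
  proof (induction rule: rtrancl_induct)
    case (step y z)
    then obtain s t where "s \<in> F" "{y, z} \<subseteq> s" "t \<in> F'" "y \<in> t" by (auto simp: tri_edge_rel_def)
    then show ?case using c2[of t y s] by auto
  qed
  obtain t0 where "t0 \<in> F'" using F' by blast
  moreover have "t0 \<noteq> {}" using c3[of t0] calculation F' by (auto simp: subset_iff)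
  ultimately obtain v0 where v0: "v0 \<in> \<Union>F'" "v0 \<in> \<Union>F" using F' by blast
  have all: "t \<in> F'" if t: "t \<in> F" for t
  proof -
    have "t \<noteq> {}" using c3[OF t] by auto
    then obtain v where v: "v \<in> t" by blast
    then have "v \<in> \<Union>F'" using c3'[OF con[OF v0(2)] v0(1)] t by blast
    then show ?thesis using c2 t v by blast
  qed
  obtain a b where ab: "(a, b) \<in> tri_edge_rel F" "card {t\<in>F. {a, b} \<subseteq> t} = 1" using bd by blast
  then obtain t where t: "{t\<in>F. {a, b} \<subseteq> t} = {t}" by (meson card_1_singletonE)
  then have tF: "t \<in> F" "{a, b} \<subseteq> t" by auto
  moreover have "a \<noteq> b" using ab by (simp add: tri_edge_rel_def)
  ultimately obtain s where "s \<in> F'" "{a, b} \<subseteq> s" "s \<noteq> t" using other[of t a b] all by auto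
  then show False using t F' by blast
qed

section \<open>Free splittings of abstract surface groups\<close>

lemma free_hnn_iso:
  assumes \<phi>: "\<phi> \<in> iso G H" and G: "group G" "group H" and f: "free_hnn G A t P"
  shows "free_hnn H (\<phi> ` A) (\<phi> t) (\<phi> ` P)"
proof -
  have hom: "\<phi> \<in> hom G H" and bij: "bij_betw \<phi> (carrier G) (carrier H)" using \<phi> by (auto simp: iso_def)
  interpret group_hom G H \<phi> using G hom by (simp add: group_hom_def group_hom_axioms_def)
  have f: "subgroup A G" "t \<in> carrier G" "generate G (insert t A) = carrier G"
     "P \<subseteq> carrier G" "\<forall>g\<in>P. \<forall>a\<in>A. g \<otimes>\<^bsub>G\<^esub> a \<in> P" "\<one>\<^bsub>G\<^esub> \<notin> P" "t \<in> P"
     "\<forall>g\<in>carrier G - {\<one>\<^bsub>G\<^esub>}. g \<in> P \<longleftrightarrow> g \<otimes>\<^bsub>G\<^esub> t \<in> P"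
    using f unfolding free_hnn_def by auto
  have Ac: "A \<subseteq> carrier G" using f(1) by (rule subgroup.subset)
  have inj: "\<phi> g \<in> \<phi> ` P \<longleftrightarrow> g \<in> P" if "g \<in> carrier G" for g
    using bij f(4) that by (auto simp: bij_betw_def inj_on_def subset_iff)
  show ?thesis
    unfolding free_hnn_def
  proof (intro conjI)
    show "subgroup (\<phi> ` A) H" using f(1) by (rule subgroup_img_is_subgroup)
    show "generate H (insert (\<phi> t) (\<phi> ` A)) = carrier H"
      using generate_img[of "insert t A"] f(2,3) Ac bij by (simp add: bij_betw_def)
    show "\<forall>g\<in>\<phi> ` P. \<forall>a\<in>\<phi> ` A. g \<otimes>\<^bsub>H\<^esub> a \<in> \<phi> ` P"
    proof clarify
      fix g a assume ga: "g \<in> P" "a \<in> A"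
      then have "\<phi> g \<otimes>\<^bsub>H\<^esub> \<phi> a = \<phi> (g \<otimes>\<^bsub>G\<^esub> a)" using f(4) Ac by (intro hom_mult[symmetric]) auto
      then show "\<phi> g \<otimes>\<^bsub>H\<^esub> \<phi> a \<in> \<phi> ` P" using f(5) ga by auto
    qed
    show "\<one>\<^bsub>H\<^esub> \<notin> \<phi> ` P" using inj[of "\<one>\<^bsub>G\<^esub>"] f(6) by simp
    show "\<forall>g\<in>carrier H - {\<one>\<^bsub>H\<^esub>}. g \<in> \<phi> ` P \<longleftrightarrow> g \<otimes>\<^bsub>H\<^esub> \<phi> t \<in> \<phi> ` P"
    proof
      fix h assume h: "h \<in> carrier H - {\<one>\<^bsub>H\<^esub>}"
      then obtain g where g: "g \<in> carrier G" "h = \<phi> g" using bij by (auto simp: bij_betw_def)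
      then have "g \<noteq> \<one>\<^bsub>G\<^esub>" using h by auto
      then show "h \<in> \<phi> ` P \<longleftrightarrow> h \<otimes>\<^bsub>H\<^esub> \<phi> t \<in> \<phi> ` P"
        using f(2,8) g inj hom_mult[OF g(1) f(2)] by (metis Diff_iff G.m_closed singletonD)
    qed
  qed (use f in auto)
qed

lemma finitely_generated_iso:
  assumes \<phi>: "\<phi> \<in> iso G H" and G: "group G" "group H" and f: "finitely_generated G"
  shows "finitely_generated H"
proof -
  have hom: "\<phi> \<in> hom G H" and bij: "bij_betw \<phi> (carrier G) (carrier H)" using \<phi> by (auto simp: iso_def)
  interpret group_hom G H \<phi> using G hom by (simp add: group_hom_def group_hom_axioms_def)
  obtain S where S: "finite S" "S \<subseteq> carrier G" "generate G S = carrier G" using f by (auto simp: finitely_generated_def)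
  then show ?thesis
    using generate_img[of S] bij unfolding finitely_generated_def
    by (intro exI[of _ "\<phi> ` S"]) (auto simp: bij_betw_def)
qed

text \<open>With \<open>A\<close> trivial the group would be generated by \<open>t\<close>, hence
  cyclic and abelian.\<close>

lemma free_hnn_nontrivial:
  fixes G :: "'g monoid" (structure)
  assumes "group G" and f: "free_hnn G A t P" and nc: "\<not> comm_group G"
  shows "A \<noteq> {\<one>}"
proof
  interpret group G by fact
  assume "A = {\<one>}"
  then have t: "t \<in> carrier G" and g: "generate G {t, \<one>} = carrier G" using f by (auto simp: free_hnn_def)
  have pow: "\<exists>k::int. g = t [^] k" if "g \<in> generate G {t, \<one>}" for g
    using that
  proof (induction rule: generate.induct)
    case one
    then show ?case by (intro exI[of _ 0]) simp
  next
    case (incl h)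
    then show ?case
    proof (cases "h = \<one>")
      case True
      then show ?thesis by (intro exI[of _ 0]) simp
    next
      case False
      then show ?thesis using incl t by (intro exI[of _ 1]) (simp add: int_pow_1)
    qed
  next
    case (inv h)
    then show ?case
    proof (cases "h = \<one>")
      case True
      then show ?thesis by (intro exI[of _ 0]) simp
    next
      case False
      then show ?thesis using inv t by (intro exI[of _ "-1"]) (simp add: int_pow_neg int_pow_1)
    qed
  next
    case (eng h1 h2)
    then obtain k l :: int where "h1 = t [^] k" "h2 = t [^] l" by blast
    then show ?case using t by (intro exI[of _ "k + l"]) (simp add: int_pow_mult)
  qed
  have "comm_group G"
  proof (rule group_comm_groupI)
    fix g h assume "g \<in> carrier G" "h \<in> carrier G"
    then obtain k l :: int where "g = t [^] k" "h = t [^] l" using pow unfolding g by blast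
    then show "g \<otimes> h = h \<otimes> g" using t by (simp add: int_pow_mult[symmetric] add.commute)
  qed
  then show False using nc by blast
qed

lemma comm_group_iso:
  assumes "G \<cong> H" "group G" "group H" "comm_group G"
  shows "comm_group H"
  using assms comm_group.iso_imp_comm_group[of G H] group.is_monoid by blast

text \<open>The splitting comes from the graph onto which the surface collapses, whereas finite
  generation is read off from the triangulation, whose edge set is visibly finite.\<close>

lemma bounded_surface_group_free_hnn:
  fixes G :: "'g monoid"
  assumes G: "group G" "bounded_surface_group G" "\<not> comm_group G"
  obtains A t P where "free_hnn G A t P" "A \<noteq> {\<one>\<^bsub>G\<^esub>}" "finitely_generated G"
proof -
  obtain F x where F: "triangulated_surface_with_boundary F" "x \<in> \<Union>F" "G \<cong> triangulation_pi1 F x"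
    using G by (auto simp: bounded_surface_group_def)
  interpret T: edge_complex "\<Union>F" "tri_edge_rel F" F x by (rule surface_edge_complex[OF F(1,2)])
  have T: "triangulation_pi1 F x = T.\<pi>" by (simp add: triangulation_pi1_def T.tri_def)
  have fin: "finite F" "\<And>t. t \<in> F \<Longrightarrow> card t = 3"
    using F(1) by (auto simp: triangulated_surface_with_boundary_def)
  then have "finite (\<Union>F)" by (metis card.infinite finite_Union zero_neq_numeral)
  then have finE: "finite (tri_edge_rel F)" using T.E_V by (meson finite_SigmaI finite_subset)
  obtain E' where E': "edge_complex (\<Union>F) E' x"
    "pi1 (with_proj \<lparr>pverts = \<Union>F, parcs = E'\<rparr>) prod.swap (edge_complex.tri {}) x \<cong> T.\<pi>"
    using collapse_to_graph[OF T.edge_complex_axioms fin]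
      surface_free_face[OF F(1)] by (fastforce simp: tri_edge_rel_def)
  interpret gr: edge_graph "\<Union>F" E' x using E'(1) by (simp add: edge_graph_def)
  have G_iso: "T.\<pi> \<cong> G" using group.iso_sym[OF G(1) F(3)] T by simp
  then have iso: "gr.\<pi> \<cong> G" using E'(2) iso_trans by blast
  have "\<not> comm_group gr.\<pi>" using comm_group_iso[OF iso gr.group_pi1 G(1)] G(3) by blast
  then obtain a b where "(a, b) \<in> E'" "(a, b) \<in> (E' - {(a, b), (b, a)})\<^sup>*" by (rule gr.exists_nonbridge)
  then obtain A t P where h: "free_hnn gr.\<pi> A t P" by (rule gr.nonbridge_free_hnn)
  obtain \<phi> where \<phi>: "\<phi> \<in> iso gr.\<pi> G" using iso by (auto simp: is_iso_def)
  have h': "free_hnn G (\<phi> ` A) (\<phi> t) (\<phi> ` P)" using free_hnn_iso[OF \<phi> gr.group_pi1 G(1) h] .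
  obtain \<psi> where \<psi>: "\<psi> \<in> iso T.\<pi> G" using G_iso by (auto simp: is_iso_def)
  have "finitely_generated G"
    using finitely_generated_iso[OF \<psi> T.group_pi1 G(1) T.pi1_finitely_generated[OF finE]] .
  then show thesis using that[OF h'] free_hnn_nontrivial[OF G(1) h' G(3)] by blast
qed

section \<open>Restriction to subgroups and quotient graphs\<close>

lemma (in tree_act) tree_act_subgroup:
  assumes M: "subgroup M G"
  shows "tree_act V E (subgrp G M) act"
proof -
  have Mc: "M \<subseteq> carrier G" using M by (rule subgroup.subset)
  interpret M: group "subgrp G M" using M by (rule subgroup_imp_group)
  show ?thesis
    by unfold_locales (use Mc act_one act_mult act_closed act_E no_inversion in \<open>simp_all add: subset_iff\<close>)
qed

lemma (in tree_act) stabilizer_subgrp_Int: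
  assumes "M \<subseteq> carrier G"
  shows "stabilizer (subgrp G M) act x = M \<inter> stab x"
  using assms by (auto simp: stabilizer_def)

locale split_act =
  fixes H :: "'g monoid" and X :: "'v pair_pre_digraph" and \<alpha>
  assumes splitting: "splitting H X \<alpha>"
begin

sublocale tree_act "pverts X" "parcs X" H \<alpha>
  using splitting by (rule splitting_imp_tree_act)

abbreviation orb where "orb \<equiv> Group_Action.orbit H \<alpha>"

definition oarc :: "'v \<Rightarrow> 'v \<Rightarrow> 'v rel" where
  "oarc x y = {(\<alpha> g x, \<alpha> g y) | g. g \<in> carrier H}"

lemma Domain_oarc: "Domain (oarc x y) = orb x" and Range_oarc: "Range (oarc x y) = orb y"
  and converse_oarc: "converse (oarc x y) = oarc y x"
  by (auto simp: oarc_def Group_Action.orbit_def)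

lemma oarc_self: "x \<in> pverts X \<Longrightarrow> y \<in> pverts X \<Longrightarrow> (x, y) \<in> oarc x y"
  unfolding oarc_def using act_one[of x] act_one[of y] by force

abbreviation base where "base \<equiv> SOME Q. Q \<in> orbits H (pverts X) \<alpha>"

lemma orbitsI: "x \<in> pverts X \<Longrightarrow> orb x \<in> orbits H (pverts X) \<alpha>"
  by (auto simp: orbits_def)

lemma base_orbit: "base \<in> orbits H (pverts X) \<alpha>"
proof -
  obtain x where "x \<in> pverts X" using V_nonempty by blast
  then have "orb x \<in> orbits H (pverts X) \<alpha>" by (rule orbitsI)
  then show ?thesis by (rule someI)
qed

lemma arcs_quotient: "arcs (quotient_graph H X \<alpha>) = (\<lambda>(x, y). oarc x y) ` parcs X"
  by (simp add: quotient_graph_def oarc_def)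

lemma verts_quotient: "verts (quotient_graph H X \<alpha>) = orbits H (pverts X) \<alpha>"
  and tail_quotient: "tail (quotient_graph H X \<alpha>) = Domain"
  and head_quotient: "head (quotient_graph H X \<alpha>) = Range"
  by (simp_all add: quotient_graph_def)

lemma arcs_quotientE:
  assumes "a \<in> arcs (quotient_graph H X \<alpha>)"
  obtains x y where "a = oarc x y" "(x, y) \<in> parcs X" "x \<in> pverts X" "y \<in> pverts X"
  using assms E_in_V unfolding arcs_quotient by force

sublocale Q: plain_graph "quotient_graph H X \<alpha>" converse base
proof
  fix a assume "a \<in> arcs (quotient_graph H X \<alpha>)"
  then obtain x y where a: "a = oarc x y" "(x, y) \<in> parcs X" "x \<in> pverts X" "y \<in> pverts X"
    by (rule arcs_quotientE)
  show "tail (quotient_graph H X \<alpha>) a \<in> verts (quotient_graph H X \<alpha>)"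
    "head (quotient_graph H X \<alpha>) a \<in> verts (quotient_graph H X \<alpha>)"
    using a orbitsI by (simp_all add: verts_quotient tail_quotient head_quotient Domain_oarc Range_oarc)
  have "(y, x) \<in> parcs X" using a(2) by (rule E_symD)
  then show "converse a \<in> arcs (quotient_graph H X \<alpha>)"
    unfolding a(1) converse_oarc arcs_quotient by force
  show "tail (quotient_graph H X \<alpha>) (converse a) = head (quotient_graph H X \<alpha>) a"
    by (simp add: tail_quotient head_quotient)
qed (use base_orbit in \<open>auto simp: verts_quotient\<close>)

lemma quotient_connected:
  assumes "z \<in> orbits H (pverts X) \<alpha>"
  shows "\<exists>p. Q.awalk base p z"
proof -
  obtain x y where xy: "x \<in> pverts X" "base = orb x" "y \<in> pverts X" "z = orb y"
    using assms base_orbit unfolding orbits_def by blast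
  have "(x, y) \<in> (parcs X)\<^sup>*" using connected xy by blast
  then have "\<exists>p. Q.awalk (orb x) p (orb y)"
  proof (induction rule: rtrancl_induct)
    case base
    have "Q.awalk (orb x) [] (orb x)" using orbitsI[OF xy(1)] by (simp add: Q.awalk_Nil verts_quotient)
    then show ?case ..
  next
    case (step u v)
    then obtain p where p: "Q.awalk (orb x) p (orb u)" by blast
    have uv: "u \<in> pverts X" "v \<in> pverts X" using step(2) E_in_V by auto
    have "oarc u v \<in> arcs (quotient_graph H X \<alpha>)" unfolding arcs_quotient using step(2) by force
    then have "Q.awalk (orb u) [oarc u v] (orb v)"
      using orbitsI uv by (simp add: Q.awalk_Cons Q.awalk_Nil verts_quotient tail_quotient head_quotient Domain_oarc Range_oarc)
    then have "Q.awalk (orb x) (p @ [oarc u v]) (orb v)" using p Q.awalk_app by blast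
    then show ?case ..
  qed
  then show ?thesis using xy by simp
qed

lemma quotient_rank_ge:
  assumes "finite (orbits H (pverts X) \<alpha>)"
    and "finite B" "B \<subseteq> arcs (quotient_graph H X \<alpha>)" "\<And>a. a \<in> B \<Longrightarrow> converse a \<notin> B"
  shows "of_nat (card B) \<le> quotient_rank H X \<alpha> + of_nat (card (orbits H (pverts X) \<alpha>))"
  using Q.rank_ge[OF _ _ assms(2-4)] quotient_connected assms(1)
  by (simp add: quotient_rank_def verts_quotient)

end

section \<open>The tree of a free splitting\<close>

locale hnn = grp G for G :: "'g monoid" (structure) +
  fixes A :: "'g set" and t :: 'g and P :: "'g set"
  assumes free_hnn: "free_hnn G A t P"
begin

lemma A: "subgroup A G" and tc: "t \<in> carrier G" and gen: "generate G (insert t A) = carrier G"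
  and Pc: "P \<subseteq> carrier G" and PA: "g \<in> P \<Longrightarrow> a \<in> A \<Longrightarrow> g \<otimes> a \<in> P" and oneP: "\<one> \<notin> P" and tP: "t \<in> P"
  and Pt: "g \<in> carrier G \<Longrightarrow> g \<noteq> \<one> \<Longrightarrow> g \<in> P \<longleftrightarrow> g \<otimes> t \<in> P"
  using free_hnn unfolding free_hnn_def by auto

lemma Ac: "A \<subseteq> carrier G"
  using A by (rule subgroup.subset)

lemma A_carrier: "a \<in> A \<Longrightarrow> a \<in> carrier G"
  using Ac by blast

lemma PA_iff:
  assumes "g \<in> carrier G" "a \<in> A"
  shows "g \<otimes> a \<in> P \<longleftrightarrow> g \<in> P"
proof
  assume "g \<otimes> a \<in> P"
  then have "g \<otimes> a \<otimes> inv a \<in> P" using subgroup.m_inv_closed[OF A assms(2)] by (rule PA)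
  then show "g \<in> P" using assms A_carrier[OF assms(2)] by (simp add: m_assoc)
qed (use PA assms in blast)

lemma A_not_P: "a \<in> A \<Longrightarrow> a \<notin> P"
  using PA_iff[of \<one> a] oneP A_carrier by simp

definition co :: "'g \<Rightarrow> 'g set" where
  "co g = g <# A"

lemma co_iff: "x \<in> co g \<longleftrightarrow> (\<exists>a\<in>A. x = g \<otimes> a)"
  by (auto simp: co_def l_coset_def)

lemma co_eq_iff:
  assumes "g \<in> carrier G" "h \<in> carrier G"
  shows "co g = co h \<longleftrightarrow> inv g \<otimes> h \<in> A"
proof
  assume "co g = co h"
  moreover have "h \<in> co h" unfolding co_iff using subgroup.one_closed[OF A] assms by (intro bexI[of _ \<one>]) simp_all
  ultimately have "h \<in> co g" by simp
  then obtain a where "a \<in> A" "h = g \<otimes> a" by (auto simp: co_iff)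
  then show "inv g \<otimes> h \<in> A" using assms A_carrier[of a] by (simp add: m_assoc[symmetric])
next
  assume a: "inv g \<otimes> h \<in> A"
  have h: "h = g \<otimes> (inv g \<otimes> h)" using assms by (simp add: m_assoc[symmetric])
  show "co g = co h"
  proof (rule equalityI; rule subsetI)
    fix x assume "x \<in> co g"
    then obtain b where b: "b \<in> A" "x = g \<otimes> b" by (auto simp: co_iff)
    have "inv (inv g \<otimes> h) \<otimes> b \<in> A" using a b A by (simp add: subgroup.m_closed subgroup.m_inv_closed)
    moreover have "x = h \<otimes> (inv (inv g \<otimes> h) \<otimes> b)"
    proof -
      have "h \<otimes> (inv h \<otimes> (g \<otimes> b)) = g \<otimes> b"
        using assms A_carrier[OF b(1)] by (simp add: m_assoc[symmetric])
      then show ?thesis using assms A_carrier[OF b(1)] b(2) by (simp add: inv_mult_group m_assoc)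
    qed
    ultimately show "x \<in> co h" by (auto simp: co_iff)
  next
    fix x assume "x \<in> co h"
    then obtain b where b: "b \<in> A" "x = h \<otimes> b" by (auto simp: co_iff)
    have "inv g \<otimes> h \<otimes> b \<in> A" using a b A by (simp add: subgroup.m_closed)
    moreover have "x = g \<otimes> (inv g \<otimes> h \<otimes> b)"
      using assms A_carrier[OF b(1)] b(2) by (simp add: m_assoc[symmetric])
    ultimately show "x \<in> co g" by (auto simp: co_iff)
  qed
qed

definition VT :: "'g set set" where
  "VT = co ` carrier G"

text \<open>Bass-Serre tree of an HNN extension of \<open>A\<close> along the trivial subgroup: the
  vertices form a single orbit, and the group element \<open>g\<close> labels the edge from
  \<open>co g\<close> to \<open>co (g \<otimes> t)\<close>.\<close>

definition ET :: "'g set rel" where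
  "ET = (\<Union>g\<in>carrier G. {(co g, co (g \<otimes> t)), (co (g \<otimes> t), co g)})"

definition actT :: "'g \<Rightarrow> 'g set \<Rightarrow> 'g set" where
  "actT h C = (\<lambda>x. h \<otimes> x) ` C"

lemma actT_co: "h \<in> carrier G \<Longrightarrow> g \<in> carrier G \<Longrightarrow> actT h (co g) = co (h \<otimes> g)"
  unfolding actT_def co_def l_coset_def using A_carrier by (auto simp: m_assoc image_iff)

lemma ETI: "g \<in> carrier G \<Longrightarrow> (co g, co (g \<otimes> t)) \<in> ET" "g \<in> carrier G \<Longrightarrow> (co (g \<otimes> t), co g) \<in> ET"
  by (auto simp: ET_def)

lemma ETE:
  assumes "(x, y) \<in> ET"
  obtains g where "g \<in> carrier G" "x = co g" "y = co (g \<otimes> t)"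
  | g where "g \<in> carrier G" "x = co (g \<otimes> t)" "y = co g"
  using assms by (auto simp: ET_def)

text \<open>Because \<open>P\<close> is invariant under \<open>A\<close> on the right, its
  translates are unions of cosets and can be regarded as sets of vertices.\<close>

lemma inP_co:
  assumes "g \<in> carrier G" "k \<in> carrier G"
  shows "(\<exists>x\<in>co k. inv g \<otimes> x \<in> P) \<longleftrightarrow> inv g \<otimes> k \<in> P"
proof -
  have *: "inv g \<otimes> (k \<otimes> a) \<in> P \<longleftrightarrow> inv g \<otimes> k \<in> P" if "a \<in> A" for a
    using PA_iff[of "inv g \<otimes> k" a] that assms A_carrier[OF that] by (simp add: m_assoc)
  show ?thesis
  proof
    assume "\<exists>x\<in>co k. inv g \<otimes> x \<in> P"
    then obtain x where "x \<in> co k" "inv g \<otimes> x \<in> P" ..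
    then obtain a where "a \<in> A" "inv g \<otimes> (k \<otimes> a) \<in> P" unfolding co_iff by auto
    then show "inv g \<otimes> k \<in> P" using * by simp
  next
    assume "inv g \<otimes> k \<in> P"
    then have "inv g \<otimes> (k \<otimes> \<one>) \<in> P" using assms by simp
    moreover have "k \<otimes> \<one> \<in> co k" unfolding co_iff using subgroup.one_closed[OF A] by (rule bexI[rotated]) simp
    ultimately show "\<exists>x\<in>co k. inv g \<otimes> x \<in> P" ..
  qed
qed

lemma step_co: "g \<in> generate G (insert t A) \<Longrightarrow> h \<in> carrier G \<Longrightarrow> (co h, co (h \<otimes> g)) \<in> ET\<^sup>*"
proof (induction arbitrary: h rule: generate.induct)
  case one
  then show ?case by simp
next
  case (incl s)
  show ?case
  proof (cases "s = t")
    case True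
    then show ?thesis using ETI(1)[OF incl(2)] by blast
  next
    case False
    then have "s \<in> A" using incl(1) by simp
    then have "co h = co (h \<otimes> s)" using incl(2) A_carrier by (simp add: co_eq_iff m_assoc[symmetric])
    then show ?thesis by simp
  qed
next
  case (inv s)
  show ?case
  proof (cases "s = t")
    case True
    have "(co (h \<otimes> inv t \<otimes> t), co (h \<otimes> inv t)) \<in> ET" using inv(2) tc by (intro ETI(2)) simp
    then show ?thesis using True inv(2) tc by (simp add: m_assoc)
  next
    case False
    then have s: "s \<in> A" "inv s \<in> A" using inv(1) subgroup.m_inv_closed[OF A] by auto
    then have "co h = co (h \<otimes> inv s)" using inv(2) A_carrier by (simp add: co_eq_iff m_assoc[symmetric])
    then show ?thesis by simp
  qed
next
  case (eng g1 g2)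
  have c: "g1 \<in> carrier G" "g2 \<in> carrier G" using eng(1,2) unfolding gen by auto
  have "(co h, co (h \<otimes> g1)) \<in> ET\<^sup>*" "(co (h \<otimes> g1), co (h \<otimes> g1 \<otimes> g2)) \<in> ET\<^sup>*"
    using eng c by auto
  then show ?case using c eng(5) rtrancl_trans[of "co h" "co (h \<otimes> g1)" ET "co (h \<otimes> g1 \<otimes> g2)"]
    by (simp add: m_assoc)
qed

text \<open>Multiplication by \<open>t\<close> on the right changes membership in \<open>P\<close>
  only at \<open>\<one>\<close>, so the translate of the half-space by \<open>g\<close> is crossed
  by no edge except the one labelled \<open>g\<close>. This is what makes that edge a
  bridge.\<close>

lemma separation:
  assumes g: "g \<in> carrier G" and xy: "(x, y) \<in> ET - {(co g, co (g \<otimes> t)), (co (g \<otimes> t), co g)}"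
  shows "(\<exists>z\<in>x. inv g \<otimes> z \<in> P) \<longleftrightarrow> (\<exists>z\<in>y. inv g \<otimes> z \<in> P)"
proof -
  have "(\<exists>z\<in>co k. inv g \<otimes> z \<in> P) \<longleftrightarrow> (\<exists>z\<in>co (k \<otimes> t). inv g \<otimes> z \<in> P)"
    if k: "k \<in> carrier G" "k \<noteq> g" for k
  proof -
    have "inv g \<otimes> k \<noteq> \<one>" using k g by (metis inv_closed inv_equality inv_inv)
    then show ?thesis using Pt[of "inv g \<otimes> k"] k g tc inP_co by (simp add: m_assoc)
  qed
  moreover have "(x, y) \<in> ET" using xy by blast
  ultimately show ?thesis using xy by (cases rule: ETE[OF \<open>(x, y) \<in> ET\<close>]) (metis DiffE insertCI)+
qed

lemma bridge_aux:
  assumes g: "g \<in> carrier G"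
  shows "(co g, co (g \<otimes> t)) \<notin> (ET - {(co g, co (g \<otimes> t)), (co (g \<otimes> t), co g)})\<^sup>*"
proof
  assume "(co g, co (g \<otimes> t)) \<in> (ET - {(co g, co (g \<otimes> t)), (co (g \<otimes> t), co g)})\<^sup>*"
  then have "(\<exists>z\<in>co g. inv g \<otimes> z \<in> P) \<longleftrightarrow> (\<exists>z\<in>co (g \<otimes> t). inv g \<otimes> z \<in> P)"
  proof (induction rule: rtrancl_induct)
    case (step y z)
    then show ?case using separation[OF g step(2)] by simp
  qed simp
  then show False using g tc oneP tP by (simp add: inP_co m_assoc[symmetric])
qed

text \<open>After conjugation by \<open>g\<close>, an inverting element \<open>k\<close> lies in
  \<open>t A\<close>, hence in \<open>P\<close>, and so does \<open>k \<otimes> t\<close>. But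
  inversion also puts \<open>k \<otimes> t\<close> into \<open>A\<close>, which is disjoint from
  \<open>P\<close>.\<close>

lemma no_inversion_T:
  assumes h: "h \<in> carrier G" and g: "g \<in> carrier G"
  shows "\<not> (co (h \<otimes> g) = co (g \<otimes> t) \<and> co (h \<otimes> (g \<otimes> t)) = co g)"
proof
  assume a: "co (h \<otimes> g) = co (g \<otimes> t) \<and> co (h \<otimes> (g \<otimes> t)) = co g"
  define k where "k = inv g \<otimes> h \<otimes> g"
  have k: "k \<in> carrier G" using h g by (simp add: k_def)
  have "inv (g \<otimes> t) \<otimes> (h \<otimes> g) \<in> A" using a co_eq_iff[of "g \<otimes> t" "h \<otimes> g"] h g tc by simp
  then have ka: "inv t \<otimes> k \<in> A" using h g tc by (simp add: k_def inv_mult_group m_assoc)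
  have "k = t \<otimes> (inv t \<otimes> k)" using k tc by (simp add: m_assoc[symmetric])
  then have kP: "k \<in> P" using PA[OF tP ka] by simp
  have "inv g \<otimes> (h \<otimes> (g \<otimes> t)) \<in> A" using a co_eq_iff[of g "h \<otimes> (g \<otimes> t)"] h g tc by simp
  then have "k \<otimes> t \<in> A" using h g tc by (simp add: k_def m_assoc)
  moreover have "k \<otimes> t \<in> P" using Pt[OF k] kP oneP by blast
  ultimately show False using A_not_P by blast
qed

sublocale T: tree_act VT ET G actT
proof
  show "VT \<noteq> {}" by (auto simp: VT_def)
  show "ET \<subseteq> VT \<times> VT" using tc by (auto simp: VT_def ET_def)
  show symET: "sym ET" by (auto simp: sym_def ET_def)
  have tA: "t \<notin> A" using A_not_P tP by blast
  show "(x, x) \<notin> ET" for x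
  proof
    assume "(x, x) \<in> ET"
    then obtain g where "g \<in> carrier G" "co g = co (g \<otimes> t)" by (cases rule: ETE) auto
    then show False using tA tc by (simp add: co_eq_iff m_assoc[symmetric])
  qed
  show "(x, y) \<in> ET\<^sup>*" if xy: "x \<in> VT" "y \<in> VT" for x y
  proof -
    obtain g h where gh: "g \<in> carrier G" "x = co g" "h \<in> carrier G" "y = co h" using xy by (auto simp: VT_def)
    have "inv g \<otimes> h \<in> generate G (insert t A)" unfolding gen using gh by simp
    from step_co[OF this gh(1)] show ?thesis using gh by (simp add: m_assoc[symmetric])
  qed
  show "(x, y) \<notin> (ET - {(x, y), (y, x)})\<^sup>*" if "(x, y) \<in> ET" for x y
    using that
  proof (cases rule: ETE)
    case (1 g)
    then show ?thesis using bridge_aux by simp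
  next
    case (2 g)
    have "sym (ET - {(x, y), (y, x)})" using symET unfolding sym_def by blast
    then have "sym ((ET - {(x, y), (y, x)})\<^sup>*)" by (rule sym_rtrancl)
    moreover have "(y, x) \<notin> (ET - {(x, y), (y, x)})\<^sup>*"
      using bridge_aux[OF 2(1)] 2 by (simp add: insert_commute)
    ultimately show ?thesis by (meson symD)
  qed
  show "actT \<one> x = x" if "x \<in> VT" for x
    using that by (auto simp: VT_def actT_co)
  show "actT (g \<otimes> h) x = actT g (actT h x)" if "g \<in> carrier G" "h \<in> carrier G" "x \<in> VT" for g h x
    using that by (auto simp: VT_def actT_co m_assoc)
  show "actT g x \<in> VT" if "g \<in> carrier G" "x \<in> VT" for g x
    using that by (auto simp: VT_def actT_co)
  show "(actT g x, actT g y) \<in> ET" if g: "g \<in> carrier G" and xy: "(x, y) \<in> ET" for g x y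
    using xy
  proof (cases rule: ETE)
    case (1 k)
    then show ?thesis using ETI(1)[of "g \<otimes> k"] g tc by (simp add: actT_co m_assoc)
  next
    case (2 k)
    then show ?thesis using ETI(2)[of "g \<otimes> k"] g tc by (simp add: actT_co m_assoc)
  qed
  show "\<not> (actT g x = y \<and> actT g y = x)" if g: "g \<in> carrier G" and xy: "(x, y) \<in> ET" for g x y
    using xy
  proof (cases rule: ETE)
    case (1 k)
    then show ?thesis using no_inversion_T[OF g 1(1)] g tc by (simp add: actT_co)
  next
    case (2 k)
    then show ?thesis using no_inversion_T[OF g 2(1)] g tc by (simp add: actT_co) blast
  qed
qed

text \<open>After conjugation by \<open>g\<close>, an element \<open>k\<close> fixing both ends lies
  in \<open>A\<close>, outside \<open>P\<close>, while \<open>k \<otimes> t\<close> lies in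
  \<open>t A\<close>, inside \<open>P\<close>. Such a change of membership happens at
  \<open>\<one>\<close> only.\<close>

lemma edge_stab_trivial:
  assumes g: "g \<in> carrier G" and h: "h \<in> T.stab (co g)" "h \<in> T.stab (co (g \<otimes> t))"
  shows "h = \<one>"
proof -
  have hc: "h \<in> carrier G" using h by (simp add: T.stab_iff)
  define k where "k = inv g \<otimes> h \<otimes> g"
  have k: "k \<in> carrier G" using hc g by (simp add: k_def)
  have "co g = co (h \<otimes> g)" using h hc g by (simp add: T.stab_iff actT_co)
  then have kA: "k \<in> A" using co_eq_iff[of g "h \<otimes> g"] hc g by (simp add: k_def m_assoc)
  have "co (g \<otimes> t) = co (h \<otimes> (g \<otimes> t))" using h hc g tc by (simp add: T.stab_iff actT_co)
  then have "inv (g \<otimes> t) \<otimes> (h \<otimes> (g \<otimes> t)) \<in> A" using co_eq_iff[of "g \<otimes> t" "h \<otimes> (g \<otimes> t)"] hc g tc by simp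
  then have kt: "inv t \<otimes> (k \<otimes> t) \<in> A" using hc g tc by (simp add: k_def inv_mult_group m_assoc)
  have "k \<otimes> t = t \<otimes> (inv t \<otimes> (k \<otimes> t))" using k tc by (simp add: m_assoc[symmetric])
  then have "k \<otimes> t \<in> P" using PA[OF tP kt] by simp
  then have "k = \<one>" using Pt[OF k] A_not_P[OF kA] by blast
  then have "h \<otimes> g = g" using hc g unfolding k_def by (metis inv_closed inv_inv inv_solve_left' l_one m_assoc m_closed r_inv)
  then show ?thesis using hc g by (simp add: r_cancel_one)
qed

lemma edge_stabs:
  assumes "(x, y) \<in> ET" "h \<in> T.stab x" "h \<in> T.stab y"
  shows "h = \<one>"
  using assms(1) by (cases rule: ETE) (use assms edge_stab_trivial in auto)

lemma conj_in_stab: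
  assumes "g \<in> carrier G" "a \<in> A"
  shows "g \<otimes> a \<otimes> inv g \<in> T.stab (co g)"
proof -
  have c: "a \<in> carrier G" using assms A_carrier by blast
  have "co (g \<otimes> a \<otimes> inv g \<otimes> g) = co g"
    using assms c subgroup.m_inv_closed[OF A assms(2)] by (simp add: m_assoc co_eq_iff inv_mult_group)
  then show ?thesis using assms c by (simp add: T.stab_iff actT_co)
qed

lemma infinite_stab:
  assumes inf: "infinite A" and x: "x \<in> VT"
  shows "infinite (T.stab x)"
proof
  assume fin: "finite (T.stab x)"
  obtain g where g: "g \<in> carrier G" "x = co g" using x by (auto simp: VT_def)
  have "inj_on (\<lambda>a. g \<otimes> a \<otimes> inv g) A"
    by (rule inj_onI) (use g A_carrier in simp)
  moreover have "(\<lambda>a. g \<otimes> a \<otimes> inv g) ` A \<subseteq> T.stab x" using conj_in_stab g by auto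
  ultimately show False using fin inf by (meson finite_imageD finite_subset)
qed

lemma C_max_fin_ge:
  assumes inf: "infinite A" and fg: "finitely_generated G"
    and M: "subgroup M G" "finite (rcosets M)"
  shows "of_nat (index G M) \<le> C_max_fin (subgrp G M)"
proof -
  let ?M = "subgrp G M"
  have Mc: "M \<subseteq> carrier G" using M(1) by (rule subgroup.subset)
  interpret TM: tree_act VT ET ?M actT by (rule T.tree_act_subgroup[OF M(1)])
  have "countable VT" unfolding VT_def using fg_countable[OF fg] by (rule countable_image)
  then obtain X :: "nat pair_pre_digraph" and \<alpha> f where X: "splitting ?M X \<alpha>" "bij_betw f VT (pverts X)"
    "parcs X = (\<lambda>(x, y). (f x, f y)) ` ET"
    "\<And>g x. x \<in> VT \<Longrightarrow> g \<in> carrier ?M \<Longrightarrow> \<alpha> g (f x) = f (actT g x)"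
    by (rule TM.countable_splitting) blast
  have pv: "pverts X = f ` VT" and inj: "inj_on f VT" using X(2) by (auto simp: bij_betw_def)
  have stabX: "stabilizer ?M \<alpha> (f x) = M \<inter> T.stab x" if "x \<in> VT" for x
  proof -
    have "\<alpha> g (f x) = f x \<longleftrightarrow> actT g x = x" if "g \<in> M" for g
      using X(4)[OF \<open>x \<in> VT\<close>, of g] that TM.act_closed[of g x] \<open>x \<in> VT\<close> inj by (simp add: inj_on_eq_iff)
    then show ?thesis using Mc by (auto simp: stabilizer_def)
  qed
  have inf_stab: "infinite (stabilizer ?M \<alpha> w)" if "w \<in> pverts X" for w
  proof -
    obtain x where x: "x \<in> VT" "w = f x" using \<open>w \<in> pverts X\<close> unfolding pv by blast
    show ?thesis unfolding x(2) stabX[OF x(1)]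
      by (rule infinite_Int[OF M T.stab_subgroup[OF x(1)] infinite_stab[OF inf x(1)]])
  qed
  have edge: "stabilizer ?M \<alpha> w \<inter> stabilizer ?M \<alpha> y \<subseteq> {\<one>}" if "(w, y) \<in> parcs X" for w y
  proof -
    obtain a b where ab: "(a, b) \<in> ET" "w = f a" "y = f b" using \<open>(w, y) \<in> parcs X\<close> unfolding X(3) by auto
    then show ?thesis using stabX T.E_in_V[OF ab(1)] edge_stabs[OF ab(1)] by auto
  qed
  have branch: "\<not> stabilizer ?M \<alpha> w \<subseteq> stabilizer ?M \<alpha> y" if "w \<in> pverts X" "(w, y) \<in> parcs X" for w y
  proof
    assume "stabilizer ?M \<alpha> w \<subseteq> stabilizer ?M \<alpha> y"
    then have "stabilizer ?M \<alpha> w \<subseteq> {\<one>}" using edge[OF that(2)] by blast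
    then show False using inf_stab[OF that(1)] by (meson finite.emptyI finite_insert finite_subset)
  qed
  interpret S: split_act ?M X \<alpha> by unfold_locales (rule X(1))
  have one: "co \<one> \<in> VT" "co t \<in> VT" "co \<one> \<noteq> co t"
    using tc A_not_P tP by (auto simp: VT_def co_eq_iff)
  interpret B: branching_splitting ?M X \<alpha> "pverts X"
  proof
    show "\<exists>w\<in>pverts X. \<exists>w'\<in>pverts X. w \<noteq> w'"
    proof (intro bexI)
      show "f (co \<one>) \<noteq> f (co t)" using one inj by (simp add: inj_on_eq_iff)
    qed (use one pv in auto)
  qed (use X(1) branch S.act_closed in auto)
  \<comment> \<open>Vertex stabilizers are infinite and edge stabilizers trivial, so all vertices
    could be taken into the branching set; hence the tree is minimal.\<close>
  have Mv: "B.M = pverts X" using B.W_minimal B.M_subset by blast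
  have sub: "sub_graph X (pverts X) = X"
    using S.E_subset by (cases X) (auto simp: sub_graph_def)
  \<comment> \<open>For elements of the group the action already consists of functions undefined off
    the tree, so the restriction to the minimal subtree, here the whole tree, changes neither orbits
    nor arcs.\<close>
  have ext: "restrict (\<alpha> g) (pverts X) = \<alpha> g" if "g \<in> carrier ?M" for g
  proof -
    have "group_action ?M (pverts X) \<alpha>" using X(1) by (simp add: splitting_def)
    then have "\<alpha> g \<in> Bij (pverts X)" using that by (rule group_action.bij_prop0)
    then have "\<alpha> g \<in> extensional (pverts X)" by (simp add: Bij_def)
    then show ?thesis by (rule extensional_restrict)
  qed
  have qr: "quotient_rank ?M (sub_graph X B.M) (\<lambda>g. restrict (\<alpha> g) B.M) = quotient_rank ?M X \<alpha>"
  proof -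
    let ?r = "\<lambda>g. restrict (\<alpha> g) (pverts X)"
    have rx: "\<alpha> g x = ?r g x" if "g \<in> M" for g x using ext[of g] that by (simp del: restrict_apply)
    have oe: "Group_Action.orbit ?M ?r x = Group_Action.orbit ?M \<alpha> x" for x
      by (auto simp: Group_Action.orbit_def ext simp del: restrict_apply) (metis rx)
    have orbits_eq: "orbits ?M (pverts X) ?r = orbits ?M (pverts X) \<alpha>"
      unfolding orbits_def oe ..
    have arcs_eq: "{(?r g x, ?r g y) | g. g \<in> carrier ?M} = {(\<alpha> g x, \<alpha> g y) | g. g \<in> carrier ?M}" for x y
      by (auto simp: ext simp del: restrict_apply) (metis rx)
    have "quotient_graph ?M X ?r = quotient_graph ?M X \<alpha>"
      unfolding quotient_graph_def orbits_eq arcs_eq ..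
    then show ?thesis unfolding Mv sub quotient_rank_def orbits_eq by simp
  qed
  let ?O = "orbits ?M (pverts X) \<alpha>"
  have O: "?O = Group_Action.orbit ?M \<alpha> ` pverts X" by (auto simp: orbits_def)
  have bound: "quotient_rank ?M X \<alpha> + of_nat (card F) \<le> weighted_complexity ?M (\<lambda>_. 0) X \<alpha>"
    if "finite F" "F \<subseteq> ?O" for F
  proof -
    have "F \<subseteq> Group_Action.orbit ?M \<alpha> ` pverts X" using that(2) unfolding O .
    from B.sum_le_weighted_complexity[OF that(1) this, of "\<lambda>_. 0"] show ?thesis unfolding qr by simp
  qed
  have "of_nat (index G M) \<le> weighted_complexity ?M (\<lambda>_. 0) X \<alpha>"
  proof (cases "finite ?O")
    \<comment> \<open>The rank is estimated for finitely many orbits of vertices only. With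
      infinitely many, the vertices alone already reach the index.\<close>
    case False
    then obtain F where F: "F \<subseteq> ?O" "finite F" "card F = index G M" using infinite_arbitrarily_large by blast
    have "of_nat (index G M) \<le> quotient_rank ?M X \<alpha> + of_nat (card F)"
      unfolding \<open>card F = index G M\<close> by (simp add: add_increasing)
    also have "\<dots> \<le> weighted_complexity ?M (\<lambda>_. 0) X \<alpha>" using \<open>finite F\<close> \<open>F \<subseteq> ?O\<close> by (rule bound)
    finally show ?thesis .
  next
    case True
    define r where "r C = (SOME k. k \<in> carrier G \<and> C = M #> k)" for C
    have r: "r C \<in> carrier G" "C = M #> r C" if "C \<in> rcosets M" for C
    proof -
      have "\<exists>k. k \<in> carrier G \<and> C = M #> k" using that by (auto simp: rcosets_image)
      from someI_ex[OF this] show "r C \<in> carrier G" "C = M #> r C" by (auto simp: r_def)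
    qed
    define arc where "arc k = S.oarc (f (co k)) (f (co (k \<otimes> t)))" for k
    have arc_eq: "(f (co k'), f (co k'')) \<in> S.oarc (f (co k)) (f (co (k \<otimes> t))) \<longleftrightarrow>
        (\<exists>m\<in>M. co k' = co (m \<otimes> k) \<and> co k'' = co (m \<otimes> (k \<otimes> t)))"
      if "k \<in> carrier G" "k' \<in> carrier G" "k'' \<in> carrier G" for k k' k''
    proof -
      have "\<alpha> m (f (co k)) = f (co (m \<otimes> k))" "\<alpha> m (f (co (k \<otimes> t))) = f (co (m \<otimes> (k \<otimes> t)))" if "m \<in> M" for m
        using that \<open>k \<in> carrier G\<close> tc Mc X(4)[of "co k" m] X(4)[of "co (k \<otimes> t)" m] by (auto simp: VT_def actT_co)
      moreover have "f (co p) = f (co q) \<longleftrightarrow> co p = co q" if "p \<in> carrier G" "q \<in> carrier G" for p q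
        using inj that by (simp add: inj_on_eq_iff VT_def)
      ultimately show ?thesis using that tc Mc unfolding S.oarc_def by (auto simp: subset_iff) (metis m_closed)+
    qed
    have V: "f (co k) \<in> pverts X" if "k \<in> carrier G" for k using that pv by (auto simp: VT_def)
    \<comment> \<open>The orientation of edges given by \<open>t\<close> is respected by the group.
      So no orbit of positively oriented edges is the reverse of another, and counting one
      orientation is legitimate.\<close>
    have conv: "converse (arc k) \<noteq> arc k'" if k: "k \<in> carrier G" "k' \<in> carrier G" for k k'
    proof
      assume "converse (arc k) = arc k'"
      moreover have "(f (co (k \<otimes> t)), f (co k)) \<in> converse (arc k)"
        using S.oarc_self[OF V V, of k "k \<otimes> t"] k tc by (simp add: arc_def)
      ultimately obtain m where m: "m \<in> M" "co (k \<otimes> t) = co (m \<otimes> k')" "co k = co (m \<otimes> (k' \<otimes> t))"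
        using arc_eq[of k' "k \<otimes> t" k] k tc unfolding arc_def by auto
      define h where "h = m \<otimes> k' \<otimes> inv k"
      have hk: "h \<in> carrier G" "h \<otimes> k = m \<otimes> k'" "h \<otimes> (k \<otimes> t) = m \<otimes> (k' \<otimes> t)"
        using m(1) k Mc tc by (auto simp: h_def m_assoc subset_iff) (simp_all add: m_assoc[symmetric])
      show False using no_inversion_T[OF hk(1) k(1)] m hk by simp
    qed
    \<comment> \<open>As edge stabilizers are trivial, orbits of edges under \<open>M\<close>
      correspond to cosets of \<open>M\<close>; this is the count of \<open>index G M\<close> edges
      in the quotient.\<close>
    have inj_arc: "M #> k = M #> k'" if k: "k \<in> carrier G" "k' \<in> carrier G" and eq: "arc k = arc k'" for k k'
    proof -
      have "(f (co k), f (co (k \<otimes> t))) \<in> arc k'"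
        using S.oarc_self[OF V V, of k "k \<otimes> t"] k tc eq by (simp add: arc_def)
      then obtain m where m: "m \<in> M" "co k = co (m \<otimes> k')" "co (k \<otimes> t) = co (m \<otimes> (k' \<otimes> t))"
        using arc_eq[of k' k "k \<otimes> t"] k tc unfolding arc_def by auto
      have mc: "m \<in> carrier G" using m Mc by blast
      define h where "h = m \<otimes> k' \<otimes> inv k"
      have hk: "h \<in> carrier G" "h \<otimes> k = m \<otimes> k'" "h \<otimes> (k \<otimes> t) = m \<otimes> (k' \<otimes> t)"
        using mc k tc by (auto simp: h_def m_assoc) (simp_all add: m_assoc[symmetric])
      have "actT h (co k) = co k" using actT_co[OF hk(1) k(1)] hk(2) m(2) by simp
      moreover have "actT h (co (k \<otimes> t)) = co (k \<otimes> t)"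
        using actT_co[OF hk(1), of "k \<otimes> t"] hk(3) m(3) k tc by simp
      ultimately have "h \<in> T.stab (co k)" "h \<in> T.stab (co (k \<otimes> t))"
        using hk(1) by (simp_all add: T.stab_iff)
      then have "h = \<one>" using edge_stab_trivial k by blast
      then have "k = m \<otimes> k'" using hk k by simp
      then have "k \<otimes> inv k' = m" using mc k by (simp add: m_assoc)
      then show ?thesis using rcos_eq_iff[OF M(1) k] m by simp
    qed
    define B where "B = (\<lambda>C. arc (r C)) ` (rcosets M)"
    have "inj_on (\<lambda>C. arc (r C)) (rcosets M)"
    proof (rule inj_onI)
      fix C D assume "C \<in> rcosets M" "D \<in> rcosets M" "arc (r C) = arc (r D)"
      then have "M #> r C = M #> r D" using inj_arc r by blast
      then show "C = D" using r(2) \<open>C \<in> rcosets M\<close> \<open>D \<in> rcosets M\<close> by metis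
    qed
    then have cardB: "card B = index G M" unfolding B_def index_def by (rule card_image)
    have "of_nat (card B) \<le> quotient_rank ?M X \<alpha> + of_nat (card ?O)"
    proof (rule S.quotient_rank_ge[OF True])
      show "finite B" unfolding B_def using M(2) by simp
      show "B \<subseteq> arcs (quotient_graph ?M X \<alpha>)"
      proof
        fix a assume "a \<in> B"
        then obtain C where C: "C \<in> rcosets M" "a = arc (r C)" by (auto simp: B_def)
        have "(f (co (r C)), f (co (r C \<otimes> t))) \<in> parcs X" unfolding X(3) using ETI(1)[OF r(1)[OF C(1)]] by force
        then show "a \<in> arcs (quotient_graph ?M X \<alpha>)" unfolding S.arcs_quotient C(2) arc_def by force
      qed
      show "converse a \<notin> B" if "a \<in> B" for a using that conv r unfolding B_def by blast
    qed
    also have "\<dots> \<le> weighted_complexity ?M (\<lambda>_. 0) X \<alpha>" using bound[OF True] by simp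
    finally show ?thesis using cardB by simp
  qed
  also have "weighted_complexity ?M (\<lambda>_. 0) X \<alpha> \<le> C_max_fin ?M"
    unfolding C_max_fin_def
  proof (rule Sup_upper, intro CollectI exI conjI)
    show "reduced ?M X \<alpha>"
      unfolding reduced_def
    proof (clarify)
      fix x y assume xy: "(x, y) \<in> parcs X"
      have p: "pointwise_stab ?M \<alpha> {x, y} = stabilizer ?M \<alpha> x \<inter> stabilizer ?M \<alpha> y"
        by (rule S.pointwise_stab_pair)
      then show "pointwise_stab ?M \<alpha> {x, y} \<subset> stabilizer ?M \<alpha> x \<and> pointwise_stab ?M \<alpha> {x, y} \<subset> stabilizer ?M \<alpha> y"
        using branch[OF S.E_in_V(1)[OF xy] xy] branch[OF S.E_in_V(2)[OF xy] S.E_symD[OF xy]] by blast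
    qed
    show "\<forall>(x, y)\<in>parcs X. finite (pointwise_stab ?M \<alpha> {x, y})"
    proof clarify
      fix x y assume "(x, y) \<in> parcs X"
      then show "finite (pointwise_stab ?M \<alpha> {x, y})"
        unfolding S.pointwise_stab_pair using edge by (meson finite.emptyI finite_insert finite_subset)
    qed
  qed (rule refl X(1))+
  finally show ?thesis .
qed

text \<open>The complexity of a subgroup \<open>K\<close> of \<open>N\<close> is at least the index
  of \<open>K\<close> in \<open>G\<close>, which is at least the product of the indices of
  \<open>N\<close> in \<open>G\<close> and of \<open>K\<close> in \<open>N\<close>. Division by the
  index in \<open>N\<close> leaves the first factor, uniformly in \<open>K\<close>.\<close>

lemma V_fin_ge:
  assumes inf: "infinite A" and fg: "finitely_generated G"
    and N: "subgroup N G" "finite (rcosets N)"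
  shows "of_nat (index G N) \<le> V_fin (subgrp G N)"
proof -
  let ?N = "subgrp G N"
  interpret N: grp ?N using subgroup_imp_group[OF N(1)] by (rule grp.intro)
  have K: "subgroup K G \<and> finite (rcosets K) \<and> K \<subseteq> N \<and> finite (rcosets\<^bsub>?N\<^esub> K)"
    if "K \<in> finite_index_normal ?N" for K
  proof -
    have k: "subgroup K ?N" "finite (rcosets\<^bsub>?N\<^esub> K)"
      using that by (auto simp: finite_index_normal_def normal_imp_subgroup)
    have "subgroup K G" using incl_subgroup[OF N(1) k(1)] .
    moreover have "K \<subseteq> N" using subgroup.subset[OF k(1)] by simp
    ultimately show ?thesis using finite_rcosets_trans[OF N(1) _ _ N(2)] k by blast
  qed
  show ?thesis
    unfolding V_fin_def
  proof (rule N.index_limsup_ge)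
    show "countable (finite_index_normal ?N)"
      using countable_finite_index[OF fg] by (rule countable_subset[rotated]) (use K in blast)
    fix K assume "K \<in> finite_index_normal ?N"
    note K = K[OF this]
    have pos: "card (rcosets\<^bsub>?N\<^esub> K) > 0"
    proof -
      have "K #> \<one> \<in> rcosets\<^bsub>?N\<^esub> K" unfolding rcosets_subgrp using subgroup.one_closed[OF N(1)] by blast
      then show ?thesis using K by (metis card_gt_0_iff empty_iff)
    qed
    have "index G N * card (rcosets\<^bsub>?N\<^esub> K) \<le> index G K"
      using index_mult_le[OF N(1), of K] K by (simp add: index_def)
    then have "of_nat (index G N) * of_nat (card (rcosets\<^bsub>?N\<^esub> K)) \<le> (of_nat (index G K) :: ennreal)"
      unfolding of_nat_mult[symmetric] by (rule of_nat_mono)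
    also have "\<dots> \<le> C_max_fin (subgrp G K)" using C_max_fin_ge[OF inf fg] K by blast
    finally have le: "of_nat (index G N) * of_nat (card (rcosets\<^bsub>?N\<^esub> K)) \<le> C_max_fin (subgrp G K)" .
    have "of_nat (index G N) * of_nat (card (rcosets\<^bsub>?N\<^esub> K)) / of_nat (card (rcosets\<^bsub>?N\<^esub> K))
        \<le> C_max_fin (subgrp G K) / of_nat (card (rcosets\<^bsub>?N\<^esub> K))"
      using le by (rule divide_right_mono_ennreal)
    moreover have "of_nat (index G N) * of_nat (card (rcosets\<^bsub>?N\<^esub> K)) / of_nat (card (rcosets\<^bsub>?N\<^esub> K))
        = (of_nat (index G N) :: ennreal)"
      using pos by (intro ennreal_mult_divide_eq) auto
    ultimately show "of_nat (index G N) \<le> C_max_fin (subgrp ?N K) / of_nat (card (rcosets\<^bsub>?N\<^esub> K))" by simp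
  qed
qed

end

section \<open>Abelian subgroups of torsion-free CSA groups\<close>

text \<open>The set \<open>P\<close> has finite boundary with respect to \<open>t\<close> and to
  each element of \<open>A\<close>, and finiteness passes to products and inverses, hence to any
  finite generating set. Both \<open>P\<close> and its complement are infinite, since they contain
  \<open>t A\<close> and \<open>A\<close>.\<close>

lemma one_ended_not_free_hnn:
  fixes G :: "'g monoid" (structure)
  assumes G: "group G" "one_ended G" and h: "free_hnn G A t P" and inf: "infinite A"
  shows False
proof -
  interpret group G by (rule G(1))
  have A: "subgroup A G" and tc: "t \<in> carrier G" and gen: "generate G (insert t A) = carrier G"
    and Pc: "P \<subseteq> carrier G" and PA: "\<And>g a. g \<in> P \<Longrightarrow> a \<in> A \<Longrightarrow> g \<otimes> a \<in> P"
    and oneP: "\<one> \<notin> P" and tP: "t \<in> P"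
    and Pt: "\<And>g. g \<in> carrier G \<Longrightarrow> g \<noteq> \<one> \<Longrightarrow> g \<in> P \<longleftrightarrow> g \<otimes> t \<in> P"
    using h unfolding free_hnn_def by auto
  have Ac: "A \<subseteq> carrier G" using A by (rule subgroup.subset)
  have PA_iff: "g \<otimes> a \<in> P \<longleftrightarrow> g \<in> P" if "g \<in> carrier G" "a \<in> A" for g a
  proof
    assume "g \<otimes> a \<in> P"
    then have "g \<otimes> a \<otimes> inv a \<in> P" using subgroup.m_inv_closed[OF A \<open>a \<in> A\<close>] by (rule PA)
    moreover have "a \<in> carrier G" using Ac that by blast
    ultimately show "g \<in> P" using that by (simp add: m_assoc)
  qed (use PA that in blast)
  define bd where "bd s = {g \<in> carrier G. (g \<in> P) \<noteq> (g \<otimes> s \<in> P)}" for s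
  have bd_inv: "bd (inv s) \<subseteq> (\<lambda>k. k \<otimes> s) ` bd s" if s: "s \<in> carrier G" for s
  proof
    fix g assume g: "g \<in> bd (inv s)"
    then have "g \<otimes> inv s \<in> bd s" using s by (auto simp: bd_def m_assoc)
    moreover have "g = g \<otimes> inv s \<otimes> s" using g s by (simp add: bd_def m_assoc)
    ultimately show "g \<in> (\<lambda>k. k \<otimes> s) ` bd s" by (rule rev_image_eqI)
  qed
  have bd_mult: "bd (s \<otimes> s') \<subseteq> bd s \<union> (\<lambda>k. k \<otimes> inv s) ` bd s'"
    if s: "s \<in> carrier G" "s' \<in> carrier G" for s s'
  proof
    fix g assume g: "g \<in> bd (s \<otimes> s')"
    show "g \<in> bd s \<union> (\<lambda>k. k \<otimes> inv s) ` bd s'"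
    proof (cases "g \<in> bd s")
      case False
      then have "g \<otimes> s \<in> bd s'" using g s by (auto simp: bd_def m_assoc)
      moreover have "g = g \<otimes> s \<otimes> inv s" using g s by (simp add: bd_def m_assoc)
      ultimately have "g \<in> (\<lambda>k. k \<otimes> inv s) ` bd s'" by (rule rev_image_eqI)
      then show ?thesis by blast
    qed blast
  qed
  have bd_gen: "finite (bd s)" if "s \<in> insert t A" for s
  proof (cases "s = t")
    case True
    have "bd t \<subseteq> {\<one>}" using Pt by (auto simp: bd_def)
    then show ?thesis using True by (simp add: finite_subset)
  next
    case False
    then have "bd s = {}" using that PA_iff by (auto simp: bd_def)
    then show ?thesis by simp
  qed
  have bd_fin: "finite (bd s)" if "s \<in> generate G (insert t A)" for s
    using that
  proof (induction rule: generate.induct)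
    case one
    have "bd \<one> = {}" by (auto simp: bd_def)
    then show ?case by simp
  next
    case (incl s)
    then show ?case by (rule bd_gen)
  next
    case (inv s)
    then have "s \<in> carrier G" using tc Ac by blast
    from bd_inv[OF this] bd_gen[OF inv] show ?case by (meson finite_imageI finite_subset)
  next
    case (eng s s')
    then have "s \<in> carrier G" "s' \<in> carrier G" using gen by auto
    from bd_mult[OF this] eng(3,4) show ?case by (meson finite_UnI finite_imageI finite_subset)
  qed
  obtain S where S: "finite S" "S \<subseteq> carrier G" "generate G S = carrier G"
    using G(2) by (auto simp: one_ended_def finitely_generated_def)
  \<comment> \<open>All boundary edges have their ends in \<open>K\<close>, so no path outside
    \<open>K\<close> leaves \<open>P\<close> or its complement. The element \<open>\<one>\<close> is
    added so that every path to \<open>\<one>\<close> must meet \<open>K\<close>.\<close>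
  define K where "K = insert \<one> (\<Union>s\<in>S. bd s \<union> (\<lambda>k. k \<otimes> s) ` bd s)"
  have Kfin: "finite K" unfolding K_def using S bd_fin gen by (auto simp: subset_iff)
  define R where "R = Restr (cayley_rel G S) (carrier G - K)"
  have ex1: "\<exists>!C. C \<in> (carrier G - K) // R\<^sup>* \<and> infinite C"
    using G(2) S Kfin unfolding one_ended_def R_def by blast
  have side: "g \<in> P \<longleftrightarrow> k \<in> P" if gk: "(g, k) \<in> R" for g k
  proof -
    have "g \<notin> K" "k \<notin> K" "g \<in> carrier G" "k \<in> carrier G" using gk by (auto simp: R_def)
    moreover have "(\<exists>s\<in>S. k = g \<otimes> s) \<or> (\<exists>s\<in>S. g = k \<otimes> s)"
      using gk by (auto simp: R_def cayley_rel_def)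
    ultimately show ?thesis unfolding K_def bd_def by blast
  qed
  have side_star: "g \<in> P \<longleftrightarrow> k \<in> P" if "(g, k) \<in> R\<^sup>*" for g k
    using that by (induction rule: rtrancl_induct) (use side in auto)
  have symR: "sym R" unfolding R_def cayley_rel_def sym_def by blast
  then have symR': "sym (R\<^sup>*)" by (rule sym_rtrancl)
  have R_closed: "k \<in> carrier G - K" if "(g, k) \<in> R\<^sup>*" "g \<in> carrier G - K" for g k
    using that by (induction rule: rtrancl_induct) (auto simp: R_def)
  \<comment> \<open>The neighbours of \<open>K\<close>: every component outside \<open>K\<close>
    contains one of them, so there are only finitely many components. Then an infinite union of
    components contains an infinite one.\<close>
  define B where "B = (\<Union>k\<in>K. \<Union>s\<in>S. {k \<otimes> s, k \<otimes> inv s})"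
  have Bfin: "finite B" unfolding B_def using Kfin S(1) by simp
  have RI: "(g, g \<otimes> s) \<in> R" "(g \<otimes> s, g) \<in> R"
    if "g \<in> carrier G - K" "s \<in> S" "g \<otimes> s \<notin> K" for g s
    using that S(2) by (auto simp: R_def cayley_rel_def)
  have reach: "(h, h \<otimes> g) \<in> R\<^sup>* \<or> (\<exists>b\<in>B. (h, b) \<in> R\<^sup>*)"
    if "g \<in> generate G S" "h \<in> carrier G - K" for g h
    using that
  proof (induction arbitrary: h rule: generate.induct)
    case one
    then show ?case by simp
  next
    case (incl s)
    have sc: "s \<in> carrier G" using incl S by blast
    show ?case
    proof (cases "h \<otimes> s \<in> K")
      case True
      have "h = h \<otimes> s \<otimes> inv s" using incl sc by (simp add: m_assoc)
      then have "h \<in> B" unfolding B_def using True incl(1) by blast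
      then show ?thesis by blast
    next
      case False
      then show ?thesis using RI(1)[OF incl(2,1)] by blast
    qed
  next
    case (inv s)
    have sc: "s \<in> carrier G" using inv S by blast
    have hs: "h = h \<otimes> inv s \<otimes> s" using inv sc by (simp add: m_assoc)
    show ?case
    proof (cases "h \<otimes> inv s \<in> K")
      case True
      then have "h \<in> B" unfolding B_def using hs inv(1) by blast
      then show ?thesis by blast
    next
      case False
      then have "(h, h \<otimes> inv s) \<in> R" using RI(2)[of "h \<otimes> inv s" s] hs inv sc by simp
      then show ?thesis by blast
    qed
  next
    case (eng g1 g2)
    have c: "g1 \<in> carrier G" "g2 \<in> carrier G" using eng(1,2) S by auto
    show ?case
    proof (cases "\<exists>b\<in>B. (h, b) \<in> R\<^sup>*")
      case False
      then have 1: "(h, h \<otimes> g1) \<in> R\<^sup>*" using eng(3)[OF eng(5)] by blast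
      then have "h \<otimes> g1 \<in> carrier G - K" using R_closed eng(5) by blast
      then have 2: "(h \<otimes> g1, h \<otimes> g1 \<otimes> g2) \<in> R\<^sup>* \<or> (\<exists>b\<in>B. (h \<otimes> g1, b) \<in> R\<^sup>*)" by (rule eng(4))
      then have "(h, h \<otimes> g1 \<otimes> g2) \<in> R\<^sup>*" using 1 False by (meson rtrancl_trans)
      then show ?thesis using c eng(5) by (simp add: m_assoc)
    qed blast
  qed
  have classes: "(carrier G - K) // R\<^sup>* \<subseteq> (\<lambda>b. R\<^sup>* `` {b}) ` B"
  proof
    fix C assume "C \<in> (carrier G - K) // R\<^sup>*"
    then obtain c where c: "c \<in> carrier G - K" "C = R\<^sup>* `` {c}" by (auto simp: quotient_def)
    have "inv c \<in> generate G S" using c S by simp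
    then have "(c, c \<otimes> inv c) \<in> R\<^sup>* \<or> (\<exists>b\<in>B. (c, b) \<in> R\<^sup>*)" using c(1) by (rule reach)
    moreover have "c \<otimes> inv c \<in> K" using c by (simp add: K_def)
    ultimately obtain b where b: "b \<in> B" "(c, b) \<in> R\<^sup>*" using R_closed c(1) by blast
    have "(b, c) \<in> R\<^sup>*" using symR' b(2) by (rule symD)
    then have "R\<^sup>* `` {c} = R\<^sup>* `` {b}" using b(2) by (auto intro: rtrancl_trans)
    then show "C \<in> (\<lambda>b. R\<^sup>* `` {b}) ` B" using b c by blast
  qed
  have fin_classes: "finite ((carrier G - K) // R\<^sup>*)"
    using classes Bfin by (meson finite_imageI finite_subset)
  have inf_class: "\<exists>C\<in>(carrier G - K) // R\<^sup>*. infinite C \<and> C \<subseteq> U"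
    if U: "infinite U" "U \<subseteq> carrier G" "\<And>g k. (g, k) \<in> R\<^sup>* \<Longrightarrow> g \<in> U \<Longrightarrow> k \<in> carrier G \<Longrightarrow> k \<in> U" for U
  proof -
    let ?\<C> = "{C \<in> (carrier G - K) // R\<^sup>*. C \<subseteq> U}"
    have "U - K \<subseteq> \<Union>?\<C>"
    proof
      fix u assume u: "u \<in> U - K"
      then have uc: "u \<in> carrier G - K" using U(2) by blast
      then have "R\<^sup>* `` {u} \<in> (carrier G - K) // R\<^sup>*" by (rule quotientI)
      moreover have "R\<^sup>* `` {u} \<subseteq> U" using U(3) u R_closed[OF _ uc] by blast
      ultimately show "u \<in> \<Union>?\<C>" by blast
    qed
    moreover have "infinite (U - K)" using U(1) Kfin by simp
    ultimately have "infinite (\<Union>?\<C>)" by (meson finite_subset)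
    moreover have "finite ?\<C>" using fin_classes by simp
    ultimately have "\<exists>C\<in>?\<C>. infinite C" using finite_Union[of ?\<C>] by blast
    then show ?thesis by blast
  qed
  \<comment> \<open>Multiplication by \<open>t\<close> embeds the infinite set \<open>A\<close> into
    \<open>P\<close>.\<close>
  have "infinite P"
  proof
    assume "finite P"
    moreover have "(\<lambda>a. t \<otimes> a) ` A \<subseteq> P" using PA tP by blast
    moreover have "inj_on (\<lambda>a. t \<otimes> a) A" by (rule inj_onI) (use tc Ac in \<open>simp add: subset_iff\<close>)
    ultimately show False using inf by (meson finite_imageD finite_subset)
  qed
  then obtain C1 where C1: "C1 \<in> (carrier G - K) // R\<^sup>*" "infinite C1" "C1 \<subseteq> P"
    using inf_class[OF _ Pc] side_star by blast
  have "A \<subseteq> carrier G - P"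
    using PA_iff[of \<one>] oneP Ac by force
  then have "infinite (carrier G - P)" using inf finite_subset by blast
  then obtain C2 where C2: "C2 \<in> (carrier G - K) // R\<^sup>*" "infinite C2" "C2 \<subseteq> carrier G - P"
    using inf_class[of "carrier G - P"] side_star by blast
  have "C1 = C2" using ex1 C1 C2 by blast
  then show False using C1 C2 by (metis Diff_disjoint Int_absorb2 finite.emptyI le_inf_iff subset_empty)
qed

locale csa = grp G for G :: "'g monoid" (structure) +
  assumes csa: "CSA G"
begin

definition comm :: "'g \<Rightarrow> 'g \<Rightarrow> bool" where
  "comm a b \<longleftrightarrow> a \<otimes> b = b \<otimes> a"

lemma comm_sym: "comm a b \<Longrightarrow> comm b a"
  by (simp add: comm_def)

lemma comm_group_subgrp_iff:
  assumes "subgroup B G"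
  shows "comm_group (subgrp G B) \<longleftrightarrow> (\<forall>a\<in>B. \<forall>b\<in>B. comm a b)"
proof
  assume "comm_group (subgrp G B)"
  then interpret B: comm_group "subgrp G B" .
  show "\<forall>a\<in>B. \<forall>b\<in>B. comm a b" using B.m_comm by (simp add: comm_def)
next
  assume a: "\<forall>a\<in>B. \<forall>b\<in>B. comm a b"
  interpret B: group "subgrp G B" using assms by (rule subgroup_imp_group)
  show "comm_group (subgrp G B)" by (rule B.group_comm_groupI) (use a in \<open>simp add: comm_def\<close>)
qed

lemma abelian_in_maximal:
  assumes B: "subgroup B G" "\<forall>a\<in>B. \<forall>b\<in>B. comm a b"
  obtains M where "maximal_abelian G M" "B \<subseteq> M"
proof -
  define \<A> where "\<A> = {A. subgroup A G \<and> (\<forall>a\<in>A. \<forall>b\<in>A. comm a b) \<and> B \<subseteq> A}"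
  have "\<exists>M\<in>\<A>. \<forall>X\<in>\<A>. M \<subseteq> X \<longrightarrow> X = M"
  proof (rule subset_Zorn_nonempty)
    show "\<A> \<noteq> {}" using B by (auto simp: \<A>_def)
    fix \<C> assume ne: "\<C> \<noteq> {}" and ch: "subset.chain \<A> \<C>"
    have sub: "C \<in> \<C> \<Longrightarrow> subgroup C G \<and> (\<forall>a\<in>C. \<forall>b\<in>C. comm a b) \<and> B \<subseteq> C" for C
      using ch by (auto simp: subset.chain_def \<A>_def)
    have two: "\<exists>C\<in>\<C>. a \<in> C \<and> b \<in> C" if "a \<in> \<Union>\<C>" "b \<in> \<Union>\<C>" for a b
    proof -
      obtain C D where cd: "C \<in> \<C>" "a \<in> C" "D \<in> \<C>" "b \<in> D" using \<open>a \<in> \<Union>\<C>\<close> \<open>b \<in> \<Union>\<C>\<close> by blast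
      then have "C \<subseteq> D \<or> D \<subseteq> C" using ch by (auto simp: subset.chain_def subset_chain_def)
      then show ?thesis using cd by blast
    qed
    obtain C0 where C0: "C0 \<in> \<C>" using ne by blast
    have "subgroup (\<Union>\<C>) G"
    proof (rule subgroupI)
      show "\<Union>\<C> \<subseteq> carrier G"
      proof (rule Union_least)
        show "C \<subseteq> carrier G" if "C \<in> \<C>" for C using sub[OF that] subgroup.subset[of C G] by blast
      qed
      show "\<Union>\<C> \<noteq> {}" using C0 sub[OF C0] subgroup.one_closed[of C0 G] by blast
      show "inv a \<in> \<Union>\<C>" if a: "a \<in> \<Union>\<C>" for a
      proof -
        obtain C where C: "C \<in> \<C>" "a \<in> C" using a by blast
        then have "inv a \<in> C" using sub[OF C(1)] subgroup.m_inv_closed[of C G a] by blast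
        then show ?thesis using C by blast
      qed
      show "a \<otimes> b \<in> \<Union>\<C>" if ab: "a \<in> \<Union>\<C>" "b \<in> \<Union>\<C>" for a b
      proof -
        obtain C where C: "C \<in> \<C>" "a \<in> C" "b \<in> C" using two[OF ab] by blast
        then have "a \<otimes> b \<in> C" using sub[OF C(1)] subgroup.m_closed[of C G a b] by blast
        then show ?thesis using C by blast
      qed
    qed
    moreover have "\<forall>a\<in>\<Union>\<C>. \<forall>b\<in>\<Union>\<C>. comm a b" using two sub by blast
    moreover have "B \<subseteq> \<Union>\<C>" using C0 sub by blast
    ultimately show "\<Union>\<C> \<in> \<A>" unfolding \<A>_def by blast
  qed
  then obtain M where M: "M \<in> \<A>" "\<And>X. X \<in> \<A> \<Longrightarrow> M \<subseteq> X \<Longrightarrow> X = M" by blast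
  have "maximal_abelian G M"
    unfolding maximal_abelian_def
  proof (intro conjI allI impI)
    show "subgroup M G" "comm_group (subgrp G M)"
      using M(1) comm_group_subgrp_iff by (auto simp: \<A>_def)
    fix A assume A: "subgroup A G \<and> comm_group (subgrp G A) \<and> M \<subseteq> A"
    then have "A \<in> \<A>" using M(1) comm_group_subgrp_iff by (auto simp: \<A>_def)
    then show "A = M" using M(2) A by blast
  qed
  then show thesis using that M(1) by (auto simp: \<A>_def)
qed

text \<open>The nontrivial element \<open>a\<close> lies in \<open>M\<close> and in the conjugate of
  \<open>M\<close> by \<open>g\<close>, so malnormality applies.\<close>

lemma maximal_abelian_conj:
  assumes M: "maximal_abelian G M" and a: "a \<in> M" "a \<noteq> \<one>" and g: "g \<in> carrier G" "inv g \<otimes> a \<otimes> g \<in> M"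
  shows "g \<in> M"
proof (rule ccontr)
  assume "g \<notin> M"
  have Mc: "M \<subseteq> carrier G" using M subgroup.subset by (auto simp: maximal_abelian_def)
  have "malnormal G M" using csa M by (auto simp: CSA_def)
  then have "M \<inter> (g <# M #> inv g) = {\<one>}" using g \<open>g \<notin> M\<close> by (auto simp: malnormal_def)
  moreover have "a \<in> g <# M #> inv g"
  proof -
    have ac: "a \<in> carrier G" using a Mc by blast
    have "a = g \<otimes> (inv g \<otimes> a \<otimes> g) \<otimes> inv g"
    proof -
      have "g \<otimes> (inv g \<otimes> a \<otimes> g) = a \<otimes> g" using g ac by (simp add: m_assoc[symmetric])
      then show ?thesis using g ac by (simp add: m_assoc)
    qed
    then show ?thesis using g(2) unfolding l_coset_def r_coset_def by blast
  qed
  ultimately show False using a by blast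
qed

lemma comm_in_maximal:
  assumes M: "maximal_abelian G M" and a: "a \<in> M" "a \<noteq> \<one>" and g: "g \<in> carrier G" "comm g a"
  shows "g \<in> M"
proof (rule maximal_abelian_conj[OF M a g(1)])
  have "a \<in> carrier G" using M a subgroup.subset by (auto simp: maximal_abelian_def)
  then have "inv g \<otimes> (g \<otimes> a) = a" using g by (simp add: m_assoc[symmetric])
  then have "inv g \<otimes> a \<otimes> g = a" using g \<open>a \<in> carrier G\<close> by (simp add: comm_def m_assoc)
  then show "inv g \<otimes> a \<otimes> g \<in> M" using a by simp
qed

lemma cyclic_abelian:
  assumes "a \<in> carrier G"
  shows "subgroup (generate G {a}) G" "\<forall>x\<in>generate G {a}. \<forall>y\<in>generate G {a}. comm x y" "a \<in> generate G {a}"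
proof -
  show "subgroup (generate G {a}) G" using assms by (intro generate_is_subgroup) simp
  show "a \<in> generate G {a}" by (rule generate.incl) simp
  have "generate G {a} = {a [^] (k::int) | k. k \<in> UNIV}" using assms by (rule generate_pow)
  then show "\<forall>x\<in>generate G {a}. \<forall>y\<in>generate G {a}. comm x y"
    using assms by (auto simp: comm_def int_pow_mult[symmetric] add.commute)
qed

text \<open>By malnormality, everything that commutes with \<open>a\<close> lies in one maximal
  abelian subgroup. This transitivity and \<open>comm_conj\<close> are the forms in which the CSA
  property is used.\<close>

lemma comm_trans:
  assumes a: "a \<in> carrier G" "a \<noteq> \<one>" and b: "b \<in> carrier G" "comm a b" and c: "c \<in> carrier G" "comm a c"
  shows "comm b c"
proof -
  obtain M where M: "maximal_abelian G M" "generate G {a} \<subseteq> M"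
    using abelian_in_maximal cyclic_abelian(1,2)[OF a(1)] by metis
  have aM: "a \<in> M" using M cyclic_abelian(3)[OF a(1)] by blast
  have "b \<in> M" "c \<in> M" using comm_in_maximal[OF M(1) aM a(2)] b c comm_sym by auto
  then show ?thesis using M(1) comm_group_subgrp_iff by (auto simp: maximal_abelian_def)
qed

text \<open>The conjugate lies in the maximal abelian subgroup that contains \<open>a\<close>, and
  malnormality then puts the conjugating element there too.\<close>

lemma comm_conj:
  assumes a: "a \<in> carrier G" "a \<noteq> \<one>" and g: "g \<in> carrier G" "comm a (g \<otimes> a \<otimes> inv g)"
  shows "comm a g"
proof -
  obtain M where M: "maximal_abelian G M" "generate G {a} \<subseteq> M"
    using abelian_in_maximal cyclic_abelian(1,2)[OF a(1)] by metis
  have aM: "a \<in> M" using M cyclic_abelian(3)[OF a(1)] by blast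
  have Mg: "subgroup M G" using M(1) by (simp add: maximal_abelian_def)
  have "g \<otimes> a \<otimes> inv g \<in> M" using comm_in_maximal[OF M(1) aM a(2), of "g \<otimes> a \<otimes> inv g"] a g comm_sym by simp
  then have "inv g \<in> M" using maximal_abelian_conj[OF M(1) aM a(2), of "inv g"] g by simp
  then have "inv (inv g) \<in> M" using subgroup.m_inv_closed[OF Mg] by blast
  then have "g \<in> M" using g by simp
  then show ?thesis using M(1) aM comm_group_subgrp_iff[OF Mg] by (auto simp: maximal_abelian_def)
qed

end

section \<open>Subtrees and collapses\<close>

lemma (in tree_act) tree_act_subtree:
  assumes S: "invariant_subtree S"
  shows "tree_act S (E \<inter> S \<times> S) G act"
proof -
  have S': "S \<noteq> {}" "S \<subseteq> V" "\<And>x y. x \<in> S \<Longrightarrow> y \<in> S \<Longrightarrow> (x, y) \<in> (E \<inter> S \<times> S)\<^sup>*"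
    "\<And>g x. g \<in> carrier G \<Longrightarrow> x \<in> S \<Longrightarrow> act g x \<in> S"
    using S unfolding invariant_subtree_def by blast+
  show ?thesis
  proof
    show "sym (E \<inter> S \<times> S)" using E_sym unfolding sym_def by blast
    show "(x, y) \<notin> (E \<inter> S \<times> S - {(x, y), (y, x)})\<^sup>*" if "(x, y) \<in> E \<inter> S \<times> S" for x y
    proof -
      have "(E \<inter> S \<times> S - {(x, y), (y, x)})\<^sup>* \<subseteq> (E - {(x, y), (y, x)})\<^sup>*" by (intro rtrancl_mono) blast
      then show ?thesis using bridge[of x y] that by blast
    qed
    show "(x, y) \<in> (E \<inter> S \<times> S)\<^sup>*" if "x \<in> S" "y \<in> S" for x y using S'(3) that .
    show "act \<one> x = x" if "x \<in> S" for x using act_one that S'(2) by blast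
    show "act (g \<otimes> h) x = act g (act h x)" if "g \<in> carrier G" "h \<in> carrier G" "x \<in> S" for g h x
      using act_mult that S'(2) by blast
    show "(act g x, act g y) \<in> E \<inter> S \<times> S" if "g \<in> carrier G" "(x, y) \<in> E \<inter> S \<times> S" for g x y
      using act_E[of g x y] S'(4) that by blast
    show "\<not> (act g x = y \<and> act g y = x)" if "g \<in> carrier G" "(x, y) \<in> E \<inter> S \<times> S" for g x y
      using no_inversion[of g x y] that by blast
  qed (use S' E_irrefl in auto)
qed

text \<open>The translates of chosen walks from \<open>x\<close> to the points of its orbit form a
  countable set because the group is countable. It is connected, as each translate of a walk starts
  at an orbit point that is itself joined to \<open>x\<close>.\<close>

lemma (in tree_act) countable_subtree:
  assumes count: "countable (carrier G)" and x: "x \<in> V"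
  obtains S where "countable S" "x \<in> S" "invariant_subtree S"
proof -
  define p where "p h = (SOME q. rwalk E q \<and> hd q = x \<and> last q = act h x \<and> set q \<subseteq> V)" for h
  have p: "rwalk E (p h)" "hd (p h) = x" "last (p h) = act h x" "set (p h) \<subseteq> V" if hc: "h \<in> carrier G" for h
  proof -
    obtain q where "rwalk E q \<and> hd q = x \<and> last q = act h x \<and> set q \<subseteq> V"
      using rwalk_exists[OF x act_closed[OF hc x]] by blast
    then have "rwalk E (p h) \<and> hd (p h) = x \<and> last (p h) = act h x \<and> set (p h) \<subseteq> V"
      unfolding p_def by (rule someI)
    then show "rwalk E (p h)" "hd (p h) = x" "last (p h) = act h x" "set (p h) \<subseteq> V" by auto
  qed
  define S where "S = (\<Union>g\<in>carrier G. \<Union>h\<in>carrier G. act g ` set (p h))"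
  have "countable S" unfolding S_def by (intro countable_UN[OF count] countable_image countable_finite[OF finite_set])
  have SV: "S \<subseteq> V" unfolding S_def using p(4) act_closed by blast
  have hdp: "x \<in> set (p h)" if "h \<in> carrier G" for h
    using p(1,2)[OF that] by (metis hd_in_set rwalk_Nil)
  have orb: "act g x \<in> S" if "g \<in> carrier G" for g
    unfolding S_def using hdp[OF one_closed] that by blast
  have xS: "x \<in> S" using orb[OF one_closed] act_one[OF x] by simp
  have inv: "act k u \<in> S" if k: "k \<in> carrier G" and u: "u \<in> S" for k u
  proof -
    obtain g h w where w: "g \<in> carrier G" "h \<in> carrier G" "w \<in> set (p h)" "u = act g w"
      using u unfolding S_def by blast
    have "w \<in> V" using w p(4) by blast
    then have "act k u = act (k \<otimes> g) w" using w k by (simp add: act_mult)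
    then show ?thesis unfolding S_def using w k by blast
  qed
  let ?E = "E \<inter> S \<times> S"
  have path: "(act g x, act g w) \<in> ?E\<^sup>*" if g: "g \<in> carrier G" "h \<in> carrier G" "w \<in> set (p h)" for g h w
  proof -
    obtain us vs where uv: "p h = us @ w # vs" using g(3) by (meson split_list)
    define q where "q = us @ [w]"
    have q: "rwalk E q" "set q \<subseteq> set (p h)" "last q = w"
      using p(1)[OF g(2)] rwalk_prefix[of E q vs] uv by (auto simp: q_def)
    have hq: "hd q = x" using p(2)[OF g(2)] uv by (cases us) (auto simp: q_def)
    have "rwalk E (map (act g) q)" using rwalk_act[OF g(1) q(1)] q(2) p(4)[OF g(2)] by blast
    moreover have "set (map (act g) q) \<subseteq> S" unfolding S_def using q(2) g by auto
    ultimately have "rwalk ?E (map (act g) q)" by (rule rwalk_restr)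
    from rwalk_imp_rtrancl[OF this] show ?thesis
      using q(3) hq \<open>rwalk E q\<close> by (cases "q = []") (simp_all add: hd_map last_map)
  qed
  have "sym ?E" using E_sym unfolding sym_def by blast
  then have symE: "sym (?E\<^sup>*)" by (rule sym_rtrancl)
  have toS: "(x, u) \<in> ?E\<^sup>*" if u: "u \<in> S" for u
  proof -
    obtain g h w where w: "g \<in> carrier G" "h \<in> carrier G" "w \<in> set (p h)" "u = act g w"
      using u unfolding S_def by blast
    have "last (p g) \<in> set (p g)" using p(1)[OF w(1)] by (metis last_in_set rwalk_Nil)
    then have "(act \<one> x, act \<one> (act g x)) \<in> ?E\<^sup>*" using path[OF one_closed w(1)] p(3)[OF w(1)] by simp
    then have "(x, act g x) \<in> ?E\<^sup>*" using act_one x act_closed[OF w(1) x] by simp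
    then show ?thesis using path[OF w(1-3)] w(4) by simp
  qed
  have "invariant_subtree S"
    unfolding invariant_subtree_def
  proof (intro conjI ballI)
    show "(u, v) \<in> ?E\<^sup>*" if "u \<in> S" "v \<in> S" for u v
      using symD[OF symE toS[OF that(1)]] toS[OF that(2)] by (rule rtrancl_trans)
  qed (use xS SV inv in auto)
  then show thesis using that \<open>countable S\<close> xS by blast
qed

text \<open>\<open>R_conn\<close> makes the classes connected through edges inside classes.
  Contracting them therefore leaves a tree, whose edges are the edges between different
  classes.\<close>

locale collapse = tree_act V E G act
  for V :: "'v set" and E and G :: "'g monoid" (structure) and act +
  fixes R :: "'v rel"
  assumes R_equiv: "equiv V R" and R_conn: "R \<subseteq> (E \<inter> R)\<^sup>*"
    and R_inv: "g \<in> carrier G \<Longrightarrow> (a, b) \<in> R \<Longrightarrow> (act g a, act g b) \<in> R"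
begin

abbreviation c where "c a \<equiv> R `` {a}"

lemma c_eq: "a \<in> V \<Longrightarrow> b \<in> V \<Longrightarrow> c a = c b \<longleftrightarrow> (a, b) \<in> R"
  using R_equiv by (rule eq_equiv_class_iff)

lemma R_V: "(a, b) \<in> R \<Longrightarrow> a \<in> V" "(a, b) \<in> R \<Longrightarrow> b \<in> V"
  using R_equiv by (auto simp: equiv_def refl_on_def)

lemma R_refl: "a \<in> V \<Longrightarrow> (a, a) \<in> R"
  using R_equiv by (auto simp: equiv_def refl_on_def)

lemma R_sym: "(a, b) \<in> R \<Longrightarrow> (b, a) \<in> R"
  using R_equiv by (auto simp: equiv_def dest: symD)

lemma R_trans: "(a, b) \<in> R \<Longrightarrow> (b, d) \<in> R \<Longrightarrow> (a, d) \<in> R"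
  using R_equiv by (auto simp: equiv_def dest: transD)

definition VQ where "VQ = V // R"
definition EQ where "EQ = {(c a, c b) | a b. (a, b) \<in> E \<and> (a, b) \<notin> R}"
definition actQ where "actQ g C = act g ` C"

lemma VQ_iff: "C \<in> VQ \<longleftrightarrow> (\<exists>a\<in>V. C = c a)"
  by (auto simp: VQ_def quotient_def)

lemma EQI: "(a, b) \<in> E \<Longrightarrow> (a, b) \<notin> R \<Longrightarrow> (c a, c b) \<in> EQ"
  unfolding EQ_def by blast

lemma EQE:
  assumes "(C, D) \<in> EQ"
  obtains a b where "C = c a" "D = c b" "(a, b) \<in> E" "(a, b) \<notin> R" "a \<in> V" "b \<in> V"
  using assms E_in_V unfolding EQ_def by blast

lemma actQ_c:
  assumes g: "g \<in> carrier G" and a: "a \<in> V"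
  shows "actQ g (c a) = c (act g a)"
proof (rule equalityI; rule subsetI)
  fix x assume "x \<in> actQ g (c a)"
  then show "x \<in> c (act g a)" using R_inv[OF g] by (auto simp: actQ_def)
next
  fix x assume "x \<in> c (act g a)"
  then have x: "(act g a, x) \<in> R" by simp
  have "(act (inv g) (act g a), act (inv g) x) \<in> R" using R_inv[OF _ x, of "inv g"] g by simp
  then have "(a, act (inv g) x) \<in> R" using act_inv[OF g a] by simp
  moreover have "x = act g (act (inv g) x)" using act_inv'[OF g] R_V(2)[OF x] by simp
  ultimately show "x \<in> actQ g (c a)" unfolding actQ_def by blast
qed

lemma fibre_path:
  assumes "(a, b) \<notin> R" "(p, q) \<in> R"
  shows "(p, q) \<in> (E - {(a, b), (b, a)})\<^sup>*"
proof -
  have "E \<inter> R \<subseteq> E - {(a, b), (b, a)}" using assms(1) R_sym by blast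
  then have "(E \<inter> R)\<^sup>* \<subseteq> (E - {(a, b), (b, a)})\<^sup>*" by (rule rtrancl_mono)
  then show ?thesis using R_conn assms(2) by blast
qed

text \<open>Two edges between the same classes would bypass each other through the connected
  classes, although each is a bridge. Edges of the quotient thus have exactly one lift.\<close>

lemma unique_lift:
  assumes "(a, b) \<in> E" "(a, b) \<notin> R" "(a', b') \<in> E" "(a, a') \<in> R" "(b, b') \<in> R"
  shows "a' = a \<and> b' = b"
proof (rule ccontr)
  assume n: "\<not> ?thesis"
  have "(a', b') \<noteq> (b, a)" using assms(2,4) by auto
  then have "(a', b') \<in> E - {(a, b), (b, a)}" using n assms(3) by auto
  moreover have "(a, a') \<in> (E - {(a, b), (b, a)})\<^sup>*" "(b', b) \<in> (E - {(a, b), (b, a)})\<^sup>*"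
    using fibre_path[OF assms(2)] assms(4) R_sym[OF assms(5)] by auto
  ultimately have "(a, b) \<in> (E - {(a, b), (b, a)})\<^sup>*" by (meson rtrancl.rtrancl_into_rtrancl rtrancl_trans)
  then show False using bridge assms(1) by blast
qed

text \<open>A path in the quotient lifts, with passages inside the classes inserted, and it avoids
  the lift of any edge that it avoids. Bridges therefore remain bridges.\<close>

lemma lift_path:
  assumes ab: "(a, b) \<in> E" "(a, b) \<notin> R" and z: "(c a, Z) \<in> (EQ - {(c a, c b), (c b, c a)})\<^sup>*"
  shows "\<forall>z\<in>Z. (a, z) \<in> (E - {(a, b), (b, a)})\<^sup>*"
  using z
proof (induction rule: rtrancl_induct)
  case base
  then show ?case using fibre_path[OF ab(2)] by auto
next
  case (step Y Z)
  have "(Y, Z) \<in> EQ" using step(2) by blast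
  then obtain p q where pq: "Y = c p" "Z = c q" "(p, q) \<in> E" "(p, q) \<notin> R" "p \<in> V" "q \<in> V"
    by (rule EQE)
  have "(p, q) \<noteq> (a, b)" "(p, q) \<noteq> (b, a)" using step(2) pq by auto
  then have e: "(p, q) \<in> E - {(a, b), (b, a)}" using pq by blast
  have "(a, p) \<in> (E - {(a, b), (b, a)})\<^sup>*" using step(3) pq R_refl by blast
  then have aq: "(a, q) \<in> (E - {(a, b), (b, a)})\<^sup>*" using e by (rule rtrancl.rtrancl_into_rtrancl)
  show ?case
  proof
    fix z assume "z \<in> Z"
    then have "(q, z) \<in> R" using pq by simp
    from rtrancl_trans[OF aq fibre_path[OF ab(2) this]] show "(a, z) \<in> (E - {(a, b), (b, a)})\<^sup>*" .
  qed
qed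

sublocale Q: tree_act VQ EQ G actQ
proof
  obtain a0 where "a0 \<in> V" using V_nonempty by blast
  then have "c a0 \<in> VQ" by (auto simp: VQ_iff)
  then show "VQ \<noteq> {}" by blast
  show "EQ \<subseteq> VQ \<times> VQ" by (auto elim!: EQE simp: VQ_iff)
  show "sym EQ"
  proof (rule symI)
    fix C D assume "(C, D) \<in> EQ"
    then obtain a b where "C = c a" "D = c b" "(a, b) \<in> E" "(a, b) \<notin> R" by (rule EQE)
    then show "(D, C) \<in> EQ" using EQI[of b a] E_symD[of a b] R_sym[of b a] by blast
  qed
  show "(C, C) \<notin> EQ" for C
  proof
    assume "(C, C) \<in> EQ"
    then obtain a b where "C = c a" "C = c b" "(a, b) \<notin> R" "a \<in> V" "b \<in> V" by (rule EQE)
    then show False using c_eq by blast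
  qed
  show "(C, D) \<in> EQ\<^sup>*" if CD: "C \<in> VQ" "D \<in> VQ" for C D
  proof -
    obtain a b where ab: "a \<in> V" "b \<in> V" "C = c a" "D = c b" using CD by (auto simp: VQ_iff)
    have "(a, b) \<in> E\<^sup>*" using connected ab by blast
    then have "(c a, c b) \<in> EQ\<^sup>*"
    proof (induction rule: rtrancl_induct)
      case (step y z)
      show ?case
      proof (cases "(y, z) \<in> R")
        case True
        then have "c y = c z" using c_eq R_V by blast
        then show ?thesis using step by simp
      next
        case False
        then show ?thesis using step EQI by (meson rtrancl.rtrancl_into_rtrancl)
      qed
    qed simp
    then show ?thesis using ab by simp
  qed
  show "(C, D) \<notin> (EQ - {(C, D), (D, C)})\<^sup>*" if "(C, D) \<in> EQ" for C D
  proof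
    assume p: "(C, D) \<in> (EQ - {(C, D), (D, C)})\<^sup>*"
    obtain a b where ab: "C = c a" "D = c b" "(a, b) \<in> E" "(a, b) \<notin> R" "a \<in> V" "b \<in> V"
      using \<open>(C, D) \<in> EQ\<close> by (rule EQE)
    have "b \<in> D" using ab R_refl by blast
    then have "(a, b) \<in> (E - {(a, b), (b, a)})\<^sup>*"
      using lift_path[OF ab(3,4), of D] p ab(1,2) by blast
    then show False using bridge ab by blast
  qed
  show "actQ \<one> C = C" if "C \<in> VQ" for C
    using that by (auto simp: VQ_iff actQ_c act_one)
  show "actQ (g \<otimes> h) C = actQ g (actQ h C)" if "g \<in> carrier G" "h \<in> carrier G" "C \<in> VQ" for g h C
    using that by (auto simp: VQ_iff actQ_c act_mult act_closed)
  show "actQ g C \<in> VQ" if "g \<in> carrier G" "C \<in> VQ" for g C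
    using that act_closed by (auto simp: VQ_iff actQ_c)
  have nR: "(act g a, act g b) \<notin> R" if g: "g \<in> carrier G" and ab: "(a, b) \<notin> R" "a \<in> V" "b \<in> V" for g a b
  proof
    assume "(act g a, act g b) \<in> R"
    then have "(act (inv g) (act g a), act (inv g) (act g b)) \<in> R" using R_inv g by simp
    then show False using g ab by (simp add: act_inv)
  qed
  show "(actQ g C, actQ g D) \<in> EQ" if g: "g \<in> carrier G" and "(C, D) \<in> EQ" for g C D
  proof -
    obtain a b where ab: "C = c a" "D = c b" "(a, b) \<in> E" "(a, b) \<notin> R" "a \<in> V" "b \<in> V"
      using \<open>(C, D) \<in> EQ\<close> by (rule EQE)
    then show ?thesis using EQI[OF act_E[OF g ab(3)] nR[OF g ab(4-6)]] g by (simp add: actQ_c)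
  qed
  show "\<not> (actQ g C = D \<and> actQ g D = C)" if g: "g \<in> carrier G" and "(C, D) \<in> EQ" for g C D
  proof
    assume sw: "actQ g C = D \<and> actQ g D = C"
    obtain a b where ab: "C = c a" "D = c b" "(a, b) \<in> E" "(a, b) \<notin> R" "a \<in> V" "b \<in> V"
      using \<open>(C, D) \<in> EQ\<close> by (rule EQE)
    have "c (act g a) = c b" "c (act g b) = c a" using sw ab g by (simp_all add: actQ_c)
    then have "(b, act g a) \<in> R" "(a, act g b) \<in> R" using c_eq ab act_closed[OF g] R_sym by blast+
    moreover have "(act g b, act g a) \<in> E" using act_E[OF g] E_symD[OF ab(3)] by blast
    ultimately have "act g b = a \<and> act g a = b" using unique_lift[OF ab(3,4)] by blast
    then show False using no_inversion[OF g ab(3)] by blast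
  qed
qed

text \<open>An element fixing both classes maps the edge between them to another lift of the same
  quotient edge. Edge groups of the quotient are thus edge groups of the original tree, and so
  commutativity and acylindricity survive the collapse.\<close>

lemma edge_stab_lift:
  assumes ab: "(a, b) \<in> E" "(a, b) \<notin> R" and g: "g \<in> Q.stab (c a)" "g \<in> Q.stab (c b)"
  shows "g \<in> stab a \<and> g \<in> stab b"
proof -
  have gc: "g \<in> carrier G" and V: "a \<in> V" "b \<in> V" using g ab E_in_V by (auto simp: Q.stab_iff)
  have "c (act g a) = c a" "c (act g b) = c b" using g gc V by (simp_all add: Q.stab_iff actQ_c)
  then have "(a, act g a) \<in> R" "(b, act g b) \<in> R" using c_eq V act_closed[OF gc] R_sym by blast+
  then have "act g a = a \<and> act g b = b" using unique_lift[OF ab act_E[OF gc ab(1)]] by blast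
  then show ?thesis using gc by (simp add: stab_iff)
qed

lemma stab_le: "a \<in> V \<Longrightarrow> stab a \<subseteq> Q.stab (c a)"
  by (auto simp: Q.stab_iff stab_iff actQ_c)

end

context tree_act
begin

text \<open>The restriction on \<open>W\<close> prevents the collapse from enlarging stabilizers of
  points of \<open>W\<close> and from identifying two of these points.\<close>

definition admissible :: "'v set \<Rightarrow> 'v rel \<Rightarrow> bool" where
  "admissible W R \<longleftrightarrow> collapse V E G act R \<and> (\<forall>w\<in>W. \<forall>w'\<in>W. (w, w') \<in> R \<longrightarrow> w = w')"

lemma collapseI:
  assumes "equiv V R" "R \<subseteq> (E \<inter> R)\<^sup>*"
    "\<And>g a b. g \<in> carrier G \<Longrightarrow> (a, b) \<in> R \<Longrightarrow> (act g a, act g b) \<in> R"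
  shows "collapse V E G act R"
  by unfold_locales (use assms in auto)

text \<open>Being admissible concerns only finitely many pairs at a time or is witnessed by a path
  inside one relation, so unions of chains are admissible and Zorn's lemma applies.\<close>

lemma exists_maximal_admissible:
  assumes "W \<subseteq> V"
  obtains R where "admissible W R" "\<And>R'. admissible W R' \<Longrightarrow> R \<subseteq> R' \<Longrightarrow> R' = R"
proof -
  have "\<exists>M\<in>{R. admissible W R}. \<forall>X\<in>{R. admissible W R}. M \<subseteq> X \<longrightarrow> X = M"
  proof (rule subset_Zorn_nonempty)
    have "collapse V E G act (Id_on V)"
      by (rule collapseI) (auto simp: equiv_def refl_on_def sym_def trans_def act_closed)
    then have "admissible W (Id_on V)" by (auto simp: admissible_def)
    then show "{R. admissible W R} \<noteq> {}" by blast
    fix \<C> assume ne: "\<C> \<noteq> {}" and ch: "subset.chain {R. admissible W R} \<C>"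
    have col: "collapse V E G act R" and Wc: "\<And>w w'. w \<in> W \<Longrightarrow> w' \<in> W \<Longrightarrow> (w, w') \<in> R \<Longrightarrow> w = w'"
      if "R \<in> \<C>" for R
      using ch that by (auto simp: subset.chain_def admissible_def)
    have two: "\<exists>R\<in>\<C>. a \<in> R \<and> b \<in> R" if ab: "a \<in> \<Union>\<C>" "b \<in> \<Union>\<C>" for a b
    proof -
      obtain C D where cd: "C \<in> \<C>" "a \<in> C" "D \<in> \<C>" "b \<in> D" using ab by blast
      then have "C \<subseteq> D \<or> D \<subseteq> C" using ch by (auto simp: subset.chain_def subset_chain_def)
      then show ?thesis using cd by blast
    qed
    obtain R0 where R0: "R0 \<in> \<C>" using ne by blast
    have "collapse V E G act (\<Union>\<C>)"
    proof (rule collapseI)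
      show "equiv V (\<Union>\<C>)"
      proof (rule equivI)
        show "\<Union>\<C> \<subseteq> V \<times> V"
        proof (rule subrelI)
          fix a b assume "(a, b) \<in> \<Union>\<C>"
          then obtain R where R: "R \<in> \<C>" "(a, b) \<in> R" by blast
          show "(a, b) \<in> V \<times> V" using collapse.R_V[OF col[OF R(1)] R(2)] by blast
        qed
        show "refl_on V (\<Union>\<C>)"
          using collapse.R_refl[OF col[OF R0]] R0 by (auto simp: refl_on_def)
        show "sym (\<Union>\<C>)"
        proof (rule symI)
          fix a b assume "(a, b) \<in> \<Union>\<C>"
          then obtain R where R: "R \<in> \<C>" "(a, b) \<in> R" by blast
          show "(b, a) \<in> \<Union>\<C>" using collapse.R_sym[OF col[OF R(1)] R(2)] R(1) by blast
        qed
        show "trans (\<Union>\<C>)"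
        proof (rule transI)
          fix x y z assume "(x, y) \<in> \<Union>\<C>" "(y, z) \<in> \<Union>\<C>"
          then obtain R where "R \<in> \<C>" "(x, y) \<in> R" "(y, z) \<in> R" using two by blast
          then show "(x, z) \<in> \<Union>\<C>" using collapse.R_trans[OF col[OF \<open>R \<in> \<C>\<close>]] by blast
        qed
      qed
      show "\<Union>\<C> \<subseteq> (E \<inter> \<Union>\<C>)\<^sup>*"
      proof (rule Union_least)
        fix R assume R: "R \<in> \<C>"
        have "R \<subseteq> (E \<inter> R)\<^sup>*" using col[OF R] by (rule collapse.R_conn)
        also have "\<dots> \<subseteq> (E \<inter> \<Union>\<C>)\<^sup>*" using R by (intro rtrancl_mono) blast
        finally show "R \<subseteq> (E \<inter> \<Union>\<C>)\<^sup>*" .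
      qed
      show "(act g a, act g b) \<in> \<Union>\<C>" if g: "g \<in> carrier G" "(a, b) \<in> \<Union>\<C>" for g a b
      proof -
        obtain R where R: "R \<in> \<C>" "(a, b) \<in> R" using g(2) by blast
        then show ?thesis using collapse.R_inv[OF col[OF R(1)] g(1) R(2)] by blast
      qed
    qed
    then have "admissible W (\<Union>\<C>)" unfolding admissible_def using Wc by blast
    then show "\<Union>\<C> \<in> {R. admissible W R}" by simp
  qed
  then show thesis using that by blast
qed

end

text \<open>If the stabilizer of \<open>A\<close> fixed the neighbour \<open>B\<close> in a
  different orbit, each translate of \<open>A\<close> could be merged into the corresponding
  translate of \<open>B\<close>. The class \<open>A\<close> contains no point of \<open>W\<close>,
  so the larger relation is still admissible, against maximality.\<close>

lemma (in collapse) maximal_reduced: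
  assumes W: "W \<subseteq> V" "\<And>g w. g \<in> carrier G \<Longrightarrow> w \<in> W \<Longrightarrow> act g w \<in> W"
    and branch: "\<And>w a b. w \<in> W \<Longrightarrow> (a, b) \<in> E \<Longrightarrow> \<not> stab w \<subseteq> stab a \<inter> stab b"
    and adm: "admissible W R" and max: "\<And>R'. admissible W R' \<Longrightarrow> R \<subseteq> R' \<Longrightarrow> R' = R"
    and ab: "(A, B) \<in> EQ" and orb: "\<And>g. g \<in> carrier G \<Longrightarrow> actQ g A \<noteq> B"
  shows "\<not> Q.stab A \<subseteq> Q.stab B"
proof
  assume le: "Q.stab A \<subseteq> Q.stab B"
  obtain a b where e: "A = c a" "B = c b" "(a, b) \<in> E" "(a, b) \<notin> R" "a \<in> V" "b \<in> V"
    using ab by (rule EQE)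
  have AB: "A \<in> VQ" "B \<in> VQ" using e by (auto simp: VQ_iff)
  \<comment> \<open>For a point \<open>w\<close> of \<open>W\<close> in the class \<open>A\<close>
    the stabilizer of \<open>w\<close> would fix \<open>A\<close>, hence \<open>B\<close>, hence the
    lifted edge; \<open>branch\<close> excludes this.\<close>
  have noW: "(w, a) \<notin> R" if "w \<in> W" for w
  proof
    assume "(w, a) \<in> R"
    then have "c w = A" using c_eq R_V e(1) by blast
    have "stab w \<subseteq> Q.stab A" using stab_le[of w] W(1) that \<open>c w = A\<close> by blast
    then have "stab w \<subseteq> stab a \<inter> stab b" using edge_stab_lift[OF e(3,4)] le e(1,2) by blast
    then show False using branch that e(3) by blast
  qed
  define orbA where "orbA = {actQ g A | g. g \<in> carrier G}"
  \<comment> \<open>The inclusion of stabilizers makes the assignment of \<open>actQ g B\<close> to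
    \<open>actQ g A\<close> independent of \<open>g\<close>.\<close>
  have Q_eq: "actQ g B = actQ h B" if g: "g \<in> carrier G" "h \<in> carrier G" "actQ g A = actQ h A" for g h
  proof -
    have "actQ (inv h \<otimes> g) A = A" using g AB Q.act_mult Q.act_inv by simp
    then have "inv h \<otimes> g \<in> Q.stab A" using g by (simp add: Q.stab_iff)
    then have "inv h \<otimes> g \<in> Q.stab B" using le by blast
    then have "actQ (inv h) (actQ g B) = B" using g AB Q.act_mult by (simp add: Q.stab_iff)
    then have "actQ h (actQ (inv h) (actQ g B)) = actQ h B" by simp
    then show ?thesis using g AB Q.act_inv' Q.act_closed by simp
  qed
  define f where "f C = (if C \<in> orbA then actQ (SOME g. g \<in> carrier G \<and> C = actQ g A) B else C)" for C
  have fA: "f (actQ g A) = actQ g B" if g: "g \<in> carrier G" for g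
  proof -
    have ex: "\<exists>h. h \<in> carrier G \<and> actQ g A = actQ h A" using g by blast
    define h where "h = (SOME h. h \<in> carrier G \<and> actQ g A = actQ h A)"
    have h: "h \<in> carrier G" "actQ g A = actQ h A" using someI_ex[OF ex] unfolding h_def by auto
    have "actQ g A \<in> orbA" using g by (auto simp: orbA_def)
    then have "f (actQ g A) = actQ h B" unfolding f_def h_def by simp
    then show ?thesis using Q_eq[OF g h] by simp
  qed
  have fn: "f C = C" if "C \<notin> orbA" for C using that by (simp add: f_def)
  have orb_inv: "actQ g C \<in> orbA \<longleftrightarrow> C \<in> orbA" if g: "g \<in> carrier G" and C: "C \<in> VQ" for g C
  proof
    assume "actQ g C \<in> orbA"
    then obtain h where h: "h \<in> carrier G" "actQ g C = actQ h A" by (auto simp: orbA_def)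
    then have "actQ (inv g) (actQ g C) = actQ (inv g \<otimes> h) A" using g AB Q.act_mult by simp
    then have "C = actQ (inv g \<otimes> h) A" using g C Q.act_inv by simp
    then show "C \<in> orbA" using g h unfolding orbA_def by blast
  next
    assume "C \<in> orbA"
    then obtain h where h: "h \<in> carrier G" "C = actQ h A" by (auto simp: orbA_def)
    then have "actQ g C = actQ (g \<otimes> h) A" using g AB Q.act_mult by simp
    then show "actQ g C \<in> orbA" using g h unfolding orbA_def by blast
  qed
  have f_equiv: "f (actQ g C) = actQ g (f C)" if g: "g \<in> carrier G" and C: "C \<in> VQ" for g C
  proof (cases "C \<in> orbA")
    case True
    then obtain h where h: "h \<in> carrier G" "C = actQ h A" by (auto simp: orbA_def)
    have "actQ g C = actQ (g \<otimes> h) A" using g h AB Q.act_mult by simp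
    then have "f (actQ g C) = actQ (g \<otimes> h) B" using fA g h by simp
    also have "\<dots> = actQ g (actQ h B)" using g h AB Q.act_mult by simp
    also have "\<dots> = actQ g (f C)" using fA[OF h(1)] h(2) by simp
    finally show ?thesis .
  next
    case False
    then show ?thesis using fn orb_inv[OF g C] by simp
  qed
  \<comment> \<open>Translates of \<open>B\<close> are not in the orbit of \<open>A\<close>, so
    \<open>f\<close> leaves them alone; in particular \<open>f\<close> identifies \<open>A\<close>
    with \<open>B\<close>.\<close>
  have B_orb: "actQ g B \<notin> orbA" if g: "g \<in> carrier G" for g
  proof -
    have "B \<notin> orbA" using orb by (auto simp: orbA_def)
    then show ?thesis using orb_inv[OF g AB(2)] by simp
  qed
  have cV: "c p \<in> VQ" if "p \<in> V" for p using that by (auto simp: VQ_iff)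
  define R' where "R' = {(p, q). p \<in> V \<and> q \<in> V \<and> f (c p) = f (c q)}"
  have RR': "R \<subseteq> R'"
  proof (rule subrelI)
    fix p q assume "(p, q) \<in> R"
    then have "p \<in> V" "q \<in> V" "c p = c q" using c_eq R_V by blast+
    then show "(p, q) \<in> R'" by (simp add: R'_def)
  qed
  have symE: "sym (E \<inter> R')" using E_sym unfolding sym_def R'_def by auto
  have mono: "(p, q) \<in> (E \<inter> R')\<^sup>*" if "(p, q) \<in> R" for p q
  proof -
    have "(E \<inter> R)\<^sup>* \<subseteq> (E \<inter> R')\<^sup>*" using RR' by (intro rtrancl_mono) blast
    then show ?thesis using R_conn that by blast
  qed
  have link: "\<exists>q\<in>V. c q = f (c p) \<and> (p, q) \<in> (E \<inter> R')\<^sup>*" if p: "p \<in> V" for p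
  proof (cases "c p \<in> orbA")
    case False
    then show ?thesis using fn p by (intro bexI[of _ p]) simp_all
  next
    case True
    then obtain g where g: "g \<in> carrier G" "c p = actQ g A" by (auto simp: orbA_def)
    have ga: "act g a \<in> V" "act g b \<in> V" using g e act_closed by auto
    have ca: "c (act g a) = actQ g A" "c (act g b) = actQ g B" using g e by (simp_all add: actQ_c)
    have "(p, act g a) \<in> R" using c_eq[OF p ga(1)] g ca by simp
    then have 1: "(p, act g a) \<in> (E \<inter> R')\<^sup>*" by (rule mono)
    have "f (c (act g a)) = f (c (act g b))" using ca fA[OF g(1)] fn[OF B_orb[OF g(1)]] by simp
    then have "(act g a, act g b) \<in> E \<inter> R'" using act_E[OF g(1) e(3)] ga by (simp add: R'_def)
    with 1 have "(p, act g b) \<in> (E \<inter> R')\<^sup>*" by (rule rtrancl.rtrancl_into_rtrancl)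
    moreover have "c (act g b) = f (c p)" using ca fA[OF g(1)] g(2) by simp
    ultimately show ?thesis using ga by blast
  qed
  have "collapse V E G act R'"
  proof (rule collapseI)
    show "equiv V R'"
      by (rule equivI) (auto simp: R'_def refl_on_def sym_def trans_def)
    show "R' \<subseteq> (E \<inter> R')\<^sup>*"
    proof (rule subrelI)
      fix p p' assume pp: "(p, p') \<in> R'"
      then have pV: "p \<in> V" "p' \<in> V" "f (c p) = f (c p')" by (auto simp: R'_def)
      obtain q where q: "q \<in> V" "c q = f (c p)" "(p, q) \<in> (E \<inter> R')\<^sup>*" using link[OF pV(1)] by blast
      obtain q' where q': "q' \<in> V" "c q' = f (c p')" "(p', q') \<in> (E \<inter> R')\<^sup>*" using link[OF pV(2)] by blast
      have "(q, q') \<in> R" using c_eq[OF q(1) q'(1)] q q' pV by simp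
      then have "(q, q') \<in> (E \<inter> R')\<^sup>*" by (rule mono)
      moreover have "(q', p') \<in> (E \<inter> R')\<^sup>*" using sym_rtrancl[OF symE] q'(3) by (rule symD)
      ultimately show "(p, p') \<in> (E \<inter> R')\<^sup>*" using q(3) by (meson rtrancl_trans)
    qed
    show "(act g p, act g q) \<in> R'" if g: "g \<in> carrier G" and pq: "(p, q) \<in> R'" for g p q
    proof -
      have V: "p \<in> V" "q \<in> V" "f (c p) = f (c q)" using pq by (auto simp: R'_def)
      have "f (c (act g p)) = actQ g (f (c p))" "f (c (act g q)) = actQ g (f (c q))"
        using f_equiv[OF g cV[OF V(1)]] f_equiv[OF g cV[OF V(2)]] actQ_c[OF g] V by simp_all
      then show ?thesis using V act_closed[OF g] by (simp add: R'_def)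
    qed
  qed
  moreover have "w = w'" if w: "w \<in> W" "w' \<in> W" "(w, w') \<in> R'" for w w'
  proof -
    have nw: "c u \<notin> orbA" if u: "u \<in> W" for u
    proof
      assume "c u \<in> orbA"
      then obtain g where g: "g \<in> carrier G" "c u = actQ g A" by (auto simp: orbA_def)
      then have "c u = c (act g a)" using e by (simp add: actQ_c)
      then have "(u, act g a) \<in> R" using c_eq W(1) u act_closed[OF g(1) e(5)] by blast
      then have "(act (inv g) u, act (inv g) (act g a)) \<in> R" using R_inv g(1) by simp
      then have "(act (inv g) u, a) \<in> R" using act_inv[OF g(1) e(5)] by simp
      moreover have "act (inv g) u \<in> W" using W(2) g(1) u by simp
      ultimately show False using noW by blast
    qed
    have "c w = c w'" using w fn nw by (simp add: R'_def)
    then have "(w, w') \<in> R" using c_eq W(1) w by blast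
    then show ?thesis using adm w unfolding admissible_def by blast
  qed
  ultimately have "admissible W R'" unfolding admissible_def by blast
  then have "R' = R" using max RR' by blast
  moreover have "(a, b) \<in> R'"
  proof -
    have "f A = B" using fA[OF one_closed] AB Q.act_one by simp
    moreover have "f B = B" using fn[OF B_orb[OF one_closed]] AB Q.act_one by simp
    ultimately show ?thesis using e by (simp add: R'_def)
  qed
  ultimately show False using e by blast
qed

section \<open>The incidence tree of vertices and cylinders\<close>

text \<open>
  A cylinder is represented by the common centralizer of its edge stabilizers, and every vertex of
  the tree is kept: the tree of cylinders arises by deleting the vertices that lie in a single cylinder.
\<close>
locale cyl_tree = tree_act V E G act
  for V :: "'v set" and E and G :: "'g monoid" (structure) and act +
  assumes csa_G: "CSA G"
    and edge_abelian: "(x, y) \<in> E \<Longrightarrow> a \<in> stab x \<inter> stab y \<Longrightarrow> b \<in> stab x \<inter> stab y \<Longrightarrow> a \<otimes> b = b \<otimes> a"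
    and edge_nontrivial: "(x, y) \<in> E \<Longrightarrow> stab x \<inter> stab y \<noteq> {\<one>}"
begin

sublocale csa G
  by unfold_locales (rule csa_G)

definition cent :: "'v \<Rightarrow> 'v \<Rightarrow> 'g set" where
  "cent x y = {g \<in> carrier G. \<forall>a\<in>stab x \<inter> stab y. comm a g}"

lemma cent_sym: "cent x y = cent y x"
  by (simp add: cent_def Int_commute)

lemma cent_carrier: "g \<in> cent x y \<Longrightarrow> g \<in> carrier G"
  by (simp add: cent_def)

lemma edge_nontrivialE:
  assumes "(x, y) \<in> E"
  obtains a where "a \<in> stab x \<inter> stab y" "a \<noteq> \<one>" "a \<in> carrier G"
proof -
  have "\<one> \<in> stab x \<inter> stab y" using E_in_V[OF assms] act_one by (simp add: stab_iff)
  then obtain a where "a \<in> stab x \<inter> stab y" "a \<noteq> \<one>" using edge_nontrivial[OF assms] by blast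
  then show thesis using that by (auto simp: stab_iff)
qed

lemma edge_stab_cent: "(x, y) \<in> E \<Longrightarrow> stab x \<inter> stab y \<subseteq> cent x y"
  using edge_abelian[of x y] by (auto simp: cent_def comm_def stab_iff)

lemma cent_comm:
  assumes "(x, y) \<in> E" "g \<in> cent x y" "h \<in> cent x y"
  shows "comm g h"
proof -
  obtain a where "a \<in> stab x \<inter> stab y" "a \<noteq> \<one>" "a \<in> carrier G" by (rule edge_nontrivialE[OF assms(1)])
  then show ?thesis using comm_trans[of a g h] assms by (auto simp: cent_def)
qed

text \<open>Everything in the first centralizer commutes with \<open>g\<close>, and so does the
  second edge stabilizer; transitivity of commutation through \<open>g\<close> does the rest. By
  symmetry, distinct centralizers meet trivially.\<close>

lemma cent_subset:
  assumes xy: "(x, y) \<in> E" and xy': "(x', y') \<in> E" and g: "g \<in> cent x y" "g \<in> cent x' y'" "g \<noteq> \<one>"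
  shows "cent x y \<subseteq> cent x' y'"
proof
  fix h assume h: "h \<in> cent x y"
  have gh: "comm g h" using cent_comm[OF xy g(1) h] .
  have "comm b h" if b: "b \<in> stab x' \<inter> stab y'" for b
  proof -
    have "comm g b" using g(2) b comm_sym by (auto simp: cent_def)
    moreover have "b \<in> carrier G" using b by (simp add: stab_iff)
    ultimately show ?thesis
      using comm_trans[of g b h] gh g cent_carrier[OF g(1)] cent_carrier[OF h] by blast
  qed
  then show "h \<in> cent x' y'" using cent_carrier[OF h] by (simp add: cent_def)
qed

lemma cent_unique:
  assumes "(x, y) \<in> E" "(x', y') \<in> E" "g \<in> cent x y" "g \<in> cent x' y'" "g \<noteq> \<one>"
  shows "cent x y = cent x' y'"
  using cent_subset[OF assms(1,2,3,4,5)] cent_subset[OF assms(2,1,4,3,5)] by (rule equalityI)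

definition cj :: "'g \<Rightarrow> 'g set \<Rightarrow> 'g set" where
  "cj g M = (\<lambda>m. g \<otimes> m \<otimes> inv g) ` M"

lemma conj_stab:
  assumes "g \<in> carrier G" "a \<in> stab x" "x \<in> V"
  shows "g \<otimes> a \<otimes> inv g \<in> stab (act g x)"
  using assms by (simp add: stab_iff act_mult act_closed act_inv)

lemma conj_comm: "g \<in> carrier G \<Longrightarrow> a \<in> carrier G \<Longrightarrow> b \<in> carrier G \<Longrightarrow> comm a b \<Longrightarrow>
    comm (g \<otimes> a \<otimes> inv g) (g \<otimes> b \<otimes> inv g)"
proof -
  assume c: "g \<in> carrier G" "a \<in> carrier G" "b \<in> carrier G" "comm a b"
  have "g \<otimes> x \<otimes> inv g \<otimes> (g \<otimes> y \<otimes> inv g) = g \<otimes> (x \<otimes> y) \<otimes> inv g"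
    if "x \<in> carrier G" "y \<in> carrier G" for x y
  proof -
    have "inv g \<otimes> (g \<otimes> (y \<otimes> inv g)) = y \<otimes> inv g" using c that by (simp add: m_assoc[symmetric])
    then show ?thesis using c that by (simp add: m_assoc)
  qed
  then show ?thesis using c by (simp add: comm_def)
qed

lemma conj_conj:
  assumes "g \<in> carrier G" "h \<in> carrier G" "a \<in> carrier G"
  shows "g \<otimes> (h \<otimes> a \<otimes> inv h) \<otimes> inv g = (g \<otimes> h) \<otimes> a \<otimes> inv (g \<otimes> h)"
  using assms by (simp add: m_assoc inv_mult_group)

lemma cent_conj_subset:
  assumes g: "g \<in> carrier G" and xy: "(x, y) \<in> E"
  shows "cj g (cent x y) \<subseteq> cent (act g x) (act g y)"
proof
  fix k assume "k \<in> cj g (cent x y)"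
  then obtain m where m: "m \<in> cent x y" "k = g \<otimes> m \<otimes> inv g" by (auto simp: cj_def)
  have mc: "m \<in> carrier G" using m cent_carrier by blast
  have V: "x \<in> V" "y \<in> V" using E_in_V xy by auto
  have "comm b k" if b: "b \<in> stab (act g x) \<inter> stab (act g y)" for b
  proof -
    have bc: "b \<in> carrier G" using b by (simp add: stab_iff)
    define a where "a = inv g \<otimes> b \<otimes> inv (inv g)"
    have "a \<in> stab (act (inv g) (act g x))" "a \<in> stab (act (inv g) (act g y))"
      unfolding a_def using conj_stab[of "inv g" b] b g V act_closed by auto
    then have "a \<in> stab x \<inter> stab y" using act_inv g V by simp
    then have am: "comm a m" "a \<in> carrier G" using m by (auto simp: cent_def stab_iff)
    have "g \<otimes> a \<otimes> inv g = b"
      unfolding a_def using conj_conj[of g "inv g" b] g bc by simp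
    then show ?thesis using conj_comm[OF g am(2) mc am(1)] m(2) by simp
  qed
  then show "k \<in> cent (act g x) (act g y)" using m(2) mc g by (simp add: cent_def)
qed

lemma cj_cj: "g \<in> carrier G \<Longrightarrow> h \<in> carrier G \<Longrightarrow> M \<subseteq> carrier G \<Longrightarrow> cj g (cj h M) = cj (g \<otimes> h) M"
  unfolding cj_def image_image by (rule image_cong) (auto simp: conj_conj subset_iff)

lemma cj_one: "M \<subseteq> carrier G \<Longrightarrow> cj \<one> M = M"
proof -
  assume M: "M \<subseteq> carrier G"
  have "cj \<one> M = (\<lambda>m. m) ` M" unfolding cj_def by (rule image_cong) (use M in auto)
  then show ?thesis by simp
qed

lemma cent_conj:
  assumes g: "g \<in> carrier G" and xy: "(x, y) \<in> E"
  shows "cj g (cent x y) = cent (act g x) (act g y)"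
proof
  show "cj g (cent x y) \<subseteq> cent (act g x) (act g y)" by (rule cent_conj_subset[OF assms])
  have V: "x \<in> V" "y \<in> V" using E_in_V xy by auto
  have M: "cent (act g x) (act g y) \<subseteq> carrier G" using cent_carrier by blast
  have "cj (inv g) (cent (act g x) (act g y)) \<subseteq> cent x y"
    using cent_conj_subset[of "inv g" "act g x" "act g y"] g act_E[OF g xy] act_inv V by simp
  then have "cj g (cj (inv g) (cent (act g x) (act g y))) \<subseteq> cj g (cent x y)"
    unfolding cj_def[of g] by (rule image_mono)
  then show "cent (act g x) (act g y) \<subseteq> cj g (cent x y)"
    using cj_cj[of g "inv g"] g M by (simp add: cj_one)
qed

text \<open>A conjugate of a nontrivial edge element stays in the abelian group, so
  \<open>comm_conj\<close> applies. As a result the stabilizer of a cylinder is contained in the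
  centralizer and is abelian.\<close>

lemma cent_fixed:
  assumes g: "g \<in> carrier G" and xy: "(x, y) \<in> E" and eq: "cj g (cent x y) = cent x y"
  shows "g \<in> cent x y"
proof -
  obtain a where a: "a \<in> stab x \<inter> stab y" "a \<noteq> \<one>" "a \<in> carrier G" by (rule edge_nontrivialE[OF xy])
  have am: "a \<in> cent x y" using edge_stab_cent[OF xy] a by blast
  then have "g \<otimes> a \<otimes> inv g \<in> cent x y" using eq by (auto simp: cj_def)
  then have "comm a (g \<otimes> a \<otimes> inv g)" using cent_comm[OF xy am] by blast
  then have ag: "comm a g" using comm_conj[OF a(3,2) g] by blast
  have "comm b g" if b: "b \<in> stab x \<inter> stab y" for b
  proof -
    have "comm a b" using cent_comm[OF xy am] edge_stab_cent[OF xy] b by blast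
    moreover have "b \<in> carrier G" using b by (simp add: stab_iff)
    ultimately show ?thesis using comm_trans[OF a(3,2) _ _ g ag] by blast
  qed
  then show ?thesis using g by (simp add: cent_def)
qed

text \<open>The commuting elliptic elements of two equivalent edges show that cylinders are convex.\<close>
lemma cylinder_convex:
  assumes e: "(x, x') \<in> E" "(y, y') \<in> E" "cent x x' = cent y y'"
    and p: "rwalk E p" "hd p = x" "last p = y" "set p \<subseteq> V" and l: "Suc l < length p"
  shows "cent (p ! l) (p ! Suc l) = cent x x'"
proof -
  obtain a where a: "a \<in> stab x \<inter> stab x'" "a \<noteq> \<one>" "a \<in> carrier G" by (rule edge_nontrivialE[OF e(1)])
  obtain b where b: "b \<in> stab y \<inter> stab y'" "b \<noteq> \<one>" "b \<in> carrier G" by (rule edge_nontrivialE[OF e(2)])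
  have M: "a \<in> cent x x'" "b \<in> cent x x'" using edge_stab_cent e a b by blast+
  have "a \<otimes> b = b \<otimes> a" using cent_comm[OF e(1) M] by (simp add: comm_def)
  then have "(act a (p ! l) = p ! l \<and> act a (p ! Suc l) = p ! Suc l) \<or>
    (act b (p ! l) = p ! l \<and> act b (p ! Suc l) = p ! Suc l)"
    using commuting_fix_rwalk[of a b p l] a b p l by (simp add: stab_iff)
  then obtain d where d: "d \<in> {a, b}" "d \<in> stab (p ! l) \<inter> stab (p ! Suc l)"
    using a(3) b(3) by (auto simp: stab_iff)
  have E: "(p ! l, p ! Suc l) \<in> E" using p(1) l by (simp add: rwalk_def)
  have "d \<in> cent (p ! l) (p ! Suc l)" using edge_stab_cent[OF E] d by blast
  moreover have "d \<in> cent x x'" "d \<noteq> \<one>" using d M a b by auto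
  ultimately show ?thesis using cent_unique[OF E e(1)] by blast
qed

definition inc :: "'v \<Rightarrow> 'g set \<Rightarrow> bool" where
  "inc u M \<longleftrightarrow> (\<exists>y. (u, y) \<in> E \<and> cent u y = M)"

definition VB :: "('v + 'g set) set" where
  "VB = Inl ` V \<union> Inr ` (\<lambda>(x, y). cent x y) ` E"

definition EB :: "('v + 'g set) rel" where
  "EB = {(Inl u, Inr M) | u M. inc u M} \<union> {(Inr M, Inl u) | u M. inc u M}"

definition actB :: "'g \<Rightarrow> 'v + 'g set \<Rightarrow> 'v + 'g set" where
  "actB g = map_sum (act g) (cj g)"

lemma incE:
  assumes "inc u M" obtains y where "(u, y) \<in> E" "M = cent u y" "u \<in> V"
  using assms E_in_V by (auto simp: inc_def)

lemma inc_convex: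
  assumes "inc u M" "inc v M"
  obtains p where "rwalk E p" "hd p = u" "last p = v" "set p \<subseteq> V"
    "\<And>l. Suc l < length p \<Longrightarrow> cent (p ! l) (p ! Suc l) = M"
proof -
  obtain y where y: "(u, y) \<in> E" "M = cent u y" "u \<in> V" by (rule incE[OF assms(1)])
  obtain z where z: "(v, z) \<in> E" "M = cent v z" "v \<in> V" by (rule incE[OF assms(2)])
  obtain p where p: "rwalk E p" "hd p = u" "last p = v" "set p \<subseteq> V" using rwalk_exists y(3) z(3) by metis
  show thesis
  proof (rule that[OF p])
    show "cent (p ! l) (p ! Suc l) = M" if "Suc l < length p" for l
      using cylinder_convex[OF y(1) z(1) _ p that] y(2) z(2) by simp
  qed
qed

lemma inc_act: "g \<in> carrier G \<Longrightarrow> inc u M \<Longrightarrow> inc (act g u) (cj g M)"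
  unfolding inc_def using act_E cent_conj by blast

lemma inc_edge: "(x, y) \<in> E \<Longrightarrow> inc x (cent x y)" "(x, y) \<in> E \<Longrightarrow> inc y (cent x y)"
  using E_symD[of x y] cent_sym[of x y] by (auto simp: inc_def)

lemma Inr_VB: "inc u M \<Longrightarrow> Inr M \<in> VB"
  by (auto simp: VB_def inc_def)

lemma Inl_VB: "Inl u \<in> VB \<longleftrightarrow> u \<in> V"
  by (auto simp: VB_def)

lemma EB_iff: "(Inl u, Inr M) \<in> EB \<longleftrightarrow> inc u M" "(Inr M, Inl u) \<in> EB \<longleftrightarrow> inc u M"
  "(Inl u, Inl v) \<notin> EB" "(Inr M, Inr N) \<notin> EB"
  by (auto simp: EB_def)

lemma EBE:
  assumes "(p, q) \<in> EB"
  obtains u M where "p = Inl u" "q = Inr M" "inc u M" | u M where "p = Inr M" "q = Inl u" "inc u M"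
  using assms by (auto simp: EB_def)

lemma sym_EB: "sym EB"
  by (auto simp: sym_def EB_def)

lemma EB_VB: "EB \<subseteq> VB \<times> VB"
proof (rule subrelI)
  fix p q assume "(p, q) \<in> EB"
  then show "(p, q) \<in> VB \<times> VB"
    by (cases rule: EBE) (auto simp: Inr_VB Inl_VB elim: incE)
qed

lemma VBE:
  assumes "p \<in> VB"
  obtains u where "p = Inl u" "u \<in> V" | x y where "p = Inr (cent x y)" "(x, y) \<in> E"
  using assms by (auto simp: VB_def)

text \<open>The set \<open>D\<close> collects the half-trees at \<open>u\<close> beyond the edges of
  the cylinder \<open>M\<close>. Along edges of other cylinders membership in \<open>D\<close> is
  constant, all vertices of \<open>M\<close> except \<open>u\<close> belong to \<open>D\<close>, and
  \<open>u\<close> does not.\<close>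

lemma bridge_B_aux:
  assumes u: "inc u M"
  shows "(Inl u, Inr M) \<notin> (EB - {(Inl u, Inr M), (Inr M, Inl u)})\<^sup>*"
proof
  assume path: "(Inl u, Inr M) \<in> (EB - {(Inl u, Inr M), (Inr M, Inl u)})\<^sup>*"
  define D where "D = (\<Union>y\<in>{y. (u, y) \<in> E \<and> cent u y = M}. side u y)"
  have D_step: "b \<in> D" if ab: "(a, b) \<in> E" "cent a b \<noteq> M" "a \<in> D" for a b
  proof -
    obtain y where y: "(u, y) \<in> E" "cent u y = M" "a \<in> side u y" using ab(3) by (auto simp: D_def)
    have "(a, b) \<noteq> (u, y)" "(a, b) \<noteq> (y, u)" using ab(2) y(2) cent_sym by auto
    then have "b \<in> side u y" using side_step[OF ab(1)] y(3) by blast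
    then show ?thesis using y by (auto simp: D_def)
  qed
  have D_walk: "last p \<in> D" if "rwalk E p" "hd p \<in> D" "\<And>l. Suc l < length p \<Longrightarrow> cent (p ! l) (p ! Suc l) \<noteq> M" for p
    using that
  proof (induction p)
    case (Cons a p)
    show ?case
    proof (cases p)
      case Nil
      then show ?thesis using Cons by simp
    next
      case p: (Cons b q)
      have "(a, b) \<in> E" "cent a b \<noteq> M" using Cons.prems(1) Cons.prems(3)[of 0] p by simp_all
      then have "hd p \<in> D" using D_step Cons.prems(2) p by simp
      moreover have "rwalk E p" using Cons.prems(1) p by simp
      moreover have "cent (p ! l) (p ! Suc l) \<noteq> M" if "Suc l < length p" for l
        using Cons.prems(3)[of "Suc l"] that by simp
      ultimately have "last p \<in> D" using Cons.IH by blast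
      then show ?thesis using p by simp
    qed
  qed simp
  have uD: "u \<notin> D" using side_neighbour by (auto simp: D_def)
  have inD: "v \<in> D" if v: "inc v M" "v \<noteq> u" for v
  proof -
    obtain p where p: "rwalk E p" "hd p = u" "last p = v" "set p \<subseteq> V"
      "\<And>l. Suc l < length p \<Longrightarrow> cent (p ! l) (p ! Suc l) = M" using inc_convex[OF u v(1)] by blast
    obtain y q where q: "p = u # y # q"
      using p(1-3) v(2) by (metis hd_Cons_tl last_ConsL rwalk_Nil)
    have "(u, y) \<in> E" using p(1) q by simp
    moreover have "cent u y = M" using p(5)[of 0] q by simp
    moreover have "last (y # q) \<in> side u y" using rwalk_side[of u y q] p(1) q last_in_set[of "y # q"] by blast
    ultimately show ?thesis using p(3) q unfolding D_def by auto
  qed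
  \<comment> \<open>A two-colouring of the incidence tree that changes only across the edge between
    \<open>u\<close> and \<open>M\<close>: \<open>M\<close> itself counts as inside, any other
    cylinder inherits the colour common to its vertices.\<close>
  define sd where "sd p = (case p of Inl v \<Rightarrow> v \<in> D | Inr M' \<Rightarrow> M' = M \<or> (\<exists>v. inc v M' \<and> v \<in> D))" for p
  have sd: "sd (Inl v) \<longleftrightarrow> v \<in> D" "sd (Inr M') \<longleftrightarrow> M' = M \<or> (\<exists>v. inc v M' \<and> v \<in> D)" for v M'
    by (simp_all add: sd_def)
  have step: "sd (Inl v) \<longleftrightarrow> sd (Inr M')" if v: "inc v M'" "(v, M') \<noteq> (u, M)" for v M'
  proof (cases "M' = M")
    case True
    then show ?thesis using inD v by (simp add: sd)
  next
    case False
    have "v \<in> D" if w: "inc w M'" "w \<in> D" for w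
    proof -
      obtain p where p: "rwalk E p" "hd p = w" "last p = v" "set p \<subseteq> V"
        "\<And>l. Suc l < length p \<Longrightarrow> cent (p ! l) (p ! Suc l) = M'" using inc_convex[OF w(1) v(1)] by blast
      have "last p \<in> D" by (rule D_walk) (use p w False in auto)
      then show ?thesis using p(3) by simp
    qed
    then show ?thesis using False v by (auto simp: sd)
  qed
  have "sd (Inl u) \<longleftrightarrow> sd (Inr M)"
    using path
  proof (induction rule: rtrancl_induct)
    case (step y z)
    then have "(y, z) \<in> EB" by blast
    then have "sd y \<longleftrightarrow> sd z"
      using step(2) \<open>\<And>v M'. inc v M' \<Longrightarrow> (v, M') \<noteq> (u, M) \<Longrightarrow> sd (Inl v) \<longleftrightarrow> sd (Inr M')\<close>
      by (cases rule: EBE) auto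
    then show ?case using step(3) by simp
  qed simp
  then show False using uD by (simp add: sd)
qed

sublocale B: tree_act VB EB G actB
proof
  show "VB \<noteq> {}" using V_nonempty by (auto simp: VB_def)
  show "EB \<subseteq> VB \<times> VB" by (rule EB_VB)
  show "sym EB" by (rule sym_EB)
  show "(p, p) \<notin> EB" for p by (cases p) (simp_all add: EB_iff)
  have ll: "(Inl u, Inl v) \<in> EB\<^sup>*" if uv: "u \<in> V" "v \<in> V" for u v
    using connected[OF uv]
  proof (induction rule: rtrancl_induct)
    case (step y z)
    have "(Inl y, Inr (cent y z)) \<in> EB" "(Inr (cent y z), Inl z) \<in> EB"
      using inc_edge[OF step(2)] by (simp_all add: EB_iff)
    then show ?case using step(3) by (meson rtrancl.rtrancl_into_rtrancl)
  qed simp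
  have toL: "\<exists>u\<in>V. (p, Inl u) \<in> EB\<^sup>*" if "p \<in> VB" for p
    using that
  proof (cases rule: VBE)
    case (2 x y)
    then have "(p, Inl x) \<in> EB" using inc_edge by (simp add: EB_iff)
    then show ?thesis using E_in_V(1)[OF 2(2)] by blast
  qed blast
  show "(p, q) \<in> EB\<^sup>*" if pq: "p \<in> VB" "q \<in> VB" for p q
  proof -
    obtain u v where uv: "u \<in> V" "(p, Inl u) \<in> EB\<^sup>*" "v \<in> V" "(q, Inl v) \<in> EB\<^sup>*"
      using toL pq by blast
    have "(Inl v, q) \<in> EB\<^sup>*" using sym_rtrancl[OF sym_EB] uv(4) by (rule symD)
    then show ?thesis using uv ll by (meson rtrancl_trans)
  qed
  show "(p, q) \<notin> (EB - {(p, q), (q, p)})\<^sup>*" if "(p, q) \<in> EB" for p q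
    using that
  proof (cases rule: EBE)
    case (1 u M)
    then show ?thesis using bridge_B_aux by simp
  next
    case (2 u M)
    have "sym (EB - {(p, q), (q, p)})" using sym_EB unfolding sym_def by blast
    then have s: "sym ((EB - {(p, q), (q, p)})\<^sup>*)" by (rule sym_rtrancl)
    have "(q, p) \<notin> (EB - {(p, q), (q, p)})\<^sup>*"
      using bridge_B_aux[OF 2(3)] 2 by (simp add: insert_commute)
    then show ?thesis using s by (meson symD)
  qed
  show "actB \<one> p = p" if "p \<in> VB" for p
    using that by (cases rule: VBE) (auto simp: actB_def act_one cent_carrier intro!: cj_one)
  show "actB (g \<otimes> h) p = actB g (actB h p)" if "g \<in> carrier G" "h \<in> carrier G" "p \<in> VB" for g h p
    using that(3)
  proof (cases rule: VBE)
    case (2 x y)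
    have "cent x y \<subseteq> carrier G" using cent_carrier by blast
    then show ?thesis using 2 cj_cj that by (simp add: actB_def)
  qed (use that in \<open>simp add: actB_def act_mult\<close>)
  show "actB g p \<in> VB" if "g \<in> carrier G" "p \<in> VB" for g p
    using that(2)
  proof (cases rule: VBE)
    case (2 x y)
    then have "inc (act g x) (cj g (cent x y))" using inc_act inc_edge that by blast
    then show ?thesis using 2 Inr_VB by (simp add: actB_def)
  qed (use that act_closed in \<open>simp add: actB_def Inl_VB\<close>)
  show "(actB g p, actB g q) \<in> EB" if "g \<in> carrier G" "(p, q) \<in> EB" for g p q
    using that(2) by (cases rule: EBE) (use inc_act[OF that(1)] in \<open>simp_all add: actB_def EB_iff\<close>)
  show "\<not> (actB g p = q \<and> actB g q = p)" if "g \<in> carrier G" "(p, q) \<in> EB" for g p q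
    using that(2) by (cases rule: EBE) (simp_all add: actB_def)
qed

lemma stab_Inl: "B.stab (Inl u) = stab u"
  by (auto simp: B.stab_iff stab_iff actB_def)

lemma stab_Inr: "inc u M \<Longrightarrow> B.stab (Inr M) \<subseteq> M"
  using cent_fixed by (auto simp: B.stab_iff actB_def elim!: incE)

lemma edge_B_abelian:
  assumes "(p, q) \<in> EB" "a \<in> B.stab p \<inter> B.stab q" "b \<in> B.stab p \<inter> B.stab q"
  shows "comm a b"
  using assms(1)
proof (cases rule: EBE)
  case (1 u M)
  then have "a \<in> M" "b \<in> M" using stab_Inr assms by blast+
  then show ?thesis using 1(3) cent_comm by (auto elim!: incE)
next
  case (2 u M)
  then have "a \<in> M" "b \<in> M" using stab_Inr assms by blast+
  then show ?thesis using 2(3) cent_comm by (auto elim!: incE)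
qed

text \<open>A nontrivial element fixes at most one cylinder, so all the edges that it fixes meet in it.\<close>
lemma fixed_edges_star:
  assumes g: "g \<noteq> \<one>"
  obtains m where "\<And>p q. (p, q) \<in> EB \<Longrightarrow> g \<in> B.stab p \<Longrightarrow> g \<in> B.stab q \<Longrightarrow> p = m \<or> q = m"
proof (cases "\<exists>u M. inc u M \<and> g \<in> M")
  case False
  have "\<not> (g \<in> B.stab p \<and> g \<in> B.stab q)" if "(p, q) \<in> EB" for p q
    using that by (cases rule: EBE) (use False stab_Inr in blast)+
  then show ?thesis using that by blast
next
  case True
  then obtain u M where M: "inc u M" "g \<in> M" by blast
  have uniq: "M' = M" if M': "inc u' M'" "g \<in> M'" for u' M'
  proof -
    obtain y where y: "(u, y) \<in> E" "M = cent u y" by (rule incE[OF M(1)])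
    obtain y' where y': "(u', y') \<in> E" "M' = cent u' y'" by (rule incE[OF M'(1)])
    show ?thesis using cent_unique[OF y'(1) y(1), of g] y y' M M' g by simp
  qed
  have "p = Inr M \<or> q = Inr M" if pq: "(p, q) \<in> EB" "g \<in> B.stab p" "g \<in> B.stab q" for p q
    using pq(1)
  proof (cases rule: EBE)
    case (1 u' M')
    then show ?thesis using uniq[of u' M'] stab_Inr[of u' M'] pq by blast
  next
    case (2 u' M')
    then show ?thesis using uniq[of u' M'] stab_Inr[of u' M'] pq by blast
  qed
  then show ?thesis by (rule that)
qed

lemma countable_VB:
  assumes "countable V" shows "countable VB"
proof -
  have "countable E" using assms E_subset by (meson countable_SIGMA countable_subset)
  then show ?thesis unfolding VB_def using assms by (intro countable_Un countable_image)
qed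

end

lemma vwalk_arcs_nth: "Suc i < length p \<Longrightarrow> (p ! i, p ! Suc i) \<in> set (vwalk_arcs p)"
proof (induction p arbitrary: i rule: vwalk_arcs.induct)
  case (3 x y xs)
  then show ?case by (cases i) auto
qed auto

section \<open>Reduced acylindrical splittings of subgroups\<close>

text \<open>The condition \<open>noncomm\<close> works twice: edge groups are abelian, so none
  contains the intersection of \<open>H\<close> with the stabilizer of a point of \<open>W\<close>.
  Hence the maximal collapse is reduced, and points of \<open>W\<close> stay branching in
  it.\<close>

lemma (in cyl_tree) exists_reduced_splitting:
  assumes count: "countable V" and k: "k \<ge> 2"
    and H: "subgroup H G"
    and W: "W \<subseteq> V" "\<And>h w. h \<in> H \<Longrightarrow> w \<in> W \<Longrightarrow> act h w \<in> W"
    and noncomm: "\<And>w. w \<in> W \<Longrightarrow> \<exists>a\<in>H \<inter> stab w. \<exists>b\<in>H \<inter> stab w. \<not> comm a b"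
  obtains X :: "nat pair_pre_digraph" and \<beta> \<phi> where
    "splitting (subgrp G H) X \<beta>" "reduced (subgrp G H) X \<beta>" "acylindrical k (subgrp G H) X \<beta>"
    "\<And>x y. (x, y) \<in> parcs X \<Longrightarrow> subgroup (pointwise_stab (subgrp G H) \<beta> {x, y}) G \<and>
       comm_group (subgrp G (pointwise_stab (subgrp G H) \<beta> {x, y}))"
    "\<phi> ` W \<subseteq> pverts X" "inj_on \<phi> W" "\<And>h w. h \<in> H \<Longrightarrow> w \<in> W \<Longrightarrow> \<beta> h (\<phi> w) = \<phi> (act h w)"
    "\<And>w. w \<in> W \<Longrightarrow> stabilizer (subgrp G H) \<beta> (\<phi> w) = H \<inter> stab w"
    "\<And>w y. w \<in> W \<Longrightarrow> (\<phi> w, y) \<in> parcs X \<Longrightarrow>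
       \<not> stabilizer (subgrp G H) \<beta> (\<phi> w) \<subseteq> stabilizer (subgrp G H) \<beta> y"
proof -
  let ?H = "subgrp G H"
  have Hc: "H \<subseteq> carrier G" using H by (rule subgroup.subset)
  interpret BH: tree_act VB EB ?H actB by (rule B.tree_act_subgroup[OF H])
  have BH_stab: "BH.stab p = H \<inter> B.stab p" for p using Hc by (rule B.stabilizer_subgrp_Int)
  define WB where "WB = (Inl ` W :: ('v + 'g set) set)"
  have WB: "WB \<subseteq> VB" using W(1) by (auto simp: WB_def Inl_VB)
  obtain R where adm: "BH.admissible WB R" and max: "\<And>R'. BH.admissible WB R' \<Longrightarrow> R \<subseteq> R' \<Longrightarrow> R' = R"
    using BH.exists_maximal_admissible[OF WB] by blast
  interpret C: collapse VB EB ?H actB R using adm by (simp add: BH.admissible_def)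
  have W_inj: "w = w'" if "w \<in> W" "w' \<in> W" "(Inl w, Inl w') \<in> R" for w w'
    using adm that by (auto simp: BH.admissible_def WB_def)
  have lift: "C.Q.stab (C.c a) \<inter> C.Q.stab (C.c b) \<subseteq> H \<inter> (B.stab a \<inter> B.stab b)"
    if "(a, b) \<in> EB" "(a, b) \<notin> R" for a b
    using C.edge_stab_lift[OF that] BH_stab by blast
  have big: "\<not> H \<inter> stab w \<subseteq> B.stab a \<inter> B.stab b" if w: "w \<in> W" and ab: "(a, b) \<in> EB" for w a b
  proof
    assume "H \<inter> stab w \<subseteq> B.stab a \<inter> B.stab b"
    then show False using noncomm[OF w] edge_B_abelian[OF ab] by blast
  qed
  have red: "\<not> C.Q.stab A \<subseteq> C.Q.stab D"
    if AD: "(A, D) \<in> C.EQ" "\<And>g. g \<in> H \<Longrightarrow> C.actQ g A \<noteq> D" for A D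
  proof (rule C.maximal_reduced[OF WB _ _ adm max AD(1)])
    show "actB g w \<in> WB" if "g \<in> carrier ?H" "w \<in> WB" for g w
      using that W(2) by (auto simp: WB_def actB_def)
    show "\<not> BH.stab w \<subseteq> BH.stab a \<inter> BH.stab b" if w: "w \<in> WB" and ab: "(a, b) \<in> EB" for w a b
    proof -
      obtain u where u: "u \<in> W" "w = Inl u" using w by (auto simp: WB_def)
      show ?thesis
      proof
        assume "BH.stab w \<subseteq> BH.stab a \<inter> BH.stab b"
        then have "H \<inter> stab u \<subseteq> BH.stab a \<inter> BH.stab b" by (simp only: BH_stab u(2) stab_Inl)
        also have "\<dots> \<subseteq> B.stab a \<inter> B.stab b" unfolding BH_stab by (intro Int_mono Int_lower2)
        finally show False using big[OF u(1) ab] by (rule notE[rotated])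
      qed
    qed
    show "C.actQ g A \<noteq> D" if "g \<in> carrier ?H" for g using AD(2) that by simp
  qed
  have "C.VQ = C.c ` VB" by (auto simp: C.VQ_iff)
  then have "countable C.VQ" using countable_VB[OF count] by simp
  then obtain X :: "nat pair_pre_digraph" and \<beta> f where X: "splitting ?H X \<beta>" "bij_betw f C.VQ (pverts X)"
    "parcs X = (\<lambda>(x, y). (f x, f y)) ` C.EQ"
    "\<And>g x. x \<in> C.VQ \<Longrightarrow> g \<in> carrier ?H \<Longrightarrow> \<beta> g (f x) = f (C.actQ g x)"
    by (rule C.Q.countable_splitting) blast
  have pv: "pverts X = f ` C.VQ" and inj: "inj_on f C.VQ" using X(2) by (auto simp: bij_betw_def)
  interpret S: split_act ?H X \<beta> by unfold_locales (rule X(1))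
  have cVQ: "C.c a \<in> C.VQ" if "a \<in> VB" for a using that by (auto simp: C.VQ_iff)
  have stabX: "S.stab (f D) = C.Q.stab D" if D: "D \<in> C.VQ" for D
  proof -
    have "\<beta> g (f D) = f D \<longleftrightarrow> C.actQ g D = D" if "g \<in> carrier ?H" for g
      using X(4)[OF D that] C.Q.act_closed[OF that D] D inj by (simp add: inj_on_eq_iff)
    then show ?thesis by (auto simp: S.stab_iff C.Q.stab_iff)
  qed
  have edgeE: "\<exists>a b. x = f (C.c a) \<and> y = f (C.c b) \<and> (a, b) \<in> EB \<and> (a, b) \<notin> R \<and> a \<in> VB \<and> b \<in> VB"
    if xy: "(x, y) \<in> parcs X" for x y
  proof -
    obtain A D where AD: "(A, D) \<in> C.EQ" "x = f A" "y = f D" using xy unfolding X(3) by auto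
    from C.EQE[OF AD(1)] show ?thesis using AD(2,3) by metis
  qed
  define \<phi> where "\<phi> w = f (C.c (Inl w))" for w
  have WV: "Inl w \<in> VB" if "w \<in> W" for w using that W(1) by (auto simp: Inl_VB)
  \<comment> \<open>An element preserving the class of \<open>w\<close> moves \<open>w\<close> to a
    point of \<open>W\<close> in the same class, which can only be \<open>w\<close>. So the collapse
    does not enlarge this stabilizer.\<close>
  have stab_\<phi>: "S.stab (\<phi> w) = H \<inter> stab w" if w: "w \<in> W" for w
  proof -
    have "C.Q.stab (C.c (Inl w)) = BH.stab (Inl w)"
    proof
      show "BH.stab (Inl w) \<subseteq> C.Q.stab (C.c (Inl w))" by (rule C.stab_le[OF WV[OF w]])
      show "C.Q.stab (C.c (Inl w)) \<subseteq> BH.stab (Inl w)"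
      proof
        fix g assume g: "g \<in> C.Q.stab (C.c (Inl w))"
        then have gH: "g \<in> H" by (simp add: C.Q.stab_iff)
        have "C.c (actB g (Inl w)) = C.c (Inl w)"
          using g C.actQ_c[of g "Inl w"] gH WV[OF w] by (simp add: C.Q.stab_iff)
        moreover have "actB g (Inl w) = Inl (act g w)" by (simp add: actB_def)
        ultimately have "(Inl (act g w), Inl w) \<in> R"
          using C.c_eq[OF WV WV, of "act g w" w] W(2)[OF gH w] w by simp
        then have "act g w = w" using W_inj[OF W(2)[OF gH w] w] by blast
        then show "g \<in> BH.stab (Inl w)" using gH Hc unfolding BH_stab stab_Inl by (auto simp: stab_iff)
      qed
    qed
    then show ?thesis unfolding \<phi>_def stabX[OF cVQ[OF WV[OF w]]] BH_stab stab_Inl by simp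
  qed
  have reduced: "reduced ?H X \<beta>"
    unfolding reduced_def
  proof (clarify)
    fix x y assume xy: "(x, y) \<in> parcs X" and orb: "S.orb x \<noteq> S.orb y"
    have no: "\<beta> g x \<noteq> y" if g: "g \<in> H" for g
    proof
      assume e: "\<beta> g x = y"
      have gc: "g \<in> carrier ?H" using g by simp
      have x: "x \<in> pverts X" using S.E_in_V[OF xy] by blast
      have "S.orb x = S.orb y"
      proof (rule equalityI; rule subsetI)
        fix z assume "z \<in> S.orb x"
        then obtain h where h: "h \<in> carrier ?H" "z = \<beta> h x" by (auto simp: Group_Action.orbit_def)
        have ic: "inv\<^bsub>?H\<^esub> g \<in> carrier ?H" using gc by (rule BH.inv_closed)
        have hc: "h \<otimes>\<^bsub>?H\<^esub> inv\<^bsub>?H\<^esub> g \<in> carrier ?H" using h(1) ic by (rule BH.m_closed)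
        have "z = \<beta> (h \<otimes>\<^bsub>?H\<^esub> inv\<^bsub>?H\<^esub> g) y"
          using S.act_mult[OF h(1) ic, of y] S.act_inv[OF gc x] S.act_closed[OF gc x] e h(2) by simp
        then show "z \<in> S.orb y" using hc unfolding Group_Action.orbit_def by blast
      next
        fix z assume "z \<in> S.orb y"
        then obtain h where h: "h \<in> carrier ?H" "z = \<beta> h y" by (auto simp: Group_Action.orbit_def)
        have hc: "h \<otimes>\<^bsub>?H\<^esub> g \<in> carrier ?H" using h(1) gc by (rule BH.m_closed)
        have "z = \<beta> (h \<otimes>\<^bsub>?H\<^esub> g) x" using S.act_mult[OF h(1) gc x] e h(2) by simp
        then show "z \<in> S.orb x" using hc unfolding Group_Action.orbit_def by blast
      qed
      then show False using orb by blast
    qed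
    have no': "\<beta> g y \<noteq> x" if g: "g \<in> H" for g
    proof
      assume e: "\<beta> g y = x"
      have gc: "g \<in> carrier ?H" using g by simp
      have "\<beta> (inv\<^bsub>?H\<^esub> g) x = y" using S.act_inv[OF gc] S.E_in_V[OF xy] e by blast
      moreover have "inv\<^bsub>?H\<^esub> g \<in> H" using BH.inv_closed[OF gc] by simp
      ultimately show False using no by blast
    qed
    have nle: "\<not> S.stab x' \<subseteq> S.stab y'" if e: "(x', y') \<in> parcs X" "\<And>g. g \<in> H \<Longrightarrow> \<beta> g x' \<noteq> y'" for x' y'
    proof -
      obtain A D where AD: "(A, D) \<in> C.EQ" "x' = f A" "y' = f D" using e(1) unfolding X(3) by auto
      have V: "A \<in> C.VQ" "D \<in> C.VQ" using C.Q.E_in_V[OF AD(1)] by auto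
      have "C.actQ g A \<noteq> D" if "g \<in> H" for g using e(2)[OF that] X(4)[OF V(1), of g] that AD by auto
      then show ?thesis using red[OF AD(1)] AD(2,3) stabX V by simp
    qed
    show "pointwise_stab ?H \<beta> {x, y} \<subset> S.stab x \<and> pointwise_stab ?H \<beta> {x, y} \<subset> S.stab y"
      using nle[OF xy no] nle[OF S.E_symD[OF xy] no'] unfolding S.pointwise_stab_pair by blast
  qed
  have acyl: "acylindrical k ?H X \<beta>"
    unfolding acylindrical_def
  proof (intro allI impI)
    fix p assume p: "vpath p (with_proj X) \<and> vwalk_length p > k + 1"
    \<comment> \<open>Length greater than \<open>k + 1\<close>, with \<open>k \<ge> 2\<close>, means
      at least four edges, that is, five vertices.\<close>
    then have pd: "distinct p" "set p \<subseteq> pverts X" "set (vwalk_arcs p) \<subseteq> parcs X" and len: "length p \<ge> 5"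
      using k by (auto simp: vpath_def vwalk_def)
    show "pointwise_stab ?H \<beta> (set p) = {\<one>\<^bsub>?H\<^esub>}"
    proof (rule equalityI; rule subsetI)
      fix g assume g: "g \<in> pointwise_stab ?H \<beta> (set p)"
      show "g \<in> {\<one>\<^bsub>?H\<^esub>}"
      proof (rule ccontr)
        assume "g \<notin> {\<one>\<^bsub>?H\<^esub>}"
        then have "g \<noteq> \<one>" by simp
        then obtain m where m: "\<forall>p q. (p, q) \<in> EB \<longrightarrow> g \<in> B.stab p \<longrightarrow> g \<in> B.stab q \<longrightarrow> p = m \<or> q = m"
          using fixed_edges_star by metis
        have key: "p ! i = f (C.c m) \<or> p ! Suc i = f (C.c m)" if i: "Suc i < length p" for i
        proof -
          have "(p ! i, p ! Suc i) \<in> parcs X" using vwalk_arcs_nth[OF i] pd(3) by blast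
          then obtain a b where ab: "p ! i = f (C.c a)" "p ! Suc i = f (C.c b)" "(a, b) \<in> EB" "(a, b) \<notin> R"
            "a \<in> VB" "b \<in> VB" using edgeE by blast
          have "p ! i \<in> set p" "p ! Suc i \<in> set p" using i by simp_all
          then have "g \<in> S.stab (p ! i)" "g \<in> S.stab (p ! Suc i)"
            using g by (auto simp: pointwise_stab_def S.stab_iff)
          then have "g \<in> C.Q.stab (C.c a) \<inter> C.Q.stab (C.c b)"
            unfolding ab(1,2) stabX[OF cVQ[OF ab(5)]] stabX[OF cVQ[OF ab(6)]] by blast
          then have "g \<in> B.stab a" "g \<in> B.stab b" using lift[OF ab(3,4)] by blast+
          then have "a = m \<or> b = m" using m ab(3) by blast
          then show ?thesis using ab(1,2) by blast
        qed
        \<comment> \<open>The first and the third edge of the path have no vertex in common, but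
          both would have to contain the image of \<open>m\<close>.\<close>
        have "p ! 0 = f (C.c m) \<or> p ! Suc 0 = f (C.c m)" "p ! 2 = f (C.c m) \<or> p ! Suc 2 = f (C.c m)"
          using key[of 0] key[of 2] len by simp_all
        moreover have "p ! 0 \<noteq> p ! 2" "p ! 0 \<noteq> p ! Suc 2" "p ! Suc 0 \<noteq> p ! 2" "p ! Suc 0 \<noteq> p ! Suc 2"
          using nth_eq_iff_index_eq[OF pd(1), of 0 2] nth_eq_iff_index_eq[OF pd(1), of 0 "Suc 2"]
            nth_eq_iff_index_eq[OF pd(1), of "Suc 0" 2] nth_eq_iff_index_eq[OF pd(1), of "Suc 0" "Suc 2"] len
          by force+
        ultimately show False by metis
      qed
    next
      fix g assume "g \<in> {\<one>\<^bsub>?H\<^esub>}"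
      then have g: "g = \<one>\<^bsub>?H\<^esub>" by blast
      show "g \<in> pointwise_stab ?H \<beta> (set p)"
        unfolding g pointwise_stab_def using S.act_one BH.one_closed pd(2) by blast
    qed
  qed
  have edges: "subgroup (pointwise_stab ?H \<beta> {x, y}) G \<and> comm_group (subgrp G (pointwise_stab ?H \<beta> {x, y}))"
    if xy: "(x, y) \<in> parcs X" for x y
  proof -
    have V: "x \<in> pverts X" "y \<in> pverts X" using S.E_in_V[OF xy] by auto
    have "subgroup (S.stab x) G" "subgroup (S.stab y) G"
      using incl_subgroup[OF H] S.stab_subgroup V by blast+
    then have sg: "subgroup (pointwise_stab ?H \<beta> {x, y}) G"
      unfolding S.pointwise_stab_pair by (rule subgroups_Inter_pair)
    obtain a b where ab: "x = f (C.c a)" "y = f (C.c b)" "(a, b) \<in> EB" "(a, b) \<notin> R" "a \<in> VB" "b \<in> VB"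
      using edgeE[OF xy] by blast
    have "pointwise_stab ?H \<beta> {x, y} \<subseteq> B.stab a \<inter> B.stab b"
      unfolding S.pointwise_stab_pair unfolding ab(1,2) stabX[OF cVQ[OF ab(5)]] stabX[OF cVQ[OF ab(6)]]
      using lift[OF ab(3,4)] by blast
    then have "\<forall>g\<in>pointwise_stab ?H \<beta> {x, y}. \<forall>h\<in>pointwise_stab ?H \<beta> {x, y}. comm g h"
      using edge_B_abelian[OF ab(3)] by blast
    then show ?thesis using sg comm_group_subgrp_iff[OF sg] by blast
  qed
  have branch: "\<not> S.stab (\<phi> w) \<subseteq> S.stab y" if w: "w \<in> W" and e: "(\<phi> w, y) \<in> parcs X" for w y
  proof
    assume le: "S.stab (\<phi> w) \<subseteq> S.stab y"
    obtain a b where ab: "\<phi> w = f (C.c a)" "y = f (C.c b)" "(a, b) \<in> EB" "(a, b) \<notin> R" "a \<in> VB" "b \<in> VB"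
      using edgeE[OF e] by blast
    have "S.stab (\<phi> w) \<subseteq> S.stab (\<phi> w) \<inter> S.stab y" using le by blast
    also have "\<dots> \<subseteq> B.stab a \<inter> B.stab b"
      unfolding ab(1,2) stabX[OF cVQ[OF ab(5)]] stabX[OF cVQ[OF ab(6)]] using lift[OF ab(3,4)] by blast
    finally show False using big[OF w ab(3)] unfolding stab_\<phi>[OF w] by blast
  qed
  show thesis
  proof (rule that[OF X(1) reduced acyl edges _ _ _ stab_\<phi> branch])
    show "\<phi> ` W \<subseteq> pverts X" unfolding pv \<phi>_def using cVQ WV by blast
    show "inj_on \<phi> W"
    proof (rule inj_onI)
      fix w w' assume w: "w \<in> W" "w' \<in> W" "\<phi> w = \<phi> w'"
      then have "C.c (Inl w) = C.c (Inl w')" using inj cVQ WV unfolding \<phi>_def by (meson inj_onD)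
      then show "w = w'" using W_inj w C.c_eq WV by blast
    qed
    show "\<beta> h (\<phi> w) = \<phi> (act h w)" if h: "h \<in> H" and w: "w \<in> W" for h w
      using X(4)[OF cVQ[OF WV[OF w]], of h] C.actQ_c[of h "Inl w"] WV[OF w] h
      by (simp add: \<phi>_def actB_def)
  qed
qed

section \<open>The volume of a group with a flexible surface vertex group\<close>

text \<open>Suppose that the intersection is abelian. It is infinite, so it has a nontrivial element
  \<open>h\<close>. For \<open>g\<close> in \<open>\<Gamma>\<close> the conjugate of
  \<open>h\<close> stays in the intersection by normality and commutes with \<open>h\<close>, so
  \<open>g\<close> commutes with \<open>h\<close>. By transitivity \<open>\<Gamma>\<close> is
  abelian.\<close>

lemma (in csa) finite_index_noncomm:
  assumes tf: "torsion_free G" and H: "H \<lhd> G" "finite (rcosets H)"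
    and \<Gamma>: "subgroup \<Gamma> G" and ab: "a \<in> \<Gamma>" "b \<in> \<Gamma>" "\<not> comm a b"
  shows "\<exists>a\<in>H \<inter> \<Gamma>. \<exists>b\<in>H \<inter> \<Gamma>. \<not> comm a b"
proof (rule ccontr)
  assume "\<not> ?thesis"
  then have all: "\<And>a b. a \<in> H \<inter> \<Gamma> \<Longrightarrow> b \<in> H \<inter> \<Gamma> \<Longrightarrow> comm a b" by blast
  have Hs: "subgroup H G" using H(1) by (rule normal_imp_subgroup)
  have \<Gamma>c: "\<Gamma> \<subseteq> carrier G" using \<Gamma> by (rule subgroup.subset)
  have "\<Gamma> \<noteq> {\<one>}" using ab by (auto simp: comm_def)
  then have "infinite \<Gamma>" using torsion_free_infinite[OF tf \<Gamma>] by blast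
  then have "infinite (H \<inter> \<Gamma>)" by (rule infinite_Int[OF Hs H(2) \<Gamma>])
  then have "\<not> H \<inter> \<Gamma> \<subseteq> {\<one>}" by (meson finite.emptyI finite_insert finite_subset)
  then obtain h where h: "h \<in> H" "h \<in> \<Gamma>" "h \<noteq> \<one>" by blast
  have hc: "h \<in> carrier G" using h \<Gamma>c by blast
  have hg: "comm h g" if g: "g \<in> \<Gamma>" for g
  proof -
    have gc: "g \<in> carrier G" using g \<Gamma>c by blast
    have "g \<otimes> h \<otimes> inv g \<in> H" using H(1) gc h(1) by (rule normal.inv_op_closed2)
    moreover have "g \<otimes> h \<otimes> inv g \<in> \<Gamma>"
      using \<Gamma> g h(2) by (simp add: subgroup.m_closed subgroup.m_inv_closed)
    ultimately have "comm h (g \<otimes> h \<otimes> inv g)" using all h by blast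
    then show ?thesis using comm_conj[OF hc h(3) gc] by blast
  qed
  have "comm a b" using comm_trans[OF hc h(3) _ hg[OF ab(1)] _ hg[OF ab(2)]] ab \<Gamma>c by blast
  then show False using ab by blast
qed

lemma torsion_free_subgrp:
  assumes "torsion_free G" "H \<subseteq> carrier G"
  shows "torsion_free (subgrp G H)"
  using assms unfolding torsion_free_def by (auto simp: nat_pow_def)

lemma (in tree_act) stab_iso:
  assumes g: "g \<in> carrier G" and x: "x \<in> V"
  shows "subgrp G (stab x) \<cong> subgrp G (stab (act g x))"
proof -
  let ?f = "\<lambda>h. g \<otimes> h \<otimes> inv g"
  have fwd: "k \<otimes> h \<otimes> inv k \<in> stab (act k y)" if "k \<in> carrier G" "h \<in> stab y" "y \<in> V" for k h y
    using that by (simp add: stab_iff act_mult act_closed act_inv)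
  have sc: "h \<in> carrier G" if "h \<in> stab y" for h y using that by (simp add: stab_iff)
  have "?f \<in> hom (subgrp G (stab x)) (subgrp G (stab (act g x)))"
  proof (rule homI)
    fix h k assume hk: "h \<in> carrier (subgrp G (stab x))" "k \<in> carrier (subgrp G (stab x))"
    then have c: "h \<in> carrier G" "k \<in> carrier G" using sc by auto
    have "inv g \<otimes> (g \<otimes> (k \<otimes> inv g)) = k \<otimes> inv g" using c g by (simp add: m_assoc[symmetric])
    then have "?f (h \<otimes> k) = ?f h \<otimes> ?f k" using c g by (simp add: m_assoc)
    then show "?f (h \<otimes>\<^bsub>subgrp G (stab x)\<^esub> k) = ?f h \<otimes>\<^bsub>subgrp G (stab (act g x))\<^esub> ?f k" by simp
  qed (use fwd[OF g _ x] in simp)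
  moreover have "bij_betw ?f (stab x) (stab (act g x))"
  proof (rule bij_betw_byWitness[where f' = "\<lambda>h. inv g \<otimes> h \<otimes> g"])
    have e: "inv g \<otimes> (g \<otimes> z) = z" "g \<otimes> (inv g \<otimes> z) = z" if "z \<in> carrier G" for z
      using that g by (simp_all add: m_assoc[symmetric])
    show "\<forall>a\<in>stab x. inv g \<otimes> ?f a \<otimes> g = a" using g sc e by (simp add: m_assoc)
    show "\<forall>a\<in>stab (act g x). ?f (inv g \<otimes> a \<otimes> g) = a" using g sc e by (simp add: m_assoc)
    show "?f ` stab x \<subseteq> stab (act g x)" using fwd[OF g _ x] by blast
    show "(\<lambda>h. inv g \<otimes> h \<otimes> g) ` stab (act g x) \<subseteq> stab x"
      using fwd[of "inv g" _ "act g x"] g act_closed[OF g x] act_inv[OF g x] by auto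
  qed
  ultimately show ?thesis unfolding is_iso_def iso_def by auto
qed

text \<open>Torsion-freeness turns the nontrivial group \<open>A\<close> of the free splitting into
  an infinite one, as is required for the vertex stabilizers of finite index subgroups to remain
  nontrivial.\<close>

lemma surface_V_fin_ge:
  fixes G :: "'g monoid" (structure)
  assumes G: "group G" "torsion_free G" and \<Gamma>: "subgroup \<Gamma> G"
    and s: "bounded_surface_group (subgrp G \<Gamma>)" "\<not> comm_group (subgrp G \<Gamma>)"
    and N: "subgroup N (subgrp G \<Gamma>)" "finite (rcosets\<^bsub>subgrp G \<Gamma>\<^esub> N)"
  shows "of_nat (index (subgrp G \<Gamma>) N) \<le> V_fin (subgrp G N)"
proof -
  interpret group G by (rule G(1))
  interpret \<Gamma>: grp "subgrp G \<Gamma>" using subgroup_imp_group[OF \<Gamma>] by (rule grp.intro)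
  obtain A t P where h: "free_hnn (subgrp G \<Gamma>) A t P" "A \<noteq> {\<one>\<^bsub>subgrp G \<Gamma>\<^esub>}" "finitely_generated (subgrp G \<Gamma>)"
    by (rule bounded_surface_group_free_hnn[OF \<Gamma>.is_group s])
  interpret hnn "subgrp G \<Gamma>" A t P by unfold_locales (rule h(1))
  have "torsion_free (subgrp G \<Gamma>)" using G(2) subgroup.subset[OF \<Gamma>] by (rule torsion_free_subgrp)
  then have "infinite A" using \<Gamma>.torsion_free_infinite[OF _ A] h(2) by blast
  from V_fin_ge[OF this h(3) N] show ?thesis by simp
qed

lemma fg_abelian_rank_le_mono: "fg_abelian_rank_le A m \<Longrightarrow> m \<le> n \<Longrightarrow> fg_abelian_rank_le A n"
  unfolding fg_abelian_rank_le_def by (meson order_trans)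

text \<open>The group is a union of double cosets of \<open>H\<close> and the stabilizer of
  \<open>x\<close>, one for each orbit of \<open>H\<close> on the orbit of \<open>x\<close>. Each of
  them consists of as many cosets of \<open>H\<close> as the index of
  \<open>H \<inter> stab (rep q)\<close> in \<open>stab (rep q)\<close>.\<close>

lemma (in tree_act) card_rcosets_le_sum:
  assumes H: "subgroup H G" "finite (rcosets H)" and x: "x \<in> V" and F: "finite F"
    and rep: "\<And>q. q \<in> F \<Longrightarrow> \<exists>g\<in>carrier G. rep q = act g x"
    and cover: "\<And>g. g \<in> carrier G \<Longrightarrow> \<exists>q\<in>F. \<exists>h\<in>H. act g x = act h (rep q)"
  shows "card (rcosets H) \<le> (\<Sum>q\<in>F. index (subgrp G (stab (rep q))) (H \<inter> stab (rep q)))"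
proof -
  interpret grp G by unfold_locales
  have Hc: "H \<subseteq> carrier G" using H(1) by (rule subgroup.subset)
  obtain r where r: "\<And>q. q \<in> F \<Longrightarrow> r q \<in> carrier G \<and> rep q = act (r q) x" using rep by metis
  have rV: "rep q \<in> V" if "q \<in> F" for q using r[OF that] act_closed x by auto
  \<comment> \<open>Taking the union over the coset avoids the choice of a representative: all its
    terms are one and the same coset of \<open>H\<close>.\<close>
  define \<Phi> where "\<Phi> q = (\<lambda>D. \<Union>s\<in>D. H #> (s \<otimes> r q))" for q
  let ?I = "\<lambda>q. rcosets\<^bsub>subgrp G (stab (rep q))\<^esub> (H \<inter> stab (rep q))"
  have fin: "finite (?I q)" if "q \<in> F" for q
    using finite_rcosets_subgrp[OF H stab_subgroup[OF rV[OF that]]] .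
  have "C \<in> (\<Union>q\<in>F. \<Phi> q ` ?I q)" if C: "C \<in> rcosets H" for C
  proof -
    obtain g where g: "g \<in> carrier G" "C = H #> g" using C by (auto simp: rcosets_image)
    obtain q h where q: "q \<in> F" "h \<in> H" "act g x = act h (rep q)" using cover[OF g(1)] by blast
    have c: "h \<in> carrier G" "r q \<in> carrier G" "rep q = act (r q) x" using q Hc r[OF q(1)] by auto
    define s where "s = inv h \<otimes> (g \<otimes> inv (r q))"
    have sc: "s \<in> carrier G" using c g by (simp add: s_def)
    have "act s (rep q) = act (inv h) (act g (act (inv (r q)) (rep q)))"
      using c(1,2) g(1) rV[OF q(1)] act_closed by (simp add: s_def act_mult)
    also have "\<dots> = act (inv h) (act g x)" using c act_inv[OF c(2) x] by simp
    also have "\<dots> = rep q" using q(3) act_inv[OF c(1) rV[OF q(1)]] by simp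
    finally have s: "s \<in> stab (rep q)" using sc by (simp add: stab_iff)
    have gs: "g = h \<otimes> (s \<otimes> r q)"
    proof -
      have "s \<otimes> r q = inv h \<otimes> g" unfolding s_def using c g by (simp add: m_assoc)
      then show ?thesis using c g by (simp add: m_assoc[symmetric])
    qed
    have "H #> (u \<otimes> r q) = C" if u: "u \<in> (H \<inter> stab (rep q)) #> s" for u
    proof -
      obtain h' where h': "h' \<in> H" "u = h' \<otimes> s" using u by (auto simp: r_coset_def)
      have h'c: "h' \<in> carrier G" using h' Hc by blast
      have uc: "u \<in> carrier G" using h' h'c sc by simp
      have "(u \<otimes> r q) \<otimes> inv g = h' \<otimes> inv h"
      proof -
        have "(u \<otimes> r q) = h' \<otimes> (inv h \<otimes> g)"
          using h' h'c sc c g gs by (simp add: m_assoc) (simp add: m_assoc[symmetric])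
        then show ?thesis using h'c c g by (simp add: m_assoc)
      qed
      also have "\<dots> \<in> H" using H(1) h'(1) q(2) by (simp add: subgroup.m_closed subgroup.m_inv_closed)
      finally show ?thesis unfolding g(2) using rcos_eq_iff[OF H(1), of "u \<otimes> r q" g] uc c g by simp
    qed
    moreover have "s \<in> (H \<inter> stab (rep q)) #> s"
      using sc subgroup.one_closed[OF H(1)] subgroup.one_closed[OF stab_subgroup[OF rV[OF q(1)]]]
      by (force simp: r_coset_def)
    ultimately have "\<Phi> q ((H \<inter> stab (rep q)) #> s) = C" unfolding \<Phi>_def by blast
    moreover have "(H \<inter> stab (rep q)) #> s \<in> ?I q" using s unfolding rcosets_subgrp by blast
    ultimately show ?thesis using q(1) by blast
  qed
  then have "card (rcosets H) \<le> card (\<Union>q\<in>F. \<Phi> q ` ?I q)"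
    using fin F by (intro card_mono finite_UN_I finite_imageI) auto
  also have "\<dots> \<le> (\<Sum>q\<in>F. card (\<Phi> q ` ?I q))" using F by (rule card_UN_le)
  also have "\<dots> \<le> (\<Sum>q\<in>F. card (?I q))" using fin by (intro sum_mono card_image_le)
  finally show ?thesis by (simp add: index_def)
qed

lemma (in cyl_tree) card_rcosets_le_C_max_CSA:
  assumes tf: "torsion_free G" and count: "countable V" and k: "k \<ge> 2"
    and H: "H \<in> finite_index_normal G" and x: "x \<in> V" and moved: "\<exists>g\<in>carrier G. act g x \<noteq> x"
    and surf: "bounded_surface_group (subgrp G (stab x))" and nonab: "\<not> comm_group (subgrp G (stab x))"
    and rank: "\<And>A. subgroup A G \<Longrightarrow> comm_group (subgrp G A) \<Longrightarrow> fg_abelian_rank_le (subgrp G A) n"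
  shows "of_nat (card (rcosets H)) \<le> C_max_CSA k n (subgrp G H)"
proof -
  let ?H = "subgrp G H"
  have Hn: "H \<lhd> G" "finite (rcosets H)" using H by (auto simp: finite_index_normal_def)
  have Hs: "subgroup H G" using Hn(1) by (rule normal_imp_subgroup)
  have Hc: "H \<subseteq> carrier G" using Hs by (rule subgroup.subset)
  define W where "W = (\<lambda>g. act g x) ` carrier G"
  have WV: "W \<subseteq> V" using act_closed x by (auto simp: W_def)
  have surfW: "bounded_surface_group (subgrp G (stab w))" "\<not> comm_group (subgrp G (stab w))" if w: "w \<in> W" for w
  proof -
    obtain g where g: "g \<in> carrier G" "w = act g x" using w by (auto simp: W_def)
    have iso: "subgrp G (stab x) \<cong> subgrp G (stab w)" unfolding g(2) using g(1) x by (rule stab_iso)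
    have gr: "group (subgrp G (stab x))" "group (subgrp G (stab w))"
      using stab_subgroup x WV w by (auto intro: subgroup_imp_group)
    have iso': "subgrp G (stab w) \<cong> subgrp G (stab x)" using gr(1) iso by (rule group.iso_sym)
    then show "bounded_surface_group (subgrp G (stab w))"
      using surf iso_trans unfolding bounded_surface_group_def by blast
    show "\<not> comm_group (subgrp G (stab w))"
      using nonab comm_group.iso_imp_comm_group[OF _ iso'] gr(1) group.is_monoid by blast
  qed
  have noncomm: "\<exists>a\<in>H \<inter> stab w. \<exists>b\<in>H \<inter> stab w. \<not> comm a b" if w: "w \<in> W" for w
  proof -
    have sg: "subgroup (stab w) G" using stab_subgroup w WV by blast
    obtain a b where "a \<in> stab w" "b \<in> stab w" "\<not> comm a b"
      using surfW(2)[OF w] unfolding comm_group_subgrp_iff[OF sg] by blast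
    then show ?thesis by (rule finite_index_noncomm[OF tf Hn sg])
  qed
  have W_inv: "act h w \<in> W" if h: "h \<in> carrier G" and w: "w \<in> W" for h w
  proof -
    obtain g where g: "g \<in> carrier G" "w = act g x" using w by (auto simp: W_def)
    have "act h w = act (h \<otimes> g) x" using h g x by (simp add: act_mult)
    then show ?thesis using h g(1) unfolding W_def by blast
  qed
  have W_invH: "act h w \<in> W" if "h \<in> H" "w \<in> W" for h w using W_inv that Hc by blast
  obtain X :: "nat pair_pre_digraph" and \<beta> \<phi> where X: "splitting ?H X \<beta>" "reduced ?H X \<beta>" "acylindrical k ?H X \<beta>"
    and edges: "\<And>x y. (x, y) \<in> parcs X \<Longrightarrow> subgroup (pointwise_stab ?H \<beta> {x, y}) G \<and>
       comm_group (subgrp G (pointwise_stab ?H \<beta> {x, y}))"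
    and \<phi>: "\<phi> ` W \<subseteq> pverts X" "inj_on \<phi> W" "\<And>h w. h \<in> H \<Longrightarrow> w \<in> W \<Longrightarrow> \<beta> h (\<phi> w) = \<phi> (act h w)"
    and stab\<phi>: "\<And>w. w \<in> W \<Longrightarrow> stabilizer ?H \<beta> (\<phi> w) = H \<inter> stab w"
    and branch: "\<And>w y. w \<in> W \<Longrightarrow> (\<phi> w, y) \<in> parcs X \<Longrightarrow> \<not> stabilizer ?H \<beta> (\<phi> w) \<subseteq> stabilizer ?H \<beta> y"
    using exists_reduced_splitting[OF count k Hs WV W_invH noncomm] by metis
  interpret BS: branching_splitting ?H X \<beta> "\<phi> ` W"
  proof
    show "splitting ?H X \<beta>" by (rule X(1))
    show "\<phi> ` W \<subseteq> pverts X" by (rule \<phi>(1))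
    show "\<beta> g w \<in> \<phi> ` W" if "g \<in> carrier ?H" "w \<in> \<phi> ` W" for g w
      using that \<phi>(3) W_invH by auto
    show "\<not> stabilizer ?H \<beta> w \<subseteq> stabilizer ?H \<beta> y" if "w \<in> \<phi> ` W" "(w, y) \<in> parcs X" for w y
      using that branch by blast
    obtain g where g: "g \<in> carrier G" "act g x \<noteq> x" using moved by blast
    have "x \<in> W" using act_one[OF x] one_closed unfolding W_def by force
    moreover have "act g x \<in> W" using g(1) unfolding W_def by blast
    ultimately
    show "\<exists>w\<in>\<phi> ` W. \<exists>w'\<in>\<phi> ` W. w \<noteq> w'" using g(2) \<phi>(2) by (metis image_eqI inj_onD)
  qed
  let ?orb = "Group_Action.orbit ?H \<beta>"
  define F where "F = ?orb ` (\<phi> ` W)"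
  \<comment> \<open>The representative has to be the very one chosen by
    \<open>graph_complexity\<close>, pulled back to the original tree, so that the vertex groups
    match literally.\<close>
  define rep where "rep Q = inv_into W \<phi> (SOME y. y \<in> Q)" for Q
  have rep: "rep Q \<in> W" "\<phi> (rep Q) = (SOME y. y \<in> Q)" "\<phi> (rep Q) \<in> Q" if Q: "Q \<in> F" for Q
  proof -
    obtain w where w: "w \<in> \<phi> ` W" "Q = ?orb w" using Q unfolding F_def by (rule imageE)
    have s: "(SOME y. y \<in> Q) \<in> Q" "(SOME y. y \<in> Q) \<in> \<phi> ` W" using BS.orbit_some[OF w(1)] w(2) by auto
    show "rep Q \<in> W" unfolding rep_def using s(2) by (rule inv_into_into)
    show e: "\<phi> (rep Q) = (SOME y. y \<in> Q)" unfolding rep_def using s(2) by (rule f_inv_into_f)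
    show "\<phi> (rep Q) \<in> Q" unfolding e by (rule s(1))
  qed
  have cover: "\<exists>Q\<in>F. \<exists>h\<in>H. act g x = act h (rep Q)" if g: "g \<in> carrier G" for g
  proof -
    have w: "act g x \<in> W" using g by (auto simp: W_def)
    define Q where "Q = ?orb (\<phi> (act g x))"
    have Q: "Q \<in> F" using w by (auto simp: F_def Q_def)
    obtain h where h: "h \<in> H" "\<phi> (rep Q) = \<beta> h (\<phi> (act g x))"
      using rep(3)[OF Q] by (auto simp: Q_def Group_Action.orbit_def)
    have hc: "h \<in> carrier G" using h Hc by blast
    have "\<phi> (rep Q) = \<phi> (act h (act g x))" using h \<phi>(3)[OF h(1) w] by simp
    then have e: "rep Q = act h (act g x)" using \<phi>(2) rep(1)[OF Q] W_invH[OF h(1) w] by (meson inj_onD)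
    have "act g x = act (inv h) (rep Q)" unfolding e using act_inv[OF hc] w WV by auto
    then show ?thesis using Q h(1) subgroup.m_inv_closed[OF Hs] by blast
  qed
  have "finite F"
  proof -
    have "F \<subseteq> (\<lambda>C. ?orb (\<phi> (act (SOME g. g \<in> C) x))) ` (rcosets H)"
    proof
      fix Q assume "Q \<in> F"
      then obtain g where g: "g \<in> carrier G" "Q = ?orb (\<phi> (act g x))" by (auto simp: F_def W_def)
      \<comment> \<open>The point chosen in the coset of \<open>g\<close> differs from
        \<open>g\<close> by an element of \<open>H\<close>, so it leads to the same orbit. There are
        hence at most as many orbits as cosets.\<close>
      define g' where "g' = (SOME u. u \<in> H #> g)"
      have "g \<in> H #> g" using rcos_self[OF g(1) Hs] .
      then have "g' \<in> H #> g" unfolding g'_def by (rule someI)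
      then obtain h where h: "h \<in> H" "g' = h \<otimes> g" by (auto simp: r_coset_def)
      have hc: "h \<in> carrier G" using h Hc by blast
      have w: "act g x \<in> W" using g by (auto simp: W_def)
      then have wV: "\<phi> (act g x) \<in> pverts X" using \<phi>(1) by blast
      have "\<phi> (act g' x) = \<beta> h (\<phi> (act g x))" using \<phi>(3)[OF h(1) w] h(2) hc g(1) x by (simp add: act_mult)
      moreover have "?orb (\<beta> h (\<phi> (act g x))) = ?orb (\<phi> (act g x))"
      proof (rule equalityI; rule subsetI)
        fix z assume "z \<in> ?orb (\<beta> h (\<phi> (act g x)))"
        then obtain u where u: "u \<in> H" "z = \<beta> u (\<beta> h (\<phi> (act g x)))" by (auto simp: Group_Action.orbit_def)
        then have "z = \<beta> (u \<otimes> h) (\<phi> (act g x))" using BS.act_mult[OF _ _ wV, of u h] h(1) by simp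
        moreover have "u \<otimes> h \<in> H" using Hs u(1) h(1) by (rule subgroup.m_closed)
        ultimately show "z \<in> ?orb (\<phi> (act g x))" by (auto simp: Group_Action.orbit_def)
      next
        fix z assume "z \<in> ?orb (\<phi> (act g x))"
        then obtain u where u: "u \<in> H" "z = \<beta> u (\<phi> (act g x))" by (auto simp: Group_Action.orbit_def)
        have uh: "u \<otimes> inv h \<in> H" using Hs u(1) h(1) by (simp add: subgroup.m_closed subgroup.m_inv_closed)
        have "u \<otimes> inv h \<otimes> h = u" using u(1) Hc hc by (auto simp: m_assoc)
        then have "z = \<beta> (u \<otimes> inv h) (\<beta> h (\<phi> (act g x)))"
          using BS.act_mult[OF _ _ wV, of "u \<otimes> inv h" h] uh h(1) u(2) by simp
        then show "z \<in> ?orb (\<beta> h (\<phi> (act g x)))" using uh by (auto simp: Group_Action.orbit_def)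
      qed
      ultimately have "Q = ?orb (\<phi> (act g' x))" using g(2) by simp
      moreover have "H #> g \<in> rcosets H" using g(1) by (auto simp: rcosets_image)
      ultimately show "Q \<in> (\<lambda>C. ?orb (\<phi> (act (SOME g. g \<in> C) x))) ` (rcosets H)" unfolding g'_def by blast
    qed
    then show ?thesis using Hn(2) finite_surj by blast
  qed
  \<comment> \<open>The summand 1 in the weighted complexity is given away; the volume of the vertex
    group alone accounts for the index.\<close>
  have le: "of_nat (index (subgrp G (stab (rep Q))) (H \<inter> stab (rep Q)))
      \<le> 1 + V_fin (vertex_group ?H \<beta> (SOME y. y \<in> Q))" if Q: "Q \<in> F" for Q
  proof -
    let ?S = "stab (rep Q)"
    have S: "subgroup ?S G" using stab_subgroup rep(1)[OF Q] WV by blast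
    have "subgroup (H \<inter> ?S) (subgrp G ?S)"
      using S Hs by (simp add: subgroups_Inter_pair subgroup_incl)
    then have "of_nat (index (subgrp G ?S) (H \<inter> ?S)) \<le> V_fin (subgrp G (H \<inter> ?S))"
      using surface_V_fin_ge[OF is_group tf S surfW[OF rep(1)[OF Q]]] finite_rcosets_subgrp[OF Hs Hn(2) S] by blast
    also have "subgrp G (H \<inter> ?S) = vertex_group ?H \<beta> (SOME y. y \<in> Q)"
      using stab\<phi>[OF rep(1)[OF Q]] rep(2)[OF Q] by simp
    also have "V_fin \<dots> \<le> 1 + V_fin \<dots>" by (rule add_increasing) simp_all
    finally show ?thesis .
  qed
  have "card (rcosets H) \<le> (\<Sum>Q\<in>F. index (subgrp G (stab (rep Q))) (H \<inter> stab (rep Q)))"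
    using rep(1) cover by (intro card_rcosets_le_sum[OF Hs Hn(2) x \<open>finite F\<close>]) (auto simp: W_def)
  then have "of_nat (card (rcosets H)) \<le> (of_nat (\<Sum>Q\<in>F. index (subgrp G (stab (rep Q))) (H \<inter> stab (rep Q))) :: ennreal)"
    by (rule of_nat_mono)
  also have "\<dots> \<le> (\<Sum>Q\<in>F. 1 + V_fin (vertex_group ?H \<beta> (SOME y. y \<in> Q)))"
    unfolding of_nat_sum using le by (rule sum_mono)
  also have "\<dots> \<le> quotient_rank ?H (sub_graph X BS.M) (\<lambda>g. restrict (\<beta> g) BS.M)
      + (\<Sum>Q\<in>F. 1 + V_fin (vertex_group ?H \<beta> (SOME y. y \<in> Q)))" by (rule add_increasing) simp_all
  also have "\<dots> \<le> weighted_complexity ?H V_fin X \<beta>"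
    by (rule BS.sum_le_weighted_complexity[OF \<open>finite F\<close>]) (simp add: F_def)
  also have "\<dots> \<le> C_max_CSA k n ?H"
    unfolding C_max_CSA_def
  proof (rule Sup_upper, rule CollectI, intro exI conjI)
    show "\<forall>(x, y)\<in>parcs X. fg_abelian_rank_le (edge_group ?H \<beta> x y) n"
    proof clarify
      fix x y assume "(x, y) \<in> parcs X"
      from edges[OF this] have "fg_abelian_rank_le (subgrp G (pointwise_stab ?H \<beta> {x, y})) n" using rank by blast
      then show "fg_abelian_rank_le (edge_group ?H \<beta> x y) n" by simp
    qed
  qed (use X in simp_all)
  finally show ?thesis .
qed

text \<open>An element preserving a cylinder moves an edge to an equivalent one, so it takes a
  nontrivial element \<open>a\<close> of the edge group to a conjugate commuting with
  \<open>a\<close>, and therefore commutes with \<open>a\<close>. Stabilizers of cylinders are thus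
  abelian, and \<open>v\<close> must be a vertex of the original tree.\<close>

lemma nonabelian_tree_of_cylinders_vertex:
  fixes G :: "'g monoid" (structure)
  assumes cyl: "cyl_tree (pverts T) (parcs T) G \<alpha>"
    and v: "v \<in> pverts (tree_of_cylinders G T \<alpha>)"
    and nonab: "\<not> comm_group (vertex_group G (tc_action G T \<alpha>) v)"
  obtains x where "x \<in> pverts T" "stabilizer G (tc_action G T \<alpha>) v = stabilizer G \<alpha> x"
proof (cases v)
  case (Inl x)
  have "x \<in> pverts T" using v by (auto simp: Inl tree_of_cylinders_def tc_old_verts_def)
  moreover have "stabilizer G (tc_action G T \<alpha>) v = stabilizer G \<alpha> x"
    using v by (simp add: Inl tc_action_def stabilizer_def)
  ultimately show ?thesis by (rule that)
next
  case (Inr Z)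
  interpret cyl_tree "pverts T" "parcs T" G \<alpha> by (rule cyl)
  let ?ps = "pointwise_stab G \<alpha>"
  have Z: "Z \<in> cylinders G T \<alpha>" using v by (auto simp: Inr tree_of_cylinders_def)
  then obtain e where e: "e \<in> edge_set T" "Z = cylinder_rel G T \<alpha> `` {e}"
    by (auto simp: cylinders_def quotient_def)
  obtain y z where yz: "(y, z) \<in> parcs T" "e = {y, z}" using e(1) by (auto simp: edge_set_def)
  have ZV: "\<And>f u. f \<in> Z \<Longrightarrow> u \<in> f \<Longrightarrow> u \<in> pverts T"
    using E_in_V by (auto simp: e(2) cylinder_rel_def edge_set_def)
  let ?im = "\<lambda>g. image (image (\<alpha> g)) Z"
  have Sub: "subgroup {g \<in> carrier G. ?im g = Z} G"
  proof (rule subgroupI)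
    have m: "?im (g \<otimes> h) = image (image (\<alpha> g)) (?im h)" if "g \<in> carrier G" "h \<in> carrier G" for g h
      unfolding image_image using act_mult[OF that] ZV by (intro image_cong refl) (auto intro: image_cong)
    have one: "?im \<one> = Z"
    proof -
      have "?im \<one> = (\<lambda>f. f) ` Z"
      proof (rule image_cong)
        fix f assume "f \<in> Z"
        then have "\<alpha> \<one> ` f = (\<lambda>u. u) ` f" using act_one ZV by (intro image_cong) auto
        then show "\<alpha> \<one> ` f = f" by simp
      qed simp
      then show ?thesis by simp
    qed
    show "{g \<in> carrier G. ?im g = Z} \<subseteq> carrier G" by blast
    show "{g \<in> carrier G. ?im g = Z} \<noteq> {}" using one one_closed by blast
    show "inv g \<in> {g \<in> carrier G. ?im g = Z}" if "g \<in> {g \<in> carrier G. ?im g = Z}" for g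
      using that m[of "inv g" g] one by simp
    show "g \<otimes> h \<in> {g \<in> carrier G. ?im g = Z}"
      if "g \<in> {g \<in> carrier G. ?im g = Z}" "h \<in> {g \<in> carrier G. ?im g = Z}" for g h
      using that m[of g h] by simp
  qed
  have st: "stabilizer G (tc_action G T \<alpha>) v = {g \<in> carrier G. ?im g = Z}"
    using v by (simp add: Inr tc_action_def stabilizer_def)
  have ps: "?ps e = stab y \<inter> stab z" unfolding yz(2) by (rule pointwise_stab_pair)
  have V: "y \<in> pverts T" "z \<in> pverts T" using E_in_V[OF yz(1)] by auto
  have sg: "subgroup (?ps e) G" unfolding ps using stab_subgroup[OF V(1)] stab_subgroup[OF V(2)] by (rule subgroups_Inter_pair)
  \<comment> \<open>The class of \<open>e\<close> contains \<open>e\<close> itself only because its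
    edge group is abelian; the relation is not reflexive by definition.\<close>
  have "generate G (?ps e \<union> ?ps e) = ?ps e" 
    using generate_subgroup_incl[OF _ sg, of "?ps e"] generate.incl[of _ "?ps e" G] by auto
  moreover have "comm_group (subgrp G (?ps e))"
    unfolding comm_group_subgrp_iff[OF sg] unfolding ps using edge_abelian[OF yz(1)] by (simp add: comm_def)
  ultimately have "e \<in> Z" using e by (simp add: cylinder_rel_def)
  obtain a where a: "a \<in> stab y \<inter> stab z" "a \<noteq> \<one>" "a \<in> carrier G" by (rule edge_nontrivialE[OF yz(1)])
  have comm: "comm a g" if g: "g \<in> carrier G" "?im g = Z" for g
  proof -
    have "\<alpha> g ` e \<in> Z" using \<open>e \<in> Z\<close> g(2) by blast
    then have c: "comm_group (subgrp G (generate G (?ps e \<union> ?ps (\<alpha> g ` e))))" by (simp add: e(2) cylinder_rel_def)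
    have "?ps e \<union> ?ps (\<alpha> g ` e) \<subseteq> carrier G" by (auto simp: pointwise_stab_def)
    then have sg': "subgroup (generate G (?ps e \<union> ?ps (\<alpha> g ` e))) G" by (rule generate_is_subgroup)
    have "g \<otimes> a \<otimes> inv g \<in> ?ps (\<alpha> g ` e)"
      using conj_stab[OF g(1) _ V(1), of a] conj_stab[OF g(1) _ V(2), of a] a(1)
      by (auto simp: yz(2) pointwise_stab_def stab_iff)
    moreover have "a \<in> ?ps e" using a(1) unfolding ps .
    ultimately have "comm a (g \<otimes> a \<otimes> inv g)"
      using c generate.incl[of _ "?ps e \<union> ?ps (\<alpha> g ` e)" G] unfolding comm_group_subgrp_iff[OF sg'] by (meson UnI1 UnI2)
    then show ?thesis by (rule comm_conj[OF a(3,2) g(1)])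
  qed
  have "comm_group (subgrp G {g \<in> carrier G. ?im g = Z})"
    unfolding comm_group_subgrp_iff[OF Sub]
  proof (intro ballI)
    fix g h assume "g \<in> {g \<in> carrier G. ?im g = Z}" "h \<in> {g \<in> carrier G. ?im g = Z}"
    then have gh: "g \<in> carrier G" "?im g = Z" "h \<in> carrier G" "?im h = Z" by blast+
    show "comm g h" by (rule comm_trans[OF a(3,2) gh(1) comm[OF gh(1,2)] gh(3) comm[OF gh(3,4)]])
  qed
  then show ?thesis using nonab unfolding st by blast
qed

theorem proposition6p2:
  fixes G :: "'g monoid"
    and T :: "'v pair_pre_digraph" and \<alpha> :: "'g \<Rightarrow> 'v \<Rightarrow> 'v"
    and v :: "'v + 'v set set" and k :: nat
  assumes k: "k \<ge> 2"
    and G: "group G" "finitely_generated G" "torsion_free G" "one_ended G" "CSA G"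
    and abelian_subgroups:
      "\<exists>N. \<forall>A. subgroup A G \<and> comm_group (subgrp G A) \<longrightarrow> fg_abelian_rank_le (subgrp G A) N"
    and T: "splitting G T \<alpha>" "abelian_edge_groups G T \<alpha>"
      "\<forall>(x, y)\<in>parcs T. pointwise_stab G \<alpha> {x, y} \<noteq> {\<one>\<^bsub>G\<^esub>}"
    and v: "v \<in> pverts (tree_of_cylinders G T \<alpha>)"
    and G\<^sub>v: "\<not> comm_group (vertex_group G (tc_action G T \<alpha>) v)"
      "flexible (vertex_group G (tc_action G T \<alpha>) v)"
      "bounded_surface_group (vertex_group G (tc_action G T \<alpha>) v)"
  shows "\<exists>n>0. V_CSA k n G > 0"
proof -
  interpret grp G using G(1) by (rule grp.intro)
  interpret csa G by unfold_locales (rule G(5))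
  interpret TG: tree_act "pverts T" "parcs T" G \<alpha> using T(1) by (rule splitting_imp_tree_act)
  have edge: "a \<otimes>\<^bsub>G\<^esub> b = b \<otimes>\<^bsub>G\<^esub> a"
    if "(x, y) \<in> parcs T" "a \<in> TG.stab x \<inter> TG.stab y" "b \<in> TG.stab x \<inter> TG.stab y" for x y a b
  proof -
    interpret e: comm_group "subgrp G (TG.stab x \<inter> TG.stab y)"
      using T(2) that(1) unfolding abelian_edge_groups_def TG.pointwise_stab_pair by auto
    show ?thesis using e.m_comm that(2,3) by simp
  qed
  have cyl: "cyl_tree (pverts T) (parcs T) G \<alpha>"
    using G(5) edge T(3) unfolding TG.pointwise_stab_pair by unfold_locales auto
  obtain x where x: "x \<in> pverts T" "stabilizer G (tc_action G T \<alpha>) v = TG.stab x"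
    by (rule nonabelian_tree_of_cylinders_vertex[OF cyl v G\<^sub>v(1)])
  have surf: "bounded_surface_group (subgrp G (TG.stab x))" and nonab: "\<not> comm_group (subgrp G (TG.stab x))"
    using G\<^sub>v(1,3) unfolding x(2) by auto
  \<comment> \<open>A fixed vertex would make the whole group a surface group with an infinite
    factor \<open>A\<close> in its free splitting, which one-endedness forbids.\<close>
  have moved: "\<exists>g\<in>carrier G. \<alpha> g x \<noteq> x"
  proof (rule ccontr)
    assume "\<not> ?thesis"
    then have "TG.stab x = carrier G" by (auto simp: TG.stab_iff)
    then have "subgrp G (TG.stab x) = G" by simp
    then have "bounded_surface_group G" "\<not> comm_group G" using surf nonab by simp_all
    then obtain A t P where h: "free_hnn G A t P" "A \<noteq> {\<one>\<^bsub>G\<^esub>}"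
      using bounded_surface_group_free_hnn[OF G(1)] by metis
    interpret hnn G A t P by unfold_locales (rule h(1))
    show False using one_ended_not_free_hnn[OF G(1,4) h(1)] torsion_free_infinite[OF G(3) A h(2)] by blast
  qed
  \<comment> \<open>The tree \<open>T\<close> may have any number of vertices; the countable
    invariant subtree through \<open>x\<close> keeps the stabilizer of \<open>x\<close> and can be
    encoded in \<open>nat\<close>.\<close>
  obtain S where S: "countable S" "x \<in> S" "TG.invariant_subtree S"
    using TG.countable_subtree[OF fg_countable[OF G(2)] x(1)] by metis
  interpret S: tree_act S "parcs T \<inter> S \<times> S" G \<alpha> using S(3) by (rule TG.tree_act_subtree)
  interpret C: cyl_tree S "parcs T \<inter> S \<times> S" G \<alpha>
    using G(5) edge T(3) unfolding TG.pointwise_stab_pair by unfold_locales auto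
  obtain N where N: "\<And>A. subgroup A G \<Longrightarrow> comm_group (subgrp G A) \<Longrightarrow> fg_abelian_rank_le (subgrp G A) N"
    using abelian_subgroups by blast
  \<comment> \<open>Any bound at least \<open>N\<close> on the rank would serve; the successor is
    positive even if \<open>N\<close> is 0.\<close>
  have "1 \<le> V_CSA k (Suc N) G"
    unfolding V_CSA_def
  proof (rule index_limsup_ge)
    show "countable (finite_index_normal G)"
      using countable_finite_index[OF G(2)] by (rule countable_subset[rotated])
        (auto simp: finite_index_normal_def normal_imp_subgroup)
    fix H assume H: "H \<in> finite_index_normal G"
    have pos: "card (rcosets\<^bsub>G\<^esub> H) > 0"
      using H rcosets_image one_closed by (auto simp: finite_index_normal_def card_gt_0_iff)
    have "of_nat (card (rcosets\<^bsub>G\<^esub> H)) \<le> C_max_CSA k (Suc N) (subgrp G H)"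
      by (rule C.card_rcosets_le_C_max_CSA[OF G(3) S(1) k H S(2) moved surf nonab])
        (rule fg_abelian_rank_le_mono[OF N le_SucI[OF order_refl]])
    then have "of_nat (card (rcosets\<^bsub>G\<^esub> H)) / of_nat (card (rcosets\<^bsub>G\<^esub> H))
        \<le> C_max_CSA k (Suc N) (subgrp G H) / of_nat (card (rcosets\<^bsub>G\<^esub> H))"
      by (rule divide_right_mono_ennreal)
    moreover have "of_nat (card (rcosets\<^bsub>G\<^esub> H)) / of_nat (card (rcosets\<^bsub>G\<^esub> H)) = (1 :: ennreal)"
      using pos by (intro ennreal_divide_self) (auto simp: of_nat_less_top)
    ultimately show "1 \<le> C_max_CSA k (Suc N) (subgrp G H) / of_nat (card (rcosets\<^bsub>G\<^esub> H))" by simp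
  qed
  then have "V_CSA k (Suc N) G > 0" by (metis less_le_trans zero_less_one)
  then show ?thesis by blast
qed

end
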